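(* Let $L$ be a nontrivial finite group and let $\Lambda$ be a finitely generated, infinite group. Let $\mu$ be a probability measure on $L\wr\Lambda$ with finite entropy and bounded lamp range, and whose support generates $L\wr\Lambda$. Let $\mu_{\rm base}$ be the projection of $\mu$ on $\Lambda$. If $\mu_{\rm base}$ generates a transient random walk on $\Lambda$, then the Poisson boundary of $(L\wr\Lambda,\mu)$ is $L^\Lambda$ endowed with the law of the limiting lamp configuration $\Phi_\infty$.
   Context: Restricted wreath product. For groups $L$ (identity $\mathrm{id}$) and $\Lambda$ (identity $o$), $L\wr\Lambda$ is the set of pairs $(\Phi,x)$ with $x\in\Lambda$ and $\Phi:\Lambda\to L$ with $\Phi(z)=\mathrm{id}$ for all but finitely many $z$, with product $(\Phi,x)(\Psi,y)=(\Phi\cdot(x\Psi),xy)$, where $(x\Psi)(z):=\Psi(x^{-1}z)$ and $\cdot$ is the pointwise product. The function $\Lambda\to L$ identically equal to $\mathrm{id}$ is denoted $\mathbf{ID}$; the identity of $L\wr\Lambda$ is $(\mathbf{ID},o)$. The projection of $\mu$ on $\Lambda$ is its push-forward under $(\Phi,x)\mapsto x$. Entropy of $\mu$: $H(\mu)=-\sum_g\mu(g)\log\mu(g)$. "Bounded lamp range" means that $\{x\in\Lambda:\ \exists(\Phi,y)\in L\wr\Lambda,\ \mu(\Phi,y)>0\text{ and }\Phi(x)\neq\mathrm{id}\}$ is finite. "The support generates" means generates as a group. A measure generates a transient random walk if the random walk with that increment law, started at the identity, visits the identity only finitely often almost surely. Random walk. For a probability measure $\mu$ on a countable group $\Gamma$,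 the $\mu$-walk is the Markov chain with transition probabilities $p(x,y)=\mu(x^{-1}y)$; $\mathbf P$ denotes the law on $\Gamma^{\mathbb N}$ ($\mathbb N\ni 0$) of the trajectory started at the identity. $\mathcal I$ is the $\sigma$-field of shift-invariant measurable subsets of $\Gamma^{\mathbb N}$; $\Gamma$ acts on $\Gamma^{\mathbb N}$ by diagonal left multiplication. Two $\sigma$-fields are equal mod $\mathbf P$ if their $\mathbf P$-completions are equal. Poisson boundary. A Poisson boundary of $(\Gamma,\mu)$ is a quadruple $(\Theta,\mathcal F,\nu,b)$ where $(\Theta,\mathcal F,\nu)$ is a probability space on which $\Gamma$ acts measurably, $\mathcal F$ is countably generated and separates points, and $b:(\Gamma^{\mathbb N},\mathcal I)\to(\Theta,\mathcal F)$ is a measurable map that is $\Gamma$-equivariant (for each $\gamma\in\Gamma$, $b(\gamma\omega)=\gamma b(\omega)$ for $\mathbf P$-a.e. $\omega$), pushes $\mathbf P$ forward to $\nu$, and satisfies $b^{-1}\mathcal F=\mathcal I$ mod $\mathbf P$. It is unique up to isomorphism. Meaning of the conclusion. Write the $\mu$-walk on $L\wr\Lambda$ started at the identity as $(\Phi_n,X_n)$, $n\ge0$. Let $\Phi_\infty:=\lim_n\Phi_n\in L^\Lambda$ be the pointwise limit (each coordinate eventually constant), which exists almost surely under the present hypotheses. "The Poisson boundary is $L^\Lambda$ endowed with the law of $\Phi_\infty$" means that $(L^\Lambda,\mathcal F,\nu,b)$ is a Poisson boundary of $(L\wr\Lambda,\mu)$, where $\mathcal F$ is the product $\sigma$-field,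 $\nu$ is the law of $\Phi_\infty$, $L\wr\Lambda$ acts on $L^\Lambda$ by $(\Phi,x)\cdot\phi=\Phi\cdot(x\phi)$ with $(x\phi)(z)=\phi(x^{-1}z)$, and $b$ sends a trajectory to its limiting lamp configuration if it exists and to $\mathbf{ID}$ otherwise. *)

theory Defs
  imports
    "HOL-Probability.Probability"
    "HOL-Algebra.Generated_Groups"
    "HOL-Algebra.Group_Action"
begin

section \<open>Restricted wreath products\<close>

text \<open>Lamp configurations are represented extensionally, as elements of
  \<open>carrier \<Lambda> \<rightarrow>\<^sub>E carrier L\<close>.\<close>

definition lamp_id ::
  "('l, 'm) monoid_scheme \<Rightarrow> ('g, 'n) monoid_scheme \<Rightarrow> 'g \<Rightarrow> 'l" where
  "lamp_id L \<Lambda> = (\<lambda>z\<in>carrier \<Lambda>. \<one>\<^bsub>L\<^esub>)"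

definition lamp_mult ::
  "('l, 'm) monoid_scheme \<Rightarrow> ('g, 'n) monoid_scheme \<Rightarrow> ('g \<Rightarrow> 'l) \<Rightarrow> ('g \<Rightarrow> 'l) \<Rightarrow> 'g \<Rightarrow> 'l" where
  "lamp_mult L \<Lambda> \<Phi> \<Psi> = (\<lambda>z\<in>carrier \<Lambda>. \<Phi> z \<otimes>\<^bsub>L\<^esub> \<Psi> z)"

definition lamp_translate ::
  "('g, 'n) monoid_scheme \<Rightarrow> 'g \<Rightarrow> ('g \<Rightarrow> 'l) \<Rightarrow> 'g \<Rightarrow> 'l" where
  "lamp_translate \<Lambda> x \<Psi> = (\<lambda>z\<in>carrier \<Lambda>. \<Psi> (inv\<^bsub>\<Lambda>\<^esub> x \<otimes>\<^bsub>\<Lambda>\<^esub> z))"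

definition wreath ::
  "('l, 'm) monoid_scheme \<Rightarrow> ('g, 'n) monoid_scheme \<Rightarrow> (('g \<Rightarrow> 'l) \<times> 'g) monoid" where
  "wreath L \<Lambda> =
    \<lparr>carrier = {\<Phi> \<in> carrier \<Lambda> \<rightarrow>\<^sub>E carrier L. finite {z \<in> carrier \<Lambda>. \<Phi> z \<noteq> \<one>\<^bsub>L\<^esub>}} \<times> carrier \<Lambda>,
     mult = (\<lambda>(\<Phi>, x) (\<Psi>, y). (lamp_mult L \<Lambda> \<Phi> (lamp_translate \<Lambda> x \<Psi>), x \<otimes>\<^bsub>\<Lambda>\<^esub> y)),
     one = (lamp_id L \<Lambda>, \<one>\<^bsub>\<Lambda>\<^esub>)\<rparr>"

lemma wreath_group:
  assumes "group L" "group \<Lambda>"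
  shows "group (wreath L \<Lambda>)"
proof -
  interpret L: group L by fact
  interpret G: group \<Lambda> by fact
  have fin_mult: "finite {z \<in> carrier \<Lambda>. lamp_mult L \<Lambda> \<Phi> (lamp_translate \<Lambda> x \<Psi>) z \<noteq> \<one>\<^bsub>L\<^esub>}"
    if "finite {z \<in> carrier \<Lambda>. \<Phi> z \<noteq> \<one>\<^bsub>L\<^esub>}" "finite {z \<in> carrier \<Lambda>. \<Psi> z \<noteq> \<one>\<^bsub>L\<^esub>}" "x \<in> carrier \<Lambda>"
    for \<Phi> \<Psi> x
  proof (rule finite_subset)
    show "finite ({z \<in> carrier \<Lambda>. \<Phi> z \<noteq> \<one>\<^bsub>L\<^esub>} \<union> (\<lambda>z. x \<otimes>\<^bsub>\<Lambda>\<^esub> z) ` {z \<in> carrier \<Lambda>. \<Psi> z \<noteq> \<one>\<^bsub>L\<^esub>})"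
      using that by auto
    show "{z \<in> carrier \<Lambda>. lamp_mult L \<Lambda> \<Phi> (lamp_translate \<Lambda> x \<Psi>) z \<noteq> \<one>\<^bsub>L\<^esub>} \<subseteq>
      {z \<in> carrier \<Lambda>. \<Phi> z \<noteq> \<one>\<^bsub>L\<^esub>} \<union> (\<lambda>z. x \<otimes>\<^bsub>\<Lambda>\<^esub> z) ` {z \<in> carrier \<Lambda>. \<Psi> z \<noteq> \<one>\<^bsub>L\<^esub>}"
    proof
      fix z assume z: "z \<in> {z \<in> carrier \<Lambda>. lamp_mult L \<Lambda> \<Phi> (lamp_translate \<Lambda> x \<Psi>) z \<noteq> \<one>\<^bsub>L\<^esub>}"
      define w where "w = inv\<^bsub>\<Lambda>\<^esub> x \<otimes>\<^bsub>\<Lambda>\<^esub> z"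
      have "w \<in> carrier \<Lambda>" "z = x \<otimes>\<^bsub>\<Lambda>\<^esub> w"
        using z that by (auto simp: w_def G.m_assoc[symmetric])
      moreover have "\<Phi> z \<noteq> \<one>\<^bsub>L\<^esub> \<or> \<Psi> w \<noteq> \<one>\<^bsub>L\<^esub>"
        using z by (auto simp: lamp_mult_def lamp_translate_def w_def)
      ultimately show "z \<in> {z \<in> carrier \<Lambda>. \<Phi> z \<noteq> \<one>\<^bsub>L\<^esub>} \<union> (\<lambda>z. x \<otimes>\<^bsub>\<Lambda>\<^esub> z) ` {z \<in> carrier \<Lambda>. \<Psi> z \<noteq> \<one>\<^bsub>L\<^esub>}"
        using z by auto
    qed
  qed
  have fin_inv: "finite {z \<in> carrier \<Lambda>. inv\<^bsub>L\<^esub> (\<Phi> (x \<otimes>\<^bsub>\<Lambda>\<^esub> z)) \<noteq> \<one>\<^bsub>L\<^esub>}"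
    if "finite {z \<in> carrier \<Lambda>. \<Phi> z \<noteq> \<one>\<^bsub>L\<^esub>}" "x \<in> carrier \<Lambda>" for \<Phi> x
  proof (rule finite_subset)
    show "finite ((\<lambda>z. inv\<^bsub>\<Lambda>\<^esub> x \<otimes>\<^bsub>\<Lambda>\<^esub> z) ` {z \<in> carrier \<Lambda>. \<Phi> z \<noteq> \<one>\<^bsub>L\<^esub>})"
      using that by auto
    show "{z \<in> carrier \<Lambda>. inv\<^bsub>L\<^esub> (\<Phi> (x \<otimes>\<^bsub>\<Lambda>\<^esub> z)) \<noteq> \<one>\<^bsub>L\<^esub>}
        \<subseteq> (\<lambda>z. inv\<^bsub>\<Lambda>\<^esub> x \<otimes>\<^bsub>\<Lambda>\<^esub> z) ` {z \<in> carrier \<Lambda>. \<Phi> z \<noteq> \<one>\<^bsub>L\<^esub>}"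
    proof
      fix z assume z: "z \<in> {z \<in> carrier \<Lambda>. inv\<^bsub>L\<^esub> (\<Phi> (x \<otimes>\<^bsub>\<Lambda>\<^esub> z)) \<noteq> \<one>\<^bsub>L\<^esub>}"
      then have "z = inv\<^bsub>\<Lambda>\<^esub> x \<otimes>\<^bsub>\<Lambda>\<^esub> (x \<otimes>\<^bsub>\<Lambda>\<^esub> z)"
        using that by (auto simp: G.m_assoc[symmetric])
      moreover have "x \<otimes>\<^bsub>\<Lambda>\<^esub> z \<in> {z \<in> carrier \<Lambda>. \<Phi> z \<noteq> \<one>\<^bsub>L\<^esub>}"
        using z that by auto
      ultimately show "z \<in> (\<lambda>z. inv\<^bsub>\<Lambda>\<^esub> x \<otimes>\<^bsub>\<Lambda>\<^esub> z) ` {z \<in> carrier \<Lambda>. \<Phi> z \<noteq> \<one>\<^bsub>L\<^esub>}"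
        by blast
    qed
  qed
  show ?thesis
  proof (rule groupI)
    fix a b assume "a \<in> carrier (wreath L \<Lambda>)" "b \<in> carrier (wreath L \<Lambda>)"
    then show "a \<otimes>\<^bsub>wreath L \<Lambda>\<^esub> b \<in> carrier (wreath L \<Lambda>)"
      using fin_mult
      by (auto simp: wreath_def) (auto simp: lamp_mult_def lamp_translate_def PiE_iff)
  next
    show "\<one>\<^bsub>wreath L \<Lambda>\<^esub> \<in> carrier (wreath L \<Lambda>)"
      by (auto simp: wreath_def lamp_id_def)
  next
    fix a b c
    assume "a \<in> carrier (wreath L \<Lambda>)" "b \<in> carrier (wreath L \<Lambda>)" "c \<in> carrier (wreath L \<Lambda>)"
    then show "a \<otimes>\<^bsub>wreath L \<Lambda>\<^esub> b \<otimes>\<^bsub>wreath L \<Lambda>\<^esub> c = a \<otimes>\<^bsub>wreath L \<Lambda>\<^esub> (b \<otimes>\<^bsub>wreath L \<Lambda>\<^esub> c)"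
      by (auto simp: wreath_def lamp_mult_def lamp_translate_def fun_eq_iff restrict_def PiE_iff
          G.m_assoc G.inv_mult_group L.m_assoc)
  next
    fix a assume "a \<in> carrier (wreath L \<Lambda>)"
    then show "\<one>\<^bsub>wreath L \<Lambda>\<^esub> \<otimes>\<^bsub>wreath L \<Lambda>\<^esub> a = a"
      by (auto simp: wreath_def lamp_mult_def lamp_translate_def lamp_id_def fun_eq_iff restrict_def PiE_iff
          extensional_def)
  next
    fix a assume a: "a \<in> carrier (wreath L \<Lambda>)"
    obtain \<Phi> x where ax: "a = (\<Phi>, x)" by (cases a)
    let ?b = "(\<lambda>z\<in>carrier \<Lambda>. inv\<^bsub>L\<^esub> (\<Phi> (x \<otimes>\<^bsub>\<Lambda>\<^esub> z)), inv\<^bsub>\<Lambda>\<^esub> x)"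
    have "?b \<in> carrier (wreath L \<Lambda>)"
      using a fin_inv[of \<Phi> x] by (auto simp: ax wreath_def PiE_iff cong: conj_cong)
    moreover have "?b \<otimes>\<^bsub>wreath L \<Lambda>\<^esub> a = \<one>\<^bsub>wreath L \<Lambda>\<^esub>"
      using a by (auto simp: ax wreath_def lamp_mult_def lamp_translate_def lamp_id_def fun_eq_iff
          restrict_def PiE_iff)
    ultimately show "\<exists>b\<in>carrier (wreath L \<Lambda>). b \<otimes>\<^bsub>wreath L \<Lambda>\<^esub> a = \<one>\<^bsub>wreath L \<Lambda>\<^esub>"
      by blast
  qed
qed

definition finitely_generated_group :: "('g, 'n) monoid_scheme \<Rightarrow> bool" where
  "finitely_generated_group G \<longleftrightarrow>
    group G \<and> (\<exists>S \<subseteq> carrier G. finite S \<and> generate G S = carrier G)"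

section \<open>Random walks\<close>

definition path_space :: "('a, 'm) monoid_scheme \<Rightarrow> (nat \<Rightarrow> 'a) measure" where
  "path_space G = PiM UNIV (\<lambda>_. count_space (carrier G))"

primrec partial_product :: "('a, 'm) monoid_scheme \<Rightarrow> (nat \<Rightarrow> 'a) \<Rightarrow> nat \<Rightarrow> 'a" where
  "partial_product G \<xi> 0 = \<one>\<^bsub>G\<^esub>"
| "partial_product G \<xi> (Suc n) = partial_product G \<xi> n \<otimes>\<^bsub>G\<^esub> \<xi> n"

text \<open>The law of the \<open>\<mu>\<close>-walk started at the identity, realised by multiplying independent
  \<open>\<mu>\<close>-distributed increments on the right.  The space of a probability mass function is the whole
  type, hence the restriction to the carrier.  Lemma \<open>measure_walk_law_cylinder\<close> identifies
  this law with that of the Markov chain with transition probabilities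
  \<open>p x y = \<mu> (x\<^sup>-\<^sup>1 y)\<close>.\<close>

definition walk_law :: "('a, 'm) monoid_scheme \<Rightarrow> 'a pmf \<Rightarrow> (nat \<Rightarrow> 'a) measure" where
  "walk_law G \<mu> =
    distr (PiM UNIV (\<lambda>_. restrict_space (measure_pmf \<mu>) (carrier G))) (path_space G)
      (partial_product G)"

lemma space_path_space: "space (path_space G) = UNIV \<rightarrow>\<^sub>E carrier G"
  by (simp add: path_space_def space_PiM)

lemma sets_walk_law [simp]: "sets (walk_law G \<mu>) = sets (path_space G)"
  by (simp add: walk_law_def)

lemma space_walk_law [simp]: "space (walk_law G \<mu>) = space (path_space G)"
  by (simp add: walk_law_def)

lemma prob_space_increment:
  assumes "set_pmf \<mu> \<subseteq> carrier G"
  shows "prob_space (restrict_space (measure_pmf \<mu>) (carrier G))"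
proof (rule prob_space_restrict_space)
  show "emeasure (measure_pmf \<mu>) (carrier G) = 1"
    using assms by (intro measure_pmf.emeasure_eq_1_AE) (auto simp: AE_measure_pmf_iff)
qed simp

lemma sets_increment:
  "sets (restrict_space (measure_pmf \<mu>) (carrier G)) = sets (count_space (carrier G))"
  by (auto simp: sets_restrict_space)

lemma measurable_partial_product:
  assumes "group G" "countable (carrier G)"
  shows "partial_product G \<in>
    PiM UNIV (\<lambda>_. restrict_space (measure_pmf \<mu>) (carrier G)) \<rightarrow>\<^sub>M path_space G"
proof -
  interpret group G by fact
  let ?M = "PiM UNIV (\<lambda>_::nat. restrict_space (measure_pmf \<mu>) (carrier G))"
  have comp: "(\<lambda>\<xi>. \<xi> n) \<in> ?M \<rightarrow>\<^sub>M count_space (carrier G)" for n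
    using measurable_component_singleton[of n UNIV "\<lambda>_. restrict_space (measure_pmf \<mu>) (carrier G)"]
    unfolding measurable_cong_sets[OF refl sets_increment] by blast
  have "(\<lambda>\<xi>. partial_product G \<xi> n) \<in> ?M \<rightarrow>\<^sub>M count_space (carrier G)" for n
  proof (induction n)
    case (Suc n)
    have "(\<lambda>\<xi>. x \<otimes>\<^bsub>G\<^esub> \<xi> n) \<in> ?M \<rightarrow>\<^sub>M count_space (carrier G)" if "x \<in> carrier G" for x
      by (rule measurable_compose[OF comp[of n]]) (use that in auto)
    from measurable_compose_countable'[OF this Suc assms(2)]
    show ?case by simp
  qed simp
  then show ?thesis
    unfolding path_space_def by (intro measurable_PiM_single') (auto simp: measurable_def)
qed

lemma prob_space_walk_law:
  assumes "group G" "countable (carrier G)" "set_pmf \<mu> \<subseteq> carrier G"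
  shows "prob_space (walk_law G \<mu>)"
proof -
  interpret product_prob_space "\<lambda>_. restrict_space (measure_pmf \<mu>) (carrier G)" "UNIV :: nat set"
    by (intro product_prob_spaceI prob_space_increment assms)
  show ?thesis
    unfolding walk_law_def by (intro P.prob_space_distr measurable_partial_product assms)
qed

lemma measure_walk_law_cylinder:
  assumes G: "group G" "countable (carrier G)" and \<mu>: "set_pmf \<mu> \<subseteq> carrier G"
    and x: "\<And>i. i \<le> n \<Longrightarrow> x i \<in> carrier G"
  shows "measure (walk_law G \<mu>) {\<omega> \<in> space (path_space G). \<forall>i\<le>n. \<omega> i = x i} =
    (if x 0 = \<one>\<^bsub>G\<^esub> then \<Prod>i<n. pmf \<mu> (inv\<^bsub>G\<^esub> (x i) \<otimes>\<^bsub>G\<^esub> x (Suc i)) else 0)"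
proof -
  interpret group G by fact
  define R where "R = restrict_space (measure_pmf \<mu>) (carrier G)"
  interpret product_prob_space "\<lambda>_. R" "UNIV :: nat set"
    unfolding R_def by (intro product_prob_spaceI prob_space_increment \<mu>)
  let ?M = "PiM UNIV (\<lambda>_::nat. R)"
  let ?C = "{\<omega> \<in> space (path_space G). \<forall>i\<le>n. \<omega> i = x i}"
  have spR: "space R = carrier G" by (simp add: R_def space_restrict_space)
  have m: "partial_product G \<in> ?M \<rightarrow>\<^sub>M path_space G"
    unfolding R_def by (intro measurable_partial_product G)
  have spM: "space ?M = UNIV \<rightarrow>\<^sub>E carrier G" by (simp add: space_PiM spR)
  have C: "?C \<in> sets (path_space G)"
  proof -
    have "{\<omega> \<in> space (path_space G). \<omega> i = x i} \<in> sets (path_space G)" if "i \<le> n" for i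
    proof -
      have "(\<lambda>\<omega>. \<omega> i) \<in> path_space G \<rightarrow>\<^sub>M count_space (carrier G)"
        unfolding path_space_def by simp
      then have "(\<lambda>\<omega>. \<omega> i) -` {x i} \<inter> space (path_space G) \<in> sets (path_space G)"
        by (rule measurable_sets) (use x that in auto)
      also have "(\<lambda>\<omega>. \<omega> i) -` {x i} \<inter> space (path_space G) = {\<omega> \<in> space (path_space G). \<omega> i = x i}"
        by auto
      finally show ?thesis .
    qed
    then have "{\<omega> \<in> space (path_space G). \<forall>i\<in>{..n}. \<omega> i = x i} \<in> sets (path_space G)"
      by (intro sets.sets_Collect_finite_All) auto
    moreover have "{\<omega> \<in> space (path_space G). \<forall>i\<in>{..n}. \<omega> i = x i} = ?C"
      by auto
    ultimately show ?thesis by argo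
  qed
  have eq: "measure (walk_law G \<mu>) ?C = measure ?M (partial_product G -` ?C \<inter> space ?M)"
    unfolding walk_law_def R_def[symmetric] by (rule measure_distr[OF m C])
  show ?thesis
  proof (cases "x 0 = \<one>\<^bsub>G\<^esub>")
    case False
    then have "partial_product G -` ?C \<inter> space ?M = {}"
      by (auto dest: spec[of _ 0])
    then show ?thesis using False eq by simp
  next
    case True
    let ?y = "\<lambda>i. inv\<^bsub>G\<^esub> (x i) \<otimes>\<^bsub>G\<^esub> x (Suc i)"
    have pp: "(\<forall>i\<le>k. partial_product G \<xi> i = x i) \<longleftrightarrow> (\<forall>i<k. \<xi> i = ?y i)"
      if \<xi>: "\<xi> \<in> UNIV \<rightarrow>\<^sub>E carrier G" and "k \<le> n" for \<xi> k
      using that(2)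
    proof (induction k)
      case (Suc k)
      have c: "x k \<in> carrier G" "x (Suc k) \<in> carrier G" "\<xi> k \<in> carrier G"
        using x Suc.prems \<xi> by auto
      have "x k \<otimes>\<^bsub>G\<^esub> \<xi> k = x (Suc k) \<longleftrightarrow> \<xi> k = ?y k"
        using c by (metis inv_solve_left m_closed inv_closed)
      with Suc show ?case
        by (auto simp: le_Suc_eq less_Suc_eq all_conj_distrib)
    qed (use True in auto)
    have preimage: "partial_product G -` ?C \<inter> space ?M = emb UNIV {..<n} (\<Pi>\<^sub>E i\<in>{..<n}. {?y i})"
      (is "?A = ?B")
    proof (rule subset_antisym; rule subsetI)
      fix \<xi> assume a: "\<xi> \<in> ?A"
      then have "\<xi> \<in> UNIV \<rightarrow>\<^sub>E carrier G" using spM by auto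
      with a pp[of \<xi> n] show "\<xi> \<in> ?B"
        by (auto simp: prod_emb_def spR)
    next
      fix \<xi> assume b: "\<xi> \<in> ?B"
      then have \<xi>: "\<xi> \<in> space ?M" by (auto simp: prod_emb_def space_PiM)
      have "\<forall>i<n. \<xi> i = ?y i" using b by (auto simp: prod_emb_def PiE_iff restrict_def)
      with pp[of \<xi> n] \<xi> spM measurable_space[OF m \<xi>] show "\<xi> \<in> ?A" by auto
    qed
    have "measure ?M (emb UNIV {..<n} (\<Pi>\<^sub>E i\<in>{..<n}. {?y i})) = (\<Prod>i<n. measure R {?y i})"
    proof (rule measure_PiM_emb)
      fix i assume "i \<in> {..<n}"
      then show "{?y i} \<in> sets R"
        using x unfolding R_def sets_increment by simp
    qed simp_all
    then have "measure (walk_law G \<mu>) ?C = (\<Prod>i<n. measure R {?y i})"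
      unfolding eq preimage .
    also have "\<dots> = (\<Prod>i<n. pmf \<mu> (?y i))"
    proof (rule prod.cong)
      fix i assume "i \<in> {..<n}"
      then have "?y i \<in> carrier G" using x by auto
      then show "measure R {?y i} = pmf \<mu> (?y i)"
        by (simp add: R_def measure_restrict_space measure_pmf_single)
    qed simp
    finally show ?thesis using True by simp
  qed
qed

definition transient_walk :: "('a, 'm) monoid_scheme \<Rightarrow> 'a pmf \<Rightarrow> bool" where
  "transient_walk G \<mu> \<longleftrightarrow> (AE \<omega> in walk_law G \<mu>. finite {n. \<omega> n = \<one>\<^bsub>G\<^esub>})"

text \<open>The entropy may be infinite; as \<open>ln 0 = 0\<close>, points of mass zero do not contribute.\<close>

definition pmf_entropy :: "'a pmf \<Rightarrow> ennreal" where
  "pmf_entropy \<mu> = (\<integral>\<^sup>+ g. ennreal (- (pmf \<mu> g * ln (pmf \<mu> g))) \<partial>count_space UNIV)"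

section \<open>The Poisson boundary\<close>

definition path_shift :: "(nat \<Rightarrow> 'a) \<Rightarrow> nat \<Rightarrow> 'a" where
  "path_shift \<omega> n = \<omega> (Suc n)"

definition path_translate :: "('a, 'm) monoid_scheme \<Rightarrow> 'a \<Rightarrow> (nat \<Rightarrow> 'a) \<Rightarrow> nat \<Rightarrow> 'a" where
  "path_translate G \<gamma> \<omega> n = \<gamma> \<otimes>\<^bsub>G\<^esub> \<omega> n"

definition invariant_space :: "('a, 'm) monoid_scheme \<Rightarrow> (nat \<Rightarrow> 'a) measure" where
  "invariant_space G = sigma (space (path_space G))
    {A \<in> sets (path_space G). path_shift -` A \<inter> space (path_space G) = A}"

lemma space_invariant_space: "space (invariant_space G) = space (path_space G)"
  unfolding invariant_space_def by (rule space_measure_of) (auto dest: sets.sets_into_space)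

lemma sets_invariant_space:
  "sets (invariant_space G) =
    {A \<in> sets (path_space G). path_shift -` A \<inter> space (path_space G) = A}"
proof -
  let ?\<Omega> = "space (path_space G)"
  have inv: "\<omega> \<in> ?\<Omega> \<Longrightarrow> path_shift \<omega> \<in> ?\<Omega>" for \<omega>
    by (auto simp: space_path_space path_shift_def)
  have "sigma_algebra ?\<Omega> {A \<in> sets (path_space G). path_shift -` A \<inter> ?\<Omega> = A}"
  proof (unfold sigma_algebra_iff2, intro conjI ballI allI impI, goal_cases)
    case 1
    then show ?case by (auto dest: sets.sets_into_space)
  next
    case 2
    then show ?case by auto
  next
    case (3 s)
    then show ?case using inv by auto
  next
    case (4 A)
    then have *: "A i \<in> sets (path_space G)" "path_shift -` A i \<inter> ?\<Omega> = A i" for i by auto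
    have "path_shift -` (\<Union>i. A i) \<inter> ?\<Omega> = (\<Union>i. path_shift -` A i \<inter> ?\<Omega>)" by blast
    with * show ?case by auto
  qed
  then show ?thesis
    unfolding invariant_space_def by (rule sigma_algebra.sets_measure_of_eq)
qed

text \<open>The completion of a sub-\<open>\<sigma>\<close>-field with respect to \<open>P\<close> adjoins all \<open>P\<close>-negligible sets, and
  not only the subsets of null sets of the sub-\<open>\<sigma>\<close>-field.\<close>

definition completed_field :: "'w measure \<Rightarrow> 'w set set \<Rightarrow> 'w set set" where
  "completed_field P \<A> = sigma_sets (space P) (\<A> \<union> null_sets (completion P))"

definition eq_fields_mod :: "'w measure \<Rightarrow> 'w set set \<Rightarrow> 'w set set \<Rightarrow> bool" where
  "eq_fields_mod P \<A> \<B> \<longleftrightarrow> completed_field P \<A> = completed_field P \<B>"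

definition countably_generated :: "'b measure \<Rightarrow> bool" where
  "countably_generated N \<longleftrightarrow>
    (\<exists>\<C> \<subseteq> Pow (space N). countable \<C> \<and> sets N = sigma_sets (space N) \<C>)"

definition separates_points :: "'b measure \<Rightarrow> bool" where
  "separates_points N \<longleftrightarrow>
    (\<forall>x\<in>space N. \<forall>y\<in>space N. x \<noteq> y \<longrightarrow> (\<exists>A\<in>sets N. x \<in> A \<and> y \<notin> A))"

text \<open>The measure space \<open>N\<close> carries the first three components of the quadruple.  The group is
  meant to be countable and discrete, so that acting measurably means acting by measurable maps.\<close>

definition poisson_boundary ::
  "('a, 'm) monoid_scheme \<Rightarrow> 'a pmf \<Rightarrow> 'b measure \<Rightarrow> ('a \<Rightarrow> 'b \<Rightarrow> 'b) \<Rightarrow> ((nat \<Rightarrow> 'a) \<Rightarrow> 'b) \<Rightarrow> bool"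
  where
  "poisson_boundary G \<mu> N act b \<longleftrightarrow>
    prob_space N \<and>
    countably_generated N \<and>
    separates_points N \<and>
    group_action G (space N) act \<and>
    (\<forall>\<gamma>\<in>carrier G. act \<gamma> \<in> N \<rightarrow>\<^sub>M N) \<and>
    b \<in> invariant_space G \<rightarrow>\<^sub>M N \<and>
    (\<forall>\<gamma>\<in>carrier G. AE \<omega> in walk_law G \<mu>. b (path_translate G \<gamma> \<omega>) = act \<gamma> (b \<omega>)) \<and>
    distr (walk_law G \<mu>) N b = N \<and>
    eq_fields_mod (walk_law G \<mu>)
      {b -` A \<inter> space (path_space G) | A. A \<in> sets N} (sets (invariant_space G))"

section \<open>Limiting lamp configurations\<close>

definition bounded_lamp_range ::
  "('l, 'm) monoid_scheme \<Rightarrow> ('g, 'n) monoid_scheme \<Rightarrow> (('g \<Rightarrow> 'l) \<times> 'g) pmf \<Rightarrow> bool" where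
  "bounded_lamp_range L \<Lambda> \<mu> \<longleftrightarrow>
    finite {x \<in> carrier \<Lambda>. \<exists>(\<Phi>, y) \<in> carrier (wreath L \<Lambda>). pmf \<mu> (\<Phi>, y) > 0 \<and> \<Phi> x \<noteq> \<one>\<^bsub>L\<^esub>}"

definition lamps_converge ::
  "('g, 'n) monoid_scheme \<Rightarrow> (nat \<Rightarrow> ('g \<Rightarrow> 'l) \<times> 'g) \<Rightarrow> bool" where
  "lamps_converge \<Lambda> \<omega> \<longleftrightarrow> (\<forall>z\<in>carrier \<Lambda>. \<exists>l. \<forall>\<^sub>F n in sequentially. fst (\<omega> n) z = l)"

definition limit_lamps ::
  "('l, 'm) monoid_scheme \<Rightarrow> ('g, 'n) monoid_scheme \<Rightarrow> (nat \<Rightarrow> ('g \<Rightarrow> 'l) \<times> 'g) \<Rightarrow> 'g \<Rightarrow> 'l" where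
  "limit_lamps L \<Lambda> \<omega> =
    (if lamps_converge \<Lambda> \<omega>
     then \<lambda>z\<in>carrier \<Lambda>. THE l. \<forall>\<^sub>F n in sequentially. fst (\<omega> n) z = l
     else lamp_id L \<Lambda>)"

definition limit_lamps_law ::
  "('l, 'm) monoid_scheme \<Rightarrow> ('g, 'n) monoid_scheme \<Rightarrow> (('g \<Rightarrow> 'l) \<times> 'g) pmf \<Rightarrow> ('g \<Rightarrow> 'l) measure"
  where
  "limit_lamps_law L \<Lambda> \<mu> =
    distr (walk_law (wreath L \<Lambda>) \<mu>) (PiM (carrier \<Lambda>) (\<lambda>_. count_space (carrier L)))
      (limit_lamps L \<Lambda>)"

text \<open>The outer restriction is needed because \<open>group_action\<close> requires extensional bijections.\<close>

definition lamp_action ::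
  "('l, 'm) monoid_scheme \<Rightarrow> ('g, 'n) monoid_scheme \<Rightarrow> ('g \<Rightarrow> 'l) \<times> 'g \<Rightarrow> ('g \<Rightarrow> 'l) \<Rightarrow> 'g \<Rightarrow> 'l"
  where
  "lamp_action L \<Lambda> = (\<lambda>(\<Phi>, x).
    \<lambda>\<phi> \<in> carrier \<Lambda> \<rightarrow>\<^sub>E carrier L. lamp_mult L \<Lambda> \<Phi> (lamp_translate \<Lambda> x \<phi>))"

end

theory Submission
  imports Defs
begin

text \<open>Write \<open>(\<Phi> n, X n)\<close> for the walk, \<open>\<theta>\<close> for the limiting configuration and \<open>h\<close> for the
  asymptotic entropy of the base walk.  By the entropy criterion it is enough to describe \<open>(\<Phi> n, X n)\<close>
  given \<open>\<theta>\<close> with \<open>o(n)\<close> nats on average.  Cut the walk into blocks of a large fixed length \<open>m\<close>.  The block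
  displacements on the base group cost \<open>(h + o(1)) n\<close>; the block increments outside a finite set are
  rare and cost little.  These data locate all lamps lit by time \<open>n\<close>, and on them \<open>\<Phi> n\<close> differs from \<open>\<theta>\<close>
  in only \<open>o(n)\<close> places, since by transience few sites are visited again after time \<open>n\<close>.

  The cost \<open>h n\<close> is recovered from \<open>\<theta>\<close> itself: almost surely infinitely many lamps stay lit, and a lit
  lamp far away in an enumeration of the base group lies within bounded distance of \<open>X t\<close> for some large
  \<open>t\<close>.  Such an \<open>X t\<close> is a proxy for the Poisson boundary of the base walk, and \<open>X n\<close> and that boundary
  have mutual information at least \<open>h n\<close>.\<close>

text \<open>The obstacle is the cost \<open>h n\<close>: when the base walk has a nontrivial
  boundary, the displacements really carry that much information, and it is not evident that the
  lamps know the boundary of the base walk. What gets transferred is not a boundary point but a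
  function: the posterior probability of the position at time \<open>n\<close>, given the remote
  future, realised as a harmonic function on the base group. Such a function can be evaluated at the
  single site betrayed by a remote lamp, and it converges along the walk. Posteriors given the
  position at a fixed late time depend on that time; observing at a random time almost invariant
  under shifts removes the dependence in the limit. Scores are logarithms of one plus a likelihood
  ratio, which are bounded below and Lipschitz in the posterior. The criterion compares two
  informations that are linear in \<open>n\<close>: that of the position with the given boundary,
  and that with the whole invariant sigma-field. A sublinear conditional entropy along some times
  forces them to agree, and the equality case of Gibbs' inequality then identifies the
  densities.\<close>

lemma integrable_pmf_bounded:
  fixes F :: "'a \<Rightarrow> real"
  assumes "\<And>x. x \<in> set_pmf p \<Longrightarrow> \<bar>F x\<bar> \<le> B"
  shows "integrable (measure_pmf p) F"
  by (rule measure_pmf.integrable_const_bound[where B = B]) (auto simp: AE_measure_pmf_iff assms)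

text \<open>Tonelli's theorem for \<open>bind_pmf\<close>: for nonnegative \<open>F\<close>
  integrability under the mixture passes to the fibres, and almost every fibre means every fibre
  over \<open>set_pmf p\<close>. Unbounded \<open>F\<close> occur later as logarithmic
  scores.\<close>

lemma expectation_bind_pmf_nonneg:
  fixes F :: "'b \<Rightarrow> real"
  assumes nn: "\<And>y. y \<in> set_pmf (bind_pmf p f) \<Longrightarrow> 0 \<le> F y"
    and int: "integrable (measure_pmf (bind_pmf p f)) F"
  shows "\<And>x. x \<in> set_pmf p \<Longrightarrow> integrable (measure_pmf (f x)) F"
    and "integrable (measure_pmf p) (\<lambda>x. measure_pmf.expectation (f x) F)"
    and "measure_pmf.expectation (bind_pmf p f) F =
      measure_pmf.expectation p (\<lambda>x. measure_pmf.expectation (f x) F)"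
proof -
  have nnx: "AE y in measure_pmf (f x). 0 \<le> F y" if "x \<in> set_pmf p" for x
    using nn that by (auto simp: AE_measure_pmf_iff)
  have "(\<integral>\<^sup>+x. \<integral>\<^sup>+y. ennreal (F y) \<partial>measure_pmf (f x) \<partial>measure_pmf p) =
      (\<integral>\<^sup>+y. ennreal (F y) \<partial>measure_pmf (bind_pmf p f))"
    by simp
  also have "\<dots> = ennreal (measure_pmf.expectation (bind_pmf p f) F)"
    by (rule nn_integral_eq_integral[OF int]) (use nn in \<open>auto simp: AE_measure_pmf_iff\<close>)
  finally have eq: "(\<integral>\<^sup>+x. \<integral>\<^sup>+y. ennreal (F y) \<partial>measure_pmf (f x) \<partial>measure_pmf p) =
    ennreal (measure_pmf.expectation (bind_pmf p f) F)" .
  have "AE x in measure_pmf p. (\<integral>\<^sup>+y. ennreal (F y) \<partial>measure_pmf (f x)) \<noteq> \<infinity>"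
    by (rule nn_integral_noteq_infinite) (auto simp: eq)
  then have fin: "(\<integral>\<^sup>+y. ennreal (F y) \<partial>measure_pmf (f x)) < \<infinity>" if "x \<in> set_pmf p" for x
    using that by (auto simp: AE_measure_pmf_iff top.not_eq_extremum)
  show 1: "integrable (measure_pmf (f x)) F" if "x \<in> set_pmf p" for x
    by (rule integrableI_nonneg) (use fin[OF that] nnx[OF that] in auto)
  have inner: "(\<integral>\<^sup>+y. ennreal (F y) \<partial>measure_pmf (f x)) = ennreal (measure_pmf.expectation (f x) F)"
    if "x \<in> set_pmf p" for x
    by (rule nn_integral_eq_integral[OF 1[OF that] nnx[OF that]])
  have nn2: "0 \<le> measure_pmf.expectation (f x) F" if "x \<in> set_pmf p" for x
    by (rule integral_nonneg_AE[OF nnx[OF that]])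
  have eq2: "(\<integral>\<^sup>+x. ennreal (measure_pmf.expectation (f x) F) \<partial>measure_pmf p) =
      ennreal (measure_pmf.expectation (bind_pmf p f) F)"
    unfolding eq[symmetric] by (rule nn_integral_cong_AE) (auto simp: AE_measure_pmf_iff inner)
  show 2: "integrable (measure_pmf p) (\<lambda>x. measure_pmf.expectation (f x) F)"
    by (rule integrableI_nonneg) (auto simp: AE_measure_pmf_iff nn2 eq2)
  have "ennreal (measure_pmf.expectation p (\<lambda>x. measure_pmf.expectation (f x) F)) =
      ennreal (measure_pmf.expectation (bind_pmf p f) F)"
    unfolding eq2[symmetric]
    by (rule nn_integral_eq_integral[OF 2, symmetric]) (auto simp: AE_measure_pmf_iff nn2)
  then show "measure_pmf.expectation (bind_pmf p f) F =
      measure_pmf.expectation p (\<lambda>x. measure_pmf.expectation (f x) F)"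
    by (subst (asm) ennreal_inj)
      (use nn nn2 in \<open>auto intro!: integral_nonneg_AE simp: AE_measure_pmf_iff\<close>)
qed

lemma expectation_mem_pmf:
  fixes F :: "'a \<Rightarrow> real"
  assumes "\<And>x. x \<in> set_pmf p \<Longrightarrow> F x \<in> {a..b}"
  shows "measure_pmf.expectation p F \<in> {a..b}"
proof -
  have i: "integrable (measure_pmf p) F"
    by (rule integrable_pmf_bounded[where B = "max \<bar>a\<bar> \<bar>b\<bar>"]) (use assms in fastforce)
  show ?thesis
    using measure_pmf.integral_ge_const[OF i, of a] measure_pmf.integral_le_const[OF i, of b] assms
    by (auto simp: AE_measure_pmf_iff)
qed

lemma expectation_bind_pmf_bounded:
  fixes F :: "'b \<Rightarrow> real"
  assumes bd: "\<And>y. y \<in> set_pmf (bind_pmf p f) \<Longrightarrow> \<bar>F y\<bar> \<le> B"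
  shows "measure_pmf.expectation (bind_pmf p f) F =
      measure_pmf.expectation p (\<lambda>x. measure_pmf.expectation (f x) F)"
proof -
  \<comment> \<open>Adding \<open>B\<close> makes the integrand nonnegative; the constant cancels at
    the end.\<close>
  have i: "integrable (measure_pmf (bind_pmf p f)) (\<lambda>y. F y + B)"
    by (rule integrable_pmf_bounded[where B = "2 * B"]) (use bd in fastforce)
  have nn: "y \<in> set_pmf (bind_pmf p f) \<Longrightarrow> 0 \<le> F y + B" for y using bd by fastforce
  note * = expectation_bind_pmf_nonneg[OF nn i]
  have ix: "integrable (measure_pmf (f x)) F" if "x \<in> set_pmf p" for x
    by (rule integrable_pmf_bounded[where B = B]) (use bd that in auto)
  have ib: "integrable (measure_pmf (bind_pmf p f)) F"
    by (rule integrable_pmf_bounded[where B = B]) (use bd in auto)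
  have ip: "integrable (measure_pmf p) (\<lambda>x. measure_pmf.expectation (f x) F)"
  proof (rule integrable_pmf_bounded[where B = B])
    fix x assume "x \<in> set_pmf p"
    then have "measure_pmf.expectation (f x) F \<in> {-B..B}"
      using bd by (intro expectation_mem_pmf) fastforce
    then show "\<bar>measure_pmf.expectation (f x) F\<bar> \<le> B" by auto
  qed
  have "measure_pmf.expectation p (\<lambda>x. measure_pmf.expectation (f x) (\<lambda>y. F y + B)) =
    measure_pmf.expectation p (\<lambda>x. measure_pmf.expectation (f x) F + B)"
    by (rule integral_cong_AE) (use ix in \<open>auto simp: AE_measure_pmf_iff\<close>)
  then show ?thesis using *(3) ib ip by simp
qed

text \<open>Jensen's inequality for the square is nonnegativity of the variance.\<close>

lemma expectation_power2_le_pmf: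
  fixes F :: "'a \<Rightarrow> real"
  assumes "\<And>x. x \<in> set_pmf p \<Longrightarrow> \<bar>F x\<bar> \<le> B"
  shows "(measure_pmf.expectation p F)\<^sup>2 \<le> measure_pmf.expectation p (\<lambda>x. (F x)\<^sup>2)"
proof -
  have "integrable (measure_pmf p) F" by (rule integrable_pmf_bounded[where B = B]) (use assms in auto)
  moreover have "integrable (measure_pmf p) (\<lambda>x. (F x)\<^sup>2)"
  proof (rule integrable_pmf_bounded[where B = "B\<^sup>2"])
    fix x assume "x \<in> set_pmf p"
    then have "(F x)\<^sup>2 \<le> B\<^sup>2" using assms by (simp add: abs_le_square_iff[symmetric]) (metis abs_of_nonneg abs_ge_zero order_trans)
    then show "\<bar>(F x)\<^sup>2\<bar> \<le> B\<^sup>2" by simp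
  qed
  ultimately show ?thesis
    using measure_pmf.variance_positive[of p F] by (simp add: measure_pmf.variance_eq)
qed

section \<open>Bayes kernels\<close>

text \<open>The posterior probability of the hidden value \<open>x\<close> under the prior \<alpha>,
  after \<open>g\<close> has been observed through the channel \<open>K\<close>. For unreachable
  \<open>g\<close> the division by zero yields 0, so the bounds below hold for every
  \<open>g\<close>.\<close>

definition bayes :: "'a pmf \<Rightarrow> ('a \<Rightarrow> 'b pmf) \<Rightarrow> 'a \<Rightarrow> 'b \<Rightarrow> real" where
  "bayes \<alpha> K x g = pmf \<alpha> x * pmf (K x) g / pmf (bind_pmf \<alpha> K) g"

lemma pmf_bind_ge: "pmf \<alpha> x * pmf (K x) g \<le> pmf (bind_pmf \<alpha> K) g"
proof -
  have "ennreal (pmf \<alpha> x * pmf (K x) g) = (\<integral>\<^sup>+ z. ennreal (pmf (K z) g) * indicator {x} z \<partial>measure_pmf \<alpha>)"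
    by (simp add: emeasure_pmf_single ennreal_mult' mult.commute)
  also have "\<dots> \<le> (\<integral>\<^sup>+ z. ennreal (pmf (K z) g) \<partial>measure_pmf \<alpha>)"
    by (rule nn_integral_mono) (auto split: split_indicator)
  also have "\<dots> = ennreal (pmf (bind_pmf \<alpha> K) g)" by (simp add: ennreal_pmf_bind)
  finally show ?thesis by simp
qed

lemma sum_pmf_bind_le: "finite F \<Longrightarrow> (\<Sum>x\<in>F. pmf \<alpha> x * pmf (K x) g) \<le> pmf (bind_pmf \<alpha> K) g"
proof -
  assume F: "finite F"
  have "ennreal (\<Sum>x\<in>F. pmf \<alpha> x * pmf (K x) g) =
      (\<Sum>x\<in>F. \<integral>\<^sup>+ z. ennreal (pmf (K z) g) * indicator {x} z \<partial>measure_pmf \<alpha>)"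
    by (simp add: emeasure_pmf_single ennreal_mult' mult.commute sum_ennreal[symmetric] del: sum_ennreal)
  also have "\<dots> = (\<integral>\<^sup>+ z. ennreal (pmf (K z) g) * indicator F z \<partial>measure_pmf \<alpha>)"
    by (subst nn_integral_sum[symmetric])
      (auto intro!: nn_integral_cong simp: F sum_distrib_left[symmetric] indicator_def)
  also have "\<dots> \<le> (\<integral>\<^sup>+ z. ennreal (pmf (K z) g) \<partial>measure_pmf \<alpha>)"
    by (rule nn_integral_mono) (auto split: split_indicator)
  also have "\<dots> = ennreal (pmf (bind_pmf \<alpha> K) g)" by (simp add: ennreal_pmf_bind)
  finally show ?thesis by simp
qed

lemma bayes_nonneg: "0 \<le> bayes \<alpha> K x g"
  by (simp add: bayes_def)

lemma bayes_sum_le_1: "finite F \<Longrightarrow> (\<Sum>x\<in>F. bayes \<alpha> K x g) \<le> 1"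
  using sum_pmf_bind_le[of F \<alpha> K g]
  by (simp add: bayes_def sum_divide_distrib[symmetric] divide_le_eq_1)
    (metis pmf_nonneg le_less)

lemma bayes_le_1: "bayes \<alpha> K x g \<le> 1"
  using bayes_sum_le_1[of "{x}"] by simp

lemma bayes_abs_le_1: "\<bar>bayes \<alpha> K x g\<bar> \<le> 1"
  using bayes_nonneg bayes_le_1 by (metis abs_of_nonneg)

text \<open>Bayes' rule as a change of measure: the marginal law of the observation, reweighted by
  the posterior of \<open>x\<close>, is the prior mass of \<open>x\<close> times the law of the
  observation given \<open>x\<close>.\<close>

lemma expectation_bayes:
  "measure_pmf.expectation (bind_pmf \<alpha> K) (\<lambda>g. bayes \<alpha> K x g * F g) = pmf \<alpha> x * measure_pmf.expectation (K x) F"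
proof -
  have eq: "pmf (bind_pmf \<alpha> K) g * bayes \<alpha> K x g = pmf \<alpha> x * pmf (K x) g" for g
    using pmf_bind_ge[of \<alpha> x K g] by (auto simp: bayes_def mult_le_0_iff)
  have "measure_pmf.expectation (bind_pmf \<alpha> K) (\<lambda>g. bayes \<alpha> K x g * F g) =
      (\<integral>g. pmf (bind_pmf \<alpha> K) g * (bayes \<alpha> K x g * F g) \<partial>count_space UNIV)"
    by (simp add: measure_pmf_eq_density[of "bind_pmf \<alpha> K"] integral_density)
  also have "\<dots> = (\<integral>g. pmf \<alpha> x * (pmf (K x) g * F g) \<partial>count_space UNIV)"
    by (simp add: mult.assoc[symmetric] eq)
  also have "\<dots> = pmf \<alpha> x * (\<integral>g. pmf (K x) g * F g \<partial>count_space UNIV)"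
    by simp
  also have "(\<integral>g. pmf (K x) g * F g \<partial>count_space UNIV) = measure_pmf.expectation (K x) F"
    by (simp add: measure_pmf_eq_density[of "K x"] integral_density)
  finally show ?thesis .
qed

text \<open>The squared L2 norm of the posterior of \<open>x\<close>. It can only drop when the
  observation is degraded, and this monotonicity drives the convergence of posteriors in
  \<open>boundary_kernel\<close>.\<close>

definition bayes_norm :: "'a pmf \<Rightarrow> ('a \<Rightarrow> 'b pmf) \<Rightarrow> 'a \<Rightarrow> real" where
  "bayes_norm \<alpha> K x = measure_pmf.expectation (bind_pmf \<alpha> K) (\<lambda>g. (bayes \<alpha> K x g)\<^sup>2)"

lemma bayes_norm_nonneg: "0 \<le> bayes_norm \<alpha> K x"
  unfolding bayes_norm_def by simp

text \<open>Observing \<open>T\<close> of the observation is a conditional expectation: the \<open>L\<^sup>2\<close> error is a difference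
  of squared norms.\<close>

lemma bayes_projection:
  fixes K :: "'a \<Rightarrow> 'b pmf" and T :: "'b \<Rightarrow> 'c pmf"
  defines "K' \<equiv> \<lambda>x. bind_pmf (K x) T"
  shows "measure_pmf.expectation (bind_pmf \<alpha> K)
      (\<lambda>g. (measure_pmf.expectation (T g) (bayes \<alpha> K' x) - bayes \<alpha> K x g)\<^sup>2)
    \<le> bayes_norm \<alpha> K x - bayes_norm \<alpha> K' x"
proof -
  let ?c = "bind_pmf \<alpha> K"
  define V where "V g = measure_pmf.expectation (T g) (bayes \<alpha> K' x)" for g
  have "V g \<in> {0..1}" for g
    unfolding V_def by (rule expectation_mem_pmf) (simp add: bayes_nonneg bayes_le_1)
  then have V: "0 \<le> V g" "V g \<le> 1" for g by auto
  have c': "bind_pmf \<alpha> K' = bind_pmf ?c T" by (simp add: K'_def bind_assoc_pmf)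
  \<comment> \<open>The cross term: \<open>expectation_bayes\<close> turns the posterior given
    \<open>g\<close> into conditioning on \<open>x\<close>, and the same rule read backwards for
    \<open>K'\<close> gives the norm of the degraded posterior.\<close>
  have 1: "measure_pmf.expectation ?c (\<lambda>g. bayes \<alpha> K x g * V g) = bayes_norm \<alpha> K' x"
  proof -
    have "measure_pmf.expectation ?c (\<lambda>g. bayes \<alpha> K x g * V g) =
       pmf \<alpha> x * measure_pmf.expectation (K' x) (bayes \<alpha> K' x)"
      unfolding expectation_bayes V_def K'_def
      by (subst expectation_bind_pmf_bounded[where B = 1]) (simp_all add: bayes_abs_le_1)
    also have "\<dots> = bayes_norm \<alpha> K' x"
      unfolding bayes_norm_def power2_eq_square expectation_bayes ..
    finally show ?thesis .
  qed
  have 2: "measure_pmf.expectation ?c (\<lambda>g. (V g)\<^sup>2) \<le> bayes_norm \<alpha> K' x"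
  proof -
    have "measure_pmf.expectation ?c (\<lambda>g. (V g)\<^sup>2) \<le>
        measure_pmf.expectation ?c (\<lambda>g. measure_pmf.expectation (T g) (\<lambda>h. (bayes \<alpha> K' x h)\<^sup>2))"
    proof (rule integral_mono)
      show "(V g)\<^sup>2 \<le> measure_pmf.expectation (T g) (\<lambda>h. (bayes \<alpha> K' x h)\<^sup>2)" for g
        unfolding V_def by (rule expectation_power2_le_pmf[where B = 1]) (simp add: bayes_abs_le_1)
      show "integrable (measure_pmf ?c) (\<lambda>g. (V g)\<^sup>2)"
        by (rule integrable_pmf_bounded[where B = 1]) (use V in \<open>auto simp: abs_square_le_1\<close>)
      have "measure_pmf.expectation (T g) (\<lambda>h. (bayes \<alpha> K' x h)\<^sup>2) \<in> {0..1}" for g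
        by (rule expectation_mem_pmf) (simp add: abs_square_le_1 bayes_abs_le_1)
      then show "integrable (measure_pmf ?c) (\<lambda>g. measure_pmf.expectation (T g) (\<lambda>h. (bayes \<alpha> K' x h)\<^sup>2))"
        by (intro integrable_pmf_bounded[where B = 1]) auto
    qed
    also have "\<dots> = bayes_norm \<alpha> K' x"
      unfolding bayes_norm_def c'
      by (subst expectation_bind_pmf_bounded[where B = 1]) (simp_all add: abs_square_le_1 bayes_abs_le_1)
    finally show ?thesis .
  qed
  have i: "integrable (measure_pmf ?c) (\<lambda>g. (V g)\<^sup>2)"
    "integrable (measure_pmf ?c) (\<lambda>g. (bayes \<alpha> K x g)\<^sup>2)"
    "integrable (measure_pmf ?c) (\<lambda>g. bayes \<alpha> K x g * V g)"
    by (rule integrable_pmf_bounded[where B = 1];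
        use V in \<open>simp add: abs_square_le_1 bayes_abs_le_1 abs_mult mult_le_one\<close>)+
  have "measure_pmf.expectation ?c (\<lambda>g. (V g - bayes \<alpha> K x g)\<^sup>2) =
      measure_pmf.expectation ?c (\<lambda>g. (V g)\<^sup>2 + (bayes \<alpha> K x g)\<^sup>2 - 2 * (bayes \<alpha> K x g * V g))"
    by (simp add: power2_diff algebra_simps)
  also have "\<dots> = measure_pmf.expectation ?c (\<lambda>g. (V g)\<^sup>2) + bayes_norm \<alpha> K x - 2 * bayes_norm \<alpha> K' x"
    unfolding bayes_norm_def[of \<alpha> K] 1[symmetric] using i by simp
  finally show ?thesis using 2 unfolding V_def by linarith
qed

text \<open>Both predictions are averages over \<open>T1 g\<close> of functions of the intermediate
  observation. Jensen's inequality removes that average and leaves \<open>bayes_projection\<close>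
  for the channel \<open>K1\<close>.\<close>

lemma bayes_projection2:
  fixes K :: "'a \<Rightarrow> 'b pmf" and T1 :: "'b \<Rightarrow> 'c pmf" and T2 :: "'c \<Rightarrow> 'd pmf"
  defines "K1 \<equiv> \<lambda>x. bind_pmf (K x) T1"
  defines "K2 \<equiv> \<lambda>x. bind_pmf (K1 x) T2"
  shows "measure_pmf.expectation (bind_pmf \<alpha> K)
      (\<lambda>g. (measure_pmf.expectation (bind_pmf (T1 g) T2) (bayes \<alpha> K2 x) -
            measure_pmf.expectation (T1 g) (bayes \<alpha> K1 x))\<^sup>2)
    \<le> bayes_norm \<alpha> K1 x - bayes_norm \<alpha> K2 x"
proof -
  define W where "W h = measure_pmf.expectation (T2 h) (bayes \<alpha> K2 x) - bayes \<alpha> K1 x h" for h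
  have "measure_pmf.expectation (T2 h) (bayes \<alpha> K2 x) \<in> {0..1}" for h
    by (rule expectation_mem_pmf) (simp add: bayes_nonneg bayes_le_1)
  then have e: "0 \<le> measure_pmf.expectation (T2 h) (bayes \<alpha> K2 x)" "measure_pmf.expectation (T2 h) (bayes \<alpha> K2 x) \<le> 1" for h
    by auto
  have W: "\<bar>W h\<bar> \<le> 1" for h
    using e[of h] bayes_nonneg[of \<alpha> K1 x h] bayes_le_1[of \<alpha> K1 x h] unfolding W_def by linarith
  have eq: "measure_pmf.expectation (bind_pmf (T1 g) T2) (bayes \<alpha> K2 x) -
            measure_pmf.expectation (T1 g) (bayes \<alpha> K1 x) = measure_pmf.expectation (T1 g) W" for g
    unfolding W_def
    by (subst expectation_bind_pmf_bounded[where B = 1], simp add: bayes_abs_le_1,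
        subst Bochner_Integration.integral_diff)
      (use e bayes_abs_le_1 in \<open>auto intro!: integrable_pmf_bounded[where B = 1]\<close>)
  have "measure_pmf.expectation (T1 g) (\<lambda>h. (W h)\<^sup>2) \<in> {0..1}" for g
    by (rule expectation_mem_pmf) (simp add: abs_square_le_1 W)
  then have sq: "0 \<le> measure_pmf.expectation (T1 g) (\<lambda>h. (W h)\<^sup>2)" "measure_pmf.expectation (T1 g) (\<lambda>h. (W h)\<^sup>2) \<le> 1" for g
    by auto
  have "measure_pmf.expectation (bind_pmf \<alpha> K) (\<lambda>g. (measure_pmf.expectation (T1 g) W)\<^sup>2)
     \<le> measure_pmf.expectation (bind_pmf \<alpha> K) (\<lambda>g. measure_pmf.expectation (T1 g) (\<lambda>h. (W h)\<^sup>2))"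
  proof (rule integral_mono)
    show "(measure_pmf.expectation (T1 g) W)\<^sup>2 \<le> measure_pmf.expectation (T1 g) (\<lambda>h. (W h)\<^sup>2)" for g
      by (rule expectation_power2_le_pmf[where B = 1]) (simp add: W)
    then show "integrable (measure_pmf (bind_pmf \<alpha> K)) (\<lambda>g. (measure_pmf.expectation (T1 g) W)\<^sup>2)"
      by (intro integrable_pmf_bounded[where B = 1]) (use sq in \<open>simp, meson order_trans\<close>)
    show "integrable (measure_pmf (bind_pmf \<alpha> K)) (\<lambda>g. measure_pmf.expectation (T1 g) (\<lambda>h. (W h)\<^sup>2))"
      by (intro integrable_pmf_bounded[where B = 1]) (use sq in auto)
  qed
  also have "\<dots> = measure_pmf.expectation (bind_pmf \<alpha> K1) (\<lambda>h. (W h)\<^sup>2)"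
    unfolding K1_def bind_assoc_pmf[symmetric]
    by (subst (2) expectation_bind_pmf_bounded[where B = 1]) (simp_all add: abs_square_le_1 W)
  also have "\<dots> \<le> bayes_norm \<alpha> K1 x - bayes_norm \<alpha> K2 x"
    unfolding W_def K2_def by (rule bayes_projection)
  finally show ?thesis unfolding eq .
qed

section \<open>Entropy of discrete distributions\<close>

definition fin_ent :: "'a pmf \<Rightarrow> bool" where
  "fin_ent p \<longleftrightarrow> integrable (measure_pmf p) (\<lambda>x. ln (pmf p x))"

text \<open>A Bochner integral, hence 0 by default when \<open>fin_ent\<close> fails; comparisons of
  entropies therefore carry \<open>fin_ent\<close>.\<close>

definition ent :: "'a pmf \<Rightarrow> real" where
  "ent p = measure_pmf.expectation p (\<lambda>x. - ln (pmf p x))"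

lemma ent_nonneg: "0 \<le> ent p"
  unfolding ent_def
proof (rule integral_nonneg_AE, rule AE_pmfI)
  fix x assume "x \<in> set_pmf p"
  then show "0 \<le> - ln (pmf p x)" using pmf_le_1[of p x] by (simp add: pmf_positive)
qed

lemma fin_ent_if_pmf_entropy:
  assumes "pmf_entropy p < \<infinity>"
  shows "fin_ent p"
proof -
  have "(\<integral>\<^sup>+x. ennreal (- ln (pmf p x)) \<partial>measure_pmf p) = pmf_entropy p"
    unfolding nn_integral_measure_pmf pmf_entropy_def
    by (intro nn_integral_cong) (simp add: ennreal_mult'[symmetric])
  then have "integrable (measure_pmf p) (\<lambda>x. - ln (pmf p x))"
    using assms by (intro integrableI_nonneg) (auto simp: AE_measure_pmf_iff pmf_le_1 pmf_positive)
  then have "integrable (measure_pmf p) (\<lambda>x. - (- ln (pmf p x)))"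
    by (rule Bochner_Integration.integrable_minus)
  then show ?thesis by (simp add: fin_ent_def)
qed

text \<open>Jensen's inequality for the logarithm, from \<open>ln t \<le> t - 1\<close>. In
  \<open>ent_conv_ge\<close>, \<open>ent_increment_mono\<close> and \<open>gibbs\<close> the
  function \<open>F\<close> is a likelihood ratio, whose mean is at most 1.\<close>

lemma (in prob_space) expectation_ln_nonpos:
  assumes [measurable]: "F \<in> borel_measurable M" and pos: "AE x in M. 0 < F x"
    and le: "(\<integral>\<^sup>+x. ennreal (F x) \<partial>M) \<le> 1" and int: "integrable M (\<lambda>x. ln (F x))"
  shows "expectation (\<lambda>x. ln (F x)) \<le> 0"
proof -
  have iF: "integrable M F"
    by (rule integrableI_nonneg) (use pos le in \<open>auto elim!: AE_mp simp: less_imp_le order.strict_trans1\<close>)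
  have "ennreal (expectation F) \<le> 1"
    using le by (subst (asm) nn_integral_eq_integral[OF iF]) (use pos in \<open>auto elim!: AE_mp\<close>)
  then have "expectation F \<le> 1" by simp
  have "expectation (\<lambda>x. ln (F x)) \<le> expectation (\<lambda>x. F x - 1)"
    by (rule integral_mono_AE) (use pos int iF in \<open>auto elim!: AE_mp simp: ln_le_minus_one\<close>)
  also have "\<dots> \<le> 0" using \<open>expectation F \<le> 1\<close> iF by (simp add: prob_space)
  finally show ?thesis .
qed

text \<open>Merging atoms raises masses pointwise, so the information content drops pointwise and is
  dominated by that of \<open>p\<close>.\<close>

lemma fin_ent_map_aux: "fin_ent p \<Longrightarrow> fin_ent (map_pmf f p) \<and> ent (map_pmf f p) \<le> ent p"
proof -
  assume p: "fin_ent p"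
  have le: "pmf p x \<le> pmf (map_pmf f p) (f x)" for x
  proof -
    have "measure p {x} \<le> measure p (f -` {f x})" by (rule measure_pmf.finite_measure_mono) auto
    then show ?thesis by (simp add: measure_pmf_single pmf_map)
  qed
  have b: "0 \<le> - ln (pmf (map_pmf f p) (f x)) \<and> - ln (pmf (map_pmf f p) (f x)) \<le> - ln (pmf p x)"
    if "x \<in> set_pmf p" for x
    using le[of x] pmf_positive[OF that] pmf_le_1[of "map_pmf f p" "f x"] by simp
  have i: "integrable (measure_pmf p) (\<lambda>x. ln (pmf (map_pmf f p) (f x)))"
    by (rule Bochner_Integration.integrable_bound[OF p[unfolded fin_ent_def]])
      (simp_all add: AE_measure_pmf_iff, use b in force)
  then have "fin_ent (map_pmf f p)" by (simp add: fin_ent_def)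
  moreover have "ent (map_pmf f p) \<le> ent p"
    unfolding ent_def integral_map_pmf
    by (rule integral_mono_AE) (use i p b in \<open>auto simp: AE_measure_pmf_iff fin_ent_def\<close>)
  ultimately show ?thesis ..
qed

lemma fin_ent_map: "fin_ent p \<Longrightarrow> fin_ent (map_pmf f p)"
  and ent_map_le: "fin_ent p \<Longrightarrow> ent (map_pmf f p) \<le> ent p"
  using fin_ent_map_aux by blast+

lemma pair_pmf_fst:
  fixes f :: "'a \<Rightarrow> real"
  shows "integrable (measure_pmf p) f \<Longrightarrow> integrable (measure_pmf (pair_pmf p q)) (\<lambda>x. f (fst x))"
    and "measure_pmf.expectation (pair_pmf p q) (\<lambda>x. f (fst x)) = measure_pmf.expectation p f"
  using integrable_map_pmf_eq[of fst "pair_pmf p q" f] integral_map_pmf[of fst "pair_pmf p q" f]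
  by (simp_all add: map_fst_pair_pmf)

lemma pair_pmf_snd:
  fixes f :: "'a \<Rightarrow> real"
  shows "integrable (measure_pmf q) f \<Longrightarrow> integrable (measure_pmf (pair_pmf p q)) (\<lambda>x. f (snd x))"
    and "measure_pmf.expectation (pair_pmf p q) (\<lambda>x. f (snd x)) = measure_pmf.expectation q f"
  using integrable_map_pmf_eq[of snd "pair_pmf p q" f] integral_map_pmf[of snd "pair_pmf p q" f]
  by (simp_all add: map_snd_pair_pmf)

lemma fin_ent_pair:
  assumes "fin_ent p" "fin_ent q"
  shows "fin_ent (pair_pmf p q)" "ent (pair_pmf p q) = ent p + ent q"
proof -
  have i: "integrable (measure_pmf (pair_pmf p q)) (\<lambda>x. ln (pmf p (fst x)))"
    "integrable (measure_pmf (pair_pmf p q)) (\<lambda>x. ln (pmf q (snd x)))"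
    using assms by (auto simp: fin_ent_def intro: pair_pmf_fst(1) pair_pmf_snd(1))
  have AE: "AE x in measure_pmf (pair_pmf p q).
      ln (pmf (pair_pmf p q) x) = ln (pmf p (fst x)) + ln (pmf q (snd x))"
    by (auto simp: AE_measure_pmf_iff pmf_pair ln_mult pmf_positive set_pmf_iff)
  show "fin_ent (pair_pmf p q)"
    unfolding fin_ent_def using i AE by (subst integrable_cong_AE[OF _ _ AE]) auto
  have "ent (pair_pmf p q) = measure_pmf.expectation (pair_pmf p q)
      (\<lambda>x. - ln (pmf p (fst x)) + - ln (pmf q (snd x)))"
    unfolding ent_def by (rule integral_cong_AE) (use AE in auto)
  also have "\<dots> = measure_pmf.expectation (pair_pmf p q) (\<lambda>x. - ln (pmf p (fst x))) +
      measure_pmf.expectation (pair_pmf p q) (\<lambda>x. - ln (pmf q (snd x)))"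
    by (rule Bochner_Integration.integral_add) (use i in auto)
  finally show "ent (pair_pmf p q) = ent p + ent q"
    by (simp only: ent_def pair_pmf_fst(2)[of p q "\<lambda>x. - ln (pmf p x)"] pair_pmf_snd(2)[of p q "\<lambda>x. - ln (pmf q x)"])
qed

text \<open>On component \<open>t\<close> the information content of the mixture exceeds that of
  \<open>f t\<close> by at most the constant \<open>- ln (pmf \<tau> t)\<close>, and there are
  finitely many components.\<close>

lemma fin_ent_bind_finite:
  assumes "finite (set_pmf \<tau>)" "\<And>t. t \<in> set_pmf \<tau> \<Longrightarrow> fin_ent (f t)"
  shows "fin_ent (bind_pmf \<tau> f)"
proof -
  define r where "r = bind_pmf \<tau> f"
  have pr: "0 \<le> - ln (pmf r g) \<and> - ln (pmf r g) \<le> - ln (pmf \<tau> t) - ln (pmf (f t) g)"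
    if "t \<in> set_pmf \<tau>" "g \<in> set_pmf (f t)" for t g
  proof -
    have "pmf \<tau> t * pmf (f t) g \<le> pmf r g" unfolding r_def by (rule pmf_bind_ge)
    moreover have "0 < pmf \<tau> t" "0 < pmf (f t) g" using that by (auto simp: pmf_positive)
    moreover from calculation have "0 < pmf r g"
      by (meson mult_pos_pos order.strict_trans2)
    ultimately have "ln (pmf \<tau> t * pmf (f t) g) \<le> ln (pmf r g)"
      by simp
    then show ?thesis using that pmf_le_1[of r g] \<open>0 < pmf r g\<close> by (simp add: ln_mult pmf_positive set_pmf_iff)
  qed
  have "(\<integral>\<^sup>+g. ennreal (- ln (pmf r g)) \<partial>measure_pmf (f t)) < \<infinity>" if t: "t \<in> set_pmf \<tau>" for t
  proof -
    have "integrable (measure_pmf (f t)) (\<lambda>g. - ln (pmf \<tau> t) - ln (pmf (f t) g))"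
      using assms(2)[OF t] by (auto simp: fin_ent_def)
    then have "integrable (measure_pmf (f t)) (\<lambda>g. - ln (pmf r g))"
      by (rule Bochner_Integration.integrable_bound) (simp_all add: AE_measure_pmf_iff, use pr[OF t] in force)
    then show ?thesis
      by (subst nn_integral_eq_integral) (use pr t in \<open>auto simp: AE_measure_pmf_iff\<close>)
  qed
  then have "(\<integral>\<^sup>+g. ennreal (- ln (pmf r g)) \<partial>measure_pmf r) < \<infinity>"
    unfolding r_def nn_integral_bind_pmf
    by (subst nn_integral_measure_pmf_support[OF assms(1)])
      (auto simp: ennreal_mult_less_top assms(1) sum_Pinfty r_def less_top)
  then have "integrable (measure_pmf r) (\<lambda>g. - ln (pmf r g))"
    by (intro integrableI_nonneg) (use pr in \<open>auto simp: AE_measure_pmf_iff r_def\<close>)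
  then have "integrable (measure_pmf r) (\<lambda>g. - (- ln (pmf r g)))"
    by (rule Bochner_Integration.integrable_minus)
  then show ?thesis by (simp add: fin_ent_def r_def)
qed

section \<open>Convolution powers\<close>

definition conv_pmf :: "('a, 'm) monoid_scheme \<Rightarrow> 'a pmf \<Rightarrow> 'a pmf \<Rightarrow> 'a pmf" where
  "conv_pmf G p q = map_pmf (\<lambda>(x, y). x \<otimes>\<^bsub>G\<^esub> y) (pair_pmf p q)"

primrec walk_pmf :: "('a, 'm) monoid_scheme \<Rightarrow> 'a pmf \<Rightarrow> nat \<Rightarrow> 'a pmf" where
  "walk_pmf G \<mu> 0 = return_pmf \<one>\<^bsub>G\<^esub>"
| "walk_pmf G \<mu> (Suc n) = conv_pmf G (walk_pmf G \<mu> n) \<mu>"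

definition mix_walk :: "('a, 'm) monoid_scheme \<Rightarrow> 'a pmf \<Rightarrow> nat pmf \<Rightarrow> 'a pmf" where
  "mix_walk G \<mu> \<tau> = bind_pmf \<tau> (walk_pmf G \<mu>)"

definition padd :: "nat pmf \<Rightarrow> nat pmf \<Rightarrow> nat pmf" where
  "padd \<sigma> \<tau> = bind_pmf \<sigma> (\<lambda>a. map_pmf (\<lambda>b. a + b) \<tau>)"

lemma conv_pmf_bind: "conv_pmf G p q = bind_pmf p (\<lambda>x. map_pmf (\<lambda>y. x \<otimes>\<^bsub>G\<^esub> y) q)"
  by (simp add: conv_pmf_def pair_pmf_def map_bind_pmf map_pmf_def bind_assoc_pmf bind_return_pmf)

lemma padd_commute: "padd \<sigma> \<tau> = padd \<tau> \<sigma>"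
  unfolding padd_def map_pmf_def by (subst bind_commute_pmf) (simp add: add.commute)

lemma padd_assoc: "padd (padd \<sigma> \<tau>) \<rho> = padd \<sigma> (padd \<tau> \<rho>)"
  by (simp add: padd_def map_pmf_def bind_assoc_pmf bind_return_pmf add.assoc)

lemma set_padd: "set_pmf (padd \<sigma> \<tau>) = {a + b | a b. a \<in> set_pmf \<sigma> \<and> b \<in> set_pmf \<tau>}"
  by (auto simp: padd_def)

lemma mix_walk_return: "mix_walk G \<mu> (return_pmf n) = walk_pmf G \<mu> n"
  by (simp add: mix_walk_def bind_return_pmf)

lemma fin_ent_conv:
  assumes "fin_ent p" "fin_ent q"
  shows "fin_ent (conv_pmf G p q)" "ent (conv_pmf G p q) \<le> ent p + ent q"
  using fin_ent_map[OF fin_ent_pair(1)[OF assms]] ent_map_le[OF fin_ent_pair(1)[OF assms]] fin_ent_pair(2)[OF assms]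
  by (auto simp: conv_pmf_def)

lemma fin_ent_return: "fin_ent (return_pmf x)"
  by (simp add: fin_ent_def integrable_measure_pmf_finite)

lemma fin_ent_walk: "fin_ent \<mu> \<Longrightarrow> fin_ent (walk_pmf G \<mu> n)"
  by (induction n) (auto simp: fin_ent_return fin_ent_conv)

lemma fin_ent_mix: "fin_ent \<mu> \<Longrightarrow> finite (set_pmf \<tau>) \<Longrightarrow> fin_ent (mix_walk G \<mu> \<tau>)"
  unfolding mix_walk_def by (rule fin_ent_bind_finite) (auto intro: fin_ent_walk)

lemma nn_integral_bayes:
  "(\<integral>\<^sup>+g. ennreal (bayes \<alpha> K x g) * F g \<partial>measure_pmf (bind_pmf \<alpha> K)) =
    ennreal (pmf \<alpha> x) * (\<integral>\<^sup>+g. F g \<partial>measure_pmf (K x))"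
proof -
  have eq: "pmf (bind_pmf \<alpha> K) g * bayes \<alpha> K x g = pmf \<alpha> x * pmf (K x) g" for g
    using pmf_bind_ge[of \<alpha> x K g] by (auto simp: bayes_def mult_le_0_iff)
  show ?thesis
    unfolding nn_integral_measure_pmf
    by (subst nn_integral_cmult[symmetric])
      (auto intro!: nn_integral_cong simp: mult.assoc[symmetric] ennreal_mult'[symmetric] eq)
qed

lemma bayes_pos: "x \<in> set_pmf \<alpha> \<Longrightarrow> g \<in> set_pmf (K x) \<Longrightarrow> 0 < bayes \<alpha> K x g"
  using pmf_bind_ge[of \<alpha> x K g] pmf_positive[of x \<alpha>] pmf_positive[of g "K x"]
  by (auto simp: bayes_def intro!: divide_pos_pos intro: order.strict_trans2[OF mult_pos_pos])

text \<open>Given \<open>x\<close>, the denominator undoes the change of measure, which leaves the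
  mean of the degraded posterior, that is, the prior mass of \<open>x\<close>. Points where the
  posterior vanishes are lost on the way, hence an inequality.\<close>

lemma nn_integral_bayes_ratio:
  fixes K :: "'a \<Rightarrow> 'b pmf" and T :: "'b \<Rightarrow> 'c pmf"
  assumes x: "x \<in> set_pmf \<alpha>"
  shows "(\<integral>\<^sup>+g. \<integral>\<^sup>+h. ennreal (bayes \<alpha> (\<lambda>x. bind_pmf (K x) T) x h / bayes \<alpha> K x g) \<partial>measure_pmf (T g) \<partial>measure_pmf (K x)) \<le> 1"
    (is "?I \<le> 1")
proof -
  let ?K' = "\<lambda>x. bind_pmf (K x) T" and ?c = "bind_pmf \<alpha> K"
  define V where "V g = (\<integral>\<^sup>+h. ennreal (bayes \<alpha> ?K' x h) \<partial>measure_pmf (T g))" for g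
  have "ennreal (pmf \<alpha> x) * ?I = (\<integral>\<^sup>+g. ennreal (bayes \<alpha> K x g) * (\<integral>\<^sup>+h. ennreal (bayes \<alpha> ?K' x h / bayes \<alpha> K x g) \<partial>measure_pmf (T g)) \<partial>measure_pmf ?c)"
    by (rule nn_integral_bayes[symmetric])
  also have "\<dots> \<le> (\<integral>\<^sup>+g. V g \<partial>measure_pmf ?c)"
  proof (rule nn_integral_mono)
    fix g
    show "ennreal (bayes \<alpha> K x g) * (\<integral>\<^sup>+h. ennreal (bayes \<alpha> ?K' x h / bayes \<alpha> K x g) \<partial>measure_pmf (T g)) \<le> V g"
      unfolding V_def
      by (cases "bayes \<alpha> K x g = 0")
        (auto simp: nn_integral_cmult[symmetric] ennreal_mult'[symmetric] bayes_nonneg)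
  qed
  also have "\<dots> = (\<integral>\<^sup>+h. ennreal (bayes \<alpha> ?K' x h) * 1 \<partial>measure_pmf (bind_pmf \<alpha> ?K'))"
    by (simp add: V_def bind_assoc_pmf[symmetric])
  also have "\<dots> = ennreal (pmf \<alpha> x)"
    unfolding nn_integral_bayes by simp
  finally have "ennreal (pmf \<alpha> x) * ?I \<le> ennreal (pmf \<alpha> x) * 1" by simp
  moreover have "ennreal (pmf \<alpha> x) \<noteq> 0" "ennreal (pmf \<alpha> x) \<noteq> \<infinity>" using x by (auto simp: set_pmf_iff)
  ultimately show ?thesis by (subst (asm) ennreal_mult_le_mult_iff) auto
qed

section \<open>Entropy inequalities for convolutions on a group\<close>

locale group_walk = group G for G (structure) +
  fixes \<mu> :: "'a pmf"
  assumes supp: "set_pmf \<mu> \<subseteq> carrier G"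
begin

abbreviation "P n \<equiv> walk_pmf G \<mu> n"

lemma supp_conv: "set_pmf p \<subseteq> carrier G \<Longrightarrow> set_pmf q \<subseteq> carrier G \<Longrightarrow> set_pmf (conv_pmf G p q) \<subseteq> carrier G"
  by (auto simp: conv_pmf_def)

lemma supp_walk: "set_pmf (P n) \<subseteq> carrier G"
  by (induction n) (use supp supp_conv in auto)

lemma supp_mix: "set_pmf (mix_walk G \<mu> \<tau>) \<subseteq> carrier G"
  using supp_walk by (auto simp: mix_walk_def)

lemma conv_assoc:
  assumes "set_pmf p \<subseteq> carrier G" "set_pmf q \<subseteq> carrier G" "set_pmf r \<subseteq> carrier G"
  shows "conv_pmf G (conv_pmf G p q) r = conv_pmf G p (conv_pmf G q r)"
  unfolding conv_pmf_bind bind_assoc_pmf bind_map_pmf map_bind_pmf map_pmf_comp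
  by (intro bind_pmf_cong refl map_pmf_cong m_assoc) (use assms in auto)

lemma walk_add: "P (m + n) = conv_pmf G (P m) (P n)"
proof (induction n)
  case 0
  have "conv_pmf G (P m) (P 0) = map_pmf (\<lambda>x. x \<otimes> \<one>) (P m)"
    by (simp add: conv_pmf_bind map_pmf_def bind_return_pmf)
  also have "\<dots> = P m" by (rule map_pmf_idI) (use supp_walk[of m] in auto)
  finally show ?case by simp
next
  case (Suc n)
  then show ?case using supp_walk supp by (simp add: conv_assoc)
qed

lemma mix_padd: "mix_walk G \<mu> (padd \<sigma> \<tau>) = conv_pmf G (mix_walk G \<mu> \<sigma>) (mix_walk G \<mu> \<tau>)"
proof -
  have "conv_pmf G (mix_walk G \<mu> \<sigma>) (mix_walk G \<mu> \<tau>) =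
    bind_pmf \<sigma> (\<lambda>a. bind_pmf (P a) (\<lambda>x. bind_pmf \<tau> (\<lambda>b. map_pmf ((\<otimes>) x) (P b))))"
    by (simp add: conv_pmf_bind mix_walk_def bind_assoc_pmf map_bind_pmf)
  also have "\<dots> = bind_pmf \<sigma> (\<lambda>a. bind_pmf \<tau> (\<lambda>b. P (a + b)))"
    by (subst bind_commute_pmf) (simp add: walk_add conv_pmf_bind)
  finally show ?thesis by (simp add: padd_def mix_walk_def bind_assoc_pmf bind_map_pmf)
qed

lemma inj_translate: "x \<in> carrier G \<Longrightarrow> A \<subseteq> carrier G \<Longrightarrow> inj_on (\<lambda>y. x \<otimes> y) A"
  by (intro inj_onI) (auto simp: subset_eq)

lemma pmf_translate:
  "x \<in> carrier G \<Longrightarrow> set_pmf q \<subseteq> carrier G \<Longrightarrow> l \<in> set_pmf q \<Longrightarrow> pmf (map_pmf (\<lambda>y. x \<otimes> y) q) (x \<otimes> l) = pmf q l"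
  by (rule pmf_map_inj) (auto intro: inj_translate)

lemma integrable_conv:
  assumes "fin_ent p" "fin_ent q"
  shows "integrable (measure_pmf (pair_pmf p q)) (\<lambda>(x, y). ln (pmf (conv_pmf G p q) (x \<otimes> y)))"
proof -
  have "integrable (measure_pmf (conv_pmf G p q)) (\<lambda>x. ln (pmf (conv_pmf G p q) x))"
    using fin_ent_conv[OF assms] by (simp add: fin_ent_def)
  then show ?thesis unfolding conv_pmf_def by (simp add: case_prod_beta')
qed

lemma ent_conv_eq:
  "ent (conv_pmf G p q) = - measure_pmf.expectation (pair_pmf p q) (\<lambda>(x, y). ln (pmf (conv_pmf G p q) (x \<otimes> y)))"
  unfolding ent_def by (simp add: conv_pmf_def case_prod_beta')

text \<open>Conditioning lowers entropy: given the left factor \<open>x\<close>, translation is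
  injective, so \<open>ent q\<close> is the conditional entropy of the product. The ratio
  \<open>?F\<close> has mean at most 1 because for fixed \<open>x\<close> the points
  \<open>x \<otimes> l\<close> are distinct.\<close>

lemma ent_conv_ge:
  assumes p: "set_pmf p \<subseteq> carrier G" "fin_ent p" and q: "set_pmf q \<subseteq> carrier G" "fin_ent q"
  shows "ent q \<le> ent (conv_pmf G p q)"
proof -
  let ?c = "conv_pmf G p q"
  let ?F = "\<lambda>(x, l). pmf ?c (x \<otimes> l) / pmf q l"
  have pos: "0 < pmf ?c (x \<otimes> l) \<and> 0 < pmf q l" if "x \<in> set_pmf p" "l \<in> set_pmf q" for x l
    using that by (auto intro!: pmf_positive simp: conv_pmf_def)
  have i: "integrable (measure_pmf (pair_pmf p q)) (\<lambda>(x, y). ln (pmf ?c (x \<otimes> y)))"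
    "integrable (measure_pmf (pair_pmf p q)) (\<lambda>x. ln (pmf q (snd x)))"
    using integrable_conv p q by (auto simp: fin_ent_def intro: pair_pmf_snd(1))
  have AE: "AE z in measure_pmf (pair_pmf p q). ln (?F z) = (case z of (x, l) \<Rightarrow> ln (pmf ?c (x \<otimes> l))) - ln (pmf q (snd z))"
  proof (rule AE_pmfI)
    fix z assume "z \<in> set_pmf (pair_pmf p q)"
    then show "ln (?F z) = (case z of (x, l) \<Rightarrow> ln (pmf ?c (x \<otimes> l))) - ln (pmf q (snd z))"
      using pos[of "fst z" "snd z"] by (auto simp: ln_div case_prod_beta')
  qed
  have i2: "integrable (measure_pmf (pair_pmf p q)) (\<lambda>z. ln (?F z))"
    using i by (subst integrable_cong_AE[OF _ _ AE]) auto
  have "(\<integral>\<^sup>+z. ennreal (?F z) \<partial>measure_pmf (pair_pmf p q)) =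
      (\<integral>\<^sup>+x. \<integral>\<^sup>+l. ennreal (pmf ?c (x \<otimes> l) / pmf q l) \<partial>measure_pmf q \<partial>measure_pmf p)"
    by (simp add: nn_integral_pair_pmf')
  also have "\<dots> \<le> (\<integral>\<^sup>+x. 1 \<partial>measure_pmf p)"
  proof (rule nn_integral_mono_AE, rule AE_pmfI)
    fix x assume x: "x \<in> set_pmf p"
    have "(\<integral>\<^sup>+l. ennreal (pmf ?c (x \<otimes> l) / pmf q l) \<partial>measure_pmf q) =
       (\<integral>\<^sup>+l. ennreal (pmf ?c (x \<otimes> l)) * indicator (set_pmf q) l \<partial>count_space UNIV)"
      unfolding nn_integral_measure_pmf
      by (intro nn_integral_cong) (auto simp: ennreal_mult'[symmetric] set_pmf_iff split: split_indicator)
    also have "\<dots> = (\<integral>\<^sup>+l. ennreal (pmf ?c (x \<otimes> l)) \<partial>count_space (set_pmf q))"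
      by (simp add: nn_integral_count_space_indicator)
    also have "\<dots> = emeasure ?c ((\<lambda>l. x \<otimes> l) ` set_pmf q)"
      by (rule nn_integral_pmf') (use x p q in \<open>auto intro!: inj_translate\<close>)
    also have "\<dots> \<le> 1" by (rule measure_pmf.emeasure_le_1)
    finally show "(\<integral>\<^sup>+l. ennreal (pmf ?c (x \<otimes> l) / pmf q l) \<partial>measure_pmf q) \<le> 1" .
  qed
  also have "\<dots> = 1" by simp
  finally have "measure_pmf.expectation (pair_pmf p q) (\<lambda>z. ln (?F z)) \<le> 0"
    using pos i2 by (intro measure_pmf.expectation_ln_nonpos) (auto simp: AE_measure_pmf_iff)
  also have "measure_pmf.expectation (pair_pmf p q) (\<lambda>z. ln (?F z)) =
     measure_pmf.expectation (pair_pmf p q) (\<lambda>z. (case z of (x, l) \<Rightarrow> ln (pmf ?c (x \<otimes> l))) - ln (pmf q (snd z)))"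
    by (rule integral_cong_AE) (use AE in auto)
  also have "\<dots> = - ent ?c + ent q"
    by (subst Bochner_Integration.integral_diff) (use i in \<open>auto simp: ent_conv_eq ent_def[of q] pair_pmf_snd(2)[where f = "\<lambda>x. ln (pmf q x)"]\<close>)
  finally show ?thesis by simp
qed

text \<open>The data processing inequality: the left side is the mutual information of the first
  factor with the triple product, the right side that with the product of the first two, and
  multiplying by the third factor degrades the observation.\<close>

lemma ent_increment_mono:
  assumes a: "set_pmf a \<subseteq> carrier G" "fin_ent a" and l: "set_pmf l \<subseteq> carrier G" "fin_ent l"
    and b: "set_pmf b \<subseteq> carrier G" "fin_ent b"
  shows "ent (conv_pmf G a (conv_pmf G l b)) - ent (conv_pmf G l b) \<le> ent (conv_pmf G a l) - ent l"
proof -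
  define K where "K x = map_pmf (\<lambda>y. x \<otimes> y) l" for x
  define T where "T g = map_pmf (\<lambda>y. g \<otimes> y) b" for g
  let ?K' = "\<lambda>x. bind_pmf (K x) T"
  let ?c = "conv_pmf G a l" and ?lb = "conv_pmf G l b" let ?c' = "conv_pmf G a ?lb"
  let ?M = "pair_pmf a (pair_pmf l b)"
  have c: "bind_pmf a K = ?c" by (simp add: K_def[abs_def] conv_pmf_bind)
  have K': "?K' x = map_pmf (\<lambda>y. x \<otimes> y) ?lb" if "x \<in> carrier G" for x
    unfolding K_def T_def conv_pmf_bind map_bind_pmf bind_map_pmf map_pmf_comp
    by (intro bind_pmf_cong refl map_pmf_cong m_assoc) (use l b that in auto)
  have c': "bind_pmf a ?K' = ?c'"
    unfolding conv_pmf_bind[of G a] by (intro bind_pmf_cong refl K') (use a in auto)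
  have slb: "set_pmf ?lb \<subseteq> carrier G" by (rule supp_conv[OF l(1) b(1)])
  have b1: "ln (bayes a K x (x \<otimes> y)) = ln (pmf a x) + ln (pmf l y) - ln (pmf ?c (x \<otimes> y))"
    if "x \<in> set_pmf a" "y \<in> set_pmf l" for x y
  proof -
    have "pmf (K x) (x \<otimes> y) = pmf l y" unfolding K_def by (rule pmf_translate) (use that a l in auto)
    moreover have "0 < pmf ?c (x \<otimes> y)" using that by (intro pmf_positive) (auto simp: conv_pmf_def)
    ultimately show ?thesis
      using that by (simp add: bayes_def c ln_div ln_mult pmf_positive set_pmf_iff)
  qed
  have b2: "ln (bayes a ?K' x (x \<otimes> y)) = ln (pmf a x) + ln (pmf ?lb y) - ln (pmf ?c' (x \<otimes> y))"
    if "x \<in> set_pmf a" "y \<in> set_pmf ?lb" for x y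
  proof -
    have "pmf (?K' x) (x \<otimes> y) = pmf ?lb y"
      by (subst K') (use that a slb in \<open>auto intro!: pmf_translate\<close>)
    moreover have "0 < pmf ?c' (x \<otimes> y)" using that by (intro pmf_positive) (auto simp: conv_pmf_def[of G a])
    ultimately show ?thesis
      using that by (simp add: bayes_def c' ln_div ln_mult pmf_positive set_pmf_iff)
  qed
  \<comment> \<open>\<open>F\<close> compares the posterior of the first factor after and before the
    degradation; in its logarithm \<open>D\<close> the prior of \<open>x\<close> has
    cancelled.\<close>
  define F where "F = (\<lambda>(x, y, z). bayes a ?K' x (x \<otimes> (y \<otimes> z)) / bayes a K x (x \<otimes> y))"
  define D where "D = (\<lambda>(x, y, z). (ln (pmf ?lb (y \<otimes> z)) - ln (pmf ?c' (x \<otimes> (y \<otimes> z)))) - (ln (pmf l y) - ln (pmf ?c (x \<otimes> y))))"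
  have pos: "0 < bayes a ?K' x (x \<otimes> (y \<otimes> z)) \<and> 0 < bayes a K x (x \<otimes> y)"
    if "x \<in> set_pmf a" "y \<in> set_pmf l" "z \<in> set_pmf b" for x y z
  proof
    have "x \<otimes> (y \<otimes> z) \<in> set_pmf (?K' x)"
      using that a by (subst K') (auto simp: conv_pmf_def)
    then show "0 < bayes a ?K' x (x \<otimes> (y \<otimes> z))"
      by (rule bayes_pos[OF that(1)])
    show "0 < bayes a K x (x \<otimes> y)"
      by (rule bayes_pos[OF that(1)]) (use that in \<open>auto simp: K_def\<close>)
  qed
  have lnF: "ln (F w) = D w" if "w \<in> set_pmf ?M" for w
  proof -
    obtain x y z where w: "w = (x, y, z)" by (cases w)
    with that have s: "x \<in> set_pmf a" "y \<in> set_pmf l" "z \<in> set_pmf b" by auto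
    then have "y \<otimes> z \<in> set_pmf ?lb" by (auto simp: conv_pmf_def)
    then show ?thesis using pos[OF s] b1[OF s(1,2)] b2[OF s(1)] by (simp add: w F_def D_def ln_div)
  qed
  have m1: "map_pmf (\<lambda>(x, y, z). (x, y \<otimes> z)) ?M = pair_pmf a ?lb"
    by (simp add: conv_pmf_def pair_map_pmf2 apsnd_def map_prod_def case_prod_beta')
  have m2: "map_pmf (\<lambda>(x, y, z). (x, y)) ?M = pair_pmf a l"
    by (simp add: pair_pmf_def map_bind_pmf map_pmf_def bind_assoc_pmf bind_return_pmf)
  have flb: "fin_ent ?lb" using fin_ent_conv l b by auto
  have i1: "integrable (measure_pmf ?M) (\<lambda>(x, y, z). ln (pmf ?lb (y \<otimes> z)))"
    and e1: "measure_pmf.expectation ?M (\<lambda>(x, y, z). ln (pmf ?lb (y \<otimes> z))) = - ent ?lb"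
  proof -
    have "integrable (measure_pmf (pair_pmf a ?lb)) (\<lambda>x. ln (pmf ?lb (snd x)))"
      by (rule pair_pmf_snd(1)) (use flb in \<open>simp add: fin_ent_def\<close>)
    then show "integrable (measure_pmf ?M) (\<lambda>(x, y, z). ln (pmf ?lb (y \<otimes> z)))"
      unfolding m1[symmetric] by (simp add: case_prod_beta')
    have "measure_pmf.expectation (pair_pmf a ?lb) (\<lambda>x. ln (pmf ?lb (snd x))) = - ent ?lb"
      by (simp add: ent_def pair_pmf_snd(2)[where f = "\<lambda>x. ln (pmf ?lb x)"])
    then show "measure_pmf.expectation ?M (\<lambda>(x, y, z). ln (pmf ?lb (y \<otimes> z))) = - ent ?lb"
      unfolding m1[symmetric] by (simp add: case_prod_beta')
  qed
  have i2: "integrable (measure_pmf ?M) (\<lambda>(x, y, z). ln (pmf ?c' (x \<otimes> (y \<otimes> z))))"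
    and e2: "measure_pmf.expectation ?M (\<lambda>(x, y, z). ln (pmf ?c' (x \<otimes> (y \<otimes> z)))) = - ent ?c'"
    using integrable_conv[OF a(2) flb] ent_conv_eq[of a ?lb]
    unfolding m1[symmetric] by (simp_all add: case_prod_beta')
  have i3: "integrable (measure_pmf ?M) (\<lambda>(x, y, z). ln (pmf ?c (x \<otimes> y)))"
    and e3: "measure_pmf.expectation ?M (\<lambda>(x, y, z). ln (pmf ?c (x \<otimes> y))) = - ent ?c"
    using integrable_conv[OF a(2) l(2)] ent_conv_eq[of a l]
    unfolding m2[symmetric] by (simp_all add: case_prod_beta')
  have i4: "integrable (measure_pmf ?M) (\<lambda>(x, y, z). ln (pmf l y))"
    and e4: "measure_pmf.expectation ?M (\<lambda>(x, y, z). ln (pmf l y)) = - ent l"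
  proof -
    have "integrable (measure_pmf (pair_pmf a l)) (\<lambda>x. ln (pmf l (snd x)))"
      by (rule pair_pmf_snd(1)) (use l in \<open>simp add: fin_ent_def\<close>)
    then show "integrable (measure_pmf ?M) (\<lambda>(x, y, z). ln (pmf l y))"
      unfolding m2[symmetric] by (simp add: case_prod_beta')
    have "measure_pmf.expectation (pair_pmf a l) (\<lambda>x. ln (pmf l (snd x))) = - ent l"
      by (simp add: ent_def pair_pmf_snd(2)[where f = "\<lambda>x. ln (pmf l x)"])
    then show "measure_pmf.expectation ?M (\<lambda>(x, y, z). ln (pmf l y)) = - ent l"
      unfolding m2[symmetric] by (simp add: case_prod_beta')
  qed
  note i = i1[unfolded case_prod_beta'] i2[unfolded case_prod_beta'] i3[unfolded case_prod_beta'] i4[unfolded case_prod_beta']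
  have iD: "integrable (measure_pmf ?M) D"
    unfolding D_def case_prod_beta' using i by simp
  have "measure_pmf.expectation ?M (\<lambda>w. ln (F w)) \<le> 0"
  proof (rule measure_pmf.expectation_ln_nonpos)
    show "AE w in measure_pmf ?M. 0 < F w" using pos by (auto simp: AE_measure_pmf_iff F_def)
    show "integrable (measure_pmf ?M) (\<lambda>w. ln (F w))"
      by (subst integrable_cong_AE[where g = D]) (use iD lnF in \<open>auto simp: AE_measure_pmf_iff simp del: set_pair_pmf\<close>)
    have "(\<integral>\<^sup>+w. ennreal (F w) \<partial>measure_pmf ?M) =
      (\<integral>\<^sup>+x. \<integral>\<^sup>+y. \<integral>\<^sup>+z. ennreal (bayes a ?K' x (x \<otimes> (y \<otimes> z)) / bayes a K x (x \<otimes> y)) \<partial>measure_pmf b \<partial>measure_pmf l \<partial>measure_pmf a)"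
      by (simp add: nn_integral_pair_pmf' F_def)
    also have "\<dots> = (\<integral>\<^sup>+x. (\<integral>\<^sup>+g. \<integral>\<^sup>+h. ennreal (bayes a ?K' x h / bayes a K x g) \<partial>measure_pmf (T g) \<partial>measure_pmf (K x)) \<partial>measure_pmf a)"
      unfolding K_def T_def nn_integral_map_pmf
      by (intro nn_integral_cong_AE AE_pmfI) (use a l b in \<open>auto simp: m_assoc subset_eq\<close>)
    also have "\<dots> \<le> (\<integral>\<^sup>+x. 1 \<partial>measure_pmf a)"
      by (rule nn_integral_mono_AE, rule AE_pmfI, rule nn_integral_bayes_ratio)
    finally show "(\<integral>\<^sup>+w. ennreal (F w) \<partial>measure_pmf ?M) \<le> 1" by simp
  qed auto
  also have "measure_pmf.expectation ?M (\<lambda>w. ln (F w)) = measure_pmf.expectation ?M D"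
    by (rule integral_cong_AE) (use lnF in \<open>auto simp: AE_measure_pmf_iff simp del: set_pair_pmf\<close>)
  also have "\<dots> = - ent ?lb + ent ?c' - (- ent l + ent ?c)"
    using i e1 e2 e3 e4 unfolding D_def case_prod_beta' by simp
  finally show ?thesis by simp
qed

end

section \<open>A harmonic posterior kernel carrying the entropy of the walk\<close>

lemma bayes_cong: "(\<And>x. x \<in> set_pmf \<alpha> \<Longrightarrow> K x = K' x) \<Longrightarrow> bayes \<alpha> K = bayes \<alpha> K'"
proof (intro ext)
  fix x g assume K: "\<And>x. x \<in> set_pmf \<alpha> \<Longrightarrow> K x = K' x"
  have "bind_pmf \<alpha> K = bind_pmf \<alpha> K'" by (intro bind_pmf_cong refl K)
  then show "bayes \<alpha> K x g = bayes \<alpha> K' x g"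
    using K by (cases "x \<in> set_pmf \<alpha>") (auto simp: bayes_def set_pmf_iff)
qed

lemma bayes_norm_cong: "(\<And>x. x \<in> set_pmf \<alpha> \<Longrightarrow> K x = K' x) \<Longrightarrow> bayes_norm \<alpha> K = bayes_norm \<alpha> K'"
  unfolding bayes_norm_def
  by (intro ext) (simp only: bayes_cong[of \<alpha> K K'] bind_pmf_cong[OF refl, of \<alpha> K K'])

lemma pmf_mult_le_expectation:
  fixes f :: "'a \<Rightarrow> real"
  assumes "\<And>x. 0 \<le> f x" "\<And>x. f x \<le> B"
  shows "pmf p g * f g \<le> measure_pmf.expectation p f"
proof -
  have B: "0 \<le> B" using assms[of g] by (rule order_trans)
  have "pmf p g * f g = measure_pmf.expectation p (\<lambda>x. indicator {g} x * f g)"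
    by (simp add: measure_pmf_single)
  also have "\<dots> \<le> measure_pmf.expectation p f"
    by (intro integral_mono integrable_pmf_bounded[where B = B] Bochner_Integration.integrable_mult_left)
      (use assms B in \<open>auto split: split_indicator intro!: integrable_pmf_bounded[where B = 1]\<close>)
  finally show ?thesis .
qed

text \<open>The reason for scoring by the logarithm of one plus a ratio: closeness of posteriors
  carries over to the scores, even where the ratio is near 0.\<close>

lemma ln_1_plus_lipschitz:
  fixes a b :: real
  assumes "0 \<le> a" "0 \<le> b"
  shows "\<bar>ln (1 + a) - ln (1 + b)\<bar> \<le> \<bar>a - b\<bar>"
proof -
  have *: "ln (1 + a) - ln (1 + b) \<le> \<bar>a - b\<bar>" if "0 \<le> a" "0 \<le> b" for a b :: real
  proof -
    have "ln (1 + a) - ln (1 + b) \<le> (a - b) / (1 + b)"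
      using ln_diff_le[of "1 + a" "1 + b"] that by simp
    also have "\<dots> \<le> \<bar>a - b\<bar> / (1 + b)" using that by (intro divide_right_mono) auto
    also have "\<dots> \<le> \<bar>a - b\<bar> / 1" using that by (intro divide_left_mono) auto
    finally show ?thesis by simp
  qed
  show ?thesis using *[of a b] *[of b a] assms by (simp add: abs_le_iff abs_minus_commute)
qed

abbreviation unif :: "nat \<Rightarrow> nat pmf" where
  "unif N \<equiv> pmf_of_set {..N}"

text \<open>The law of \<open>U (t + 1) + \<dots> + U (t + d)\<close> for independent \<open>U i\<close> uniform on \<open>{0..i}\<close>.  The walk at
  such a random time is almost invariant under a fixed time shift, while the increasing windows keep the
  observations at successive \<open>t\<close> nested, so that posteriors form a reversed martingale.\<close>

primrec seg :: "nat \<Rightarrow> nat \<Rightarrow> nat pmf" where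
  "seg t 0 = return_pmf 0"
| "seg t (Suc d) = padd (seg t d) (unif (Suc (t + d)))"

lemma seg_add: "seg t (d + e) = padd (seg t d) (seg (t + d) e)"
proof (induction e)
  case 0
  have "padd (seg t d) (return_pmf 0) = seg t d" by (simp add: padd_def bind_return_pmf')
  then show ?case by simp
qed (simp add: padd_assoc add.assoc)

lemma finite_seg: "finite (set_pmf (seg t d))"
proof (induction d)
  case (Suc d)
  have "set_pmf (seg t (Suc d)) = (\<lambda>(a, b). a + b) ` (set_pmf (seg t d) \<times> {..Suc (t + d)})"
    by (auto simp: set_padd)
  then show ?case using Suc by simp
qed simp

text \<open>Whatever the first summand, at most \<open>C\<close> of the \<open>N + 1\<close> values
  of the uniform one keep the total below \<open>C\<close>. It shows that the random observation
  time escapes to infinity.\<close>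

lemma measure_padd_unif_le: "measure_pmf.prob (padd \<sigma> (unif N)) {..<C} \<le> real C / real (N + 1)"
proof -
  have "measure_pmf.prob (padd \<sigma> (unif N)) {..<C} = measure_pmf.expectation (padd \<sigma> (unif N)) (indicator {..<C})"
    by simp
  also have "\<dots> = measure_pmf.expectation \<sigma> (\<lambda>a. measure_pmf.prob (unif N) ((\<lambda>b. a + b) -` {..<C}))"
    unfolding padd_def
    by (subst expectation_bind_pmf_bounded[where B = 1]) (auto simp del: measure_pmf_of_set simp: indicator_vimage[symmetric])
  also have "\<dots> \<in> {0..real C / real (N + 1)}"
  proof (rule expectation_mem_pmf)
    fix a
    have "measure_pmf.prob (unif N) ((\<lambda>b. a + b) -` {..<C}) \<le> measure_pmf.prob (unif N) {..<C}"
      by (rule measure_pmf.finite_measure_mono) auto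
    also have "\<dots> = card ({..N} \<inter> {..<C}) / real (N + 1)"
      by (subst measure_pmf_of_set) auto
    also have "\<dots> \<le> real C / real (N + 1)"
      using card_mono[of "{..<C}" "{..N} \<inter> {..<C}"] by (intro divide_right_mono) auto
    finally show "measure_pmf.prob (unif N) ((\<lambda>b. a + b) -` {..<C}) \<in> {0..real C / real (N + 1)}" by simp
  qed
  finally show ?thesis by simp
qed

context group_walk
begin

text \<open>Moving a uniform window by one step exchanges two boundary terms in
  \<open>{0..1}\<close>, so the average changes by at most \<open>1 / (N + 1)\<close>; the extra
  delay \<rho> amounts to at most \<open>C\<close> such steps.\<close>

lemma shift_mix:
  fixes F :: "'a \<Rightarrow> real"
  assumes F: "\<And>g. F g \<in> {0..1}" and \<rho>: "set_pmf \<rho> \<subseteq> {..C}"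
  shows "\<bar>measure_pmf.expectation (mix_walk G \<mu> (padd \<rho> (padd \<sigma> (unif N)))) F -
    measure_pmf.expectation (mix_walk G \<mu> (padd \<sigma> (unif N))) F\<bar> \<le> C / (N + 1)"
proof -
  define e where "e i = measure_pmf.expectation (mix_walk G \<mu> (map_pmf ((+) i) \<sigma>)) F" for i
  have e: "e i \<in> {0..1}" for i unfolding e_def by (rule expectation_mem_pmf) (rule F)
  have absF: "\<bar>F g\<bar> \<le> 1" for g using F[of g] by auto
  define E where "E j = (\<Sum>i\<le>N. e (j + i)) / (N + 1)" for j
  have Ej: "measure_pmf.expectation (mix_walk G \<mu> (padd (return_pmf j) (padd \<sigma> (unif N)))) F = E j" for j
  proof -
    have "mix_walk G \<mu> (padd (return_pmf j) (padd \<sigma> (unif N))) =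
       bind_pmf (unif N) (\<lambda>i. mix_walk G \<mu> (map_pmf ((+) (j + i)) \<sigma>))"
    proof -
      have "(\<lambda>b. j + (i + b)) = (+) (j + i)" for i by auto
      then show ?thesis
        unfolding padd_commute[of \<sigma>]
        by (simp add: padd_def mix_walk_def bind_return_pmf map_bind_pmf map_pmf_comp bind_assoc_pmf)
    qed
    then have "measure_pmf.expectation (mix_walk G \<mu> (padd (return_pmf j) (padd \<sigma> (unif N)))) F =
       measure_pmf.expectation (unif N) (\<lambda>i. e (j + i))"
      by (simp add: expectation_bind_pmf_bounded[where B = 1] absF e_def)
    then show ?thesis by (simp add: integral_pmf_of_set E_def)
  qed
  have padd0: "padd (return_pmf 0) \<tau> = \<tau>" for \<tau>
    by (simp add: padd_def bind_return_pmf) (rule map_pmf_idI, simp)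
  have diff: "\<bar>E j - E 0\<bar> \<le> j / (N + 1)" for j
  proof (induction j)
    case (Suc j)
    have "(\<Sum>i\<le>N. e (Suc j + i)) - (\<Sum>i\<le>N. e (j + i)) = e (j + Suc N) - e j"
      using sum_lessThan_telescope[of "\<lambda>i. e (j + i)" "Suc N"]
      by (simp add: sum_subtractf[symmetric] lessThan_Suc_atMost del: sum.lessThan_Suc)
    then have "\<bar>(\<Sum>i\<le>N. e (Suc j + i)) - (\<Sum>i\<le>N. e (j + i))\<bar> \<le> 1"
      using e[of j] e[of "j + Suc N"] by auto
    then have "\<bar>E (Suc j) - E j\<bar> \<le> 1 / (N + 1)"
      unfolding E_def diff_divide_distrib[symmetric] abs_divide by (simp add: divide_right_mono)
    with Suc show ?case by (simp add: add_divide_distrib)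
  qed simp
  have "mix_walk G \<mu> (padd \<rho> (padd \<sigma> (unif N))) = bind_pmf \<rho> (\<lambda>j. mix_walk G \<mu> (padd (return_pmf j) (padd \<sigma> (unif N))))"
    by (simp add: padd_def mix_walk_def bind_return_pmf bind_assoc_pmf)
  then have "measure_pmf.expectation (mix_walk G \<mu> (padd \<rho> (padd \<sigma> (unif N)))) F = measure_pmf.expectation \<rho> E"
    by (simp add: expectation_bind_pmf_bounded[where B = 1] absF Ej)
  also have "\<dots> \<in> {E 0 - C / (N + 1)..E 0 + C / (N + 1)}"
  proof (rule expectation_mem_pmf)
    fix j assume "j \<in> set_pmf \<rho>"
    then have "real j / (N + 1) \<le> C / (N + 1)" using \<rho> by (intro divide_right_mono) auto
    with diff[of j] show "E j \<in> {E 0 - C / (N + 1)..E 0 + C / (N + 1)}" by auto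
  qed
  finally show ?thesis using Ej[of 0] by (auto simp: padd0 add.commute)
qed

lemma walk_1: "P (Suc 0) = \<mu>"
  by (simp add: conv_pmf_bind bind_return_pmf) (rule map_pmf_idI, use supp in auto)

text \<open>\<open>D\<close> is the mutual information of the first \<open>n\<close> steps with the
  walk at time \<open>n + \<tau>\<close>. By data processing each further batch of \<open>n\<close>
  steps adds at most \<open>D\<close> to the entropy, while after \<open>i\<close> batches the
  entropy is at least \<open>n * i * h\<close>; large \<open>i\<close> gives the bound.\<close>

lemma ent_conv_mix_ge:
  assumes fin: "fin_ent \<mu>" "finite (set_pmf \<tau>)" and h: "\<And>m. real m * h \<le> ent (P m)"
  shows "real n * h \<le> ent (conv_pmf G (P n) (mix_walk G \<mu> \<tau>)) - ent (mix_walk G \<mu> \<tau>)"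
proof -
  let ?r = "mix_walk G \<mu> \<tau>"
  note [simp] = supp_walk supp_mix fin_ent_walk[OF fin(1)] fin_ent_mix[OF fin] fin_ent_conv supp_conv
  define D where "D = ent (conv_pmf G (P n) ?r) - ent ?r"
  define a where "a i = ent (conv_pmf G ?r (P (n * i)))" for i
  \<comment> \<open>All factors are random powers of one law, so the batch of \<open>n\<close> steps
    may be moved from the front to the back although the group need not be commutative.\<close>
  have comm: "conv_pmf G (P n) (conv_pmf G ?r (P m)) = conv_pmf G ?r (P (n + m))" for m
  proof -
    have "conv_pmf G (P n) (conv_pmf G ?r (P m)) = mix_walk G \<mu> (padd (return_pmf n) (padd \<tau> (return_pmf m)))"
      by (simp add: mix_padd mix_walk_return)
    also have "\<dots> = mix_walk G \<mu> (padd \<tau> (return_pmf (n + m)))"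
      by (simp add: padd_def bind_return_pmf map_bind_pmf map_pmf_def bind_assoc_pmf add.left_commute)
    also have "\<dots> = conv_pmf G ?r (P (n + m))" by (simp add: mix_padd mix_walk_return)
    finally show ?thesis .
  qed
  have "a (Suc i) - a i \<le> D" for i
    unfolding a_def D_def using ent_increment_mono[of "P n" ?r "P (n * i)"]
    by (simp add: comm)
  then have *: "a i \<le> a 0 + real i * D" for i
    by (induction i) (auto simp: algebra_simps, smt (verit))
  have "real (n * i) * h \<le> a i" for i
    unfolding a_def using ent_conv_ge[of ?r "P (n * i)"] h[of "n * i"] by simp
  with * have **: "real i * (n * h - D) \<le> a 0" for i
    by (smt (verit) mult.commute mult.left_commute of_nat_mult right_diff_distrib)
  have "n * h - D \<le> 0"
  proof (rule ccontr)
    assume "\<not> n * h - D \<le> 0"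
    then obtain i :: nat where "a 0 < real i * (n * h - D)"
      using reals_Archimedean3[of "n * h - D"] by auto
    with **[of i] show False by simp
  qed
  then show ?thesis by (simp add: D_def)
qed

text \<open>Morally \<open>u x g\<close> is the mean, over the continuations of the walk from
  \<open>g\<close>, of the conditional probability that the walk stood at \<open>x\<close> at time
  \<open>n\<close> given its Poisson boundary. Being a function on the group, it can be evaluated at
  a site read off from a lamp. The existence of the limit \<open>c\<close> is left to the user of
  the lemma, who obtains it from convergence along paths.\<close>

lemma boundary_kernel:
  assumes fin: "fin_ent \<mu>" and h: "\<And>m. real m * h \<le> ent (P m)"
  obtains u :: "'a \<Rightarrow> 'a \<Rightarrow> real" where
    "\<And>x g. 0 \<le> u x g" "\<And>F g. finite F \<Longrightarrow> (\<Sum>x\<in>F. u x g) \<le> 1"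
    "\<And>x j g. n \<le> j \<Longrightarrow> g \<in> set_pmf (P j) \<Longrightarrow> u x g = measure_pmf.expectation \<mu> (\<lambda>a. u x (g \<otimes> a))"
    "\<And>c. (\<lambda>j. measure_pmf.expectation (pair_pmf (P n) (P j)) (\<lambda>(x, l). ln (1 + u x (x \<otimes> l) / pmf (P n) x))) \<longlonglongrightarrow> c
      \<Longrightarrow> real n * h \<le> c"
proof -
  let ?\<alpha> = "P n"
  \<comment> \<open>\<open>K t\<close> observes the walk at the random time \<open>tau t\<close>
    after time \<open>n\<close>, and \<open>T t d\<close> lets it run on to
    \<open>tau (t + d)\<close>. \<open>v\<close> predicts the later posterior from the earlier
    observation; \<open>U\<close> lets the walk run from \<open>g\<close> for the full time
    \<open>tau N\<close>, whenever \<open>g\<close> was reached, and so depends on \<open>g\<close>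
    alone.\<close>
  define tau where "tau t = seg 0 t" for t
  define r where "r t = mix_walk G \<mu> (tau t)" for t
  define K where "K t x = map_pmf ((\<otimes>) x) (r t)" for t x
  define T where "T t d g = map_pmf ((\<otimes>) g) (mix_walk G \<mu> (seg t d))" for t d g
  define c where "c t = bind_pmf ?\<alpha> (K t)" for t
  define \<kappa> where "\<kappa> t = bayes ?\<alpha> (K t)" for t
  define A where "A t x = bayes_norm ?\<alpha> (K t) x" for t x
  define v where "v t d x g = measure_pmf.expectation (T t d g) (\<kappa> (t + d) x)" for t d x g
  define U where "U N x g = measure_pmf.expectation (map_pmf ((\<otimes>) g) (r N)) (\<kappa> N x)" for N x g
  \<comment> \<open>Convergence is only known at reachable points; the value 0 elsewhere keeps the
    bounds on \<open>u\<close> valid for every \<open>g\<close>.\<close>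
  define Rch where "Rch = (\<Union>t. set_pmf (c t))"
  define u where "u x g = (if g \<in> Rch then lim (\<lambda>N. U N x g) else 0)" for x g
  have \<kappa>01: "\<kappa> t x g \<in> {0..1}" for t x g
    by (simp add: \<kappa>_def bayes_nonneg bayes_le_1)
  have \<kappa>abs: "\<bar>\<kappa> t x g\<bar> \<le> 1" for t x g by (simp add: \<kappa>_def bayes_abs_le_1)
  have v01: "v t d x g \<in> {0..1}" for t d x g
    unfolding v_def by (rule expectation_mem_pmf) (rule \<kappa>01)
  have U01: "U N x g \<in> {0..1}" for N x g
    unfolding U_def by (rule expectation_mem_pmf) (rule \<kappa>01)
  have sq1: "(a - b)\<^sup>2 \<le> 1" if "a \<in> {0..1}" "b \<in> {0..1}" for a b :: real
    using that by (auto simp: abs_square_le_1)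
  have c_conv: "c t = conv_pmf G ?\<alpha> (r t)" for t by (simp add: c_def K_def[abs_def] conv_pmf_bind)
  have c_car: "set_pmf (c t) \<subseteq> carrier G" for t
    unfolding c_conv r_def by (rule supp_conv[OF supp_walk supp_mix])
  have tau_add: "tau (t + d) = padd (tau t) (seg t d)" for t d
    unfolding tau_def by (simp add: seg_add)
  have TT: "bind_pmf (T t d g) (T (t + d) e) = T t (d + e) g" if "g \<in> carrier G" for t d e g
  proof -
    have "bind_pmf (T t d g) (T (t + d) e) =
        map_pmf ((\<otimes>) g) (conv_pmf G (mix_walk G \<mu> (seg t d)) (mix_walk G \<mu> (seg (t + d) e)))"
      unfolding T_def conv_pmf_bind bind_map_pmf map_bind_pmf map_pmf_comp
      by (intro bind_pmf_cong map_pmf_cong refl m_assoc) (use that supp_mix in auto)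
    then show ?thesis by (simp add: T_def mix_padd[symmetric] seg_add[symmetric])
  qed
  have KT: "bind_pmf (K t x) (T t d) = K (t + d) x" if "x \<in> carrier G" for t d x
    using TT[OF that, of 0 t d] by (simp add: K_def T_def r_def tau_def)
  have KT': "x \<in> set_pmf ?\<alpha> \<Longrightarrow> bind_pmf (K t x) (T t d) = K (t + d) x" for t d x
    using KT supp_walk by blast
  have bc: "bayes ?\<alpha> (\<lambda>x. bind_pmf (K t x) (T t d)) = bayes ?\<alpha> (K (t + d))"
    "bayes_norm ?\<alpha> (\<lambda>x. bind_pmf (K t x) (T t d)) = bayes_norm ?\<alpha> (K (t + d))" for t d
    by (rule bayes_cong bayes_norm_cong; rule KT'; assumption)+
  have K3: "measure_pmf.expectation (c t) (\<lambda>g. (v t d x g - \<kappa> t x g)\<^sup>2) \<le> A t x - A (t + d) x" for t d x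
    using bayes_projection[of ?\<alpha> "K t" "T t d" x]
    unfolding bc v_def \<kappa>_def A_def c_def .
  have K4: "measure_pmf.expectation (c t) (\<lambda>g. (v t (d + e) x g - v t d x g)\<^sup>2) \<le> A (t + d) x - A (t + d + e) x" for t d e x
  proof -
    have K2: "x \<in> set_pmf ?\<alpha> \<Longrightarrow> bind_pmf (bind_pmf (K t x) (T t d)) (T (t + d) e) = K (t + d + e) x" for x
      by (simp add: KT')
    have bc2: "bayes ?\<alpha> (\<lambda>x. bind_pmf (bind_pmf (K t x) (T t d)) (T (t + d) e)) = bayes ?\<alpha> (K (t + d + e))"
      "bayes_norm ?\<alpha> (\<lambda>x. bind_pmf (bind_pmf (K t x) (T t d)) (T (t + d) e)) = bayes_norm ?\<alpha> (K (t + d + e))"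
      by (rule bayes_cong bayes_norm_cong; rule K2; assumption)+
    have "measure_pmf.expectation (c t) (\<lambda>g. (v t (d + e) x g - v t d x g)\<^sup>2) =
      measure_pmf.expectation (c t) (\<lambda>g. (measure_pmf.expectation (bind_pmf (T t d g) (T (t + d) e)) (\<kappa> (t + d + e) x) - v t d x g)\<^sup>2)"
      by (rule integral_cong_AE) (use c_car in \<open>auto simp: AE_measure_pmf_iff TT v_def add.assoc subset_eq\<close>)
    also have "\<dots> \<le> A (t + d) x - A (t + d + e) x"
      using bayes_projection2[of ?\<alpha> "K t" "T t d" "T (t + d) e" x]
      unfolding bc bc2 v_def \<kappa>_def A_def c_def .
    finally show ?thesis .
  qed
  have Amono: "A (t + d) x \<le> A t x" for t d x
    using order_trans[OF _ K3[of t d x], of 0] by simp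
  have "\<exists>l. (\<lambda>t. A t x) \<longlonglongrightarrow> l \<and> (\<forall>t. l \<le> A t x)" for x
  proof -
    have "decseq (\<lambda>t. A t x)" by (rule decseq_SucI) (use Amono[of _ 1 x] in simp)
    then obtain l where "(\<lambda>t. A t x) \<longlonglongrightarrow> l" "\<And>t. l \<le> A t x"
      by (rule decseq_convergent[where B = 0]) (auto simp: A_def bayes_norm_nonneg)
    then show ?thesis by blast
  qed
  then obtain A' where A': "(\<lambda>t. A t x) \<longlonglongrightarrow> A' x" "A' x \<le> A t x" for x t by metis
  \<comment> \<open>\<open>U\<close> and \<open>v\<close> differ by the initial delay
    \<open>tau t\<close>, which is bounded for fixed \<open>t\<close>. The last uniform window of
    \<open>seg\<close> absorbs it at a cost that vanishes as \<open>d\<close> grows.\<close>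
  have Uv: "\<exists>C. \<forall>d. \<bar>U (t + Suc d) x g - v t (Suc d) x g\<bar> \<le> real C / real (Suc (t + d) + 1)" for t x g
  proof -
    obtain C where C: "set_pmf (tau t) \<subseteq> {..C}"
      using finite_seg[of 0 t] unfolding tau_def finite_nat_set_iff_bounded_le by auto
    have "\<bar>U (t + Suc d) x g - v t (Suc d) x g\<bar> \<le> real C / real (Suc (t + d) + 1)" for d
      using shift_mix[OF _ C, of "\<lambda>y. \<kappa> (t + Suc d) x (g \<otimes> y)" "seg t d" "Suc (t + d)"] \<kappa>01
      by (simp only: U_def v_def T_def r_def tau_add seg.simps integral_map_pmf) simp
    then show ?thesis by blast
  qed
  \<comment> \<open>A reachable \<open>g\<close> has positive mass under \<open>c t\<close>, which
    turns the mean square Cauchy bound \<open>K4\<close> into a pointwise one.\<close>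
  have v_conv: "convergent (\<lambda>d. v t d x g)" if g: "g \<in> set_pmf (c t)" for t x g
  proof -
    let ?p = "pmf (c t) g"
    have p: "0 < ?p" using g by (rule pmf_positive)
    have bd: "?p * (v t (d + e) x g - v t d x g)\<^sup>2 \<le> A (t + d) x - A' x" for d e
    proof -
      have "?p * (v t (d + e) x g - v t d x g)\<^sup>2 \<le> measure_pmf.expectation (c t) (\<lambda>g. (v t (d + e) x g - v t d x g)\<^sup>2)"
        by (rule pmf_mult_le_expectation[where B = 1])
          (auto intro!: sq1 v01)
      also have "\<dots> \<le> A (t + d) x - A' x" using K4[of t d e x] A'(2)[of x "t + d + e"] by linarith
      finally show ?thesis .
    qed
    have "Cauchy (\<lambda>d. v t d x g)"
    proof (rule metric_CauchyI)
      fix \<epsilon> :: real assume \<epsilon>: "0 < \<epsilon>"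
      have "(\<lambda>d. A (t + d) x) \<longlonglongrightarrow> A' x"
        using LIMSEQ_ignore_initial_segment[OF A'(1)[of x], of t] by (simp add: add.commute)
      then have "\<forall>\<^sub>F d in sequentially. dist (A (t + d) x) (A' x) < ?p * (\<epsilon> / 2)\<^sup>2"
        using p \<epsilon> by (intro tendstoD) auto
      then obtain d0 where "dist (A (t + d0) x) (A' x) < ?p * (\<epsilon> / 2)\<^sup>2"
        by (auto simp: eventually_sequentially)
      then have d0: "A (t + d0) x - A' x < ?p * (\<epsilon> / 2)\<^sup>2" by (simp add: dist_real_def)
      have *: "\<bar>v t m x g - v t d0 x g\<bar> < \<epsilon> / 2" if "d0 \<le> m" for m
      proof -
        have "?p * (v t m x g - v t d0 x g)\<^sup>2 < ?p * (\<epsilon> / 2)\<^sup>2"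
          using bd[of d0 "m - d0"] d0 that by simp
        then have "(v t m x g - v t d0 x g)\<^sup>2 < (\<epsilon> / 2)\<^sup>2" using p by simp
        then show ?thesis using \<epsilon> by (metis abs_of_pos half_gt_zero power2_less_imp_less abs_ge_zero power2_abs)
      qed
      show "\<exists>M. \<forall>m\<ge>M. \<forall>n\<ge>M. dist (v t m x g) (v t n x g) < \<epsilon>"
      proof (intro exI[of _ d0] allI impI)
        fix m m' assume "d0 \<le> m" "d0 \<le> m'"
        then show "dist (v t m x g) (v t m' x g) < \<epsilon>" using *[of m] *[of m'] unfolding dist_real_def by linarith
      qed
    qed
    then show ?thesis by (simp add: Cauchy_convergent_iff)
  qed
  have lims: "(\<lambda>N. U N x g) \<longlonglongrightarrow> u x g" "(\<lambda>d. v t d x g) \<longlonglongrightarrow> u x g" if g: "g \<in> set_pmf (c t)" for t x g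
  proof -
    obtain l where l: "(\<lambda>d. v t d x g) \<longlonglongrightarrow> l" using v_conv[OF g, of x] by (auto simp: convergent_def)
    obtain C where C: "\<And>d. \<bar>U (t + Suc d) x g - v t (Suc d) x g\<bar> \<le> real C / real (Suc (t + d) + 1)"
      using Uv by blast
    have "(\<lambda>d. real C / real (Suc (t + d) + 1)) \<longlonglongrightarrow> 0" by real_asymp
    then have "(\<lambda>d. U (t + Suc d) x g - v t (Suc d) x g) \<longlonglongrightarrow> 0"
      by (rule Lim_null_comparison[rotated]) (use C in auto)
    from tendsto_add[OF this LIMSEQ_Suc[OF l]] have "(\<lambda>d. U (d + Suc t) x g) \<longlonglongrightarrow> l"
      by (simp add: add.commute)
    then have Ul: "(\<lambda>N. U N x g) \<longlonglongrightarrow> l" by (rule LIMSEQ_offset)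
    have "g \<in> Rch" using g by (auto simp: Rch_def)
    then have "u x g = l" using limI[OF Ul] by (simp add: u_def)
    with Ul l show "(\<lambda>N. U N x g) \<longlonglongrightarrow> u x g" "(\<lambda>d. v t d x g) \<longlonglongrightarrow> u x g" by auto
  qed
  have u01: "u x g \<in> {0..1}" for x g
  proof (cases "g \<in> Rch")
    case True
    then obtain t where "g \<in> set_pmf (c t)" by (auto simp: Rch_def)
    from lims(1)[OF this] show ?thesis
      by (rule Lim_in_closed_set[OF closed_atLeastAtMost, rotated 2]) (use U01 in auto)
  qed (simp add: u_def)
  have u_nonneg: "0 \<le> u x g" for x g using u01[of x g] by simp
  have u_sum: "(\<Sum>x\<in>F. u x g) \<le> 1" if F: "finite F" for F g
  proof (cases "g \<in> Rch")
    case True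
    then obtain t where g: "g \<in> set_pmf (c t)" by (auto simp: Rch_def)
    have "(\<lambda>N. \<Sum>x\<in>F. U N x g) \<longlonglongrightarrow> (\<Sum>x\<in>F. u x g)" by (intro tendsto_sum lims(1)[OF g])
    moreover have "(\<Sum>x\<in>F. U N x g) \<le> 1" for N
    proof -
      have "(\<Sum>x\<in>F. U N x g) = measure_pmf.expectation (map_pmf ((\<otimes>) g) (r N)) (\<lambda>y. \<Sum>x\<in>F. \<kappa> N x y)"
        unfolding U_def by (rule Bochner_Integration.integral_sum[symmetric])
          (use \<kappa>abs in \<open>auto intro!: integrable_pmf_bounded[where B = 1]\<close>)
      also have "\<dots> \<in> {0..1}"
        by (rule expectation_mem_pmf) (use F in \<open>auto simp: \<kappa>_def bayes_sum_le_1 intro!: sum_nonneg bayes_nonneg\<close>)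
      finally show ?thesis by simp
    qed
    ultimately show ?thesis by (intro LIMSEQ_le_const2) auto
  qed (simp add: u_def)
  \<comment> \<open>Letting \<open>d\<close> grow in \<open>K3\<close>: at stage \<open>t\<close>
    the distance from the posterior to its limit is governed by the remaining drop of the
    norms.\<close>
  have L2: "measure_pmf.expectation (c t) (\<lambda>g. (u x g - \<kappa> t x g)\<^sup>2) \<le> A t x - A' x" for t x
  proof -
    have "(\<lambda>d. measure_pmf.expectation (c t) (\<lambda>g. (v t d x g - \<kappa> t x g)\<^sup>2)) \<longlonglongrightarrow>
      measure_pmf.expectation (c t) (\<lambda>g. (u x g - \<kappa> t x g)\<^sup>2)"
    proof (rule integral_dominated_convergence[where w = "\<lambda>_. 1"])
      show "AE g in c t. (\<lambda>d. (v t d x g - \<kappa> t x g)\<^sup>2) \<longlonglongrightarrow> (u x g - \<kappa> t x g)\<^sup>2"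
        by (intro AE_pmfI tendsto_intros lims(2))
      show "AE g in c t. norm ((v t d x g - \<kappa> t x g)\<^sup>2) \<le> 1" for d
        by (intro AE_pmfI) (simp only: real_norm_def abs_power2, rule sq1[OF v01 \<kappa>01])
    qed auto
    moreover have "(\<lambda>d. A t x - A (t + d) x) \<longlonglongrightarrow> A t x - A' x"
      using LIMSEQ_ignore_initial_segment[OF A'(1)[of x], of t]
      by (intro tendsto_intros) (simp add: add.commute)
    ultimately show ?thesis by (rule LIMSEQ_le) (use K3 in auto)
  qed
  \<comment> \<open>One step followed by \<open>tau N\<close> is the random time
    \<open>1 + tau N\<close>, which \<open>shift_mix\<close> cannot tell from \<open>tau N\<close>
    in the limit.\<close>
  have harm: "u x g = measure_pmf.expectation \<mu> (\<lambda>a. u x (g \<otimes> a))" if j: "n \<le> j" "g \<in> set_pmf (P j)" for x j g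
  proof -
    \<comment> \<open>At this stage both \<open>j - n\<close> and its successor are values of
      \<open>tau t\<close>, since the last window reaches up to \<open>t\<close> and all the others
      may contribute 0. Thus \<open>g\<close> and its successors are reachable at one common
      stage.\<close>
    define t where "t = Suc (j - n)"
    have gcar: "g \<in> carrier G" using j supp_walk by blast
    have tau0: "0 \<in> set_pmf (tau t)" for t
      unfolding tau_def by (induction t) (auto simp: set_padd intro: exI[of _ 0])
    have tau_all: "j - n \<in> set_pmf (tau t)" "Suc (j - n) \<in> set_pmf (tau t)"
    proof -
      have "i \<in> set_pmf (tau t)" if "i \<le> t" for i
        using tau0[of "j - n"] that unfolding t_def tau_def seg.simps set_padd
        by (intro CollectI exI[of _ 0] exI[of _ i]) auto
      then show "j - n \<in> set_pmf (tau t)" "Suc (j - n) \<in> set_pmf (tau t)" by (auto simp: t_def)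
    qed
    have PP: "set_pmf (P (n + i)) \<subseteq> set_pmf (c t)" if "i \<in> set_pmf (tau t)" for i
      unfolding walk_add c_conv r_def mix_walk_def conv_pmf_def using that by auto
    have g: "g \<in> set_pmf (c t)" using PP[OF tau_all(1)] j by auto
    have ga: "g \<otimes> a \<in> set_pmf (c t)" if "a \<in> set_pmf \<mu>" for a
    proof -
      have "g \<otimes> a \<in> set_pmf (P (Suc j))" using j that by (auto simp: conv_pmf_def)
      then show ?thesis using PP[OF tau_all(2)] j by auto
    qed
    have 1: "(\<lambda>N. measure_pmf.expectation \<mu> (\<lambda>a. U N x (g \<otimes> a))) \<longlonglongrightarrow> measure_pmf.expectation \<mu> (\<lambda>a. u x (g \<otimes> a))"
      by (rule integral_dominated_convergence[where w = "\<lambda>_. 1"])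
        (use U01 in \<open>auto intro!: AE_pmfI lims(1)[OF ga]\<close>)
    have eq: "measure_pmf.expectation \<mu> (\<lambda>a. U N x (g \<otimes> a)) =
        measure_pmf.expectation (mix_walk G \<mu> (padd (return_pmf 1) (tau N))) (\<lambda>y. \<kappa> N x (g \<otimes> y))" for N
    proof -
      have "mix_walk G \<mu> (padd (return_pmf 1) (tau N)) = conv_pmf G \<mu> (r N)"
        by (simp only: mix_padd mix_walk_return r_def One_nat_def walk_1)
      then have "map_pmf ((\<otimes>) g) (mix_walk G \<mu> (padd (return_pmf 1) (tau N))) = map_pmf ((\<otimes>) g) (conv_pmf G \<mu> (r N))"
        by simp
      also have "\<dots> = bind_pmf \<mu> (\<lambda>a. map_pmf ((\<otimes>) (g \<otimes> a)) (r N))"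
        unfolding conv_pmf_bind map_bind_pmf map_pmf_comp
        by (intro bind_pmf_cong map_pmf_cong refl m_assoc[symmetric]) (use supp supp_mix gcar in \<open>auto simp: r_def\<close>)
      finally have "map_pmf ((\<otimes>) g) (mix_walk G \<mu> (padd (return_pmf 1) (tau N))) = bind_pmf \<mu> (\<lambda>a. map_pmf ((\<otimes>) (g \<otimes> a)) (r N))" .
      then have "measure_pmf.expectation (map_pmf ((\<otimes>) g) (mix_walk G \<mu> (padd (return_pmf 1) (tau N)))) (\<kappa> N x) =
          measure_pmf.expectation \<mu> (\<lambda>a. U N x (g \<otimes> a))"
        unfolding U_def by (simp only:) (rule expectation_bind_pmf_bounded[where B = 1], rule \<kappa>abs)
      then show ?thesis by simp
    qed
    have "\<bar>measure_pmf.expectation \<mu> (\<lambda>a. U (Suc M) x (g \<otimes> a)) - U (Suc M) x g\<bar> \<le> real 1 / real (Suc M + 1)" for M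
    proof -
      have t: "tau (Suc M) = padd (seg 0 M) (unif (Suc M))" by (simp add: tau_def)
      have U: "U (Suc M) x g = measure_pmf.expectation (mix_walk G \<mu> (tau (Suc M))) (\<lambda>y. \<kappa> (Suc M) x (g \<otimes> y))"
        by (simp only: U_def r_def integral_map_pmf)
      have "set_pmf (return_pmf (1::nat)) \<subseteq> {..1}" by simp
      note shift_mix[OF _ this, of "\<lambda>y. \<kappa> (Suc M) x (g \<otimes> y)" "seg 0 M" "Suc M", folded t, OF \<kappa>01]
      then show ?thesis by (simp only: eq U of_nat_add of_nat_1)
    qed
    then have "\<forall>\<^sub>F M in sequentially. norm (measure_pmf.expectation \<mu> (\<lambda>a. U (Suc M) x (g \<otimes> a)) - U (Suc M) x g) \<le> real 1 / real (Suc M + 1)"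
      by (simp only: real_norm_def eventually_True)
    moreover have "(\<lambda>M. real 1 / real (Suc M + 1)) \<longlonglongrightarrow> 0" by real_asymp
    ultimately have "(\<lambda>M. measure_pmf.expectation \<mu> (\<lambda>a. U (Suc M) x (g \<otimes> a)) - U (Suc M) x g) \<longlonglongrightarrow> 0"
      by (rule Lim_null_comparison)
    moreover have "(\<lambda>M. measure_pmf.expectation \<mu> (\<lambda>a. U (Suc M) x (g \<otimes> a)) - U (Suc M) x g) \<longlonglongrightarrow>
       measure_pmf.expectation \<mu> (\<lambda>a. u x (g \<otimes> a)) - u x g"
      by (intro tendsto_diff LIMSEQ_Suc[OF 1] LIMSEQ_Suc[OF lims(1)[OF g]])
    ultimately show ?thesis using LIMSEQ_unique by fastforce
  qed
  have "real n * h \<le> c0" if c0: "(\<lambda>j. measure_pmf.expectation (pair_pmf ?\<alpha> (P j)) (\<lambda>(x, l). ln (1 + u x (x \<otimes> l) / pmf ?\<alpha> x))) \<longlonglongrightarrow> c0" for c0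
  proof -
    define f where "f = (\<lambda>(x, l). ln (1 + u x (x \<otimes> l) / pmf ?\<alpha> x))"
    define fk where "fk t = (\<lambda>(x, l). ln (1 + \<kappa> t x (x \<otimes> l) / pmf ?\<alpha> x))" for t
    define w where "w x = ln 2 - ln (pmf ?\<alpha> x)" for x
    define J where "J j = measure_pmf.expectation (pair_pmf ?\<alpha> (P j)) f" for j
    have finr: "fin_ent (r t)" for t unfolding r_def tau_def by (rule fin_ent_mix[OF fin finite_seg])
    have fin\<alpha>: "fin_ent ?\<alpha>" by (rule fin_ent_walk[OF fin])
    \<comment> \<open>As \<open>s\<close> and the mass of \<open>x\<close> are at most 1, the
      argument of the logarithm is at most twice the inverse mass; \<open>w\<close> is its logarithm
      and has finite mean by finiteness of the entropy.\<close>
    have lnb: "0 \<le> ln (1 + s / pmf ?\<alpha> x) \<and> ln (1 + s / pmf ?\<alpha> x) \<le> w x"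
      if "x \<in> set_pmf ?\<alpha>" "s \<in> {0..1}" for s x
    proof -
      have p: "0 < pmf ?\<alpha> x" "pmf ?\<alpha> x \<le> 1" using that by (auto simp: pmf_positive pmf_le_1)
      have "1 + s / pmf ?\<alpha> x = (pmf ?\<alpha> x + s) / pmf ?\<alpha> x" using p by (simp add: add_divide_distrib)
      also have "\<dots> \<le> 2 / pmf ?\<alpha> x" using p that by (intro divide_right_mono) auto
      finally have "1 + s / pmf ?\<alpha> x \<le> 2 / pmf ?\<alpha> x" .
      then have "ln (1 + s / pmf ?\<alpha> x) \<le> ln (2 / pmf ?\<alpha> x)"
        using p that by (subst ln_le_cancel_iff) (auto intro!: add_pos_nonneg divide_nonneg_pos)
      also have "\<dots> = w x" using p by (simp add: w_def ln_div)
      finally show ?thesis using p that by (auto intro!: ln_ge_zero)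
    qed
    have iw: "integrable (measure_pmf ?\<alpha>) w" unfolding w_def using fin\<alpha> by (auto simp: fin_ent_def)
    have iw': "integrable (measure_pmf (pair_pmf ?\<alpha> q)) (\<lambda>z. w (fst z))" for q by (rule pair_pmf_fst(1)[OF iw])
    have fb: "0 \<le> f (x, l) \<and> f (x, l) \<le> w x" and fkb: "0 \<le> fk t (x, l) \<and> fk t (x, l) \<le> w x"
      if "x \<in> set_pmf ?\<alpha>" for x l t
      unfolding f_def fk_def case_prod_conv by (rule lnb[OF that u01] lnb[OF that \<kappa>01])+
    have int_w: "integrable (measure_pmf (pair_pmf ?\<alpha> q)) F"
      if "\<And>x l. x \<in> set_pmf ?\<alpha> \<Longrightarrow> 0 \<le> F (x, l) \<and> F (x, l) \<le> w x" for q :: "'a pmf" and F :: "'a \<times> 'a \<Rightarrow> real"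
    proof (rule Bochner_Integration.integrable_bound[OF iw'[of q]])
      show "AE z in measure_pmf (pair_pmf ?\<alpha> q). norm (F z) \<le> norm (w (fst z))"
      proof (rule AE_pmfI)
        fix z assume "z \<in> set_pmf (pair_pmf ?\<alpha> q)"
        then show "norm (F z) \<le> norm (w (fst z))" using that[of "fst z" "snd z"] by (auto simp: mem_Times_iff)
      qed
    qed simp
    have if': "integrable (measure_pmf (pair_pmf ?\<alpha> q)) f" "integrable (measure_pmf (pair_pmf ?\<alpha> q)) (fk t)" for q :: "'a pmf" and t
      by (rule int_w[OF fb] int_w[OF fkb]; assumption)+
    define Kc where "Kc = measure_pmf.expectation ?\<alpha> w"
    have J: "0 \<le> J j" "J j \<le> Kc" for j
    proof -
      show "0 \<le> J j" unfolding J_def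
        by (rule integral_nonneg_AE, rule AE_pmfI) (use fb in auto)
      have "J j \<le> measure_pmf.expectation (pair_pmf ?\<alpha> (P j)) (\<lambda>z. w (fst z))" unfolding J_def
        by (rule integral_mono_AE[OF if'(1) iw'], rule AE_pmfI) (use fb in auto)
      then show "J j \<le> Kc" by (simp add: Kc_def pair_pmf_fst(2))
    qed
    have Jc: "J \<longlonglongrightarrow> c0" using c0 unfolding J_def f_def .
    have c0nn: "0 \<le> c0" by (rule LIMSEQ_le_const[OF Jc]) (use J in auto)
    have hatJ: "measure_pmf.expectation (pair_pmf ?\<alpha> (r t)) f = measure_pmf.expectation (tau t) J" for t
    proof -
      have "pair_pmf ?\<alpha> (r t) = bind_pmf (tau t) (\<lambda>j. pair_pmf ?\<alpha> (P j))"
        unfolding r_def mix_walk_def pair_pmf_def bind_assoc_pmf by (rule bind_commute_pmf)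
      then show ?thesis
        using expectation_bind_pmf_nonneg(3)[of "tau t" "\<lambda>j. pair_pmf ?\<alpha> (P j)" f] if'(1)[of "r t"] fb
        unfolding J_def by auto
    qed
    \<comment> \<open>The mutual information is the mean logarithm of the exact likelihood ratio,
      posterior over prior; adding 1 under the logarithm only raises it.\<close>
    have low: "real n * h \<le> measure_pmf.expectation (pair_pmf ?\<alpha> (r t)) (fk t)" for t
    proof -
      have "real n * h \<le> ent (c t) - ent (r t)"
        unfolding c_conv r_def tau_def by (rule ent_conv_mix_ge[OF fin finite_seg h])
      also have "\<dots> = measure_pmf.expectation (pair_pmf ?\<alpha> (r t)) (\<lambda>z. ln (pmf (r t) (snd z)) - (case z of (x, l) \<Rightarrow> ln (pmf (c t) (x \<otimes> l))))"
        using integrable_conv[OF fin\<alpha> finr, of t] pair_pmf_snd[where q = "r t" and f = "\<lambda>x. ln (pmf (r t) x)" and p = ?\<alpha>] finr[of t]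
        by (subst Bochner_Integration.integral_diff) (auto simp: c_conv ent_conv_eq ent_def[of "r t"] fin_ent_def)
      also have "\<dots> \<le> measure_pmf.expectation (pair_pmf ?\<alpha> (r t)) (fk t)"
      proof (rule integral_mono_AE[OF _ if'(2)])
        show "integrable (measure_pmf (pair_pmf ?\<alpha> (r t))) (\<lambda>z. ln (pmf (r t) (snd z)) - (case z of (x, l) \<Rightarrow> ln (pmf (c t) (x \<otimes> l))))"
          using integrable_conv[OF fin\<alpha> finr, of t] pair_pmf_snd[where q = "r t" and f = "\<lambda>x. ln (pmf (r t) x)" and p = ?\<alpha>] finr[of t]
          by (auto simp: c_conv fin_ent_def)
        show "AE z in measure_pmf (pair_pmf ?\<alpha> (r t)). ln (pmf (r t) (snd z)) - (case z of (x, l) \<Rightarrow> ln (pmf (c t) (x \<otimes> l))) \<le> fk t z"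
        proof (rule AE_pmfI)
          fix z assume "z \<in> set_pmf (pair_pmf ?\<alpha> (r t))"
          then obtain x l where z: "z = (x, l)" "x \<in> set_pmf ?\<alpha>" "l \<in> set_pmf (r t)" by auto
          have p: "0 < pmf ?\<alpha> x" "0 < pmf (r t) l" "0 < pmf (c t) (x \<otimes> l)"
            using z by (auto intro!: pmf_positive simp: c_conv conv_pmf_def)
          have "pmf (K t x) (x \<otimes> l) = pmf (r t) l"
            unfolding K_def by (rule pmf_translate) (use z supp_walk supp_mix in \<open>auto simp: r_def\<close>)
          then have "\<kappa> t x (x \<otimes> l) / pmf ?\<alpha> x = pmf (r t) l / pmf (c t) (x \<otimes> l)"
            using p by (simp add: \<kappa>_def bayes_def c_def)
          then have "ln (pmf (r t) l) - ln (pmf (c t) (x \<otimes> l)) = ln (\<kappa> t x (x \<otimes> l) / pmf ?\<alpha> x)"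
            using p by (simp add: ln_div)
          also have "\<dots> \<le> ln (1 + \<kappa> t x (x \<otimes> l) / pmf ?\<alpha> x)"
          proof (subst ln_le_cancel_iff)
            have "0 < \<kappa> t x (x \<otimes> l)" unfolding \<kappa>_def
              by (rule bayes_pos) (use z in \<open>auto simp: K_def\<close>)
            then show "0 < \<kappa> t x (x \<otimes> l) / pmf ?\<alpha> x" using p by simp
            then show "0 < 1 + \<kappa> t x (x \<otimes> l) / pmf ?\<alpha> x" by simp
          qed simp
          finally show "ln (pmf (r t) (snd z)) - (case z of (x, l) \<Rightarrow> ln (pmf (c t) (x \<otimes> l))) \<le> fk t z"
            by (simp add: z fk_def)
        qed
      qed
      finally show ?thesis .
    qed
    have diff0: "(\<lambda>t. measure_pmf.expectation (pair_pmf ?\<alpha> (r t)) f - measure_pmf.expectation (pair_pmf ?\<alpha> (r t)) (fk t)) \<longlonglongrightarrow> 0"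
    proof -
      define D where "D t x = measure_pmf.expectation (r t) (\<lambda>l. f (x, l) - fk t (x, l))" for t x
      have pf: "pair_pmf ?\<alpha> (r t) = bind_pmf ?\<alpha> (\<lambda>x. map_pmf (Pair x) (r t))" for t
        by (simp add: pair_pmf_def map_pmf_def)
      have Dle: "\<bar>D t x\<bar> \<le> w x" if x: "x \<in> set_pmf ?\<alpha>" for t x
      proof -
        have "D t x \<in> {- w x..w x}" unfolding D_def
        proof (rule expectation_mem_pmf)
          show "f (x, l) - fk t (x, l) \<in> {- w x..w x}" for l
            using fb[OF x, of l] fkb[OF x, of t l] unfolding atLeastAtMost_iff by linarith
        qed
        then show ?thesis by auto
      qed
      have eqD: "measure_pmf.expectation (pair_pmf ?\<alpha> (r t)) f - measure_pmf.expectation (pair_pmf ?\<alpha> (r t)) (fk t) =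
        measure_pmf.expectation ?\<alpha> (D t)" for t
      proof -
        have nn: "0 \<le> f z" "0 \<le> fk t z" if "z \<in> set_pmf (pair_pmf ?\<alpha> (r t))" for z
          using that fb fkb by auto
        have b: "(\<forall>x\<in>set_pmf ?\<alpha>. integrable (measure_pmf (r t)) (\<lambda>l. F (x, l))) \<and>
            integrable (measure_pmf ?\<alpha>) (\<lambda>x. measure_pmf.expectation (r t) (\<lambda>l. F (x, l))) \<and>
            measure_pmf.expectation (pair_pmf ?\<alpha> (r t)) F = measure_pmf.expectation ?\<alpha> (\<lambda>x. measure_pmf.expectation (r t) (\<lambda>l. F (x, l)))"
          if nn: "\<And>z. z \<in> set_pmf (pair_pmf ?\<alpha> (r t)) \<Longrightarrow> 0 \<le> F z" and i: "integrable (measure_pmf (pair_pmf ?\<alpha> (r t))) F"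
          for F :: "'a \<times> 'a \<Rightarrow> real"
          using expectation_bind_pmf_nonneg[of ?\<alpha> "\<lambda>x. map_pmf (Pair x) (r t)" F] nn i unfolding pf by simp
        note b1 = b[OF nn(1) if'(1)] and b2 = b[OF nn(2) if'(2)]
        have "measure_pmf.expectation ?\<alpha> (D t) = measure_pmf.expectation ?\<alpha>
            (\<lambda>x. measure_pmf.expectation (r t) (\<lambda>l. f (x, l)) - measure_pmf.expectation (r t) (\<lambda>l. fk t (x, l)))"
          by (rule integral_cong_AE) (use b1 b2 in \<open>auto simp: AE_measure_pmf_iff D_def\<close>)
        then show ?thesis using b1 b2 by simp
      qed
      have Dlim: "(\<lambda>t. D t x) \<longlonglongrightarrow> 0" if x: "x \<in> set_pmf ?\<alpha>" for x
      proof -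
        let ?p = "pmf ?\<alpha> x"
        have p: "0 < ?p" using x by (rule pmf_positive)
        \<comment> \<open>One factor \<open>1 / ?p\<close> is the Lipschitz constant of the score,
          the other bounds the density of the law given \<open>x\<close> with respect to the mixture
          \<open>c t\<close>. The square root comes from passing from the first to the second
          moment.\<close>
        have "\<bar>D t x\<bar> \<le> sqrt (A t x - A' x) / ?p\<^sup>2" for t
        proof -
          let ?d = "\<lambda>g. \<bar>u x g - \<kappa> t x g\<bar>"
          have d01: "?d g \<in> {0..1}" for g using u01[of x g] \<kappa>01[of t x g] by auto
          have lip: "\<bar>ln (1 + a / ?p) - ln (1 + b / ?p)\<bar> \<le> \<bar>a - b\<bar> / ?p" if "0 \<le> a" "0 \<le> b" for a b
            using ln_1_plus_lipschitz[of "a / ?p" "b / ?p"] that p by (simp add: diff_divide_distrib[symmetric])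
          have "\<bar>D t x\<bar> \<le> measure_pmf.expectation (r t) (\<lambda>l. \<bar>f (x, l) - fk t (x, l)\<bar>)"
            unfolding D_def by (rule integral_abs_bound)
          also have "\<dots> \<le> measure_pmf.expectation (r t) (\<lambda>l. ?d (x \<otimes> l) / ?p)"
          proof (rule integral_mono)
            show "\<bar>f (x, l) - fk t (x, l)\<bar> \<le> ?d (x \<otimes> l) / ?p" for l
              using lip[of "u x (x \<otimes> l)" "\<kappa> t x (x \<otimes> l)"] u01 \<kappa>01 by (auto simp: f_def fk_def)
            show i: "integrable (measure_pmf (r t)) (\<lambda>l. ?d (x \<otimes> l) / ?p)"
              by (intro integrable_divide integrable_pmf_bounded[where B = 1]) (use d01 in auto)
            have *: "\<bar>f (x, l) - fk t (x, l)\<bar> \<le> 1 / ?p" for l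
            proof -
              have "\<bar>f (x, l) - fk t (x, l)\<bar> \<le> ?d (x \<otimes> l) / ?p"
                using lip[of "u x (x \<otimes> l)" "\<kappa> t x (x \<otimes> l)"] u01 \<kappa>01 by (auto simp: f_def fk_def)
              also have "\<dots> \<le> 1 / ?p" using d01[of "x \<otimes> l"] p by (intro divide_right_mono) auto
              finally show ?thesis .
            qed
            then show "integrable (measure_pmf (r t)) (\<lambda>l. \<bar>f (x, l) - fk t (x, l)\<bar>)"
              by (intro integrable_pmf_bounded[where B = "1 / ?p"]) simp
          qed
          also have "\<dots> = measure_pmf.expectation (K t x) ?d / ?p" by (simp add: K_def)
          also have "\<dots> = (?p * measure_pmf.expectation (K t x) ?d) / ?p\<^sup>2" using p by (simp add: power2_eq_square)
          also have "\<dots> = measure_pmf.expectation (c t) (\<lambda>g. \<kappa> t x g * ?d g) / ?p\<^sup>2"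
            unfolding c_def \<kappa>_def expectation_bayes ..
          also have "\<dots> \<le> measure_pmf.expectation (c t) ?d / ?p\<^sup>2"
            by (intro divide_right_mono integral_mono integrable_pmf_bounded[where B = 1])
              (use d01 \<kappa>01 in \<open>auto simp: abs_mult mult_le_one mult_left_le_one_le\<close>)
          also have "\<dots> \<le> sqrt (A t x - A' x) / ?p\<^sup>2"
          proof (intro divide_right_mono real_le_rsqrt)
            have "(measure_pmf.expectation (c t) ?d)\<^sup>2 \<le> measure_pmf.expectation (c t) (\<lambda>g. (?d g)\<^sup>2)"
              by (rule expectation_power2_le_pmf[where B = 1]) (use d01 in auto)
            also have "\<dots> \<le> A t x - A' x" using L2[of t x] by simp
            finally show "(measure_pmf.expectation (c t) ?d)\<^sup>2 \<le> A t x - A' x" .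
          qed simp
          finally show ?thesis .
        qed
        then have "\<forall>\<^sub>F t in sequentially. norm (D t x) \<le> sqrt (A t x - A' x) / ?p\<^sup>2"
          by (simp only: real_norm_def eventually_True)
        moreover have "(\<lambda>t. sqrt (A t x - A' x) / ?p\<^sup>2) \<longlonglongrightarrow> sqrt (A' x - A' x) / ?p\<^sup>2"
          by (intro tendsto_intros A'(1)) (use p in auto)
        then have "(\<lambda>t. sqrt (A t x - A' x) / ?p\<^sup>2) \<longlonglongrightarrow> 0" by (simp only: diff_self real_sqrt_zero div_0)
        ultimately show ?thesis by (rule Lim_null_comparison)
      qed
      have "(\<lambda>t. measure_pmf.expectation ?\<alpha> (D t)) \<longlonglongrightarrow> measure_pmf.expectation ?\<alpha> (\<lambda>_. 0)"
        by (rule integral_dominated_convergence[OF _ _ iw]) (use Dlim Dle in \<open>auto simp: AE_measure_pmf_iff\<close>)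
      then show ?thesis by (simp add: eqD)
    qed
    show ?thesis
    proof (rule field_le_epsilon)
      fix \<epsilon> :: real assume \<epsilon>: "0 < \<epsilon>"
      have "\<forall>\<^sub>F j in sequentially. J j < c0 + \<epsilon> / 3" by (rule order_tendstoD[OF Jc]) (use \<epsilon> in simp)
      then obtain C where C: "\<And>j. C \<le> j \<Longrightarrow> J j < c0 + \<epsilon> / 3" by (auto simp: eventually_sequentially)
      have "\<forall>\<^sub>F t in sequentially. \<bar>measure_pmf.expectation (pair_pmf ?\<alpha> (r t)) f - measure_pmf.expectation (pair_pmf ?\<alpha> (r t)) (fk t)\<bar> < \<epsilon> / 3"
        using tendstoD[OF diff0, of "\<epsilon> / 3"] \<epsilon> by (simp add: dist_real_def)
      \<comment> \<open>The limit controls \<open>J j\<close> only for \<open>j \<ge> C\<close>.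
        With probability at most \<open>C / (t + 1)\<close> the random time falls below
        \<open>C\<close>, where only the crude bound \<open>Kc\<close> is available.\<close>
      moreover have "\<forall>\<^sub>F t in sequentially. Kc * (real C / real (t + 1)) < \<epsilon> / 3"
      proof -
        have "(\<lambda>t. Kc * (real C / real (t + 1))) \<longlonglongrightarrow> 0" by real_asymp
        then show ?thesis by (rule order_tendstoD) (use \<epsilon> in simp)
      qed
      ultimately have "\<forall>\<^sub>F t in sequentially. \<bar>measure_pmf.expectation (pair_pmf ?\<alpha> (r t)) f - measure_pmf.expectation (pair_pmf ?\<alpha> (r t)) (fk t)\<bar> < \<epsilon> / 3 \<and> Kc * (real C / real (t + 1)) < \<epsilon> / 3 \<and> 1 \<le> t"
        using eventually_ge_at_top[of "1::nat"] by eventually_elim auto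
      then obtain t where t: "\<bar>measure_pmf.expectation (pair_pmf ?\<alpha> (r t)) f - measure_pmf.expectation (pair_pmf ?\<alpha> (r t)) (fk t)\<bar> < \<epsilon> / 3"
        "Kc * (real C / real (t + 1)) < \<epsilon> / 3" "1 \<le> t"
        by (auto simp: eventually_sequentially)
      have ii: "integrable (measure_pmf (tau t)) (indicator {..<C} :: nat \<Rightarrow> real)"
        by (rule integrable_pmf_bounded[where B = 1]) (auto split: split_indicator)
      have "measure_pmf.expectation (tau t) J \<le> measure_pmf.expectation (tau t) (\<lambda>j. (c0 + \<epsilon> / 3) + Kc * indicator {..<C} j)"
      proof (rule integral_mono)
        show "integrable (measure_pmf (tau t)) J" by (rule integrable_pmf_bounded[where B = Kc]) (use J in auto)
        show "integrable (measure_pmf (tau t)) (\<lambda>j. (c0 + \<epsilon> / 3) + Kc * indicator {..<C} j)"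
          using ii by simp
        show "J j \<le> (c0 + \<epsilon> / 3) + Kc * indicator {..<C} j" for j
        proof (cases "j < C")
          case True then show ?thesis using J(2)[of j] c0nn \<epsilon> by simp
        next
          case False then show ?thesis using C[of j] by simp
        qed
      qed
      also have "\<dots> = c0 + \<epsilon> / 3 + Kc * measure_pmf.prob (tau t) {..<C}"
        using ii by simp
      also have "\<dots> \<le> c0 + \<epsilon> / 3 + Kc * (real C / real (t + 1))"
      proof -
        obtain t' where t': "t = Suc t'" using t(3) by (cases t) auto
        have "measure_pmf.prob (tau t) {..<C} \<le> real C / real (t + 1)"
          using measure_padd_unif_le[of "seg 0 t'" "Suc t'" C] by (simp add: tau_def t')
        moreover have "0 \<le> Kc" using J[of 0] by linarith
        ultimately show ?thesis by (intro add_left_mono mult_left_mono)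
      qed
      finally have "measure_pmf.expectation (pair_pmf ?\<alpha> (r t)) f \<le> c0 + \<epsilon> / 3 + \<epsilon> / 3"
        unfolding hatJ using t(2) by linarith
      then show "real n * h \<le> c0 + \<epsilon>" using low[of t] t(1) by linarith
    qed
  qed
  with u_nonneg u_sum harm show ?thesis by (rule that)
qed

end

section \<open>Path spaces\<close>

locale countable_walk = group_walk +
  assumes countable_carrier: "countable (carrier G)"
begin

definition R :: "'a measure" where "R = restrict_space (measure_pmf \<mu>) (carrier G)"

lemma prob_space_R: "prob_space R"
  unfolding R_def by (rule prob_space_increment[OF supp])

end

sublocale countable_walk \<subseteq> seq: sequence_space R
  by (intro sequence_space.intro product_prob_spaceI prob_space_R)

context countable_walk
begin

text \<open>Almost sure statements are proved for sequences of increments, where independence and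
  shifts are explicit, and carried to trajectories by \<open>partial_product G\<close>.\<close>

abbreviation "S \<equiv> PiM (UNIV :: nat set) (\<lambda>_. R)"

abbreviation "Y n \<xi> \<equiv> partial_product G \<xi> n"

definition advance :: "nat \<Rightarrow> (nat \<Rightarrow> 'a) \<Rightarrow> nat \<Rightarrow> 'a" where "advance n \<xi> = (\<lambda>i. \<xi> (n + i))"

lemma space_R: "space R = carrier G" by (simp add: R_def space_restrict_space)

lemma sets_R: "sets R = Pow (carrier G)"
  unfolding R_def sets_increment by simp

lemma space_S: "\<xi> \<in> space S \<longleftrightarrow> (\<forall>i. \<xi> i \<in> carrier G)"
  by (auto simp: space_PiM space_R PiE_iff)

lemma measurable_coord [measurable]: "(\<lambda>\<xi>. \<xi> n) \<in> S \<rightarrow>\<^sub>M count_space (carrier G)"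
proof -
  have "(\<lambda>\<xi>. \<xi> n) \<in> S \<rightarrow>\<^sub>M R" by simp
  then show ?thesis by (simp add: measurable_def space_R sets_R)
qed

lemma measurable_W [measurable]: "partial_product G \<in> S \<rightarrow>\<^sub>M path_space G"
  unfolding R_def by (rule measurable_partial_product[OF is_group countable_carrier])

lemma measurable_path_coord [measurable]: "(\<lambda>\<omega>. \<omega> n) \<in> path_space G \<rightarrow>\<^sub>M count_space (carrier G)"
  unfolding path_space_def by simp

lemma measurable_Y [measurable]: "(\<lambda>\<xi>. Y n \<xi>) \<in> S \<rightarrow>\<^sub>M count_space (carrier G)"
  by (rule measurable_compose[OF measurable_W measurable_path_coord])

lemma measurable_fun_Y [measurable]: "(\<lambda>\<xi>. (f :: 'a \<Rightarrow> 'c :: topological_space) (Y n \<xi>)) \<in> borel_measurable S"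
  by (rule measurable_compose[OF measurable_Y]) simp

lemma measurable_fun_coord [measurable]: "(\<lambda>\<xi>. (f :: 'a \<Rightarrow> 'c :: topological_space) (\<xi> n)) \<in> borel_measurable S"
  by (rule measurable_compose[OF measurable_coord]) simp

lemma pred_fun_Y [measurable]: "Measurable.pred S (\<lambda>\<xi>. Q (Y n \<xi>))"
  by (rule measurable_compose[OF measurable_Y]) simp

lemma Y_closed: "\<xi> \<in> space S \<Longrightarrow> Y n \<xi> \<in> carrier G"
  by (induction n) (auto simp: space_S)

lemma advance_apply: "advance n \<xi> i = \<xi> (n + i)"
  by (simp add: advance_def)

lemma advance_space: "\<xi> \<in> space S \<Longrightarrow> advance n \<xi> \<in> space S"
  by (simp add: space_S advance_def)

lemma Y_cong: "(\<And>i. i < n \<Longrightarrow> \<xi> i = \<xi>' i) \<Longrightarrow> Y n \<xi> = Y n \<xi>'"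
  by (induction n) auto

lemma Y_shift: "\<xi> \<in> space S \<Longrightarrow> Y (n + j) \<xi> = Y n \<xi> \<otimes> Y j (advance n \<xi>)"
proof (induction j)
  case (Suc j)
  then show ?case using Y_closed[OF advance_space[of \<xi> n]] Y_closed[of \<xi> n]
    by (simp add: m_assoc space_S advance_apply[of n \<xi> j])
qed (simp add: Y_closed)

lemma W_shift: "\<xi> \<in> space S \<Longrightarrow> (\<lambda>j. partial_product G \<xi> (n + j)) = path_translate G (Y n \<xi>) (partial_product G (advance n \<xi>))"
  by (rule ext) (simp add: path_translate_def Y_shift)

lemma comb_space: "\<omega> \<in> space S \<Longrightarrow> \<omega>' \<in> space S \<Longrightarrow> comb_seq n \<omega> \<omega>' \<in> space S"
  by (auto simp: space_S comb_seq_def)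

lemma Y_comb: "i \<le> n \<Longrightarrow> Y i (comb_seq n \<omega> \<omega>') = Y i \<omega>"
  by (rule Y_cong) (simp add: comb_seq_def)

lemma advance_comb: "advance n (comb_seq n \<omega> \<omega>') = \<omega>'"
  by (rule ext) (simp add: advance_def comb_seq_def)

text \<open>Gluing the first \<open>n\<close> increments of one sequence to an independent second
  sequence preserves the law. The inner integral plays the role of a conditional expectation given
  the first \<open>n\<close> increments.\<close>

lemma nn_integral_comb:
  assumes [measurable]: "F \<in> borel_measurable S"
  shows "(\<integral>\<^sup>+\<xi>. F \<xi> \<partial>S) = (\<integral>\<^sup>+\<omega>. \<integral>\<^sup>+\<omega>'. F (comb_seq n \<omega> \<omega>') \<partial>S \<partial>S)"
proof -
  have m: "(\<lambda>(\<omega>, \<omega>'). comb_seq n \<omega> \<omega>') \<in> S \<Otimes>\<^sub>M S \<rightarrow>\<^sub>M S" by (rule measurable_comb_seq)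
  have "(\<integral>\<^sup>+\<xi>. F \<xi> \<partial>S) = (\<integral>\<^sup>+\<xi>. F \<xi> \<partial>distr (S \<Otimes>\<^sub>M S) S (\<lambda>(\<omega>, \<omega>'). comb_seq n \<omega> \<omega>'))"
    by (simp only: seq.PiM_comb_seq)
  also have "\<dots> = (\<integral>\<^sup>+z. F (case z of (\<omega>, \<omega>') \<Rightarrow> comb_seq n \<omega> \<omega>') \<partial>(S \<Otimes>\<^sub>M S))"
    by (rule nn_integral_distr[OF m]) simp
  also have "\<dots> = (\<integral>\<^sup>+\<omega>. \<integral>\<^sup>+\<omega>'. F (comb_seq n \<omega> \<omega>') \<partial>S \<partial>S)"
    using measurable_compose[OF m assms] by (subst seq.P.nn_integral_fst[symmetric]) auto
  finally show ?thesis .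
qed

lemma measurable_advance [measurable]: "advance n \<in> S \<rightarrow>\<^sub>M S"
  unfolding advance_def by (rule measurable_PiM_single') (auto simp: space_PiM PiE_iff)

lemma nn_integral_coord: "(\<integral>\<^sup>+\<xi>. F (\<xi> n) \<partial>S) = (\<integral>\<^sup>+a. F a \<partial>measure_pmf \<mu>)"
proof -
  have "(\<integral>\<^sup>+\<xi>. F (\<xi> n) \<partial>S) = (\<integral>\<^sup>+a. F a \<partial>distr S R (\<lambda>\<xi>. \<xi> n))"
    by (rule nn_integral_distr[symmetric]) (simp, simp add: measurable_def sets_R space_R)
  also have "distr S R (\<lambda>\<xi>. \<xi> n) = R"
    by (rule distr_PiM_component) (auto intro: prob_space_R)
  also have "(\<integral>\<^sup>+a. F a \<partial>R) = (\<integral>\<^sup>+a. F a * indicator (carrier G) a \<partial>measure_pmf \<mu>)"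
    unfolding R_def by (rule nn_integral_restrict_space) simp
  also have "\<dots> = (\<integral>\<^sup>+a. F a \<partial>measure_pmf \<mu>)"
    by (rule nn_integral_cong_AE) (use supp in \<open>auto simp: AE_measure_pmf_iff\<close>)
  finally show ?thesis .
qed

lemma nn_integral_comb_aux:
  assumes F: "\<And>y. y \<in> carrier G \<Longrightarrow> F y \<in> borel_measurable S"
  shows "(\<lambda>\<xi>. F (Y n \<xi>) (advance n \<xi>)) \<in> borel_measurable S"
  by (rule measurable_compose_countable'[OF _ measurable_Y countable_carrier])
    (rule measurable_compose[OF measurable_advance F])

lemma nn_integral_Y: "(\<integral>\<^sup>+\<xi>. F (Y n \<xi>) \<partial>S) = (\<integral>\<^sup>+y. F y \<partial>measure_pmf (P n))"
proof (induction n arbitrary: F)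
  case 0
  then show ?case by (simp add: seq.P.emeasure_space_1)
next
  case (Suc n)
  have "(\<integral>\<^sup>+\<xi>. F (Y (Suc n) \<xi>) \<partial>S) = (\<integral>\<^sup>+\<omega>. \<integral>\<^sup>+\<omega>'. F (Y n \<omega> \<otimes> \<omega>' 0) \<partial>S \<partial>S)"
    by (subst nn_integral_comb[where n = n], rule measurable_fun_Y) (simp add: Y_comb, simp add: comb_seq_def)
  also have "\<dots> = (\<integral>\<^sup>+\<omega>. \<integral>\<^sup>+a. F (Y n \<omega> \<otimes> a) \<partial>measure_pmf \<mu> \<partial>S)"
    by (rule nn_integral_cong) (rule nn_integral_coord[where n = 0 and F = "\<lambda>a. F (Y n \<omega> \<otimes> a)" for \<omega>])
  also have "\<dots> = (\<integral>\<^sup>+y. F y \<partial>measure_pmf (P (Suc n)))"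
    by (subst Suc) (simp add: conv_pmf_bind)
  finally show ?case .
qed

text \<open>The Markov property: \<open>Y n\<close> depends only on the increments before
  \<open>n\<close>, and \<open>advance n\<close> only on those from \<open>n\<close> on.\<close>

lemma nn_integral_Y_shift:
  assumes F: "\<And>y. y \<in> carrier G \<Longrightarrow> F y \<in> borel_measurable S"
  shows "(\<integral>\<^sup>+\<xi>. F (Y n \<xi>) (advance n \<xi>) \<partial>S) = (\<integral>\<^sup>+y. \<integral>\<^sup>+\<xi>. F y \<xi> \<partial>S \<partial>measure_pmf (P n))"
  by (subst nn_integral_comb[OF nn_integral_comb_aux[OF F, where n = n], where n = n])
    (simp_all add: Y_comb advance_comb nn_integral_Y[of "\<lambda>y. \<integral>\<^sup>+\<xi>. F y \<xi> \<partial>S"])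

lemma nn_integral_advance:
  assumes "F \<in> borel_measurable S"
  shows "(\<integral>\<^sup>+\<xi>. F (advance n \<xi>) \<partial>S) = (\<integral>\<^sup>+\<xi>. F \<xi> \<partial>S)"
  using nn_integral_Y_shift[of "\<lambda>_. F" n] assms by (simp add: assms)

lemma distr_advance: "distr S S (advance n) = S"
proof (rule measure_eqI)
  fix A assume "A \<in> sets (distr S S (advance n))"
  then have A: "A \<in> sets S" by simp
  have "emeasure (distr S S (advance n)) A = (\<integral>\<^sup>+\<xi>. indicator A (advance n \<xi>) \<partial>S)"
    using A by (subst nn_integral_distr[symmetric, of _ _ S]) auto
  also have "\<dots> = emeasure S A" using A by (subst nn_integral_advance) auto
  finally show "emeasure (distr S S (advance n)) A = emeasure S A" .
qed simp

lemma AE_advance: "AE \<xi> in S. Q \<xi> \<Longrightarrow> AE \<xi> in S. Q (advance n \<xi>)"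
  by (rule AE_distrD[of "advance n" S S, OF measurable_advance]) (simp only: distr_advance)

lemma AE_Y: "AE \<xi> in S. Y n \<xi> \<in> set_pmf (P n)"
proof -
  have "(\<integral>\<^sup>+\<xi>. indicator (- set_pmf (P n)) (Y n \<xi>) \<partial>S) = 0"
    unfolding nn_integral_Y[where F = "indicator (- set_pmf (P n))"]
    by (simp add: measure_pmf.emeasure_eq_measure measure_pmf_zero_iff)
  then have "AE \<xi> in S. indicator (- set_pmf (P n)) (Y n \<xi>) = (0 :: ennreal)"
    by (subst (asm) nn_integral_0_iff_AE) auto
  then show ?thesis by eventually_elim (auto split: split_indicator_asm)
qed

lemma AE_Y_shift:
  assumes "\<And>y. y \<in> set_pmf (P n) \<Longrightarrow> AE \<xi> in S. Q y \<xi>"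
  shows "AE \<xi> in S. Q (Y n \<xi>) (advance n \<xi>)"
proof -
  have "AE \<xi> in S. \<forall>y\<in>set_pmf (P n). Q y (advance n \<xi>)"
    unfolding AE_ball_countable[OF countable_set_pmf] using assms by (blast intro: AE_advance)
  with AE_Y[of n] show ?thesis by eventually_elim auto
qed

lemma integrable_Y:
  fixes F :: "'a \<Rightarrow> real"
  shows "integrable S (\<lambda>\<xi>. F (Y n \<xi>)) \<longleftrightarrow> integrable (measure_pmf (P n)) F"
    and "(\<integral>\<xi>. F (Y n \<xi>) \<partial>S) = measure_pmf.expectation (P n) F"
proof -
  have *: "distr S (count_space UNIV) (\<lambda>\<xi>. Y n \<xi>) = measure_pmf (P n)"
  proof (rule measure_eqI)
    fix A :: "'a set"
    have m: "(\<lambda>\<xi>. Y n \<xi>) \<in> S \<rightarrow>\<^sub>M count_space UNIV" by (rule measurable_compose[OF measurable_Y]) simp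
    have "emeasure (distr S (count_space UNIV) (\<lambda>\<xi>. Y n \<xi>)) A = (\<integral>\<^sup>+\<xi>. indicator A (Y n \<xi>) \<partial>S)"
      by (subst nn_integral_distr[symmetric, OF m]) auto
    then show "emeasure (distr S (count_space UNIV) (\<lambda>\<xi>. Y n \<xi>)) A = emeasure (P n) A"
      by (simp add: nn_integral_Y)
  qed simp
  have m: "(\<lambda>\<xi>. Y n \<xi>) \<in> S \<rightarrow>\<^sub>M count_space UNIV" by (rule measurable_compose[OF measurable_Y]) simp
  show "integrable S (\<lambda>\<xi>. F (Y n \<xi>)) \<longleftrightarrow> integrable (measure_pmf (P n)) F"
    unfolding *[symmetric] by (rule integrable_distr_eq[OF m, symmetric]) simp
  show "(\<integral>\<xi>. F (Y n \<xi>) \<partial>S) = measure_pmf.expectation (P n) F"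
    unfolding *[symmetric] by (rule integral_distr[OF m, symmetric]) simp
qed

section \<open>Bounded harmonic functions converge along paths\<close>

text \<open>Bounded martingale convergence in mean square form: the second moments \<open>q\<close>
  increase to a limit, so late oscillations are small by a maximal inequality, and almost every path
  is Cauchy. Harmonicity is assumed only at points reached from time \<open>n0\<close> on, as
  \<open>boundary_kernel\<close> provides it.\<close>

lemma harmonic_converges:
  fixes u :: "'a \<Rightarrow> real"
  assumes u01: "\<And>g. u g \<in> {0..1}"
    and harm: "\<And>j g. n0 \<le> j \<Longrightarrow> g \<in> set_pmf (P j) \<Longrightarrow> u g = measure_pmf.expectation \<mu> (\<lambda>a. u (g \<otimes> a))"
  shows "AE \<xi> in S. convergent (\<lambda>t. u (Y t \<xi>))"
proof -
  let ?U = "\<lambda>t \<xi>. u (Y t \<xi>)"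
  have U01: "?U t \<xi> \<in> {0..1}" for t \<xi> by (rule u01)
  have Uabs: "\<bar>?U t \<xi>\<bar> \<le> 1" for t \<xi> using U01[of \<xi> t] by auto
  have uabs: "\<bar>u g\<bar> \<le> 1" for g using u01[of g] by auto
  \<comment> \<open>Measurability with respect to the first \<open>t\<close> increments, expressed
    as invariance under replacing all later ones.\<close>
  define adapted where "adapted t (h :: (nat \<Rightarrow> 'a) \<Rightarrow> real) \<longleftrightarrow> h \<in> borel_measurable S \<and> (\<forall>\<xi>. h \<xi> \<in> {0..1}) \<and>
    (\<forall>\<omega> \<omega>'. h (comb_seq t \<omega> \<omega>') = h \<omega>)" for t h
  have step: "(\<integral>\<^sup>+\<xi>. ennreal (?U (Suc t) \<xi> * h \<xi>) \<partial>S) = (\<integral>\<^sup>+\<xi>. ennreal (?U t \<xi> * h \<xi>) \<partial>S)"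
    if t: "n0 \<le> t" and h: "adapted t h" for t h
  proof -
    have [measurable]: "h \<in> borel_measurable S" using h by (simp add: adapted_def)
    have h0: "0 \<le> h \<xi>" for \<xi> using h by (auto simp: adapted_def)
    have "(\<integral>\<^sup>+\<xi>. ennreal (?U (Suc t) \<xi> * h \<xi>) \<partial>S) = (\<integral>\<^sup>+\<omega>. \<integral>\<^sup>+\<omega>'. ennreal (h \<omega>) * ennreal (u (Y t \<omega> \<otimes> \<omega>' 0)) \<partial>S \<partial>S)"
    proof -
      have m: "(\<lambda>\<xi>. ennreal (?U (Suc t) \<xi> * h \<xi>)) \<in> borel_measurable S" by measurable
      show ?thesis
        unfolding nn_integral_comb[OF m, where n = t] using h h0 u01
        by (auto intro!: nn_integral_cong simp: Y_comb adapted_def comb_seq_def ennreal_mult'[symmetric] mult.commute)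
    qed
    also have "\<dots> = (\<integral>\<^sup>+\<omega>. ennreal (h \<omega>) * (\<integral>\<^sup>+\<omega>'. ennreal (u (Y t \<omega> \<otimes> \<omega>' 0)) \<partial>S) \<partial>S)"
      by (intro nn_integral_cong nn_integral_cmult) measurable
    also have "\<dots> = (\<integral>\<^sup>+\<omega>. ennreal (h \<omega>) * (\<integral>\<^sup>+a. ennreal (u (Y t \<omega> \<otimes> a)) \<partial>measure_pmf \<mu>) \<partial>S)"
      by (rule nn_integral_cong)
        (simp only: nn_integral_coord[where n = 0 and F = "\<lambda>a. ennreal (u (Y t \<omega> \<otimes> a))" for \<omega>])
    also have "\<dots> = (\<integral>\<^sup>+\<omega>. ennreal (?U t \<omega> * h \<omega>) \<partial>S)"
    proof (rule nn_integral_cong_AE, use AE_Y[of t] in eventually_elim)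
      fix \<omega> assume "Y t \<omega> \<in> set_pmf (P t)"
      from harm[OF t this] have "(\<integral>\<^sup>+a. ennreal (u (Y t \<omega> \<otimes> a)) \<partial>measure_pmf \<mu>) = ennreal (?U t \<omega>)"
        using u01 by (subst nn_integral_eq_integral) (simp_all add: integrable_pmf_bounded[where B = 1] uabs)
      then show "ennreal (h \<omega>) * (\<integral>\<^sup>+a. ennreal (u (Y t \<omega> \<otimes> a)) \<partial>measure_pmf \<mu>) = ennreal (?U t \<omega> * h \<omega>)"
        using h0 u01 by (simp add: ennreal_mult'[symmetric] mult.commute)
    qed
    finally show ?thesis .
  qed
  have adapted_mono: "adapted t' h" if "adapted t h" "t \<le> t'" for t t' h
    unfolding adapted_def
  proof (intro conjI allI)
    fix \<omega> \<omega>'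
    have "h (comb_seq t' \<omega> \<omega>') = h (comb_seq t (comb_seq t' \<omega> \<omega>') \<omega>)" using that by (simp add: adapted_def)
    also have "comb_seq t (comb_seq t' \<omega> \<omega>') \<omega> = comb_seq t \<omega> \<omega>"
      using that by (auto simp: comb_seq_def fun_eq_iff)
    also have "h (comb_seq t \<omega> \<omega>) = h \<omega>" using that by (simp add: adapted_def)
    finally show "h (comb_seq t' \<omega> \<omega>') = h \<omega>" .
  qed (use that in \<open>auto simp: adapted_def\<close>)
  have int: "integrable S f" if "f \<in> borel_measurable S" "\<And>\<xi>. \<bar>f \<xi>\<bar> \<le> 4" for f :: "(nat \<Rightarrow> 'a) \<Rightarrow> real"
    by (rule seq.P.integrable_const_bound[where B = 4]) (use that in auto)
  have mart: "(\<integral>\<xi>. ?U (t + d) \<xi> * h \<xi> \<partial>S) = (\<integral>\<xi>. ?U t \<xi> * h \<xi> \<partial>S)" if t: "n0 \<le> t" and h: "adapted t h" for t d h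
  proof -
    have [measurable]: "h \<in> borel_measurable S" using h by (simp add: adapted_def)
    have h01: "h \<xi> \<in> {0..1}" for \<xi> using h by (auto simp: adapted_def)
    have "(\<integral>\<^sup>+\<xi>. ennreal (?U (t + d) \<xi> * h \<xi>) \<partial>S) = (\<integral>\<^sup>+\<xi>. ennreal (?U t \<xi> * h \<xi>) \<partial>S)"
      by (induction d) (use step[of "t + _" h] t adapted_mono[OF h] in auto)
    then show ?thesis
      using U01 h01 by (subst (1 2) integral_eq_nn_integral) auto
  qed
  define q where "q t = (\<integral>\<xi>. (?U t \<xi>)\<^sup>2 \<partial>S)" for t
  have adU: "adapted t (?U s)" if "s \<le> t" for s t
    using that U01 by (auto simp: adapted_def Y_comb)
  have ad_mult: "adapted t (\<lambda>\<xi>. f \<xi> * g \<xi>)" if "adapted t f" "adapted t g" for t f g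
    using that by (auto simp: adapted_def mult_le_one)
  have b1: "\<bar>?U t \<xi> * ?U s \<xi> * h \<xi>\<bar> \<le> 4" if "adapted r h" for t s r h \<xi>
    using that U01 by (auto simp: adapted_def abs_mult abs_of_nonneg intro!: order_trans[OF mult_le_one] mult_le_one)
  \<comment> \<open>Orthogonality of martingale increments, localised by a weight \<open>h\<close>
    known at time \<open>t\<close>: the cross terms at time \<open>t + d\<close> equal those at time
    \<open>t\<close>.\<close>
  have key: "(\<integral>\<xi>. (?U t \<xi> - ?U s \<xi>)\<^sup>2 * h \<xi> \<partial>S) \<le> (\<integral>\<xi>. (?U (t + d) \<xi> - ?U s \<xi>)\<^sup>2 * h \<xi> \<partial>S)"
    if st: "n0 \<le> s" "s \<le> t" and h: "adapted t h" for s t d h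
  proof -
    have hm[measurable]: "h \<in> borel_measurable S" using h by (simp add: adapted_def)
    have h0: "0 \<le> h \<xi>" for \<xi> using h by (auto simp: adapted_def)
    have i: "integrable S (\<lambda>\<xi>. ?U a \<xi> * ?U b \<xi> * h \<xi>)" for a b
      by (rule int) (auto simp: b1[OF h])
    have ex: "(\<integral>\<xi>. (?U a \<xi> - ?U b \<xi>)\<^sup>2 * h \<xi> \<partial>S) =
        (\<integral>\<xi>. ?U a \<xi> * ?U a \<xi> * h \<xi> \<partial>S) - 2 * (\<integral>\<xi>. ?U a \<xi> * ?U b \<xi> * h \<xi> \<partial>S) + (\<integral>\<xi>. ?U b \<xi> * ?U b \<xi> * h \<xi> \<partial>S)" for a b
    proof -
      have "(\<integral>\<xi>. (?U a \<xi> - ?U b \<xi>)\<^sup>2 * h \<xi> \<partial>S) = (\<integral>\<xi>. ?U a \<xi> * ?U a \<xi> * h \<xi> - 2 * (?U a \<xi> * ?U b \<xi> * h \<xi>) + ?U b \<xi> * ?U b \<xi> * h \<xi> \<partial>S)"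
        by (rule Bochner_Integration.integral_cong) (auto simp: power2_eq_square algebra_simps)
      then show ?thesis using i by simp
    qed
    have m: "(\<integral>\<xi>. ?U (t + d) \<xi> * ?U b \<xi> * h \<xi> \<partial>S) = (\<integral>\<xi>. ?U t \<xi> * ?U b \<xi> * h \<xi> \<partial>S)" if "b \<le> t" for b
      using mart[of t "\<lambda>\<xi>. ?U b \<xi> * h \<xi>" d] ad_mult[OF adU[OF that] h] st by (simp add: mult.assoc)
    have "0 \<le> (\<integral>\<xi>. (?U (t + d) \<xi> - ?U t \<xi>)\<^sup>2 * h \<xi> \<partial>S)"
      by (intro integral_nonneg_AE) (auto simp: h0)
    then show ?thesis unfolding ex[of "t + d" t] ex[of "t + d" s] ex[of t s] m[OF order_refl] m[OF st(2)] by simp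
  qed
  have q_inc: "(\<integral>\<xi>. (?U (s + d) \<xi> - ?U s \<xi>)\<^sup>2 \<partial>S) = q (s + d) - q s" if "n0 \<le> s" for s d
  proof -
    have i: "integrable S (\<lambda>\<xi>. ?U a \<xi> * ?U b \<xi>)" for a b
      by (rule int) (use U01 in \<open>auto simp: abs_mult abs_of_nonneg intro!: order_trans[OF mult_le_one]\<close>)
    have m: "(\<integral>\<xi>. ?U (s + d) \<xi> * ?U s \<xi> \<partial>S) = (\<integral>\<xi>. ?U s \<xi> * ?U s \<xi> \<partial>S)"
      by (rule mart[OF that adU]) simp
    have "(\<integral>\<xi>. (?U (s + d) \<xi> - ?U s \<xi>)\<^sup>2 \<partial>S) = (\<integral>\<xi>. ?U (s + d) \<xi> * ?U (s + d) \<xi> - 2 * (?U (s + d) \<xi> * ?U s \<xi>) + ?U s \<xi> * ?U s \<xi> \<partial>S)"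
      by (rule Bochner_Integration.integral_cong) (auto simp: power2_eq_square algebra_simps)
    also have "\<dots> = q (s + d) - q s" using i m by (simp add: q_def power2_eq_square)
    finally show ?thesis .
  qed
  have q1: "q t \<le> 1" for t
  proof -
    have "q t \<le> (\<integral>\<xi>. 1 \<partial>S)" unfolding q_def
      by (rule integral_mono) (auto intro!: int simp: abs_square_le_1 Uabs intro: order_trans[of _ 1])
    then show ?thesis by (simp add: seq.P.prob_space)
  qed
  have "\<exists>l. (\<lambda>d. q (n0 + d)) \<longlonglongrightarrow> l \<and> (\<forall>d. q (n0 + d) \<le> l)"
  proof -
    have "incseq (\<lambda>d. q (n0 + d))"
    proof (rule incseq_SucI)
      fix d
      have "0 \<le> q (n0 + d + 1) - q (n0 + d)" by (subst q_inc[symmetric]) simp_all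
      then show "q (n0 + d) \<le> q (n0 + Suc d)" by simp
    qed
    then obtain l where "(\<lambda>d. q (n0 + d)) \<longlonglongrightarrow> l" "\<And>d. q (n0 + d) \<le> l"
      by (rule incseq_convergent[where B = 1]) (use q1 in auto)
    then show ?thesis by blast
  qed
  then obtain Q where Q: "(\<lambda>d. q (n0 + d)) \<longlonglongrightarrow> Q" "\<And>d. q (n0 + d) \<le> Q" by auto
  \<comment> \<open>Kolmogorov's maximal inequality: the event is split according to the first time
    at which the deviation reaches \<epsilon>, and \<open>key\<close> is applied on each
    part.\<close>
  have maxi: "measure S {\<xi> \<in> space S. \<exists>t\<in>{s..s + d}. \<epsilon> \<le> \<bar>?U t \<xi> - ?U s \<xi>\<bar>} \<le> (q (s + d) - q s) / \<epsilon>\<^sup>2"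
    if \<epsilon>: "0 < \<epsilon>" and s: "n0 \<le> s" for \<epsilon> s d
  proof -
    define B where "B t = {\<xi> \<in> space S. \<epsilon> \<le> \<bar>?U t \<xi> - ?U s \<xi>\<bar> \<and> (\<forall>r\<in>{s..<t}. \<bar>?U r \<xi> - ?U s \<xi>\<bar> < \<epsilon>)}" for t
    \<comment> \<open>\<open>adapted\<close> quantifies over arbitrary sequences, so membership in
      \<open>space S\<close> is dropped here; on the space both indicators agree.\<close>
    define B' where "B' t = {\<xi>. \<epsilon> \<le> \<bar>?U t \<xi> - ?U s \<xi>\<bar> \<and> (\<forall>r\<in>{s..<t}. \<bar>?U r \<xi> - ?U s \<xi>\<bar> < \<epsilon>)}" for t
    have [measurable]: "B t \<in> sets S" for t unfolding B_def by measurable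
    have BB: "indicator (B' t) \<xi> = indicator (B t) \<xi>" if "\<xi> \<in> space S" for t \<xi>
      using that by (auto simp: B_def B'_def indicator_def)
    have adB: "adapted t (indicator (B' t))" if "s \<le> t" for t
      unfolding adapted_def
    proof (intro conjI allI)
      show "indicat_real (B' t) \<in> borel_measurable S"
        by (subst measurable_cong[OF BB]) auto
      show "indicat_real (B' t) (comb_seq t \<omega> \<omega>') = indicat_real (B' t) \<omega>" for \<omega> \<omega>'
        using that by (auto simp: B'_def indicator_def Y_comb)
    qed (auto split: split_indicator)
    have un: "{\<xi> \<in> space S. \<exists>t\<in>{s..s + d}. \<epsilon> \<le> \<bar>?U t \<xi> - ?U s \<xi>\<bar>} = (\<Union>t\<in>{s..s + d}. B t)"
    proof (rule subset_antisym; rule subsetI)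
      fix \<xi> assume "\<xi> \<in> {\<xi> \<in> space S. \<exists>t\<in>{s..s + d}. \<epsilon> \<le> \<bar>?U t \<xi> - ?U s \<xi>\<bar>}"
      then obtain t where t: "\<xi> \<in> space S" "s \<le> t" "t \<le> s + d" "\<epsilon> \<le> \<bar>?U t \<xi> - ?U s \<xi>\<bar>" by auto
      define t0 where "t0 = (LEAST t. s \<le> t \<and> \<epsilon> \<le> \<bar>?U t \<xi> - ?U s \<xi>\<bar>)"
      have 1: "s \<le> t0 \<and> \<epsilon> \<le> \<bar>?U t0 \<xi> - ?U s \<xi>\<bar>" unfolding t0_def by (rule LeastI[of _ t]) (use t in auto)
      have 2: "t0 \<le> t" unfolding t0_def by (rule Least_le) (use t in auto)
      have 3: "\<bar>?U r \<xi> - ?U s \<xi>\<bar> < \<epsilon>" if "r \<in> {s..<t0}" for r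
        using not_less_Least[of r "\<lambda>t. s \<le> t \<and> \<epsilon> \<le> \<bar>?U t \<xi> - ?U s \<xi>\<bar>"] that by (auto simp: t0_def)
      show "\<xi> \<in> (\<Union>t\<in>{s..s + d}. B t)" using 1 2 3 t by (auto simp: B_def intro!: bexI[of _ t0])
    qed (auto simp: B_def)
    have disj: "disjoint_family_on B {s..s + d}"
      unfolding disjoint_family_on_def B_def by (auto, metis atLeastLessThan_iff atLeastAtMost_iff linorder_neqE_nat not_le)
    have "measure S {\<xi> \<in> space S. \<exists>t\<in>{s..s + d}. \<epsilon> \<le> \<bar>?U t \<xi> - ?U s \<xi>\<bar>} = (\<Sum>t\<in>{s..s + d}. measure S (B t))"
      unfolding un by (rule seq.P.finite_measure_finite_Union) (use disj in auto)
    also have "\<dots> \<le> (\<Sum>t\<in>{s..s + d}. (\<integral>\<xi>. (?U (s + d) \<xi> - ?U s \<xi>)\<^sup>2 * indicator (B t) \<xi> \<partial>S) / \<epsilon>\<^sup>2)"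
    proof (rule sum_mono)
      fix t assume t: "t \<in> {s..s + d}"
      have bd: "\<bar>(?U a \<xi> - ?U b \<xi>)\<^sup>2 * indicator (B t) \<xi>\<bar> \<le> 4" for a b \<xi>
      proof -
        have "\<bar>?U a \<xi> - ?U b \<xi>\<bar> \<le> 1" using U01[of \<xi> a] U01[of \<xi> b] by auto
        then have "(?U a \<xi> - ?U b \<xi>)\<^sup>2 \<le> 1" by (simp add: abs_square_le_1)
        then show ?thesis by (auto split: split_indicator)
      qed
      have "\<epsilon>\<^sup>2 * measure S (B t) = (\<integral>\<xi>. \<epsilon>\<^sup>2 * indicator (B t) \<xi> \<partial>S)" by simp
      also have "\<dots> \<le> (\<integral>\<xi>. (?U t \<xi> - ?U s \<xi>)\<^sup>2 * indicator (B t) \<xi> \<partial>S)"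
      proof (rule integral_mono)
        show "integrable S (\<lambda>\<xi>. (?U t \<xi> - ?U s \<xi>)\<^sup>2 * indicator (B t) \<xi>)" by (rule int[OF _ bd]) simp
        show "\<epsilon>\<^sup>2 * indicator (B t) \<xi> \<le> (?U t \<xi> - ?U s \<xi>)\<^sup>2 * indicator (B t) \<xi>" for \<xi>
        proof (cases "\<xi> \<in> B t")
          case True
          then have "\<epsilon> \<le> \<bar>?U t \<xi> - ?U s \<xi>\<bar>" by (simp add: B_def)
          then have "\<epsilon>\<^sup>2 \<le> \<bar>?U t \<xi> - ?U s \<xi>\<bar>\<^sup>2" using \<epsilon> by (intro power_mono) auto
          then show ?thesis using True by simp
        qed simp
        show "integrable S (\<lambda>\<xi>. \<epsilon>\<^sup>2 * indicator (B t) \<xi>)"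
          by (intro Bochner_Integration.integrable_mult_right int) (auto split: split_indicator)
      qed
      also have "\<dots> = (\<integral>\<xi>. (?U t \<xi> - ?U s \<xi>)\<^sup>2 * indicator (B' t) \<xi> \<partial>S)"
        by (rule Bochner_Integration.integral_cong) (auto simp: BB)
      also have "\<dots> \<le> (\<integral>\<xi>. (?U (t + (s + d - t)) \<xi> - ?U s \<xi>)\<^sup>2 * indicator (B' t) \<xi> \<partial>S)"
        by (rule key[OF s _ adB]) (use t in auto)
      also have "\<dots> = (\<integral>\<xi>. (?U (s + d) \<xi> - ?U s \<xi>)\<^sup>2 * indicator (B t) \<xi> \<partial>S)"
        using t by (intro Bochner_Integration.integral_cong) (auto simp: BB)
      finally show "measure S (B t) \<le> (\<integral>\<xi>. (?U (s + d) \<xi> - ?U s \<xi>)\<^sup>2 * indicator (B t) \<xi> \<partial>S) / \<epsilon>\<^sup>2"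
        using \<epsilon> by (simp add: field_simps)
    qed
    also have "\<dots> = (\<integral>\<xi>. (?U (s + d) \<xi> - ?U s \<xi>)\<^sup>2 * (\<Sum>t\<in>{s..s + d}. indicator (B t) \<xi>) \<partial>S) / \<epsilon>\<^sup>2"
    proof -
      have "integrable S (\<lambda>\<xi>. (?U (s + d) \<xi> - ?U s \<xi>)\<^sup>2 * indicator (B t) \<xi>)" for t
      proof (rule int)
        fix \<xi>
        have "\<bar>?U (s + d) \<xi> - ?U s \<xi>\<bar> \<le> 1" using U01[of \<xi> "s + d"] U01[of \<xi> s] by auto
        then have "(?U (s + d) \<xi> - ?U s \<xi>)\<^sup>2 \<le> 1" by (simp add: abs_square_le_1)
        then show "\<bar>(?U (s + d) \<xi> - ?U s \<xi>)\<^sup>2 * indicator (B t) \<xi>\<bar> \<le> 4" by (auto split: split_indicator)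
      qed simp
      then show ?thesis unfolding sum_divide_distrib[symmetric] sum_distrib_left
        by (subst Bochner_Integration.integral_sum) simp_all
    qed
    also have "\<dots> \<le> (\<integral>\<xi>. (?U (s + d) \<xi> - ?U s \<xi>)\<^sup>2 \<partial>S) / \<epsilon>\<^sup>2"
    proof (intro divide_right_mono integral_mono)
      have sq: "(?U (s + d) \<xi> - ?U s \<xi>)\<^sup>2 \<le> 1" for \<xi>
        using U01[of \<xi> "s + d"] U01[of \<xi> s] by (auto simp: abs_square_le_1)
      have le1: "(\<Sum>t\<in>{s..s + d}. indicator (B t) \<xi>) \<le> (1::real)" for \<xi>
      proof (cases "\<exists>t\<in>{s..s + d}. \<xi> \<in> B t")
        case True
        then obtain t where t: "t \<in> {s..s + d}" "\<xi> \<in> B t" by blast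
        have "(\<Sum>t\<in>{s..s + d}. indicator (B t) \<xi>) = (\<Sum>r\<in>{s..s + d}. if r = t then 1 else (0::real))"
        proof (intro sum.cong refl)
          fix r assume r: "r \<in> {s..s + d}"
          have "r = t" if "\<xi> \<in> B r"
          proof (rule ccontr)
            assume "r \<noteq> t"
            from disjoint_family_onD[OF disj r t(1) this] t(2) that show False by blast
          qed
          then show "indicator (B r) \<xi> = (if r = t then 1 else (0::real))"
            using t(2) by (cases "r = t") (simp_all add: indicator_def, blast)
        qed
        then show ?thesis using t by (simp only: sum.delta[OF finite_atLeastAtMost] if_True order_refl)
      next
        case False
        then have "(\<Sum>t\<in>{s..s + d}. indicator (B t) \<xi>) = (0::real)" by (intro sum.neutral) auto
        then show ?thesis by simp
      qed
      then show "(?U (s + d) \<xi> - ?U s \<xi>)\<^sup>2 * (\<Sum>t\<in>{s..s + d}. indicator (B t) \<xi>) \<le> (?U (s + d) \<xi> - ?U s \<xi>)\<^sup>2" for \<xi>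
        by (intro mult_left_le) auto
      show "integrable S (\<lambda>\<xi>. (?U (s + d) \<xi> - ?U s \<xi>)\<^sup>2)"
        by (rule int) (simp, simp only: abs_power2, rule order_trans[OF sq], simp)
      show "integrable S (\<lambda>\<xi>. (?U (s + d) \<xi> - ?U s \<xi>)\<^sup>2 * (\<Sum>t\<in>{s..s + d}. indicator (B t) \<xi>))"
      proof (rule int)
        fix \<xi>
        have "(?U (s + d) \<xi> - ?U s \<xi>)\<^sup>2 * (\<Sum>t\<in>{s..s + d}. indicator (B t) \<xi>) \<le> 1"
          by (rule mult_le_one[OF sq _ le1]) (auto intro!: sum_nonneg)
        moreover have "0 \<le> (?U (s + d) \<xi> - ?U s \<xi>)\<^sup>2 * (\<Sum>t\<in>{s..s + d}. indicat_real (B t) \<xi>)"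
          by (intro mult_nonneg_nonneg sum_nonneg) auto
        ultimately show "\<bar>(?U (s + d) \<xi> - ?U s \<xi>)\<^sup>2 * (\<Sum>t\<in>{s..s + d}. indicator (B t) \<xi>)\<bar> \<le> 4"
          unfolding abs_le_iff by linarith
      qed simp
    qed simp
    also have "\<dots> = (q (s + d) - q s) / \<epsilon>\<^sup>2" by (simp add: q_inc[OF s])
    finally show ?thesis .
  qed
  have maxi': "measure S {\<xi> \<in> space S. \<exists>t\<ge>n0 + s. \<epsilon> \<le> \<bar>?U t \<xi> - ?U (n0 + s) \<xi>\<bar>} \<le> (Q - q (n0 + s)) / \<epsilon>\<^sup>2"
    if \<epsilon>: "0 < \<epsilon>" for \<epsilon> s
  proof -
    let ?s = "n0 + s"
    let ?A = "\<lambda>d. {\<xi> \<in> space S. \<exists>t\<in>{?s..?s + d}. \<epsilon> \<le> \<bar>?U t \<xi> - ?U ?s \<xi>\<bar>}"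
    have "(\<lambda>d. measure S (?A d)) \<longlonglongrightarrow> measure S (\<Union>d. ?A d)"
      by (rule seq.P.finite_Lim_measure_incseq) (auto simp: incseq_def intro: order_trans)
    moreover have "(\<Union>d. ?A d) = {\<xi> \<in> space S. \<exists>t\<ge>?s. \<epsilon> \<le> \<bar>?U t \<xi> - ?U ?s \<xi>\<bar>}"
      by (auto intro: le_add_diff_inverse) (metis atLeastAtMost_iff le_add_diff_inverse order_refl)
    moreover have "measure S (?A d) \<le> (Q - q ?s) / \<epsilon>\<^sup>2" for d
      by (rule order_trans[OF maxi[OF \<epsilon> le_add1]])
        (use Q(2)[of "s + d"] in \<open>auto intro!: divide_right_mono simp: add.assoc\<close>)
    ultimately show ?thesis by (auto intro: LIMSEQ_le_const2)
  qed
  \<comment> \<open>If every starting time is followed by a large oscillation, the maximal bound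
    applies from each \<open>n0 + s\<close>, and its right side vanishes as \<open>s\<close>
    grows.\<close>
  have osc: "AE \<xi> in S. \<exists>s. \<forall>t\<ge>s. \<bar>?U t \<xi> - ?U s \<xi>\<bar> < 1 / real (Suc k)" for k
  proof -
    let ?\<epsilon> = "1 / real (Suc k)"
    let ?N = "{\<xi> \<in> space S. \<forall>s. \<exists>t\<ge>s. ?\<epsilon> \<le> \<bar>?U t \<xi> - ?U s \<xi>\<bar>}"
    have le: "measure S ?N \<le> (Q - q (n0 + s)) / ?\<epsilon>\<^sup>2" for s
    proof -
      have "measure S ?N \<le> measure S {\<xi> \<in> space S. \<exists>t\<ge>n0 + s. ?\<epsilon> \<le> \<bar>?U t \<xi> - ?U (n0 + s) \<xi>\<bar>}"
        by (rule seq.P.finite_measure_mono) auto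
      also have "\<dots> \<le> (Q - q (n0 + s)) / ?\<epsilon>\<^sup>2" by (rule maxi') simp
      finally show ?thesis .
    qed
    have "(\<lambda>s. (Q - q (n0 + s)) / ?\<epsilon>\<^sup>2) \<longlonglongrightarrow> (Q - Q) / ?\<epsilon>\<^sup>2"
      by (intro tendsto_intros Q(1)) auto
    then have "measure S ?N \<le> (Q - Q) / ?\<epsilon>\<^sup>2" by (rule LIMSEQ_le_const) (use le in auto)
    then have "measure S ?N = 0" by (simp add: measure_le_0_iff)
    then have "?N \<in> null_sets S" by (auto simp: null_sets_def seq.P.emeasure_eq_measure)
    then show ?thesis by (rule AE_I') (auto simp: not_less)
  qed
  then have "AE \<xi> in S. \<forall>k. \<exists>s. \<forall>t\<ge>s. \<bar>?U t \<xi> - ?U s \<xi>\<bar> < 1 / real (Suc k)"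
    by (simp add: AE_all_countable)
  then show ?thesis
  proof eventually_elim
    fix \<xi> assume *: "\<forall>k. \<exists>s. \<forall>t\<ge>s. \<bar>?U t \<xi> - ?U s \<xi>\<bar> < 1 / real (Suc k)"
    have "Cauchy (\<lambda>t. ?U t \<xi>)"
    proof (rule metric_CauchyI)
      fix e :: real assume "0 < e"
      then obtain k where k: "1 / real (Suc k) < e / 2" using nat_approx_posE[of "e / 2"] by auto
      obtain s where s: "\<And>t. s \<le> t \<Longrightarrow> \<bar>?U t \<xi> - ?U s \<xi>\<bar> < 1 / real (Suc k)" using * by blast
      show "\<exists>M. \<forall>m\<ge>M. \<forall>n\<ge>M. dist (?U m \<xi>) (?U n \<xi>) < e"
      proof (intro exI[of _ s] allI impI)
        fix m n assume "s \<le> m" "s \<le> n"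
        then show "dist (?U m \<xi>) (?U n \<xi>) < e" using s[of m] s[of n] k unfolding dist_real_def by linarith
      qed
    qed
    then show "convergent (\<lambda>t. ?U t \<xi>)" by (simp add: Cauchy_convergent_iff)
  qed
qed

end

section \<open>Boundaries and their entropy\<close>

text \<open>The equality case of \<open>expectation_ln_nonpos\<close>: \<open>F - 1 - ln F\<close>
  is nonnegative, has mean at most 0, and vanishes only where \<open>F\<close> is 1.\<close>

lemma (in prob_space) expectation_ln_nonneg_imp_one:
  assumes [measurable]: "F \<in> borel_measurable M" and pos: "AE x in M. 0 < F x"
    and le: "(\<integral>\<^sup>+x. ennreal (F x) \<partial>M) \<le> 1" and int: "integrable M (\<lambda>x. ln (F x))"
    and ge: "0 \<le> expectation (\<lambda>x. ln (F x))"
  shows "AE x in M. F x = 1"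
proof -
  have iF: "integrable M F"
    by (rule integrableI_nonneg) (use pos le in \<open>auto elim!: AE_mp simp: less_imp_le order.strict_trans1\<close>)
  have "ennreal (expectation F) \<le> 1"
    using le by (subst (asm) nn_integral_eq_integral[OF iF]) (use pos in \<open>auto elim!: AE_mp\<close>)
  then have eF: "expectation F \<le> 1" by simp
  let ?g = "\<lambda>x. F x - 1 - ln (F x)"
  have g: "AE x in M. 0 \<le> ?g x" using pos by eventually_elim (simp add: ln_le_minus_one)
  have ig: "integrable M ?g" using iF int by simp
  have "expectation ?g = expectation F - 1 - expectation (\<lambda>x. ln (F x))"
    using iF int by (simp add: prob_space)
  then have "expectation ?g = 0" using integral_nonneg_AE[OF g] eF ge by linarith
  then have "AE x in M. ?g x = 0" using integral_nonneg_eq_0_iff_AE[OF ig g] by simp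
  with pos show ?thesis
  proof eventually_elim
    fix x assume "0 < F x" "?g x = 0"
    then show "F x = 1" using ln_eq_minus_one[of "F x"] by simp
  qed
qed

text \<open>Shift invariance of \<open>b\<close> is only tested against measurable functions: this admits the identity map onto
  the invariant \<open>\<sigma>\<close>-field, whose points are not shift invariant, as an instance.\<close>

locale boundary = countable_walk +
  fixes N :: "'c measure" and act :: "'a \<Rightarrow> 'c \<Rightarrow> 'c" and b :: "(nat \<Rightarrow> 'a) \<Rightarrow> 'c"
  assumes fin: "fin_ent \<mu>"
    and b_meas [measurable]: "b \<in> path_space G \<rightarrow>\<^sub>M N"
    and b_law: "distr (walk_law G \<mu>) N b = N"
    and b_shift: "\<And>f \<omega>. (f :: 'c \<Rightarrow> ennreal) \<in> borel_measurable N \<Longrightarrow> \<omega> \<in> space (path_space G) \<Longrightarrow> f (b (path_shift \<omega>)) = f (b \<omega>)"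
    and b_equiv: "\<And>\<gamma>. \<gamma> \<in> carrier G \<Longrightarrow> AE \<omega> in walk_law G \<mu>. b (path_translate G \<gamma> \<omega>) = act \<gamma> (b \<omega>)"
    and act_meas: "\<And>\<gamma>. \<gamma> \<in> carrier G \<Longrightarrow> act \<gamma> \<in> N \<rightarrow>\<^sub>M N"
    and act_comp: "\<And>\<gamma> \<delta> \<theta>. \<gamma> \<in> carrier G \<Longrightarrow> \<delta> \<in> carrier G \<Longrightarrow> \<theta> \<in> space N \<Longrightarrow> act (\<gamma> \<otimes> \<delta>) \<theta> = act \<gamma> (act \<delta> \<theta>)"
    and act_one: "\<And>\<theta>. \<theta> \<in> space N \<Longrightarrow> act \<one> \<theta> = \<theta>"

lemma (in countable_walk) walk_law_eq: "walk_law G \<mu> = distr S (path_space G) (partial_product G)"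
  unfolding walk_law_def R_def ..

lemma (in countable_walk) AE_walk_law: "AE \<omega> in walk_law G \<mu>. Q \<omega> \<Longrightarrow> AE \<xi> in S. Q (partial_product G \<xi>)"
  unfolding walk_law_eq by (rule AE_distrD[OF measurable_W])

lemma (in countable_walk) W_space: "\<xi> \<in> space S \<Longrightarrow> partial_product G \<xi> \<in> space (path_space G)"
  by (rule measurable_space[OF measurable_W])

context boundary
begin

abbreviation "\<beta> \<xi> \<equiv> b (partial_product G \<xi>)"

lemma beta_meas [measurable]: "(\<lambda>\<xi>. \<beta> \<xi>) \<in> S \<rightarrow>\<^sub>M N"
  by (rule measurable_compose[OF measurable_W b_meas])

lemma beta_law: "distr S N (\<lambda>\<xi>. \<beta> \<xi>) = N"
  using b_law unfolding walk_law_eq by (simp add: distr_distr[OF b_meas measurable_W] comp_def)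

lemma beta_space: "\<xi> \<in> space S \<Longrightarrow> \<beta> \<xi> \<in> space N"
  by (rule measurable_space[OF beta_meas])

lemma prob_N: "prob_space N"
  using seq.P.prob_space_distr[OF beta_meas] unfolding beta_law .

lemma nn_integral_beta:
  assumes f: "f \<in> borel_measurable N"
  shows "(\<integral>\<^sup>+\<xi>. f (\<beta> \<xi>) \<partial>S) = (\<integral>\<^sup>+\<theta>. f \<theta> \<partial>N)"
proof -
  have "(\<integral>\<^sup>+\<xi>. f (\<beta> \<xi>) \<partial>S) = (\<integral>\<^sup>+\<theta>. f \<theta> \<partial>distr S N (\<lambda>\<xi>. \<beta> \<xi>))"
    by (rule nn_integral_distr[symmetric, OF beta_meas]) (simp add: f)
  then show ?thesis by (simp only: beta_law)
qed

lemma AE_beta: "AE \<theta> in N. Q \<theta> \<Longrightarrow> AE \<xi> in S. Q (\<beta> \<xi>)"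
  by (rule AE_distrD[OF beta_meas]) (simp only: beta_law)

text \<open>After \<open>n\<close> shifts the trajectory is the translate by \<open>Y n\<close> of
  the walk driven by the later increments; each shift is invisible to \<open>f\<close> after
  \<open>b\<close>.\<close>

lemma beta_translate:
  fixes f :: "'c \<Rightarrow> ennreal"
  assumes f: "f \<in> borel_measurable N" and \<xi>: "\<xi> \<in> space S"
  shows "f (\<beta> \<xi>) = f (b (path_translate G (Y n \<xi>) (partial_product G (advance n \<xi>))))"
proof -
  have "f (b (\<lambda>j. partial_product G \<xi> (n + j))) = f (\<beta> \<xi>)"
  proof (induction n)
    case (Suc n)
    have sp: "(\<lambda>j. partial_product G \<xi> (n + j)) \<in> space (path_space G)"
      using \<xi> Y_closed by (auto simp: space_path_space)
    have "path_shift (\<lambda>j. partial_product G \<xi> (n + j)) = (\<lambda>j. partial_product G \<xi> (Suc n + j))"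
      by (auto simp: path_shift_def fun_eq_iff)
    then show ?case using b_shift[OF f sp] Suc by simp
  qed simp
  then show ?thesis using W_shift[OF \<xi>] by simp
qed

text \<open>Equivariance holds off a null set that depends on the group element; \<open>Y n\<close>
  has countably many values, so these null sets may be united.\<close>

lemma AE_beta_act:
  fixes F :: "'a \<Rightarrow> 'c \<Rightarrow> ennreal"
  assumes F: "\<And>y. y \<in> carrier G \<Longrightarrow> F y \<in> borel_measurable N"
  shows "AE \<xi> in S. F (Y n \<xi>) (\<beta> \<xi>) = F (Y n \<xi>) (act (Y n \<xi>) (\<beta> (advance n \<xi>)))"
proof -
  have "AE \<xi> in S. b (path_translate G (Y n \<xi>) (partial_product G (advance n \<xi>))) = act (Y n \<xi>) (\<beta> (advance n \<xi>))"
  proof (rule AE_Y_shift[of n "\<lambda>y \<xi>. b (path_translate G y (partial_product G \<xi>)) = act y (\<beta> \<xi>)"])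
    fix y assume "y \<in> set_pmf (P n)"
    then have "y \<in> carrier G" using supp_walk by blast
    from AE_walk_law[OF b_equiv[OF this]]
    show "AE \<xi> in S. b (path_translate G y (partial_product G \<xi>)) = act y (\<beta> \<xi>)" .
  qed
  then show ?thesis
  proof (rule AE_mp, intro AE_I2 impI)
    fix \<xi> assume \<xi>: "\<xi> \<in> space S" and eq: "b (path_translate G (Y n \<xi>) (partial_product G (advance n \<xi>))) = act (Y n \<xi>) (\<beta> (advance n \<xi>))"
    show "F (Y n \<xi>) (\<beta> \<xi>) = F (Y n \<xi>) (act (Y n \<xi>) (\<beta> (advance n \<xi>)))"
      using beta_translate[OF F[OF Y_closed[OF \<xi>]] \<xi>, of n n] unfolding eq .
  qed
qed

text \<open>The boundary point is \<open>Y n\<close> applied to the boundary point of the later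
  walk, which is independent of \<open>Y n\<close> and again has law \<open>N\<close>. Hence its law
  given \<open>Y n = y\<close> is the image of \<open>N\<close> under \<open>act y\<close>.\<close>

lemma nn_integral_joint:
  fixes F :: "'a \<Rightarrow> 'c \<Rightarrow> ennreal"
  assumes F: "\<And>y. y \<in> carrier G \<Longrightarrow> F y \<in> borel_measurable N"
  shows "(\<integral>\<^sup>+\<xi>. F (Y n \<xi>) (\<beta> \<xi>) \<partial>S) = (\<integral>\<^sup>+y. \<integral>\<^sup>+\<theta>. F y (act y \<theta>) \<partial>N \<partial>measure_pmf (P n))"
proof -
  have m: "(\<lambda>\<theta>. F y (act y \<theta>)) \<in> borel_measurable N" if "y \<in> carrier G" for y
    by (rule measurable_compose[OF act_meas[OF that] F[OF that]])
  have "(\<integral>\<^sup>+\<xi>. F (Y n \<xi>) (\<beta> \<xi>) \<partial>S) = (\<integral>\<^sup>+\<xi>. F (Y n \<xi>) (act (Y n \<xi>) (\<beta> (advance n \<xi>))) \<partial>S)"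
    by (rule nn_integral_cong_AE) (rule AE_beta_act[OF F])
  also have "\<dots> = (\<integral>\<^sup>+y. \<integral>\<^sup>+\<xi>. F y (act y (\<beta> \<xi>)) \<partial>S \<partial>measure_pmf (P n))"
    by (rule nn_integral_Y_shift) (rule measurable_compose[OF beta_meas m])
  also have "\<dots> = (\<integral>\<^sup>+y. \<integral>\<^sup>+\<theta>. F y (act y \<theta>) \<partial>N \<partial>measure_pmf (P n))"
    by (intro nn_integral_cong_AE AE_pmfI) (use supp_walk m in \<open>auto intro!: nn_integral_beta\<close>)
  finally show ?thesis .
qed

text \<open>The density of the boundary law conditioned on \<open>Y n = y\<close>; \<open>I n\<close> below is therefore the mutual
  information of \<open>Y n\<close> and the boundary point.\<close>

definition D :: "'a \<Rightarrow> 'c \<Rightarrow> real" where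
  "D y \<theta> = enn2real (RN_deriv N (distr N N (act y)) \<theta>)"

lemma D_meas [measurable]: "D y \<in> borel_measurable N"
  unfolding D_def[abs_def] by measurable

lemma D_nonneg: "0 \<le> D y \<theta>" by (simp add: D_def)

text \<open>Stationarity: \<open>N\<close> is the mixture of its translates with weights
  \<open>P n\<close>, so a null set of \<open>N\<close> is null for every translate of positive
  weight.\<close>

lemma abs_cont:
  assumes y: "y \<in> set_pmf (P n)"
  shows "absolutely_continuous N (distr N N (act y))"
proof -
  have yc: "y \<in> carrier G" using y supp_walk by blast
  show ?thesis
    unfolding absolutely_continuous_def
  proof
    fix A assume A: "A \<in> null_sets N"
    then have [measurable]: "A \<in> sets N" by auto
    have "0 = emeasure N A" using A by auto
    also have "\<dots> = (\<integral>\<^sup>+\<xi>. indicator A (\<beta> \<xi>) \<partial>S)" by (subst nn_integral_beta) auto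
    also have "\<dots> = (\<integral>\<^sup>+y. \<integral>\<^sup>+\<theta>. indicator A (act y \<theta>) \<partial>N \<partial>measure_pmf (P n))"
      by (rule nn_integral_joint) auto
    finally have "(\<integral>\<^sup>+\<theta>. indicator A (act y \<theta>) \<partial>N) = 0"
      using y by (subst (asm) eq_commute, subst (asm) nn_integral_0_iff_AE) (auto simp: AE_measure_pmf_iff)
    then have "emeasure (distr N N (act y)) A = 0"
      using nn_integral_distr[OF act_meas[OF yc], of "indicator A"] by simp
    then show "A \<in> null_sets (distr N N (act y))" by (auto simp: null_sets_def)
  qed
qed

lemma D_density:
  assumes y: "y \<in> set_pmf (P n)"
  shows "AE \<theta> in N. RN_deriv N (distr N N (act y)) \<theta> = ennreal (D y \<theta>)"
proof -
  have yc: "y \<in> carrier G" using y supp_walk by blast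
  interpret N: prob_space N by (rule prob_N)
  have "prob_space (distr N N (act y))" by (rule N.prob_space_distr[OF act_meas[OF yc]])
  then have "sigma_finite_measure (distr N N (act y))" by (rule prob_space_imp_sigma_finite)
  from N.RN_deriv_finite[OF this abs_cont[OF y]]
  show ?thesis by (auto simp: D_def less_top)
qed

lemma nn_integral_act:
  fixes f :: "'c \<Rightarrow> ennreal"
  assumes y: "y \<in> set_pmf (P n)" and f[measurable]: "f \<in> borel_measurable N"
  shows "(\<integral>\<^sup>+\<theta>. f (act y \<theta>) \<partial>N) = (\<integral>\<^sup>+\<theta>. ennreal (D y \<theta>) * f \<theta> \<partial>N)"
proof -
  have yc: "y \<in> carrier G" using y supp_walk by blast
  interpret N: prob_space N by (rule prob_N)
  have "(\<integral>\<^sup>+\<theta>. f (act y \<theta>) \<partial>N) = (\<integral>\<^sup>+\<theta>. f \<theta> \<partial>distr N N (act y))"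
    by (rule nn_integral_distr[symmetric, OF act_meas[OF yc]]) simp
  also have "\<dots> = (\<integral>\<^sup>+\<theta>. RN_deriv N (distr N N (act y)) \<theta> * f \<theta> \<partial>N)"
    by (rule N.RN_deriv_nn_integral[OF abs_cont[OF y]]) auto
  also have "\<dots> = (\<integral>\<^sup>+\<theta>. ennreal (D y \<theta>) * f \<theta> \<partial>N)"
    by (rule nn_integral_cong_AE) (use D_density[OF y] in \<open>auto elim!: AE_mp\<close>)
  finally show ?thesis .
qed

lemma nn_integral_D: "y \<in> set_pmf (P n) \<Longrightarrow> (\<integral>\<^sup>+\<theta>. ennreal (D y \<theta>) \<partial>N) = 1"
  using nn_integral_act[of y n "\<lambda>_. 1"] prob_space.emeasure_space_1[OF prob_N] by simp

lemma nn_integral_joint_D: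
  fixes F :: "'a \<Rightarrow> 'c \<Rightarrow> ennreal"
  assumes F: "\<And>y. y \<in> carrier G \<Longrightarrow> F y \<in> borel_measurable N"
  shows "(\<integral>\<^sup>+\<xi>. F (Y n \<xi>) (\<beta> \<xi>) \<partial>S) = (\<integral>\<^sup>+y. \<integral>\<^sup>+\<theta>. ennreal (D y \<theta>) * F y \<theta> \<partial>N \<partial>measure_pmf (P n))"
proof -
  have eq: "(\<integral>\<^sup>+\<theta>. F y (act y \<theta>) \<partial>N) = (\<integral>\<^sup>+\<theta>. ennreal (D y \<theta>) * F y \<theta> \<partial>N)" if "y \<in> set_pmf (P n)" for y
    using that supp_walk by (intro nn_integral_act[of y n] F) auto
  show ?thesis
    by (rule trans[OF nn_integral_joint[of F]], rule F, assumption) (rule nn_integral_cong_AE, rule AE_pmfI, rule eq)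
qed

lemma joint_meas:
  assumes F: "\<And>y. y \<in> carrier G \<Longrightarrow> F y \<in> N \<rightarrow>\<^sub>M M"
  shows "(\<lambda>\<xi>. F (Y n \<xi>) (\<beta> \<xi>)) \<in> S \<rightarrow>\<^sub>M M"
  by (rule measurable_compose_countable'[OF _ measurable_Y countable_carrier])
    (rule measurable_compose[OF beta_meas F])

lemma D_joint_meas [measurable]: "(\<lambda>\<xi>. D (Y n \<xi>) (\<beta> \<xi>)) \<in> borel_measurable S"
  by (rule joint_meas[of D]) measurable

lemma D_pos: "AE \<xi> in S. 0 < D (Y n \<xi>) (\<beta> \<xi>)"
proof -
  have "(\<integral>\<^sup>+\<xi>. indicator {\<theta>. D (Y n \<xi>) \<theta> = 0} (\<beta> \<xi>) \<partial>S) =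
    (\<integral>\<^sup>+y. \<integral>\<^sup>+\<theta>. ennreal (D y \<theta>) * indicator {\<theta>. D y \<theta> = 0} \<theta> \<partial>N \<partial>measure_pmf (P n))"
    by (rule nn_integral_joint_D) simp
  also have "\<dots> = (\<integral>\<^sup>+y. \<integral>\<^sup>+\<theta>. 0 \<partial>N \<partial>measure_pmf (P n))"
    by (intro nn_integral_cong) (auto split: split_indicator)
  finally have "(\<integral>\<^sup>+\<xi>. indicator {\<theta>. D (Y n \<xi>) \<theta> = 0} (\<beta> \<xi>) \<partial>S) = 0" by simp
  moreover have "(\<lambda>\<xi>. indicator {\<theta>. D (Y n \<xi>) \<theta> = 0} (\<beta> \<xi>) :: ennreal) \<in> borel_measurable S"
    by (rule joint_meas[of "\<lambda>y. indicator {\<theta>. D y \<theta> = 0}"]) simp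
  ultimately have "AE \<xi> in S. indicator {\<theta>. D (Y n \<xi>) \<theta> = 0} (\<beta> \<xi>) = (0::ennreal)"
    by (subst (asm) nn_integral_0_iff_AE)
  then show ?thesis
    by eventually_elim (use D_nonneg in \<open>auto simp: indicator_def less_le split: if_splits\<close>)
qed

text \<open>By stationarity the translate by \<open>y\<close>, weighted by its mass, is one summand
  of the mixture \<open>N\<close> and hence dominated by it. This is what bounds the mutual
  information by the entropy.\<close>

lemma D_le:
  assumes y: "y \<in> set_pmf (P n)"
  shows "AE \<theta> in N. pmf (P n) y * D y \<theta> \<le> 1"
proof -
  interpret N: prob_space N by (rule prob_N)
  let ?p = "pmf (P n) y"
  define A where "A = {\<theta> \<in> space N. 1 < ?p * D y \<theta>}"
  have [measurable]: "A \<in> sets N" unfolding A_def by measurable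
  have le: "(\<integral>\<^sup>+\<theta>. ennreal (?p * D y \<theta>) * indicator A \<theta> \<partial>N) \<le> (\<integral>\<^sup>+\<theta>. indicator A \<theta> \<partial>N)"
  proof -
    have "(\<integral>\<^sup>+\<theta>. ennreal (?p * D y \<theta>) * indicator A \<theta> \<partial>N) = ennreal ?p * (\<integral>\<^sup>+\<theta>. ennreal (D y \<theta>) * indicator A \<theta> \<partial>N)"
      by (subst nn_integral_cmult[symmetric]) (auto simp: ennreal_mult' mult.assoc)
    also have "\<dots> = (\<integral>\<^sup>+z. (\<integral>\<^sup>+\<theta>. ennreal (D z \<theta>) * indicator A \<theta> \<partial>N) * indicator {y} z \<partial>measure_pmf (P n))"
      using nn_integral_indicator_singleton[of y "measure_pmf (P n)" "\<lambda>z. \<integral>\<^sup>+\<theta>. ennreal (D z \<theta>) * indicator A \<theta> \<partial>N"]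
      by (simp add: emeasure_pmf_single mult.commute[of "ennreal (pmf (P n) y)"])
    also have "\<dots> \<le> (\<integral>\<^sup>+z. (\<integral>\<^sup>+\<theta>. ennreal (D z \<theta>) * indicator A \<theta> \<partial>N) \<partial>measure_pmf (P n))"
      by (rule nn_integral_mono) (auto split: split_indicator)
    also have "\<dots> = (\<integral>\<^sup>+\<xi>. indicator A (\<beta> \<xi>) \<partial>S)"
      by (rule nn_integral_joint_D[symmetric]) simp
    also have "\<dots> = (\<integral>\<^sup>+\<theta>. indicator A \<theta> \<partial>N)" by (rule nn_integral_beta) simp
    finally show ?thesis .
  qed
  have "AE \<theta> in N. ennreal (?p * D y \<theta>) * indicator A \<theta> \<le> indicator A \<theta>"
  proof (rule ccontr)
    assume "\<not> ?thesis"
    then have "(\<integral>\<^sup>+\<theta>. indicator A \<theta> \<partial>N) < (\<integral>\<^sup>+\<theta>. ennreal (?p * D y \<theta>) * indicator A \<theta> \<partial>N)"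
      by (intro nn_integral_less) (auto simp: A_def N.emeasure_eq_measure split: split_indicator)
    with le show False by simp
  qed
  with AE_space[of N] show ?thesis
  proof eventually_elim
    fix \<theta> assume "ennreal (?p * D y \<theta>) * indicator A \<theta> \<le> indicator A \<theta>" "\<theta> \<in> space N"
    then show "?p * D y \<theta> \<le> 1"
      by (cases "\<theta> \<in> A") (auto simp: A_def not_less)
  qed
qed

lemma D_le_joint: "AE \<xi> in S. pmf (P n) (Y n \<xi>) * D (Y n \<xi>) (\<beta> \<xi>) \<le> 1"
proof -
  have "AE \<theta> in N. \<forall>y\<in>set_pmf (P n). pmf (P n) y * D y \<theta> \<le> 1"
    by (simp add: AE_ball_countable D_le)
  from AE_beta[OF this] AE_Y[of n] show ?thesis by eventually_elim auto
qed

definition I :: "nat \<Rightarrow> real" where "I n = (\<integral>\<xi>. ln (D (Y n \<xi>) (\<beta> \<xi>)) \<partial>S)"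

lemma integrable_ln_pmf: "integrable S (\<lambda>\<xi>. ln (pmf (P n) (Y n \<xi>)))"
  "(\<integral>\<xi>. ln (pmf (P n) (Y n \<xi>)) \<partial>S) = - ent (P n)"
  using fin_ent_walk[OF fin, of G n] integrable_Y[where F = "\<lambda>y. ln (pmf (P n) y)" and n = n]
  by (auto simp: fin_ent_def ent_def)

lemma AE_ln_D_le: "AE \<xi> in S. ln (D (Y n \<xi>) (\<beta> \<xi>)) \<le> - ln (pmf (P n) (Y n \<xi>))"
  using D_pos[of n] D_le_joint[of n] AE_Y[of n]
proof eventually_elim
  fix \<xi> assume *: "0 < D (Y n \<xi>) (\<beta> \<xi>)" "pmf (P n) (Y n \<xi>) * D (Y n \<xi>) (\<beta> \<xi>) \<le> 1" "Y n \<xi> \<in> set_pmf (P n)"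
  then have p: "0 < pmf (P n) (Y n \<xi>)" by (simp add: pmf_positive)
  have "ln (pmf (P n) (Y n \<xi>) * D (Y n \<xi>) (\<beta> \<xi>)) \<le> ln 1"
    using * p by (subst ln_le_cancel_iff) auto
  then show "ln (D (Y n \<xi>) (\<beta> \<xi>)) \<le> - ln (pmf (P n) (Y n \<xi>))"
    using p * by (subst (asm) ln_mult_pos) auto
qed

text \<open>The positive part is dominated by the information content, by \<open>AE_ln_D_le\<close>.
  The negative part becomes, after the change of measure, a mean of values of
  \<open>t * max 0 (- ln t)\<close>, which never exceed 1.\<close>

lemma integrable_ln_D: "integrable S (\<lambda>\<xi>. ln (D (Y n \<xi>) (\<beta> \<xi>)))"
proof -
  let ?g = "\<lambda>\<xi>. max 0 (- ln (D (Y n \<xi>) (\<beta> \<xi>)))"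
  have t: "t * max 0 (- ln t) \<le> 1" if "0 \<le> t" for t :: real
  proof (cases "0 < t \<and> t \<le> 1")
    case True
    then have "- ln t \<le> 1 / t - 1" using ln_le_minus_one[of "1 / t"] by (simp add: ln_div)
    then have "t * - ln t \<le> t * (1 / t - 1)" using True by (intro mult_left_mono) auto
    also have "t * (1 / t - 1) = 1 - t" using True by (simp add: right_diff_distrib)
    also have "\<dots> \<le> 1" using True by simp
    finally show ?thesis using True by (simp add: max_def)
  next
    case False
    then show ?thesis using that by (auto simp: max_def not_less)
  qed
  have "(\<integral>\<^sup>+\<xi>. ennreal (?g \<xi>) \<partial>S) = (\<integral>\<^sup>+y. \<integral>\<^sup>+\<theta>. ennreal (D y \<theta>) * ennreal (max 0 (- ln (D y \<theta>))) \<partial>N \<partial>measure_pmf (P n))"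
    by (rule nn_integral_joint_D[where F = "\<lambda>y \<theta>. ennreal (max 0 (- ln (D y \<theta>)))"]) measurable
  also have "\<dots> \<le> (\<integral>\<^sup>+y. \<integral>\<^sup>+\<theta>. 1 \<partial>N \<partial>measure_pmf (P n))"
  proof (intro nn_integral_mono)
    fix y \<theta>
    have "ennreal (D y \<theta>) * ennreal (max 0 (- ln (D y \<theta>))) = ennreal (D y \<theta> * max 0 (- ln (D y \<theta>)))"
      by (rule ennreal_mult'[symmetric]) (rule D_nonneg)
    also have "\<dots> \<le> ennreal 1" by (rule ennreal_leI) (rule t[OF D_nonneg])
    finally show "ennreal (D y \<theta>) * ennreal (max 0 (- ln (D y \<theta>))) \<le> 1" by simp
  qed
  also have "\<dots> = 1" by (simp add: prob_space.emeasure_space_1[OF prob_N])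
  finally have "(\<integral>\<^sup>+\<xi>. ennreal (?g \<xi>) \<partial>S) < \<infinity>" by (simp add: order.strict_trans1)
  then have ig: "integrable S ?g" by (intro integrableI_nonneg) auto
  have "integrable S (\<lambda>\<xi>. ?g \<xi> - ln (pmf (P n) (Y n \<xi>)))" using ig integrable_ln_pmf by simp
  then show ?thesis
  proof (rule Bochner_Integration.integrable_bound)
    show "AE \<xi> in S. norm (ln (D (Y n \<xi>) (\<beta> \<xi>))) \<le> norm (?g \<xi> - ln (pmf (P n) (Y n \<xi>)))"
      using AE_ln_D_le[of n] AE_Y[of n]
    proof eventually_elim
      fix \<xi> assume *: "ln (D (Y n \<xi>) (\<beta> \<xi>)) \<le> - ln (pmf (P n) (Y n \<xi>))" "Y n \<xi> \<in> set_pmf (P n)"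
      then have "0 \<le> - ln (pmf (P n) (Y n \<xi>))" by (simp add: pmf_positive pmf_le_1)
      with * show "norm (ln (D (Y n \<xi>) (\<beta> \<xi>))) \<le> norm (?g \<xi> - ln (pmf (P n) (Y n \<xi>)))" by auto
    qed
  qed simp
qed

lemma I_le_ent: "I n \<le> ent (P n)"
proof -
  have "I n \<le> (\<integral>\<xi>. - ln (pmf (P n) (Y n \<xi>)) \<partial>S)"
    unfolding I_def by (rule integral_mono_AE[OF integrable_ln_D _ AE_ln_D_le]) (simp add: integrable_ln_pmf)
  then show ?thesis by (simp add: integrable_ln_pmf)
qed

lemma act_inv: "g \<in> carrier G \<Longrightarrow> \<theta> \<in> space N \<Longrightarrow> act (inv g) (act g \<theta>) = \<theta>"
  using act_comp[of "inv g" g \<theta>] act_one by simp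

text \<open>The chain rule for densities, by uniqueness of the Radon-Nikodym derivative: acting by
  \<open>g \<otimes> x\<close> means acting by \<open>x\<close> and then by
  \<open>g\<close>.\<close>

lemma D_cocycle:
  assumes g: "g \<in> set_pmf (P m)" and x: "x \<in> set_pmf (P n)"
  shows "AE \<theta> in N. D (g \<otimes> x) \<theta> = D g \<theta> * D x (act (inv g) \<theta>)"
proof -
  interpret N: prob_space N by (rule prob_N)
  have gc: "g \<in> carrier G" and xc: "x \<in> carrier G" using g x supp_walk by blast+
  have [measurable]: "act (inv g) \<in> N \<rightarrow>\<^sub>M N" "act g \<in> N \<rightarrow>\<^sub>M N" "act (g \<otimes> x) \<in> N \<rightarrow>\<^sub>M N"
    using gc xc by (auto intro: act_meas)
  let ?f = "\<lambda>\<theta>. ennreal (D g \<theta> * D x (act (inv g) \<theta>))"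
  have "AE \<theta> in N. ?f \<theta> = RN_deriv N (distr N N (act (g \<otimes> x))) \<theta>"
  proof (rule N.RN_deriv_unique)
    show "density N ?f = distr N N (act (g \<otimes> x))"
    proof (rule measure_eqI)
      fix A assume "A \<in> sets (density N ?f)"
      then have [measurable]: "A \<in> sets N" by simp
      have "emeasure (distr N N (act (g \<otimes> x))) A = (\<integral>\<^sup>+\<theta>. indicator A (act (g \<otimes> x) \<theta>) \<partial>N)"
        using nn_integral_distr[of "act (g \<otimes> x)" N N "indicator A"] by simp
      also have "\<dots> = (\<integral>\<^sup>+\<theta>. indicator A (act g (act x \<theta>)) \<partial>N)"
        by (intro nn_integral_cong) (simp add: act_comp gc xc)
      also have "\<dots> = (\<integral>\<^sup>+\<theta>. ennreal (D x \<theta>) * indicator A (act g \<theta>) \<partial>N)"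
        by (rule nn_integral_act[OF x]) measurable
      also have "\<dots> = (\<integral>\<^sup>+\<theta>. ennreal (D x (act (inv g) (act g \<theta>))) * indicator A (act g \<theta>) \<partial>N)"
        by (intro nn_integral_cong) (simp add: act_inv gc)
      also have "\<dots> = (\<integral>\<^sup>+\<theta>. ennreal (D g \<theta>) * (ennreal (D x (act (inv g) \<theta>)) * indicator A \<theta>) \<partial>N)"
        by (rule nn_integral_act[OF g]) measurable
      also have "\<dots> = emeasure (density N ?f) A"
        by (subst emeasure_density) (auto simp: ennreal_mult D_nonneg mult.assoc)
      finally show "emeasure (density N ?f) A = emeasure (distr N N (act (g \<otimes> x))) A" ..
    qed simp
  qed measurable
  then show ?thesis
  proof eventually_elim
    fix \<theta> assume "?f \<theta> = RN_deriv N (distr N N (act (g \<otimes> x))) \<theta>"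
    then show "D (g \<otimes> x) \<theta> = D g \<theta> * D x (act (inv g) \<theta>)"
      unfolding D_def[of "g \<otimes> x"] by (metis D_nonneg enn2real_ennreal mult_nonneg_nonneg)
  qed
qed

text \<open>Along a path the cocycle splits the density at time \<open>Suc n\<close> into that of
  the first step and that of the remaining walk seen from \<open>Y 1\<close>, whose increments have
  the original law.\<close>

lemma I_Suc: "I (Suc n) = I 1 + I n"
proof -
  have coc: "AE \<theta> in N. \<forall>g\<in>set_pmf (P 1). \<forall>x\<in>set_pmf (P n). D (g \<otimes> x) \<theta> = D g \<theta> * D x (act (inv g) \<theta>)"
    by (simp only: AE_ball_countable countable_set_pmf) (blast intro: D_cocycle)
  \<comment> \<open>Only measurable functions of the two boundary points are known to agree, so the
    identity is stated inside \<open>D x\<close>, for the countably many relevant \<open>x\<close>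
    at once.\<close>
  have inner: "AE \<xi> in S. \<forall>x\<in>set_pmf (P n). ennreal (D x (act (inv (Y 1 \<xi>)) (\<beta> \<xi>))) = ennreal (D x (act (inv (Y 1 \<xi>)) (act (Y 1 \<xi>) (\<beta> (advance 1 \<xi>)))))"
    unfolding AE_ball_countable[OF countable_set_pmf]
  proof
    fix x
    show "AE \<xi> in S. ennreal (D x (act (inv (Y 1 \<xi>)) (\<beta> \<xi>))) = ennreal (D x (act (inv (Y 1 \<xi>)) (act (Y 1 \<xi>) (\<beta> (advance 1 \<xi>)))))"
      by (rule AE_beta_act[of "\<lambda>y \<theta>. ennreal (D x (act (inv y) \<theta>))" 1])
        (rule measurable_compose[OF measurable_compose[OF act_meas[OF inv_closed] D_meas] measurable_ennreal])
  qed
  have "AE \<xi> in S. ln (D (Y (Suc n) \<xi>) (\<beta> \<xi>)) = ln (D (Y 1 \<xi>) (\<beta> \<xi>)) + ln (D (Y n (advance 1 \<xi>)) (\<beta> (advance 1 \<xi>)))"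
    using AE_beta[OF coc] inner D_pos[of 1] AE_advance[OF D_pos[of n], of 1] AE_Y[of 1] AE_advance[OF AE_Y[of n], of 1] AE_space
  proof eventually_elim
    fix \<xi> assume c: "\<forall>g\<in>set_pmf (P 1). \<forall>x\<in>set_pmf (P n). D (g \<otimes> x) (\<beta> \<xi>) = D g (\<beta> \<xi>) * D x (act (inv g) (\<beta> \<xi>))"
      and i: "\<forall>x\<in>set_pmf (P n). ennreal (D x (act (inv (Y 1 \<xi>)) (\<beta> \<xi>))) = ennreal (D x (act (inv (Y 1 \<xi>)) (act (Y 1 \<xi>) (\<beta> (advance 1 \<xi>)))))"
      and p: "0 < D (Y 1 \<xi>) (\<beta> \<xi>)" "0 < D (Y n (advance 1 \<xi>)) (\<beta> (advance 1 \<xi>))"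
      and s: "Y 1 \<xi> \<in> set_pmf (P 1)" "Y n (advance 1 \<xi>) \<in> set_pmf (P n)" and sp: "\<xi> \<in> space S"
    let ?x = "Y n (advance 1 \<xi>)"
    have e: "act (inv (Y 1 \<xi>)) (act (Y 1 \<xi>) (\<beta> (advance 1 \<xi>))) = \<beta> (advance 1 \<xi>)"
      by (rule act_inv[OF Y_closed[OF sp] beta_space[OF advance_space[OF sp]]])
    have "D ?x (act (inv (Y 1 \<xi>)) (\<beta> \<xi>)) = D ?x (\<beta> (advance 1 \<xi>))"
      using i s(2) unfolding e by (metis D_nonneg ennreal_inj)
    moreover have "Y (Suc n) \<xi> = Y 1 \<xi> \<otimes> ?x" using Y_shift[OF sp, of 1 n] by simp
    ultimately have "D (Y (Suc n) \<xi>) (\<beta> \<xi>) = D (Y 1 \<xi>) (\<beta> \<xi>) * D ?x (\<beta> (advance 1 \<xi>))"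
      using c s by metis
    then show "ln (D (Y (Suc n) \<xi>) (\<beta> \<xi>)) = ln (D (Y 1 \<xi>) (\<beta> \<xi>)) + ln (D ?x (\<beta> (advance 1 \<xi>)))"
      using p by (simp only: ln_mult_pos)
  qed
  then have "I (Suc n) = (\<integral>\<xi>. ln (D (Y 1 \<xi>) (\<beta> \<xi>)) + ln (D (Y n (advance 1 \<xi>)) (\<beta> (advance 1 \<xi>))) \<partial>S)"
    unfolding I_def
    by (rule integral_cong_AE[rotated 2]; use measurable_compose[OF measurable_advance D_joint_meas] in measurable)
  also have "\<dots> = I 1 + (\<integral>\<xi>. ln (D (Y n (advance 1 \<xi>)) (\<beta> (advance 1 \<xi>))) \<partial>S)"
    unfolding I_def
  proof (rule Bochner_Integration.integral_add[OF integrable_ln_D])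
    have "integrable (distr S S (advance 1)) (\<lambda>\<xi>. ln (D (Y n \<xi>) (\<beta> \<xi>)))"
      by (simp only: distr_advance integrable_ln_D)
    then show "integrable S (\<lambda>\<xi>. ln (D (Y n (advance 1 \<xi>)) (\<beta> (advance 1 \<xi>))))"
      by (subst (asm) integrable_distr_eq) auto
  qed
  also have "(\<integral>\<xi>. ln (D (Y n (advance 1 \<xi>)) (\<beta> (advance 1 \<xi>))) \<partial>S) = (\<integral>\<xi>. ln (D (Y n \<xi>) (\<beta> \<xi>)) \<partial>distr S S (advance 1))"
    by (rule integral_distr[symmetric]) auto
  also have "\<dots> = I n" by (simp only: distr_advance I_def)
  finally show ?thesis .
qed

lemma I_linear: "I (Suc n) = real (Suc n) * I 1"
  by (induction n) (simp_all add: I_Suc[of "Suc _"] algebra_simps del: One_nat_def add: One_nat_def[symmetric])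

text \<open>Gibbs' inequality: \<open>ent (P n) - I n\<close> is the optimal mean length of a code for \<open>Y n\<close> given the
  boundary point.\<close>

lemma gibbs:
  fixes q :: "'c \<Rightarrow> 'a \<Rightarrow> real"
  assumes m: "\<And>y. y \<in> carrier G \<Longrightarrow> (\<lambda>\<theta>. q \<theta> y) \<in> borel_measurable N" and nn: "\<And>\<theta> y. 0 \<le> q \<theta> y"
    and sum: "(\<integral>\<^sup>+y. \<integral>\<^sup>+\<theta>. ennreal (q \<theta> y) \<partial>N \<partial>count_space (set_pmf (P n))) \<le> 1"
    and pos: "AE \<xi> in S. 0 < q (\<beta> \<xi>) (Y n \<xi>)"
    and int: "integrable S (\<lambda>\<xi>. ln (q (\<beta> \<xi>) (Y n \<xi>)))"
  defines "F \<equiv> \<lambda>\<xi>. q (\<beta> \<xi>) (Y n \<xi>) / (pmf (P n) (Y n \<xi>) * D (Y n \<xi>) (\<beta> \<xi>))"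
  shows "F \<in> borel_measurable S" "AE \<xi> in S. 0 < F \<xi>" "(\<integral>\<^sup>+\<xi>. ennreal (F \<xi>) \<partial>S) \<le> 1" "integrable S (\<lambda>\<xi>. ln (F \<xi>))"
    "(\<integral>\<xi>. ln (F \<xi>) \<partial>S) = (\<integral>\<xi>. ln (q (\<beta> \<xi>) (Y n \<xi>)) \<partial>S) + ent (P n) - I n"
    "ent (P n) - I n \<le> - (\<integral>\<xi>. ln (q (\<beta> \<xi>) (Y n \<xi>)) \<partial>S)"
proof -
  have qm[measurable]: "(\<lambda>\<xi>. q (\<beta> \<xi>) (Y n \<xi>)) \<in> borel_measurable S"
    by (rule joint_meas[of "\<lambda>y \<theta>. q \<theta> y"]) (rule m)
  show Fm: "F \<in> borel_measurable S" unfolding F_def by measurable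
  show Fpos: "AE \<xi> in S. 0 < F \<xi>"
    using pos D_pos[of n] AE_Y[of n] by eventually_elim (simp add: F_def pmf_positive)
  have lnF: "AE \<xi> in S. ln (F \<xi>) = ln (q (\<beta> \<xi>) (Y n \<xi>)) - ln (pmf (P n) (Y n \<xi>)) - ln (D (Y n \<xi>) (\<beta> \<xi>))"
    using pos D_pos[of n] AE_Y[of n]
  proof eventually_elim
    fix \<xi> assume "0 < q (\<beta> \<xi>) (Y n \<xi>)" "0 < D (Y n \<xi>) (\<beta> \<xi>)" "Y n \<xi> \<in> set_pmf (P n)"
    moreover from this have "0 < pmf (P n) (Y n \<xi>)" by (simp add: pmf_positive)
    ultimately show "ln (F \<xi>) = ln (q (\<beta> \<xi>) (Y n \<xi>)) - ln (pmf (P n) (Y n \<xi>)) - ln (D (Y n \<xi>) (\<beta> \<xi>))"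
      unfolding F_def by (subst ln_divide_pos) (auto simp: ln_mult_pos)
  qed
  show iF: "integrable S (\<lambda>\<xi>. ln (F \<xi>))"
    using int integrable_ln_pmf integrable_ln_D[of n] Fm by (subst integrable_cong_AE[OF _ _ lnF]) auto
  have "(\<integral>\<xi>. ln (F \<xi>) \<partial>S) = (\<integral>\<xi>. ln (q (\<beta> \<xi>) (Y n \<xi>)) - ln (pmf (P n) (Y n \<xi>)) - ln (D (Y n \<xi>) (\<beta> \<xi>)) \<partial>S)"
    by (rule integral_cong_AE[OF _ _ lnF]) (use Fm in auto)
  also have "\<dots> = (\<integral>\<xi>. ln (q (\<beta> \<xi>) (Y n \<xi>)) \<partial>S) + ent (P n) - I n"
    using int integrable_ln_pmf[of n] integrable_ln_D[of n] by (simp add: I_def)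
  finally show eq: "(\<integral>\<xi>. ln (F \<xi>) \<partial>S) = (\<integral>\<xi>. ln (q (\<beta> \<xi>) (Y n \<xi>)) \<partial>S) + ent (P n) - I n" .
  let ?F = "\<lambda>y \<theta>. ennreal (q \<theta> y / (pmf (P n) y * D y \<theta>))"
  \<comment> \<open>The change of measure cancels \<open>D\<close>, and summation over
    \<open>y\<close> cancels the mass of \<open>y\<close>; what remains is the total mass bounded in
    the assumption \<open>sum\<close>.\<close>
  have "(\<integral>\<^sup>+\<xi>. ennreal (F \<xi>) \<partial>S) = (\<integral>\<^sup>+y. \<integral>\<^sup>+\<theta>. ennreal (D y \<theta>) * ?F y \<theta> \<partial>N \<partial>measure_pmf (P n))"
    unfolding F_def by (rule nn_integral_joint_D[of ?F]) (use m in measurable)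
  also have "\<dots> \<le> (\<integral>\<^sup>+y. \<integral>\<^sup>+\<theta>. ennreal (q \<theta> y) / ennreal (pmf (P n) y) \<partial>N \<partial>measure_pmf (P n))"
  proof (rule nn_integral_mono_AE, rule AE_pmfI, rule nn_integral_mono)
    fix y \<theta> assume "y \<in> set_pmf (P n)"
    then have "0 < pmf (P n) y" by (rule pmf_positive)
    then show "ennreal (D y \<theta>) * ?F y \<theta> \<le> ennreal (q \<theta> y) / ennreal (pmf (P n) y)"
      using D_nonneg[of y \<theta>] nn[of \<theta> y]
      by (cases "D y \<theta> = 0") (auto simp: ennreal_mult'[symmetric] divide_ennreal)
  qed
  also have "\<dots> = (\<integral>\<^sup>+y. ennreal (pmf (P n) y) * (\<integral>\<^sup>+\<theta>. ennreal (q \<theta> y) / ennreal (pmf (P n) y) \<partial>N) * indicator (set_pmf (P n)) y \<partial>count_space UNIV)"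
    unfolding nn_integral_measure_pmf by (intro nn_integral_cong) (auto simp: set_pmf_iff split: split_indicator)
  also have "\<dots> = (\<integral>\<^sup>+y. (\<integral>\<^sup>+\<theta>. ennreal (q \<theta> y) \<partial>N) * indicator (set_pmf (P n)) y \<partial>count_space UNIV)"
  proof (intro nn_integral_cong)
    fix y
    show "ennreal (pmf (P n) y) * (\<integral>\<^sup>+\<theta>. ennreal (q \<theta> y) / ennreal (pmf (P n) y) \<partial>N) * indicator (set_pmf (P n)) y =
      (\<integral>\<^sup>+\<theta>. ennreal (q \<theta> y) \<partial>N) * indicator (set_pmf (P n)) y"
    proof (cases "y \<in> set_pmf (P n)")
      case True
      then have p: "0 < pmf (P n) y" by (rule pmf_positive)
      have [measurable]: "(\<lambda>\<theta>. q \<theta> y) \<in> borel_measurable N" using m True supp_walk by blast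
      have "ennreal (pmf (P n) y) * (\<integral>\<^sup>+\<theta>. ennreal (q \<theta> y) / ennreal (pmf (P n) y) \<partial>N) = (\<integral>\<^sup>+\<theta>. ennreal (pmf (P n) y) * (ennreal (q \<theta> y) / ennreal (pmf (P n) y)) \<partial>N)"
        by (rule nn_integral_cmult[symmetric]) measurable
      also have "\<dots> = (\<integral>\<^sup>+\<theta>. ennreal (q \<theta> y) \<partial>N)"
        using p nn by (intro nn_integral_cong) (simp add: divide_ennreal ennreal_mult'[symmetric])
      finally show ?thesis by simp
    qed simp
  qed
  also have "\<dots> = (\<integral>\<^sup>+y. \<integral>\<^sup>+\<theta>. ennreal (q \<theta> y) \<partial>N \<partial>count_space (set_pmf (P n)))"
    by (simp add: nn_integral_count_space_indicator)
  also note sum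
  finally show le1: "(\<integral>\<^sup>+\<xi>. ennreal (F \<xi>) \<partial>S) \<le> 1" .
  have "(\<integral>\<xi>. ln (F \<xi>) \<partial>S) \<le> 0"
    by (rule seq.P.expectation_ln_nonpos[OF Fm Fpos le1 iF])
  then show "ent (P n) - I n \<le> - (\<integral>\<xi>. ln (q (\<beta> \<xi>) (Y n \<xi>)) \<partial>S)" unfolding eq by linarith
qed

end

section \<open>A criterion for a boundary to be the Poisson boundary\<close>

text \<open>The measures with densities \<open>h1\<close> and \<open>h2\<close> agree on every
  cylinder, and cylinders determine a finite measure on the product. This does the work of Levy's
  theorem on conditioning by ever longer initial segments.\<close>

lemma (in countable_walk) AE_eq_if_conditional_eq:
  fixes h1 h2 :: "(nat \<Rightarrow> 'a) \<Rightarrow> ennreal"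
  assumes m[measurable]: "h1 \<in> borel_measurable S" "h2 \<in> borel_measurable S" and fin: "(\<integral>\<^sup>+\<xi>. h1 \<xi> \<partial>S) < \<infinity>"
    and eq: "\<And>n. AE \<omega> in S. (\<integral>\<^sup>+\<omega>'. h1 (comb_seq n \<omega> \<omega>') \<partial>S) = (\<integral>\<^sup>+\<omega>'. h2 (comb_seq n \<omega> \<omega>') \<partial>S)"
  shows "AE \<xi> in S. h1 \<xi> = h2 \<xi>"
proof -
  have "density S h1 = density S h2"
  proof (rule measure_eqI_PiM_infinite[where I = UNIV and M = "\<lambda>_. R"])
    fix A :: "nat \<Rightarrow> 'a set" and J :: "nat set"
    assume J: "finite J" "J \<subseteq> UNIV" and A: "\<And>i. i \<in> J \<Longrightarrow> A i \<in> sets R"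
    define E where "E = prod_emb UNIV (\<lambda>_. R) J (Pi\<^sub>E J A)"
    have E[measurable]: "E \<in> sets S" unfolding E_def using J A by (intro sets_PiM_I) auto
    obtain n where n: "\<And>j. j \<in> J \<Longrightarrow> j < n" using J(1) finite_nat_set_iff_bounded by auto
    have ind: "indicator E (comb_seq n \<omega> \<omega>') = (indicator E \<omega> :: ennreal)" if "\<omega> \<in> space S" "\<omega>' \<in> space S" for \<omega> \<omega>'
    proof -
      have "comb_seq n \<omega> \<omega>' j = \<omega> j" if "j \<in> J" for j using n[OF that] by (simp add: comb_seq_def)
      then have "comb_seq n \<omega> \<omega>' \<in> E \<longleftrightarrow> \<omega> \<in> E"
        using comb_space[OF that, of n] that by (auto simp: E_def prod_emb_def PiE_iff space_PiM)
      then show ?thesis by (simp add: indicator_def)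
    qed
    have split: "emeasure (density S h) E = (\<integral>\<^sup>+\<omega>. (\<integral>\<^sup>+\<omega>'. h (comb_seq n \<omega> \<omega>') \<partial>S) * indicator E \<omega> \<partial>S)"
      if [measurable]: "h \<in> borel_measurable S" for h
    proof -
      have "emeasure (density S h) E = (\<integral>\<^sup>+\<xi>. h \<xi> * indicator E \<xi> \<partial>S)" by (rule emeasure_density) auto
      also have "\<dots> = (\<integral>\<^sup>+\<omega>. \<integral>\<^sup>+\<omega>'. h (comb_seq n \<omega> \<omega>') * indicator E (comb_seq n \<omega> \<omega>') \<partial>S \<partial>S)"
        by (rule nn_integral_comb) measurable
      also have "\<dots> = (\<integral>\<^sup>+\<omega>. \<integral>\<^sup>+\<omega>'. h (comb_seq n \<omega> \<omega>') * indicator E \<omega> \<partial>S \<partial>S)"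
        by (intro nn_integral_cong) (simp add: ind)
      also have "\<dots> = (\<integral>\<^sup>+\<omega>. (\<integral>\<^sup>+\<omega>'. h (comb_seq n \<omega> \<omega>') \<partial>S) * indicator E \<omega> \<partial>S)"
      proof (rule nn_integral_cong)
        fix \<omega> assume "\<omega> \<in> space S"
        then have "(\<lambda>\<omega>'. h (comb_seq n \<omega> \<omega>')) \<in> borel_measurable S"
          using measurable_compose[OF measurable_Pair1'[of \<omega> S S] measurable_compose[OF measurable_comb_seq[of n R] that]] by simp
        then show "(\<integral>\<^sup>+\<omega>'. h (comb_seq n \<omega> \<omega>') * indicator E \<omega> \<partial>S) = (\<integral>\<^sup>+\<omega>'. h (comb_seq n \<omega> \<omega>') \<partial>S) * indicator E \<omega>"
          by (rule nn_integral_multc)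
      qed
      finally show ?thesis .
    qed
    have "emeasure (density S h1) E = emeasure (density S h2) E"
      unfolding split[OF m(1)] split[OF m(2)] by (rule nn_integral_cong_AE) (use eq[of n] in \<open>auto elim!: AE_mp\<close>)
    then show "emeasure (density S h1) (prod_emb UNIV (\<lambda>_. R) J (Pi\<^sub>E J A)) = emeasure (density S h2) (prod_emb UNIV (\<lambda>_. R) J (Pi\<^sub>E J A))"
      by (simp only: E_def)
  next
    have "emeasure (density S h1) (space S) = (\<integral>\<^sup>+\<xi>. h1 \<xi> \<partial>S)"
      by (subst emeasure_density) (auto intro!: nn_integral_cong)
    then show "finite_measure (density S h1)"
      using fin by (intro finite_measureI) auto
  qed auto
  then show ?thesis by (simp add: seq.P.density_unique_iff m)
qed

lemma path_translate_space:
  "group G \<Longrightarrow> \<gamma> \<in> carrier G \<Longrightarrow> \<omega> \<in> space (path_space G) \<Longrightarrow> path_translate G \<gamma> \<omega> \<in> space (path_space G)"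
  by (auto simp: space_path_space path_translate_def PiE_iff intro: group.is_monoid monoid.m_closed)

context countable_walk
begin

text \<open>The trajectory law restricted to the invariant sigma-field: the tautological model of
  the Poisson boundary.\<close>

abbreviation "N0 \<equiv> distr (walk_law G \<mu>) (invariant_space G) (\<lambda>\<omega>. \<omega>)"

lemma id_invariant: "(\<lambda>\<omega>. \<omega>) \<in> path_space G \<rightarrow>\<^sub>M invariant_space G"
  by (rule measurableI) (auto simp: space_invariant_space sets_invariant_space)

text \<open>Treating the whole invariant field as a boundary makes its mutual information with the
  walk comparable with that of \<open>b\<close>, through the same lemmas.\<close>

lemma inv_boundary:
  assumes fin: "fin_ent \<mu>"
  shows "boundary G \<mu> N0 (path_translate G) (\<lambda>\<omega>. \<omega>)"
proof (unfold_locales)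
  show "fin_ent \<mu>" by (rule fin)
  show "(\<lambda>\<omega>. \<omega>) \<in> path_space G \<rightarrow>\<^sub>M N0"
    using id_invariant by (simp add: measurable_def)
  show "distr (walk_law G \<mu>) N0 (\<lambda>\<omega>. \<omega>) = N0" by (rule distr_cong) auto
  show "f (path_shift \<omega>) = f \<omega>" if f: "(f :: _ \<Rightarrow> ennreal) \<in> borel_measurable N0" and \<omega>: "\<omega> \<in> space (path_space G)" for f \<omega>
  proof -
    have f': "f \<in> borel_measurable (invariant_space G)" using f by simp
    \<comment> \<open>A level set of a function measurable for the invariant field is an invariant
      set, so it contains the shift of each of its points.\<close>
    define A where "A = f -` {f \<omega>} \<inter> space (path_space G)"
    have "A \<in> sets (invariant_space G)"
      using measurable_sets[OF f', of "{f \<omega>}"] by (simp add: A_def space_invariant_space)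
    then have "path_shift -` A \<inter> space (path_space G) = A" by (simp add: sets_invariant_space)
    moreover have "\<omega> \<in> A" using \<omega> by (simp add: A_def)
    ultimately have "path_shift \<omega> \<in> A" by blast
    then show ?thesis by (simp add: A_def)
  qed
  show "path_translate G \<gamma> \<in> N0 \<rightarrow>\<^sub>M N0" if \<gamma>: "\<gamma> \<in> carrier G" for \<gamma>
  proof (rule measurableI)
    show "path_translate G \<gamma> \<omega> \<in> space N0" if "\<omega> \<in> space N0" for \<omega>
      using path_translate_space[OF is_group \<gamma>] that by (simp add: space_invariant_space)
    fix A assume "A \<in> sets N0"
    then have A: "A \<in> sets (path_space G)" "path_shift -` A \<inter> space (path_space G) = A"
      by (auto simp: sets_invariant_space)
    have tm: "path_translate G \<gamma> \<in> path_space G \<rightarrow>\<^sub>M path_space G"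
      unfolding path_translate_def[abs_def] path_space_def
    proof (rule measurable_PiM_single')
      fix i :: nat
      have c: "(\<lambda>\<omega>. \<omega> i) \<in> Pi\<^sub>M UNIV (\<lambda>_::nat. count_space (carrier G)) \<rightarrow>\<^sub>M count_space (carrier G)" by simp
      show "(\<lambda>\<omega>. \<gamma> \<otimes> \<omega> i) \<in> Pi\<^sub>M UNIV (\<lambda>_::nat. count_space (carrier G)) \<rightarrow>\<^sub>M count_space (carrier G)"
        by (rule measurable_compose[OF c]) (use \<gamma> in auto)
    qed (use \<gamma> in \<open>auto simp: space_PiM PiE_iff\<close>)
    let ?B = "path_translate G \<gamma> -` A \<inter> space (path_space G)"
    have "?B \<in> sets (path_space G)" using measurable_sets[OF tm A(1)] .
    moreover have "path_shift -` ?B \<inter> space (path_space G) = ?B"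
    proof -
      have sh: "path_shift (path_translate G \<gamma> \<omega>) = path_translate G \<gamma> (path_shift \<omega>)" for \<omega>
        by (auto simp: path_shift_def path_translate_def fun_eq_iff)
      have sp: "path_shift \<omega> \<in> space (path_space G)" if "\<omega> \<in> space (path_space G)" for \<omega>
        using that by (auto simp: space_path_space path_shift_def)
      have "path_translate G \<gamma> (path_shift \<omega>) \<in> A \<longleftrightarrow> path_translate G \<gamma> \<omega> \<in> A" if "\<omega> \<in> space (path_space G)" for \<omega>
        using A(2) path_translate_space[OF is_group \<gamma> that] unfolding sh[symmetric] by blast
      then show ?thesis using sp by auto
    qed
    ultimately show "path_translate G \<gamma> -` A \<inter> space N0 \<in> sets N0"
      by (simp add: sets_invariant_space space_invariant_space)
  qed
  show "path_translate G (\<gamma> \<otimes> \<delta>) \<omega> = path_translate G \<gamma> (path_translate G \<delta> \<omega>)"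
    if "\<gamma> \<in> carrier G" "\<delta> \<in> carrier G" "\<omega> \<in> space N0" for \<gamma> \<delta> \<omega>
    using that by (auto simp: path_translate_def fun_eq_iff space_invariant_space space_path_space m_assoc PiE_iff)
  show "path_translate G \<one> \<omega> = \<omega>" if "\<omega> \<in> space N0" for \<omega>
    using that by (auto simp: path_translate_def fun_eq_iff space_invariant_space space_path_space PiE_iff)
qed auto

end

context boundary
begin

text \<open>Both informations are linear in time, and that of the invariant field is at most the
  entropy; the assumption \<open>small\<close> thus makes it at most that of \<open>b\<close>. Then
  Gibbs' inequality holds with equality, so the density of the invariant field given the position is
  already a function of \<open>b\<close>.\<close>

lemma nn_integral_translate_invariant:
  assumes binv: "b \<in> invariant_space G \<rightarrow>\<^sub>M N"
    and small: "\<And>\<epsilon>. 0 < \<epsilon> \<Longrightarrow> \<exists>n. ent (P (Suc n)) - I (Suc n) \<le> \<epsilon> * real (Suc n)"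
    and y: "y \<in> set_pmf (P (Suc n))"
    and A: "A \<in> sets (invariant_space G)"
  shows "(\<integral>\<^sup>+\<omega>. indicator A (path_translate G y \<omega>) \<partial>N0) = (\<integral>\<^sup>+\<omega>. indicator A \<omega> * ennreal (D y (b \<omega>)) \<partial>N0)"
proof -
  interpret inv: boundary G \<mu> N0 "path_translate G" "\<lambda>\<omega>. \<omega>" by (rule inv_boundary[OF fin])
  note binv[measurable]
  have bN0[measurable]: "b \<in> N0 \<rightarrow>\<^sub>M N" using binv by simp
  have dN: "distr N0 N b = N"
    using b_law by (subst distr_distr[OF binv]) (simp_all add: comp_def measurable_def[symmetric], use id_invariant in \<open>simp_all add: measurable_def\<close>)
  have nnb: "(\<integral>\<^sup>+\<omega>. f (b \<omega>) \<partial>N0) = (\<integral>\<^sup>+\<theta>. f \<theta> \<partial>N)" if "f \<in> borel_measurable N" for f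
    using nn_integral_distr[OF bN0, of f] that unfolding dN by simp
  have [measurable]: "inv.D y \<in> borel_measurable (invariant_space G)" for y using inv.D_meas[of y] by simp
  have le1: "inv.I 1 \<le> I 1"
  proof (rule field_le_epsilon)
    fix \<epsilon> :: real assume "0 < \<epsilon>"
    then obtain n where "ent (P (Suc n)) - I (Suc n) \<le> \<epsilon> * real (Suc n)" using small by blast
    moreover have "inv.I (Suc n) \<le> ent (P (Suc n))" by (rule inv.I_le_ent)
    ultimately have "real (Suc n) * inv.I 1 \<le> real (Suc n) * (I 1 + \<epsilon>)"
      unfolding I_linear inv.I_linear by (simp only: distrib_left mult.commute[of \<epsilon>])
    then show "inv.I 1 \<le> I 1 + \<epsilon>" by (subst (asm) mult_le_cancel_left_pos) simp_all
  qed
  let ?n = "Suc n"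
  \<comment> \<open>The conditional law of the position computed from \<open>b\<close> alone,
    offered as a code to a decoder that knows the whole invariant field.\<close>
  let ?q = "\<lambda>\<omega> y. pmf (P ?n) y * D y (b \<omega>)"
  define F where "F \<xi> = ?q (partial_product G \<xi>) (Y ?n \<xi>) / (pmf (P ?n) (Y ?n \<xi>) * inv.D (Y ?n \<xi>) (partial_product G \<xi>))" for \<xi>
  have lnq: "AE \<xi> in S. ln (?q (partial_product G \<xi>) (Y ?n \<xi>)) = ln (pmf (P ?n) (Y ?n \<xi>)) + ln (D (Y ?n \<xi>) (\<beta> \<xi>))"
    using D_pos[of ?n] AE_Y[of ?n] by eventually_elim (simp only: ln_mult_pos pmf_positive)
  have qm: "(\<lambda>\<xi>. ?q (partial_product G \<xi>) (Y ?n \<xi>)) \<in> borel_measurable S" by (intro borel_measurable_times D_joint_meas measurable_fun_Y)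
  have q1: "(\<lambda>\<omega>. ?q \<omega> y) \<in> borel_measurable N0" for y by measurable
  have q2: "0 \<le> ?q \<omega> y" for \<omega> y by (simp add: D_nonneg)
  have q3: "(\<integral>\<^sup>+y. \<integral>\<^sup>+\<omega>. ennreal (?q \<omega> y) \<partial>N0 \<partial>count_space (set_pmf (P ?n))) \<le> 1"
  proof -
    have "(\<integral>\<^sup>+\<omega>. ennreal (?q \<omega> y) \<partial>N0) = ennreal (pmf (P ?n) y)" if "y \<in> set_pmf (P ?n)" for y
    proof -
      have "(\<integral>\<^sup>+\<omega>. ennreal (?q \<omega> y) \<partial>N0) = ennreal (pmf (P ?n) y) * (\<integral>\<^sup>+\<omega>. ennreal (D y (b \<omega>)) \<partial>N0)"
        by (subst nn_integral_cmult[symmetric]) (auto simp: ennreal_mult')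
      also have "(\<integral>\<^sup>+\<omega>. ennreal (D y (b \<omega>)) \<partial>N0) = 1"
        using nnb[of "\<lambda>\<theta>. ennreal (D y \<theta>)"] nn_integral_D[OF that] by simp
      finally show ?thesis by simp
    qed
    then have "(\<integral>\<^sup>+y. \<integral>\<^sup>+\<omega>. ennreal (?q \<omega> y) \<partial>N0 \<partial>count_space (set_pmf (P ?n))) = (\<integral>\<^sup>+y. ennreal (pmf (P ?n) y) \<partial>count_space (set_pmf (P ?n)))"
      by (intro nn_integral_cong) simp
    also have "\<dots> \<le> 1" by (subst nn_integral_pmf) (rule measure_pmf.emeasure_le_1)
    finally show ?thesis .
  qed
  have q4: "AE \<xi> in S. 0 < ?q (partial_product G \<xi>) (Y ?n \<xi>)"
    using D_pos[of ?n] AE_Y[of ?n] by eventually_elim (simp only: mult_pos_pos pmf_positive)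
  have q5: "integrable S (\<lambda>\<xi>. ln (?q (partial_product G \<xi>) (Y ?n \<xi>)))"
    using integrable_ln_pmf(1)[of ?n] integrable_ln_D[of ?n] qm
    by (subst integrable_cong_AE[OF _ _ lnq]) (auto simp del: partial_product.simps)
  note gi = inv.gibbs[of ?q ?n, OF q1 q2 q3 q4 q5, folded F_def]
  have "(\<integral>\<xi>. ln (?q (partial_product G \<xi>) (Y ?n \<xi>)) \<partial>S) = (\<integral>\<xi>. ln (pmf (P ?n) (Y ?n \<xi>)) + ln (D (Y ?n \<xi>) (\<beta> \<xi>)) \<partial>S)"
    using qm by (intro integral_cong_AE[OF _ _ lnq]) (auto simp del: partial_product.simps)
  also have "\<dots> = - ent (P ?n) + I ?n"
    using integrable_ln_pmf[of ?n] integrable_ln_D[of ?n] unfolding I_def by (simp del: partial_product.simps)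
  finally have eq: "(\<integral>\<xi>. ln (F \<xi>) \<partial>S) = I ?n - inv.I ?n" using gi(5) by linarith
  have "0 \<le> (\<integral>\<xi>. ln (F \<xi>) \<partial>S)" unfolding eq I_linear inv.I_linear using le1 by (simp add: mult_left_mono)
  then have F1: "AE \<xi> in S. F \<xi> = 1"
    by (rule seq.P.expectation_ln_nonneg_imp_one[OF gi(1-4)])
  have "AE \<xi> in S. inv.D (Y ?n \<xi>) (partial_product G \<xi>) = D (Y ?n \<xi>) (\<beta> \<xi>)"
    using F1 inv.D_pos[of ?n] AE_Y[of ?n]
  proof eventually_elim
    fix \<xi> assume *: "F \<xi> = 1" "0 < inv.D (Y ?n \<xi>) (partial_product G \<xi>)" "Y ?n \<xi> \<in> set_pmf (P ?n)"
    then have "0 < pmf (P ?n) (Y ?n \<xi>)" by (simp only: pmf_positive)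
    with * show "inv.D (Y ?n \<xi>) (partial_product G \<xi>) = D (Y ?n \<xi>) (\<beta> \<xi>)"
      by (simp add: F_def divide_eq_1_iff del: partial_product.simps)
  qed
  then have int0: "(\<integral>\<^sup>+\<xi>. indicator {\<omega>. inv.D (Y ?n \<xi>) \<omega> \<noteq> D (Y ?n \<xi>) (b \<omega>)} (partial_product G \<xi>) \<partial>S) = (\<integral>\<^sup>+\<xi>. 0 \<partial>S)"
    by (intro nn_integral_cong_AE) (auto elim!: AE_mp simp del: partial_product.simps)
  have indm: "(indicator {\<omega>. inv.D y \<omega> \<noteq> D y (b \<omega>)} :: _ \<Rightarrow> ennreal) \<in> borel_measurable N0" for y
    by (rule borel_measurable_indicator', unfold pred_def mem_Collect_eq,
        rule borel_measurable_neq[OF inv.D_meas measurable_compose[OF bN0 D_meas]])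
  note int0
  moreover have "(\<integral>\<^sup>+\<xi>. indicator {\<omega>. inv.D (Y ?n \<xi>) \<omega> \<noteq> D (Y ?n \<xi>) (b \<omega>)} (partial_product G \<xi>) \<partial>S) =
    (\<integral>\<^sup>+y. \<integral>\<^sup>+\<omega>. ennreal (inv.D y \<omega>) * indicator {\<omega>. inv.D y \<omega> \<noteq> D y (b \<omega>)} \<omega> \<partial>N0 \<partial>measure_pmf (P ?n))"
    by (rule inv.nn_integral_joint_D[of "\<lambda>y. indicator {\<omega>. inv.D y \<omega> \<noteq> D y (b \<omega>)}" ?n]) (rule indm)
  ultimately have "(\<integral>\<^sup>+y. \<integral>\<^sup>+\<omega>. ennreal (inv.D y \<omega>) * indicator {\<omega>. inv.D y \<omega> \<noteq> D y (b \<omega>)} \<omega> \<partial>N0 \<partial>measure_pmf (P ?n)) = 0"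
    by simp
  then have "(\<integral>\<^sup>+\<omega>. ennreal (inv.D y \<omega>) * indicator {\<omega>. inv.D y \<omega> \<noteq> D y (b \<omega>)} \<omega> \<partial>N0) = 0"
    using y by (simp add: nn_integral_0_iff_AE AE_measure_pmf_iff del: walk_pmf.simps)
  then have "AE \<omega> in N0. ennreal (inv.D y \<omega>) * indicator {\<omega>. inv.D y \<omega> \<noteq> D y (b \<omega>)} \<omega> = 0"
    by (subst (asm) nn_integral_0_iff_AE[OF borel_measurable_times_ennreal[OF measurable_compose[OF inv.D_meas measurable_ennreal] indm[of y]]])
  \<comment> \<open>The exceptional set is null only after weighting by \<open>inv.D y\<close>, so
    where that density vanishes no more than an inequality is known. Both densities have total mass
    1, which upgrades it to equality.\<close>
  then have le: "AE \<omega> in N0. ennreal (inv.D y \<omega>) \<le> ennreal (D y (b \<omega>))"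
    by eventually_elim (auto simp: indicator_def split: if_splits)
  have "AE \<omega> in N0. ennreal (D y (b \<omega>)) \<le> ennreal (inv.D y \<omega>)"
  proof (rule ccontr)
    assume "\<not> ?thesis"
    then have "(\<integral>\<^sup>+\<omega>. ennreal (inv.D y \<omega>) \<partial>N0) < (\<integral>\<^sup>+\<omega>. ennreal (D y (b \<omega>)) \<partial>N0)"
      using le inv.nn_integral_D[OF y] by (intro nn_integral_less) auto
    then show False
      using inv.nn_integral_D[OF y] nn_integral_D[OF y] nnb[of "\<lambda>\<theta>. ennreal (D y \<theta>)"] by simp
  qed
  with le have eq: "AE \<omega> in N0. ennreal (inv.D y \<omega>) * indicator A \<omega> = indicator A \<omega> * ennreal (D y (b \<omega>))"
  proof eventually_elim
    fix \<omega> assume "ennreal (inv.D y \<omega>) \<le> ennreal (D y (b \<omega>))" "ennreal (D y (b \<omega>)) \<le> ennreal (inv.D y \<omega>)"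
    then have "ennreal (inv.D y \<omega>) = ennreal (D y (b \<omega>))" by (rule antisym)
    then show "ennreal (inv.D y \<omega>) * indicator A \<omega> = indicator A \<omega> * ennreal (D y (b \<omega>))"
      by (simp add: mult.commute)
  qed
  have [measurable]: "A \<in> sets N0" using A by simp
  have "(\<integral>\<^sup>+\<omega>. indicator A (path_translate G y \<omega>) \<partial>N0) = (\<integral>\<^sup>+\<omega>. ennreal (inv.D y \<omega>) * indicator A \<omega> \<partial>N0)"
    by (rule inv.nn_integral_act[OF y borel_measurable_indicator[OF \<open>A \<in> sets N0\<close>]])
  also have "\<dots> = (\<integral>\<^sup>+\<omega>. indicator A \<omega> * ennreal (D y (b \<omega>)) \<partial>N0)"
    by (rule nn_integral_cong_AE[OF eq])
  finally show ?thesis .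
qed

text \<open>For an invariant set \<open>A\<close> let \<open>f\<close> be its conditional
  probability given \<open>b\<close>. Conditioned on the first \<open>n\<close> increments, the
  indicator of \<open>A\<close> and \<open>f\<close> at the boundary point have the same mean,
  because the density of the position is a function of \<open>b\<close>. As this holds for all
  \<open>n\<close>, the two coincide almost surely, and \<open>A\<close> is a level set of
  \<open>f\<close> up to a null set.\<close>

theorem poisson_criterion:
  assumes binv: "b \<in> invariant_space G \<rightarrow>\<^sub>M N"
    and small: "\<And>\<epsilon>. 0 < \<epsilon> \<Longrightarrow> \<exists>n. ent (P (Suc n)) - I (Suc n) \<le> \<epsilon> * real (Suc n)"
  shows "eq_fields_mod (walk_law G \<mu>) {b -` A \<inter> space (path_space G) | A. A \<in> sets N} (sets (invariant_space G))"
proof -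
  interpret inv: boundary G \<mu> N0 "path_translate G" "\<lambda>\<omega>. \<omega>" by (rule inv_boundary[OF fin])
  interpret N: prob_space N by (rule prob_N)
  note binv[measurable]
  have bN0[measurable]: "b \<in> N0 \<rightarrow>\<^sub>M N" using binv by simp
  have dN: "distr N0 N b = N"
    using b_law by (subst distr_distr[OF binv]) (simp_all add: comp_def measurable_def[symmetric], use id_invariant in \<open>simp_all add: measurable_def\<close>)
  have main: "\<exists>B\<in>sets N. AE \<omega> in walk_law G \<mu>. \<omega> \<in> A \<longleftrightarrow> b \<omega> \<in> B" if A: "A \<in> sets (invariant_space G)" for A
  proof -
    have [measurable]: "A \<in> sets N0" using A by simp
    have Ap: "A \<in> sets (path_space G)" using A by (simp add: sets_invariant_space)
    \<comment> \<open>The density of this image of the law restricted to \<open>A\<close> is the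
      conditional probability of \<open>A\<close> given \<open>b\<close>.\<close>
    define mA where "mA = distr (density N0 (indicator A)) N b"
    have mA: "(\<integral>\<^sup>+\<theta>. f \<theta> \<partial>mA) = (\<integral>\<^sup>+\<omega>. indicator A \<omega> * f (b \<omega>) \<partial>N0)" if [measurable]: "f \<in> borel_measurable N" for f
    proof -
      have "(\<integral>\<^sup>+\<theta>. f \<theta> \<partial>mA) = (\<integral>\<^sup>+\<omega>. f (b \<omega>) \<partial>density N0 (indicator A))"
        unfolding mA_def by (rule nn_integral_distr) (use binv in \<open>simp_all add: measurable_def\<close>)
      also have "\<dots> = (\<integral>\<^sup>+\<omega>. indicator A \<omega> * f (b \<omega>) \<partial>N0)"
        by (rule nn_integral_density) measurable
      finally show ?thesis .
    qed
    have ac: "absolutely_continuous N mA"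
      unfolding absolutely_continuous_def
    proof
      fix B assume B: "B \<in> null_sets N"
      then have [measurable]: "B \<in> sets N" by auto
      have "emeasure mA B = (\<integral>\<^sup>+\<theta>. indicator B \<theta> \<partial>mA)" by (simp add: mA_def)
      also have "\<dots> = (\<integral>\<^sup>+\<omega>. indicator A \<omega> * indicator B (b \<omega>) \<partial>N0)" by (rule mA) simp
      also have "\<dots> \<le> (\<integral>\<^sup>+\<omega>. indicator B (b \<omega>) \<partial>N0)" by (intro nn_integral_mono) (auto split: split_indicator)
      also have "\<dots> = (\<integral>\<^sup>+\<theta>. indicator B \<theta> \<partial>distr N0 N b)" by (rule nn_integral_distr[symmetric]) simp_all
      also have "\<dots> = 0" using null_setsD1[OF B] unfolding dN by simp
      finally show "B \<in> null_sets mA" by (auto simp: null_sets_def mA_def)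
    qed
    define f where "f = RN_deriv N mA"
    have [measurable]: "f \<in> borel_measurable N" unfolding f_def by simp
    have mAf: "(\<integral>\<^sup>+\<theta>. g \<theta> \<partial>mA) = (\<integral>\<^sup>+\<theta>. f \<theta> * g \<theta> \<partial>N)" if "g \<in> borel_measurable N" for g
      unfolding f_def by (rule N.RN_deriv_nn_integral[OF ac _ that]) (simp add: mA_def)
    have key: "(\<integral>\<^sup>+\<omega>. indicator A (path_translate G y \<omega>) \<partial>N0) = (\<integral>\<^sup>+\<theta>. f (act y \<theta>) \<partial>N)" if y: "y \<in> set_pmf (P (Suc n))" for y n
    proof -
      have "(\<integral>\<^sup>+\<omega>. indicator A (path_translate G y \<omega>) \<partial>N0) = (\<integral>\<^sup>+\<omega>. indicator A \<omega> * ennreal (D y (b \<omega>)) \<partial>N0)"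
        by (rule nn_integral_translate_invariant[OF binv small y A])
      also have "\<dots> = (\<integral>\<^sup>+\<theta>. f \<theta> * ennreal (D y \<theta>) \<partial>N)"
        using mA[of "\<lambda>\<theta>. ennreal (D y \<theta>)"] mAf[of "\<lambda>\<theta>. ennreal (D y \<theta>)"] by simp
      also have "\<dots> = (\<integral>\<^sup>+\<theta>. f (act y \<theta>) \<partial>N)"
        by (simp add: nn_integral_act[OF y] mult.commute)
      finally show ?thesis .
    qed
    have "AE \<xi> in S. indicator A (partial_product G \<xi>) = f (\<beta> \<xi>)"
    proof (rule AE_eq_if_conditional_eq)
      show "(\<lambda>\<xi>. indicator A (partial_product G \<xi>) :: ennreal) \<in> borel_measurable S"
        using measurable_compose[OF measurable_W borel_measurable_indicator[OF Ap]] by simp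
      have "(\<integral>\<^sup>+\<xi>. indicator A (partial_product G \<xi>) \<partial>S) \<le> (\<integral>\<^sup>+\<xi>. 1 \<partial>S)" by (rule nn_integral_mono) (auto split: split_indicator)
      also have "\<dots> < \<infinity>" by (simp add: seq.P.emeasure_space_1)
      finally show "(\<integral>\<^sup>+\<xi>. indicator A (partial_product G \<xi>) \<partial>S) < \<infinity>" .
      fix n
      have gen: "AE \<omega> in S. (\<integral>\<^sup>+\<omega>'. indicator A (partial_product G (comb_seq n \<omega> \<omega>')) \<partial>S) = (\<integral>\<^sup>+\<eta>. indicator A (path_translate G (Y n \<omega>) \<eta>) \<partial>N0) \<and>
          (\<integral>\<^sup>+\<omega>'. f (\<beta> (comb_seq n \<omega> \<omega>')) \<partial>S) = (\<integral>\<^sup>+\<theta>. f (act (Y n \<omega>) \<theta>) \<partial>N)" for n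
      proof (rule AE_I2, rule conjI)
        fix \<omega> assume \<omega>: "\<omega> \<in> space S"
        have yc: "Y n \<omega> \<in> carrier G" by (rule Y_closed[OF \<omega>])
        have "(\<integral>\<^sup>+\<omega>'. indicator A (partial_product G (comb_seq n \<omega> \<omega>')) \<partial>S) = (\<integral>\<^sup>+\<omega>'. indicator A (path_translate G (Y n \<omega>) (partial_product G \<omega>')) \<partial>S)"
        proof (rule nn_integral_cong)
          fix \<omega>' assume "\<omega>' \<in> space S"
          then show "indicator A (partial_product G (comb_seq n \<omega> \<omega>')) = (indicator A (path_translate G (Y n \<omega>) (partial_product G \<omega>')) :: ennreal)"
            using inv.beta_translate[OF borel_measurable_indicator[OF \<open>A \<in> sets N0\<close>], of "comb_seq n \<omega> \<omega>'" n] comb_space[OF \<omega>, of \<omega>' n]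
            by (simp add: Y_comb advance_comb)
        qed
        also have "\<dots> = (\<integral>\<^sup>+\<omega>'. indicator A (path_translate G (Y n \<omega>) \<omega>') \<partial>N0)"
          by (rule inv.nn_integral_beta) (rule measurable_compose[OF inv.act_meas[OF yc] borel_measurable_indicator[OF \<open>A \<in> sets N0\<close>]])
        finally show "(\<integral>\<^sup>+\<omega>'. indicator A (partial_product G (comb_seq n \<omega> \<omega>')) \<partial>S) = (\<integral>\<^sup>+\<eta>. indicator A (path_translate G (Y n \<omega>) \<eta>) \<partial>N0)" .
        have "(\<integral>\<^sup>+\<omega>'. f (\<beta> (comb_seq n \<omega> \<omega>')) \<partial>S) = (\<integral>\<^sup>+\<omega>'. f (b (path_translate G (Y n \<omega>) (partial_product G \<omega>'))) \<partial>S)"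
        proof (rule nn_integral_cong)
          fix \<omega>' assume "\<omega>' \<in> space S"
          then show "f (\<beta> (comb_seq n \<omega> \<omega>')) = f (b (path_translate G (Y n \<omega>) (partial_product G \<omega>')))"
            using beta_translate[of f "comb_seq n \<omega> \<omega>'" n] comb_space[OF \<omega>, of \<omega>' n]
            by (simp add: Y_comb advance_comb)
        qed
        also have "\<dots> = (\<integral>\<^sup>+\<omega>'. f (act (Y n \<omega>) (\<beta> \<omega>')) \<partial>S)"
          by (rule nn_integral_cong_AE) (use AE_walk_law[OF b_equiv[OF yc]] in \<open>auto elim!: AE_mp\<close>)
        also have "\<dots> = (\<integral>\<^sup>+\<theta>. f (act (Y n \<omega>) \<theta>) \<partial>N)"
          by (rule nn_integral_beta) (rule measurable_compose[OF act_meas[OF yc]], simp)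
        finally show "(\<integral>\<^sup>+\<omega>'. f (\<beta> (comb_seq n \<omega> \<omega>')) \<partial>S) = (\<integral>\<^sup>+\<theta>. f (act (Y n \<omega>) \<theta>) \<partial>N)" .
      qed
      have 1: "AE \<omega> in S. (\<integral>\<^sup>+\<omega>'. indicator A (partial_product G (comb_seq (Suc n) \<omega> \<omega>')) \<partial>S) = (\<integral>\<^sup>+\<omega>'. f (\<beta> (comb_seq (Suc n) \<omega> \<omega>')) \<partial>S)" for n
        using gen[of "Suc n"] AE_Y[of "Suc n"]
        by eventually_elim (simp add: key del: partial_product.simps walk_pmf.simps)
      show "AE \<omega> in S. (\<integral>\<^sup>+\<omega>'. indicator A (partial_product G (comb_seq n \<omega> \<omega>')) \<partial>S) = (\<integral>\<^sup>+\<omega>'. f (\<beta> (comb_seq n \<omega> \<omega>')) \<partial>S)"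
      proof (cases n)
        \<comment> \<open>\<open>key\<close> is available only at positive times; the means over the
          whole space follow by averaging the case \<open>Suc 0\<close>.\<close>
        case 0
        let ?h = "\<lambda>\<xi>. indicator A (partial_product G \<xi>) :: ennreal"
        have hm: "?h \<in> borel_measurable S" by fact
        have c0: "comb_seq 0 \<omega> \<omega>' = \<omega>'" for \<omega> \<omega>' :: "nat \<Rightarrow> 'a" by (auto simp: comb_seq_def)
        have "(\<integral>\<^sup>+\<xi>. ?h \<xi> \<partial>S) = (\<integral>\<^sup>+\<xi>. f (\<beta> \<xi>) \<partial>S)"
          unfolding nn_integral_comb[OF hm, of "Suc 0"] nn_integral_comb[OF measurable_compose[OF beta_meas \<open>f \<in> borel_measurable N\<close>], of "Suc 0"]
          by (rule nn_integral_cong_AE) (rule 1)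
        then show ?thesis by (simp add: 0 c0)
      qed (use 1 in simp)
    qed simp
    then have "AE \<xi> in S. partial_product G \<xi> \<in> A \<longleftrightarrow> f (\<beta> \<xi>) = 1"
      by eventually_elim (auto simp: indicator_def split: if_splits)
    then have S: "AE \<xi> in S. partial_product G \<xi> \<in> A \<longleftrightarrow> \<beta> \<xi> \<in> {\<theta> \<in> space N. f \<theta> = 1}"
      using AE_space[of S] by eventually_elim (use beta_space in blast)
    have B: "{\<theta> \<in> space N. f \<theta> = 1} \<in> sets N" by measurable
    show ?thesis
    proof (rule bexI[OF _ B])
      have "{\<omega> \<in> space (path_space G). \<omega> \<in> A \<longleftrightarrow> b \<omega> \<in> {\<theta> \<in> space N. f \<theta> = 1}} \<in> sets (path_space G)"
        using Ap B by measurable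
      then show "AE \<omega> in walk_law G \<mu>. \<omega> \<in> A \<longleftrightarrow> b \<omega> \<in> {\<theta> \<in> space N. f \<theta> = 1}"
        unfolding walk_law_eq by (subst AE_distr_iff[OF measurable_W]) (use S in auto)
    qed
  qed
  let ?P = "walk_law G \<mu>" and ?\<B> = "{b -` A \<inter> space (path_space G) | A. A \<in> sets N}" and ?\<I> = "sets (invariant_space G)"
  have sub: "?\<B> \<subseteq> ?\<I>"
    using measurable_sets[OF binv] by (auto simp: space_invariant_space)
  have pow: "?\<I> \<union> null_sets (completion ?P) \<subseteq> Pow (space ?P)"
  proof -
    have "?\<I> \<subseteq> Pow (space ?P)" using sets.sets_into_space[of _ "invariant_space G"] by (auto simp: space_invariant_space)
    moreover have "null_sets (completion ?P) \<subseteq> Pow (space ?P)"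
      using sets.sets_into_space[of _ "completion ?P"] by (fastforce simp: null_sets_def)
    ultimately show ?thesis by blast
  qed
  show ?thesis
    unfolding eq_fields_mod_def completed_field_def
  proof (rule subset_antisym)
    show "sigma_sets (space ?P) (?\<B> \<union> null_sets (completion ?P)) \<subseteq> sigma_sets (space ?P) (?\<I> \<union> null_sets (completion ?P))"
      using sub by (intro sigma_sets_mono') blast
    have pow': "?\<B> \<union> null_sets (completion ?P) \<subseteq> Pow (space ?P)" using sub pow by blast
    interpret sa: sigma_algebra "space ?P" "sigma_sets (space ?P) (?\<B> \<union> null_sets (completion ?P))"
      by (rule sigma_algebra_sigma_sets[OF pow'])
    show "sigma_sets (space ?P) (?\<I> \<union> null_sets (completion ?P)) \<subseteq> sigma_sets (space ?P) (?\<B> \<union> null_sets (completion ?P))"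
    proof (rule sigma_sets_mono, rule subsetI)
      fix A assume "A \<in> ?\<I> \<union> null_sets (completion ?P)"
      then show "A \<in> sigma_sets (space ?P) (?\<B> \<union> null_sets (completion ?P))"
      proof
        assume A: "A \<in> ?\<I>"
        then have Ap: "A \<in> sets ?P" by (simp add: sets_invariant_space)
        obtain B where B: "B \<in> sets N" "AE \<omega> in ?P. \<omega> \<in> A \<longleftrightarrow> b \<omega> \<in> B" using main[OF A] by blast
        define A' where "A' = b -` B \<inter> space (path_space G)"
        have A': "A' \<in> sets ?P" unfolding A'_def using measurable_sets[OF b_meas B(1)] by simp
        have nul: "A - A' \<in> null_sets ?P" "A' - A \<in> null_sets ?P"
        proof -
          have ae: "AE \<omega> in ?P. \<omega> \<notin> A - A'" "AE \<omega> in ?P. \<omega> \<notin> A' - A"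
            using B(2) AE_space[of ?P] by (eventually_elim, simp add: A'_def)+
          show "A - A' \<in> null_sets ?P" "A' - A \<in> null_sets ?P"
            by (rule AE_iff_null_sets[THEN iffD2, OF sets.Diff[OF Ap A'] ae(1)])
              (rule AE_iff_null_sets[THEN iffD2, OF sets.Diff[OF A' Ap] ae(2)])
        qed
        have s1: "A' \<in> sigma_sets (space ?P) (?\<B> \<union> null_sets (completion ?P))"
          unfolding A'_def using B(1) by (intro sigma_sets.Basic) blast
        have s2: "A - A' \<in> sigma_sets (space ?P) (?\<B> \<union> null_sets (completion ?P))"
          "A' - A \<in> sigma_sets (space ?P) (?\<B> \<union> null_sets (completion ?P))"
          using nul by (auto intro!: sigma_sets.Basic null_sets_completionI)
        have "(A' \<union> (A - A')) - (A' - A) \<in> sigma_sets (space ?P) (?\<B> \<union> null_sets (completion ?P))"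
          by (rule sa.Diff[OF sa.Un[OF s1 s2(1)] s2(2)])
        moreover have "(A' \<union> (A - A')) - (A' - A) = A" by blast
        ultimately show ?thesis by simp
      qed (auto intro: sigma_sets.Basic)
    qed
  qed
qed

end

section \<open>Walks on wreath products\<close>

text \<open>Every element is the value of a finite word over the generators and their inverses.
  Applied to the support of \<mu>, it makes the wreath product countable, and with it the base
  group.\<close>

lemma (in group) countable_generate:
  assumes S: "S \<subseteq> carrier G" "countable S"
  shows "countable (generate G S)"
proof -
  let ?T = "S \<union> m_inv G ` S"
  define pr where "pr w = foldr (\<otimes>) w \<one>" for w
  have T: "?T \<subseteq> carrier G" using S by auto
  have prc: "pr w \<in> carrier G" if "set w \<subseteq> ?T" for w
    using that T by (induction w) (auto simp: pr_def)
  have app: "pr (v @ w) = pr v \<otimes> pr w" if "set v \<subseteq> ?T" "set w \<subseteq> ?T" for v w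
    using that
  proof (induction v)
    case Nil
    then show ?case using prc by (simp add: pr_def)
  next
    case (Cons a v)
    then have "a \<in> carrier G" "pr v \<in> carrier G" "pr w \<in> carrier G" using T prc by auto
    moreover have "pr (v @ w) = pr v \<otimes> pr w" using Cons by auto
    ultimately show ?case by (simp add: pr_def m_assoc)
  qed
  have "generate G S \<subseteq> pr ` {w. set w \<subseteq> ?T}"
  proof
    fix g assume "g \<in> generate G S"
    then show "g \<in> pr ` {w. set w \<subseteq> ?T}"
    proof induction
      case one
      show ?case by (rule image_eqI[of _ _ "[]"]) (auto simp: pr_def)
    next
      case (incl h)
      then show ?case using S by (intro image_eqI[of _ _ "[h]"]) (auto simp: pr_def)
    next
      case (inv h)
      then show ?case using S by (intro image_eqI[of _ _ "[inv h]"]) (auto simp: pr_def)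
    next
      case (eng h1 h2)
      then obtain v w where "h1 = pr v" "set v \<subseteq> ?T" "h2 = pr w" "set w \<subseteq> ?T" by auto
      then show ?case using app by (intro image_eqI[of _ _ "v @ w"]) auto
    qed
  qed
  moreover have "countable {w. set w \<subseteq> ?T}"
    using countable_lists[of ?T] S by (simp add: lists_eq_set)
  ultimately show ?thesis by (meson countable_image countable_subset)
qed

section \<open>The walk on the wreath product and its projection\<close>

locale lamplighter =
  fixes L :: "('l, 'm) monoid_scheme" and \<Lambda> :: "('g, 'n) monoid_scheme"
    and \<mu> :: "(('g \<Rightarrow> 'l) \<times> 'g) pmf"
  assumes L_group: "group L" and L_finite: "finite (carrier L)" and L_nontriv: "carrier L \<noteq> {\<one>\<^bsub>L\<^esub>}"
    and \<Lambda>_group: "group \<Lambda>" and \<Lambda>_infinite: "infinite (carrier \<Lambda>)"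
    and supp_\<mu>: "set_pmf \<mu> \<subseteq> carrier (wreath L \<Lambda>)"
    and fin_\<mu>: "fin_ent \<mu>"
    and blr: "bounded_lamp_range L \<Lambda> \<mu>"
    and gen: "generate (wreath L \<Lambda>) (set_pmf \<mu>) = carrier (wreath L \<Lambda>)"
    and trans: "transient_walk \<Lambda> (map_pmf snd \<mu>)"
begin

abbreviation "\<Gamma> \<equiv> wreath L \<Lambda>"
abbreviation "\<mu>b \<equiv> map_pmf snd \<mu>"

lemma \<Gamma>_group: "group \<Gamma>" by (rule wreath_group[OF L_group \<Lambda>_group])

lemma carrier_\<Gamma>: "carrier \<Gamma> = {\<Phi> \<in> carrier \<Lambda> \<rightarrow>\<^sub>E carrier L. finite {z \<in> carrier \<Lambda>. \<Phi> z \<noteq> \<one>\<^bsub>L\<^esub>}} \<times> carrier \<Lambda>"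
  by (simp add: wreath_def)

lemma snd_\<Gamma>: "g \<in> carrier \<Gamma> \<Longrightarrow> snd g \<in> carrier \<Lambda>"
  and fst_\<Gamma>: "g \<in> carrier \<Gamma> \<Longrightarrow> fst g \<in> carrier \<Lambda> \<rightarrow>\<^sub>E carrier L"
  by (auto simp: carrier_\<Gamma>)

lemma mult_\<Gamma>: "g \<otimes>\<^bsub>\<Gamma>\<^esub> h = (lamp_mult L \<Lambda> (fst g) (lamp_translate \<Lambda> (snd g) (fst h)), snd g \<otimes>\<^bsub>\<Lambda>\<^esub> snd h)"
  by (simp add: wreath_def case_prod_beta')

lemma one_\<Gamma>: "\<one>\<^bsub>\<Gamma>\<^esub> = (lamp_id L \<Lambda>, \<one>\<^bsub>\<Lambda>\<^esub>)"
  by (simp add: wreath_def)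

end

sublocale lamplighter \<subseteq> LL: group L by (rule L_group)
sublocale lamplighter \<subseteq> GL: group \<Lambda> by (rule \<Lambda>_group)
sublocale lamplighter \<subseteq> w: countable_walk "wreath L \<Lambda>" \<mu>
  by (intro countable_walk.intro group_walk.intro group_walk_axioms.intro countable_walk_axioms.intro \<Gamma>_group supp_\<mu>)
    (use group.countable_generate[OF \<Gamma>_group supp_\<mu>] gen in simp)

context lamplighter
begin

lemma id_lamp_in: "(lamp_id L \<Lambda>, z) \<in> carrier \<Gamma> \<longleftrightarrow> z \<in> carrier \<Lambda>"
  by (auto simp: carrier_\<Gamma> lamp_id_def)

lemma countable_\<Lambda>: "countable (carrier \<Lambda>)"
proof -
  have "carrier \<Lambda> \<subseteq> snd ` carrier \<Gamma>"
  proof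
    fix z assume "z \<in> carrier \<Lambda>"
    then show "z \<in> snd ` carrier \<Gamma>" by (intro image_eqI[of _ _ "(lamp_id L \<Lambda>, z)"]) (auto simp: id_lamp_in)
  qed
  then show ?thesis using w.countable_carrier by (meson countable_image countable_subset)
qed

lemma supp_\<mu>b: "set_pmf \<mu>b \<subseteq> carrier \<Lambda>" using supp_\<mu> by (auto simp: carrier_\<Gamma>)

end

sublocale lamplighter \<subseteq> bs: countable_walk \<Lambda> "map_pmf snd \<mu>"
  by (intro countable_walk.intro group_walk.intro group_walk_axioms.intro countable_walk_axioms.intro \<Lambda>_group supp_\<mu>b countable_\<Lambda>)

context lamplighter
begin

lemma fin_\<mu>b: "fin_ent \<mu>b" by (rule fin_ent_map[OF fin_\<mu>])

abbreviation "X n \<xi> \<equiv> snd (w.Y n \<xi>)"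
abbreviation "\<Phi> n \<xi> \<equiv> fst (w.Y n \<xi>)"

lemma X_closed: "\<xi> \<in> space w.S \<Longrightarrow> X n \<xi> \<in> carrier \<Lambda>"
  using w.Y_closed[of \<xi> n] by (auto simp: carrier_\<Gamma>)

lemma \<Phi>_closed: "\<xi> \<in> space w.S \<Longrightarrow> \<Phi> n \<xi> \<in> carrier \<Lambda> \<rightarrow>\<^sub>E carrier L"
  using w.Y_closed[of \<xi> n] by (auto simp: carrier_\<Gamma>)

lemma X_base: "X n \<xi> = bs.Y n (\<lambda>i. snd (\<xi> i))"
  by (induction n) (auto simp: one_\<Gamma> mult_\<Gamma>)

lemma walk_snd: "map_pmf snd (w.P n) = bs.P n"
proof (induction n)
  case (Suc n)
  have "map_pmf snd (w.P (Suc n)) = conv_pmf \<Lambda> (map_pmf snd (w.P n)) \<mu>b"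
    by (simp add: conv_pmf_def map_pmf_comp map_pair[symmetric] mult_\<Gamma> case_prod_beta')
  then show ?case using Suc by simp
qed (simp add: one_\<Gamma>)

lemma X_add: "\<xi> \<in> space w.S \<Longrightarrow> X (n + j) \<xi> = X n \<xi> \<otimes>\<^bsub>\<Lambda>\<^esub> X j (w.advance n \<xi>)"
  using w.Y_shift[of \<xi> n j] by (simp add: mult_\<Gamma>)

lemma base_path_meas: "(\<lambda>\<xi> i. snd (\<xi> i)) \<in> w.S \<rightarrow>\<^sub>M bs.S"
proof (rule measurable_PiM_single')
  fix i
  show "(\<lambda>\<xi>. snd (\<xi> i)) \<in> w.S \<rightarrow>\<^sub>M bs.R"
    by (rule measurable_compose[OF w.measurable_coord])
      (auto simp: measurable_def bs.space_R bs.sets_R carrier_\<Gamma>)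
qed (auto simp: space_PiM PiE_iff w.space_R bs.space_R intro: snd_\<Gamma>)

text \<open>Almost sure facts on the base walk, namely transience and convergence of harmonic
  functions, are pulled back to the wreath product through this identity.\<close>

lemma base_path_law: "distr w.S bs.S (\<lambda>\<xi> i. snd (\<xi> i)) = bs.S"
proof (rule bs.seq.PiM_eq)
  fix J and F :: "nat \<Rightarrow> 'g set"
  assume J: "finite J" "J \<subseteq> UNIV" and F: "\<And>j. j \<in> J \<Longrightarrow> F j \<in> sets bs.R"
  let ?F = "\<lambda>j. snd -` F j \<inter> carrier \<Gamma>"
  have Fs: "F j \<subseteq> carrier \<Lambda>" if "j \<in> J" for j using F[OF that] by (simp add: bs.sets_R)
  have E: "prod_emb UNIV (\<lambda>_. bs.R) J (Pi\<^sub>E J F) \<in> sets bs.S" using J F by (intro sets_PiM_I) auto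
  have "emeasure (distr w.S bs.S (\<lambda>\<xi> i. snd (\<xi> i))) (prod_emb UNIV (\<lambda>_. bs.R) J (Pi\<^sub>E J F)) =
    emeasure w.S ((\<lambda>\<xi> i. snd (\<xi> i)) -` prod_emb UNIV (\<lambda>_. bs.R) J (Pi\<^sub>E J F) \<inter> space w.S)"
    by (rule emeasure_distr[OF base_path_meas E])
  also have "(\<lambda>\<xi> i. snd (\<xi> i)) -` prod_emb UNIV (\<lambda>_. bs.R) J (Pi\<^sub>E J F) \<inter> space w.S = prod_emb UNIV (\<lambda>_. w.R) J (Pi\<^sub>E J ?F)"
    by (auto simp: prod_emb_def space_PiM PiE_iff w.space_R bs.space_R intro: snd_\<Gamma>)
  also have "emeasure w.S (prod_emb UNIV (\<lambda>_. w.R) J (Pi\<^sub>E J ?F)) = (\<Prod>j\<in>J. emeasure w.R (?F j))"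
    using J by (intro w.seq.emeasure_PiM_emb) (auto simp: w.sets_R)
  also have "\<dots> = (\<Prod>j\<in>J. emeasure bs.R (F j))"
  proof (rule prod.cong[OF refl])
    fix j assume j: "j \<in> J"
    have "emeasure w.R (?F j) = emeasure \<mu> (?F j)"
      unfolding w.R_def by (subst emeasure_restrict_space) auto
    also have "\<dots> = emeasure \<mu> (snd -` F j)"
      by (rule emeasure_eq_AE) (use supp_\<mu> in \<open>auto simp: AE_measure_pmf_iff\<close>)
    also have "\<dots> = emeasure bs.R (F j)"
      unfolding bs.R_def using Fs[OF j] by (subst emeasure_restrict_space) auto
    finally show "emeasure w.R (?F j) = emeasure bs.R (F j)" .
  qed
  finally show "emeasure (distr w.S bs.S (\<lambda>\<xi> i. snd (\<xi> i))) (prod_emb UNIV (\<lambda>_. bs.R) J (Pi\<^sub>E J F)) = (\<Prod>j\<in>J. emeasure bs.R (F j))" .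
qed simp

lemma AE_returns: "AE \<xi> in w.S. finite {n. X n \<xi> = \<one>\<^bsub>\<Lambda>\<^esub>}"
proof -
  have "AE \<eta> in bs.S. finite {n. bs.Y n \<eta> = \<one>\<^bsub>\<Lambda>\<^esub>}"
    using bs.AE_walk_law trans unfolding transient_walk_def by fast
  then have "AE \<eta> in distr w.S bs.S (\<lambda>\<xi> i. snd (\<xi> i)). finite {n. bs.Y n \<eta> = \<one>\<^bsub>\<Lambda>\<^esub>}"
    by (simp only: base_path_law)
  from AE_distrD[OF base_path_meas this] show ?thesis by (simp only: X_base)
qed

section \<open>Lamp range, finitely many visits, and stabilisation of the lamps\<close>

definition B :: "'g set" where
  "B = {x \<in> carrier \<Lambda>. \<exists>(\<Phi>, y) \<in> carrier \<Gamma>. pmf \<mu> (\<Phi>, y) > 0 \<and> \<Phi> x \<noteq> \<one>\<^bsub>L\<^esub>}"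

lemma finite_B: "finite B" using blr unfolding B_def bounded_lamp_range_def .

lemma B_carrier: "B \<subseteq> carrier \<Lambda>" by (auto simp: B_def)

lemma in_B: "g \<in> set_pmf \<mu> \<Longrightarrow> x \<in> carrier \<Lambda> \<Longrightarrow> fst g x \<noteq> \<one>\<^bsub>L\<^esub> \<Longrightarrow> x \<in> B"
  using supp_\<mu> by (auto simp: B_def set_pmf_iff intro!: bexI[of _ g] split: prod.split)

text \<open>Gathers the almost sure properties of a path once and for all, so that the arguments
  about visits and lamps become deterministic.\<close>

definition good :: "(nat \<Rightarrow> ('g \<Rightarrow> 'l) \<times> 'g) \<Rightarrow> bool" where
  "good \<xi> \<longleftrightarrow> \<xi> \<in> space w.S \<and> (\<forall>i. \<xi> i \<in> set_pmf \<mu>) \<and> (\<forall>q\<in>carrier \<Lambda>. finite {n. X n \<xi> = q})"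

text \<open>Transience speaks of returns to the identity. From a visit to \<open>q\<close> at time
  \<open>s\<close> on, further visits to \<open>q\<close> are returns to the identity of the walk
  restarted at \<open>s\<close>, and there are only countably many \<open>s\<close>.\<close>

lemma AE_good: "AE \<xi> in w.S. good \<xi>"
proof -
  have 1: "AE \<xi> in w.S. \<xi> i \<in> set_pmf \<mu>" for i
  proof -
    have "AE \<xi> in w.S. w.Y 1 (w.advance i \<xi>) \<in> set_pmf (w.P 1)" by (rule w.AE_advance[OF w.AE_Y])
    then show ?thesis using AE_space[of w.S]
    proof eventually_elim
      fix \<xi> assume *: "w.Y 1 (w.advance i \<xi>) \<in> set_pmf (w.P 1)" "\<xi> \<in> space w.S"
      have "w.Y 1 (w.advance i \<xi>) = \<xi> i" using *(2) by (simp add: w.advance_def w.space_S)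
      then show "\<xi> i \<in> set_pmf \<mu>" using * w.walk_1 by (simp only: One_nat_def)
    qed
  qed
  have "AE \<xi> in w.S. \<forall>s. finite {n. X n (w.advance s \<xi>) = \<one>\<^bsub>\<Lambda>\<^esub>}"
    by (simp add: AE_all_countable w.AE_advance[OF AE_returns])
  moreover have "AE \<xi> in w.S. \<forall>i. \<xi> i \<in> set_pmf \<mu>" using 1 by (simp add: AE_all_countable)
  ultimately show ?thesis using AE_space[of w.S]
  proof eventually_elim
    fix \<xi> assume f: "\<forall>s. finite {n. X n (w.advance s \<xi>) = \<one>\<^bsub>\<Lambda>\<^esub>}" and s: "\<forall>i. \<xi> i \<in> set_pmf \<mu>" and sp: "\<xi> \<in> space w.S"
    have "finite {n. X n \<xi> = q}" if q: "q \<in> carrier \<Lambda>" for q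
    proof (cases "{n. X n \<xi> = q} = {}")
      case False
      then obtain s where s: "X s \<xi> = q" by auto
      have "{n. X n \<xi> = q} \<subseteq> {..s} \<union> (+) s ` {n. X n (w.advance s \<xi>) = \<one>\<^bsub>\<Lambda>\<^esub>}"
      proof
        fix n assume "n \<in> {n. X n \<xi> = q}"
        then have n: "X n \<xi> = q" by simp
        show "n \<in> {..s} \<union> (+) s ` {n. X n (w.advance s \<xi>) = \<one>\<^bsub>\<Lambda>\<^esub>}"
        proof (cases "n \<le> s")
          case False
          then have nn: "n = s + (n - s)" by simp
          have "q \<otimes>\<^bsub>\<Lambda>\<^esub> X (n - s) (w.advance s \<xi>) = q" using X_add[OF sp, of s "n - s"] n s nn by simp
          then have "X (n - s) (w.advance s \<xi>) = \<one>\<^bsub>\<Lambda>\<^esub>"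
            using GL.l_cancel_one[OF q X_closed[OF w.advance_space[OF sp]]] by simp
          then show ?thesis using nn by auto
        qed simp
      qed
      then show ?thesis using f by (meson finite_Un finite_atMost finite_imageI finite_subset)
    qed simp
    then show "good \<xi>" using s sp by (simp add: good_def)
  qed
qed

text \<open>The set \<open>B\<close> is relative to the walker, so this says that the lamp at
  \<open>z\<close> comes within reach, switched or not. The event depends on the base walk
  only.\<close>

definition touched :: "nat \<Rightarrow> 'g \<Rightarrow> (nat \<Rightarrow> ('g \<Rightarrow> 'l) \<times> 'g) \<Rightarrow> bool" where
  "touched n z \<xi> \<longleftrightarrow> (\<exists>t\<ge>n. inv\<^bsub>\<Lambda>\<^esub> (X t \<xi>) \<otimes>\<^bsub>\<Lambda>\<^esub> z \<in> B)"

lemma \<Phi>_Suc: "z \<in> carrier \<Lambda> \<Longrightarrow> \<Phi> (Suc n) \<xi> z = \<Phi> n \<xi> z \<otimes>\<^bsub>L\<^esub> fst (\<xi> n) (inv\<^bsub>\<Lambda>\<^esub> (X n \<xi>) \<otimes>\<^bsub>\<Lambda>\<^esub> z)"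
  by (simp add: mult_\<Gamma> lamp_mult_def lamp_translate_def)

lemma \<Phi>_untouched_step:
  assumes g: "good \<xi>" and z: "z \<in> carrier \<Lambda>" and nB: "inv\<^bsub>\<Lambda>\<^esub> (X n \<xi>) \<otimes>\<^bsub>\<Lambda>\<^esub> z \<notin> B"
  shows "\<Phi> (Suc n) \<xi> z = \<Phi> n \<xi> z"
proof -
  have sp: "\<xi> \<in> space w.S" and s: "\<xi> n \<in> set_pmf \<mu>" using g by (auto simp: good_def)
  have "inv\<^bsub>\<Lambda>\<^esub> (X n \<xi>) \<otimes>\<^bsub>\<Lambda>\<^esub> z \<in> carrier \<Lambda>" using X_closed[OF sp] z by simp
  then have "fst (\<xi> n) (inv\<^bsub>\<Lambda>\<^esub> (X n \<xi>) \<otimes>\<^bsub>\<Lambda>\<^esub> z) = \<one>\<^bsub>L\<^esub>" using in_B[OF s] nB by blast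
  moreover have "\<Phi> n \<xi> z \<in> carrier L" using \<Phi>_closed[OF sp] z by (auto simp: PiE_iff)
  ultimately show ?thesis unfolding \<Phi>_Suc[OF z] by simp
qed

lemma \<Phi>_untouched:
  assumes g: "good \<xi>" and z: "z \<in> carrier \<Lambda>" and nt: "\<not> touched n z \<xi>"
  shows "\<Phi> (n + j) \<xi> z = \<Phi> n \<xi> z"
proof (induction j)
  case (Suc j)
  have "inv\<^bsub>\<Lambda>\<^esub> (X (n + j) \<xi>) \<otimes>\<^bsub>\<Lambda>\<^esub> z \<notin> B" using nt by (auto simp: touched_def)
  from \<Phi>_untouched_step[OF g z this] Suc show ?case by (simp del: partial_product.simps)
qed simp

lemma finite_touch:
  assumes g: "good \<xi>" and z: "z \<in> carrier \<Lambda>"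
  shows "finite {t. inv\<^bsub>\<Lambda>\<^esub> (X t \<xi>) \<otimes>\<^bsub>\<Lambda>\<^esub> z \<in> B}"
proof (rule finite_subset)
  have sp: "\<xi> \<in> space w.S" using g by (auto simp: good_def)
  show "{t. inv\<^bsub>\<Lambda>\<^esub> (X t \<xi>) \<otimes>\<^bsub>\<Lambda>\<^esub> z \<in> B} \<subseteq> (\<Union>b\<in>B. {t. X t \<xi> = z \<otimes>\<^bsub>\<Lambda>\<^esub> inv\<^bsub>\<Lambda>\<^esub> b})"
  proof
    fix t assume "t \<in> {t. inv\<^bsub>\<Lambda>\<^esub> (X t \<xi>) \<otimes>\<^bsub>\<Lambda>\<^esub> z \<in> B}"
    then have b: "inv\<^bsub>\<Lambda>\<^esub> (X t \<xi>) \<otimes>\<^bsub>\<Lambda>\<^esub> z \<in> B" by simp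
    have x: "X t \<xi> \<in> carrier \<Lambda>" by (rule X_closed[OF sp])
    have "X t \<xi> = z \<otimes>\<^bsub>\<Lambda>\<^esub> inv\<^bsub>\<Lambda>\<^esub> (inv\<^bsub>\<Lambda>\<^esub> (X t \<xi>) \<otimes>\<^bsub>\<Lambda>\<^esub> z)"
      using x z by (simp add: GL.inv_mult_group GL.m_assoc[symmetric])
    then show "t \<in> (\<Union>b\<in>B. {t. X t \<xi> = z \<otimes>\<^bsub>\<Lambda>\<^esub> inv\<^bsub>\<Lambda>\<^esub> b})" using b by blast
  qed
  show "finite (\<Union>b\<in>B. {t. X t \<xi> = z \<otimes>\<^bsub>\<Lambda>\<^esub> inv\<^bsub>\<Lambda>\<^esub> b})"
    using g finite_B B_carrier z by (auto simp: good_def)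
qed

lemma not_touched_eventually:
  assumes g: "good \<xi>" and z: "z \<in> carrier \<Lambda>"
  obtains n where "\<not> touched n z \<xi>"
proof -
  obtain n where "\<forall>t\<in>{t. inv\<^bsub>\<Lambda>\<^esub> (X t \<xi>) \<otimes>\<^bsub>\<Lambda>\<^esub> z \<in> B}. t < n"
    using finite_touch[OF g z] finite_nat_set_iff_bounded by auto
  then have "\<not> touched n z \<xi>" by (auto simp: touched_def not_less[symmetric])
  then show ?thesis by (rule that)
qed

section \<open>The limiting configuration as a measurable, shift invariant map\<close>

abbreviation "W \<equiv> partial_product \<Gamma>"
abbreviation "lim_lamps \<equiv> limit_lamps L \<Lambda>"

lemma ev_untouched:
  assumes g: "good \<xi>" and z: "z \<in> carrier \<Lambda>" and nt: "\<not> touched n z \<xi>"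
  shows "\<forall>\<^sub>F t in sequentially. fst (W \<xi> t) z = \<Phi> n \<xi> z"
  unfolding eventually_sequentially
  using \<Phi>_untouched[OF g z nt] by (metis le_add_diff_inverse)

lemma good_converge: "good \<xi> \<Longrightarrow> lamps_converge \<Lambda> (W \<xi>)"
  unfolding lamps_converge_def using ev_untouched not_touched_eventually by metis

lemma ev_unique:
  assumes "\<forall>\<^sub>F t in sequentially. f t = (a::'x)" "\<forall>\<^sub>F t in sequentially. f t = b" shows "a = b"
proof -
  have "\<forall>\<^sub>F t in sequentially. a = b" using assms by eventually_elim simp
  then show ?thesis by simp
qed

lemma limit_lamps_eqI:
  assumes c: "lamps_converge \<Lambda> \<omega>" and z: "z \<in> carrier \<Lambda>" and e: "\<forall>\<^sub>F t in sequentially. fst (\<omega> t) z = l"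
  shows "lim_lamps \<omega> z = l"
proof -
  have "(THE l. \<forall>\<^sub>F n in sequentially. fst (\<omega> n) z = l) = l"
    by (rule the_equality[where P = "\<lambda>l. \<forall>\<^sub>F n in sequentially. fst (\<omega> n) z = l", OF e]) (rule ev_unique[OF _ e])
  then show ?thesis using c z by (simp add: limit_lamps_def)
qed

lemma limit_untouched:
  assumes "good \<xi>" "z \<in> carrier \<Lambda>" "\<not> touched n z \<xi>"
  shows "lim_lamps (W \<xi>) z = \<Phi> n \<xi> z"
  by (rule limit_lamps_eqI[OF good_converge[OF assms(1)] assms(2) ev_untouched[OF assms]])

abbreviation "NN \<equiv> PiM (carrier \<Lambda>) (\<lambda>_. count_space (carrier L))"

lemma limit_ev:
  assumes c: "lamps_converge \<Lambda> \<omega>" and z: "z \<in> carrier \<Lambda>"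
  shows "\<forall>\<^sub>F t in sequentially. fst (\<omega> t) z = lim_lamps \<omega> z"
proof -
  obtain l where "\<forall>\<^sub>F t in sequentially. fst (\<omega> t) z = l" using c z by (auto simp: lamps_converge_def)
  with limit_lamps_eqI[OF c z this] show ?thesis by simp
qed

lemma path_in: "\<omega> \<in> space (path_space \<Gamma>) \<Longrightarrow> z \<in> carrier \<Lambda> \<Longrightarrow> fst (\<omega> n) z \<in> carrier L"
  using fst_\<Gamma>[of "\<omega> n"] by (auto simp: space_path_space PiE_iff)

lemma limit_in:
  assumes \<omega>: "\<omega> \<in> space (path_space \<Gamma>)"
  shows "lim_lamps \<omega> \<in> carrier \<Lambda> \<rightarrow>\<^sub>E carrier L"
proof (rule PiE_I)
  fix z assume z: "z \<in> carrier \<Lambda>"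
  show "lim_lamps \<omega> z \<in> carrier L"
  proof (cases "lamps_converge \<Lambda> \<omega>")
    case True
    from limit_ev[OF True z] obtain t where "fst (\<omega> t) z = lim_lamps \<omega> z" by (auto simp: eventually_sequentially)
    then show ?thesis using path_in[OF \<omega> z, of t] by simp
  qed (use z in \<open>simp add: limit_lamps_def lamp_id_def\<close>)
qed (simp add: limit_lamps_def lamp_id_def)

lemma limit_shift: "lim_lamps (path_shift \<omega>) = lim_lamps \<omega>" "lamps_converge \<Lambda> (path_shift \<omega>) = lamps_converge \<Lambda> \<omega>"
proof -
  have e: "(\<forall>\<^sub>F n in sequentially. fst (path_shift \<omega> n) z = l) \<longleftrightarrow> (\<forall>\<^sub>F n in sequentially. fst (\<omega> n) z = l)" for z l
    unfolding path_shift_def by (rule eventually_sequentially_Suc)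
  show "lim_lamps (path_shift \<omega>) = lim_lamps \<omega>" "lamps_converge \<Lambda> (path_shift \<omega>) = lamps_converge \<Lambda> \<omega>"
    by (simp_all only: limit_lamps_def lamps_converge_def e)
qed

lemma conv_meas: "Measurable.pred (path_space \<Gamma>) (lamps_converge \<Lambda>)"
  and ev_meas: "z \<in> carrier \<Lambda> \<Longrightarrow> Measurable.pred (path_space \<Gamma>) (\<lambda>\<omega>. \<forall>\<^sub>F n in sequentially. fst (\<omega> n) z = l)"
proof -
  have c: "Measurable.pred (path_space \<Gamma>) (\<lambda>\<omega>. Q (\<omega> n))" for Q n
    by (rule measurable_compose[OF w.measurable_path_coord]) simp
  show ev: "Measurable.pred (path_space \<Gamma>) (\<lambda>\<omega>. \<forall>\<^sub>F n in sequentially. fst (\<omega> n) z = l)" for z l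
  proof -
    have [measurable]: "Measurable.pred (path_space \<Gamma>) (\<lambda>\<omega>. fst (\<omega> n) z = l)" for n
      by (rule c)
    have "Measurable.pred (path_space \<Gamma>) (\<lambda>\<omega>. \<exists>N. \<forall>n. N \<le> n \<longrightarrow> fst (\<omega> n) z = l)"
      by measurable
    then show ?thesis by (simp add: eventually_sequentially)
  qed
  \<comment> \<open>Confining the limit value to the finite \<open>carrier L\<close> makes the
    existential quantifier harmless for measurability; on the path space no limit value is
    lost.\<close>
  have "Measurable.pred (path_space \<Gamma>) (\<lambda>\<omega>. \<forall>z\<in>carrier \<Lambda>. \<exists>l\<in>carrier L. \<forall>\<^sub>F n in sequentially. fst (\<omega> n) z = l)"
    by (rule measurable_pred_countable(1)[OF countable_\<Lambda>], rule pred_intros_finite(4)[OF L_finite], rule ev)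
  then show "Measurable.pred (path_space \<Gamma>) (lamps_converge \<Lambda>)"
  proof (rule measurable_cong[THEN iffD1, rotated])
    fix \<omega> assume \<omega>: "\<omega> \<in> space (path_space \<Gamma>)"
    have "l \<in> carrier L" if "\<forall>\<^sub>F n in sequentially. fst (\<omega> n) z = l" "z \<in> carrier \<Lambda>" for z l
      using that path_in[OF \<omega> that(2)] by (auto simp: eventually_sequentially)
    then show "(\<forall>z\<in>carrier \<Lambda>. \<exists>l\<in>carrier L. \<forall>\<^sub>F n in sequentially. fst (\<omega> n) z = l) = lamps_converge \<Lambda> \<omega>"
      unfolding lamps_converge_def by blast
  qed
qed

lemma limit_meas: "lim_lamps \<in> path_space \<Gamma> \<rightarrow>\<^sub>M NN"
proof -
  have comp: "(\<lambda>\<omega>. lim_lamps \<omega> z) \<in> path_space \<Gamma> \<rightarrow>\<^sub>M count_space (carrier L)" if z: "z \<in> carrier \<Lambda>" for z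
  proof (rule measurable_count_space_eq2[THEN iffD2, OF L_finite], intro conjI ballI)
    show "(\<lambda>\<omega>. lim_lamps \<omega> z) \<in> space (path_space \<Gamma>) \<rightarrow> carrier L" using limit_in z by (auto simp: PiE_iff)
    fix l assume "l \<in> carrier L"
    have "(\<lambda>\<omega>. lim_lamps \<omega> z) -` {l} \<inter> space (path_space \<Gamma>) =
      {\<omega> \<in> space (path_space \<Gamma>). (lamps_converge \<Lambda> \<omega> \<and> (\<forall>\<^sub>F n in sequentially. fst (\<omega> n) z = l)) \<or> (\<not> lamps_converge \<Lambda> \<omega> \<and> l = \<one>\<^bsub>L\<^esub>)}"
      using limit_ev[OF _ z] limit_lamps_eqI[OF _ z] z by (auto simp: limit_lamps_def[of L \<Lambda>] lamp_id_def split: if_splits)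
    also have "\<dots> \<in> sets (path_space \<Gamma>)"
      using conv_meas ev_meas[OF z] by measurable
    finally show "(\<lambda>\<omega>. lim_lamps \<omega> z) -` {l} \<inter> space (path_space \<Gamma>) \<in> sets (path_space \<Gamma>)" .
  qed
  have "(\<lambda>\<omega> z. lim_lamps \<omega> z) \<in> path_space \<Gamma> \<rightarrow>\<^sub>M NN"
    by (rule measurable_PiM_single'[OF comp]) (use limit_in in auto)
  then show ?thesis by (simp only: eta_contract_eq)
qed

lemma limit_meas_inv: "lim_lamps \<in> invariant_space \<Gamma> \<rightarrow>\<^sub>M NN"
proof (rule measurableI)
  show "lim_lamps \<omega> \<in> space NN" if "\<omega> \<in> space (invariant_space \<Gamma>)" for \<omega>
    using limit_in that by (simp add: space_invariant_space space_PiM)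
  fix A assume "A \<in> sets NN"
  from measurable_sets[OF limit_meas this] show "lim_lamps -` A \<inter> space (invariant_space \<Gamma>) \<in> sets (invariant_space \<Gamma>)"
    by (auto simp: sets_invariant_space space_invariant_space limit_shift) (auto simp: space_path_space path_shift_def PiE_iff)
qed

section \<open>The law of the limit and the action on configurations\<close>

abbreviation "N \<equiv> limit_lamps_law L \<Lambda> \<mu>"
abbreviation "act \<equiv> lamp_action L \<Lambda>"

lemma space_N: "space N = carrier \<Lambda> \<rightarrow>\<^sub>E carrier L"
  by (simp add: limit_lamps_law_def space_PiM)

lemma sets_N: "sets N = sets NN"
  by (simp add: limit_lamps_law_def)

lemma meas_N: "measurable M N = measurable M NN" "measurable N M = measurable NN M"
  by (simp_all add: sets_N cong: measurable_cong_sets)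

lemma act_apply:
  assumes "\<theta> \<in> carrier \<Lambda> \<rightarrow>\<^sub>E carrier L" "z \<in> carrier \<Lambda>"
  shows "act \<gamma> \<theta> z = fst \<gamma> z \<otimes>\<^bsub>L\<^esub> \<theta> (inv\<^bsub>\<Lambda>\<^esub> (snd \<gamma>) \<otimes>\<^bsub>\<Lambda>\<^esub> z)"
  using assms by (simp add: lamp_action_def case_prod_beta' lamp_mult_def lamp_translate_def)

lemma act_in:
  assumes "\<gamma> \<in> carrier \<Gamma>" "\<theta> \<in> carrier \<Lambda> \<rightarrow>\<^sub>E carrier L"
  shows "act \<gamma> \<theta> \<in> carrier \<Lambda> \<rightarrow>\<^sub>E carrier L"
proof (rule PiE_I)
  fix z assume z: "z \<in> carrier \<Lambda>"
  have "inv\<^bsub>\<Lambda>\<^esub> (snd \<gamma>) \<otimes>\<^bsub>\<Lambda>\<^esub> z \<in> carrier \<Lambda>" using assms z by (auto simp: carrier_\<Gamma>)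
  then show "act \<gamma> \<theta> z \<in> carrier L" using assms z by (auto simp: act_apply carrier_\<Gamma> PiE_iff)
next
  fix z assume "z \<notin> carrier \<Lambda>"
  then show "act \<gamma> \<theta> z = undefined" using assms by (simp add: lamp_action_def case_prod_beta' lamp_mult_def)
qed

lemma act_comp:
  assumes g: "\<gamma> \<in> carrier \<Gamma>" and d: "\<delta> \<in> carrier \<Gamma>" and t: "\<theta> \<in> carrier \<Lambda> \<rightarrow>\<^sub>E carrier L"
  shows "act (\<gamma> \<otimes>\<^bsub>\<Gamma>\<^esub> \<delta>) \<theta> = act \<gamma> (act \<delta> \<theta>)"
proof (rule PiE_ext[OF act_in[OF group.is_monoid[OF \<Gamma>_group, THEN monoid.m_closed, OF g d] t] act_in[OF g act_in[OF d t]]])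
  fix z assume z: "z \<in> carrier \<Lambda>"
  have c: "snd \<gamma> \<in> carrier \<Lambda>" "snd \<delta> \<in> carrier \<Lambda>" using g d by (auto simp: carrier_\<Gamma>)
  have z': "inv\<^bsub>\<Lambda>\<^esub> (snd \<gamma>) \<otimes>\<^bsub>\<Lambda>\<^esub> z \<in> carrier \<Lambda>" using c z by simp
  have z'': "inv\<^bsub>\<Lambda>\<^esub> (snd \<delta>) \<otimes>\<^bsub>\<Lambda>\<^esub> (inv\<^bsub>\<Lambda>\<^esub> (snd \<gamma>) \<otimes>\<^bsub>\<Lambda>\<^esub> z) \<in> carrier \<Lambda>" using c z by simp
  have l: "fst \<gamma> z \<in> carrier L" "fst \<delta> (inv\<^bsub>\<Lambda>\<^esub> (snd \<gamma>) \<otimes>\<^bsub>\<Lambda>\<^esub> z) \<in> carrier L"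
    "\<theta> (inv\<^bsub>\<Lambda>\<^esub> (snd \<delta>) \<otimes>\<^bsub>\<Lambda>\<^esub> (inv\<^bsub>\<Lambda>\<^esub> (snd \<gamma>) \<otimes>\<^bsub>\<Lambda>\<^esub> z)) \<in> carrier L"
    using g d t z z' z'' by (auto simp: carrier_\<Gamma> PiE_iff)
  show "act (\<gamma> \<otimes>\<^bsub>\<Gamma>\<^esub> \<delta>) \<theta> z = act \<gamma> (act \<delta> \<theta>) z"
    unfolding act_apply[OF t z] act_apply[OF act_in[OF d t] z] act_apply[OF t z']
    using c z z' l by (simp add: mult_\<Gamma> lamp_mult_def lamp_translate_def GL.inv_mult_group GL.m_assoc LL.m_assoc)
qed

lemma act_one: "\<theta> \<in> carrier \<Lambda> \<rightarrow>\<^sub>E carrier L \<Longrightarrow> act \<one>\<^bsub>\<Gamma>\<^esub> \<theta> = \<theta>"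
  by (rule PiE_ext[OF act_in[OF monoid.one_closed[OF group.is_monoid[OF \<Gamma>_group]]]])
    (auto simp: act_apply one_\<Gamma> lamp_id_def PiE_iff)

lemma act_meas: "\<gamma> \<in> carrier \<Gamma> \<Longrightarrow> act \<gamma> \<in> NN \<rightarrow>\<^sub>M NN"
proof -
  assume g: "\<gamma> \<in> carrier \<Gamma>"
  have "(\<lambda>\<theta> z. act \<gamma> \<theta> z) \<in> NN \<rightarrow>\<^sub>M NN"
  proof (rule measurable_PiM_single')
    fix z assume z: "z \<in> carrier \<Lambda>"
    have z': "inv\<^bsub>\<Lambda>\<^esub> (snd \<gamma>) \<otimes>\<^bsub>\<Lambda>\<^esub> z \<in> carrier \<Lambda>" using g z by (auto simp: carrier_\<Gamma>)
    have f: "fst \<gamma> z \<in> carrier L" using g z by (auto simp: carrier_\<Gamma> PiE_iff)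
    have "(\<lambda>\<theta>. fst \<gamma> z \<otimes>\<^bsub>L\<^esub> \<theta> (inv\<^bsub>\<Lambda>\<^esub> (snd \<gamma>) \<otimes>\<^bsub>\<Lambda>\<^esub> z)) \<in> NN \<rightarrow>\<^sub>M count_space (carrier L)"
      by (rule measurable_compose[OF measurable_component_singleton[OF z']]) (use f in auto)
    then show "(\<lambda>\<theta>. act \<gamma> \<theta> z) \<in> NN \<rightarrow>\<^sub>M count_space (carrier L)"
      by (rule measurable_cong[THEN iffD1, rotated]) (simp add: act_apply[OF _ z] space_PiM)
  qed (use act_in[OF g] in \<open>auto simp: space_PiM\<close>)
  then show ?thesis by (simp only: eta_contract_eq)
qed

lemma group_action_act: "group_action \<Gamma> (space N) act"
proof -
  have inv_act: "act (inv\<^bsub>\<Gamma>\<^esub> \<gamma>) (act \<gamma> \<theta>) = \<theta>" "act \<gamma> (act (inv\<^bsub>\<Gamma>\<^esub> \<gamma>) \<theta>) = \<theta>"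
    if g: "\<gamma> \<in> carrier \<Gamma>" and t: "\<theta> \<in> carrier \<Lambda> \<rightarrow>\<^sub>E carrier L" for \<gamma> \<theta>
    using act_comp[of "inv\<^bsub>\<Gamma>\<^esub> \<gamma>" \<gamma> \<theta>] act_comp[of \<gamma> "inv\<^bsub>\<Gamma>\<^esub> \<gamma>" \<theta>] act_one[OF t] g t by auto
  have Bij: "act \<gamma> \<in> Bij (space N)" if g: "\<gamma> \<in> carrier \<Gamma>" for \<gamma>
  proof -
    have "bij_betw (act \<gamma>) (space N) (space N)"
      unfolding space_N
    proof (rule bij_betw_byWitness[where f' = "act (inv\<^bsub>\<Gamma>\<^esub> \<gamma>)"])
      show "act \<gamma> ` (carrier \<Lambda> \<rightarrow>\<^sub>E carrier L) \<subseteq> carrier \<Lambda> \<rightarrow>\<^sub>E carrier L"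
        using act_in[OF g] by blast
      show "act (inv\<^bsub>\<Gamma>\<^esub> \<gamma>) ` (carrier \<Lambda> \<rightarrow>\<^sub>E carrier L) \<subseteq> carrier \<Lambda> \<rightarrow>\<^sub>E carrier L"
        using act_in[of "inv\<^bsub>\<Gamma>\<^esub> \<gamma>"] g by blast
    qed (use inv_act[OF g] in blast)+
    moreover have "act \<gamma> \<in> extensional (space N)"
      by (simp add: lamp_action_def case_prod_beta' space_N)
    ultimately show ?thesis by (simp add: Bij_def)
  qed
  show ?thesis
    unfolding group_action_def
  proof (rule group_hom.intro[OF \<Gamma>_group group_BijGroup], unfold group_hom_axioms_def, rule homI)
    show "act \<gamma> \<in> carrier (BijGroup (space N))" if "\<gamma> \<in> carrier \<Gamma>" for \<gamma>
      using Bij[OF that] by (simp add: BijGroup_def)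
    show "act (\<gamma> \<otimes>\<^bsub>\<Gamma>\<^esub> \<delta>) = act \<gamma> \<otimes>\<^bsub>BijGroup (space N)\<^esub> act \<delta>" if g: "\<gamma> \<in> carrier \<Gamma>" and d: "\<delta> \<in> carrier \<Gamma>" for \<gamma> \<delta>
    proof -
      have "act (\<gamma> \<otimes>\<^bsub>\<Gamma>\<^esub> \<delta>) \<theta> = compose (space N) (act \<gamma>) (act \<delta>) \<theta>" for \<theta>
        using act_comp[OF g d, of \<theta>] by (simp add: compose_def space_N lamp_action_def case_prod_beta')
      then show ?thesis using Bij[OF g] Bij[OF d] by (auto simp: BijGroup_def)
    qed
  qed
qed

lemma limit_equiv:
  assumes g: "\<gamma> \<in> carrier \<Gamma>" and \<omega>: "\<omega> \<in> space (path_space \<Gamma>)" and c: "lamps_converge \<Lambda> \<omega>"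
  shows "lim_lamps (path_translate \<Gamma> \<gamma> \<omega>) = act \<gamma> (lim_lamps \<omega>)"
proof -
  have ev: "\<forall>\<^sub>F t in sequentially. fst (path_translate \<Gamma> \<gamma> \<omega> t) z = act \<gamma> (lim_lamps \<omega>) z" if z: "z \<in> carrier \<Lambda>" for z
  proof -
    have z': "inv\<^bsub>\<Lambda>\<^esub> (snd \<gamma>) \<otimes>\<^bsub>\<Lambda>\<^esub> z \<in> carrier \<Lambda>" using g z by (auto simp: carrier_\<Gamma>)
    from limit_ev[OF c z'] show ?thesis
      by eventually_elim (simp add: act_apply[OF limit_in[OF \<omega>] z] path_translate_def mult_\<Gamma> lamp_mult_def lamp_translate_def z)
  qed
  have c': "lamps_converge \<Lambda> (path_translate \<Gamma> \<gamma> \<omega>)"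
    unfolding lamps_converge_def using ev by blast
  have \<omega>': "path_translate \<Gamma> \<gamma> \<omega> \<in> space (path_space \<Gamma>)" by (rule path_translate_space[OF \<Gamma>_group g \<omega>])
  show ?thesis
    by (rule PiE_ext[OF limit_in[OF \<omega>'] act_in[OF g limit_in[OF \<omega>]]]) (rule limit_lamps_eqI[OF c' _ ev])
qed

lemma AE_converge: "AE \<omega> in walk_law \<Gamma> \<mu>. lamps_converge \<Lambda> \<omega>"
proof -
  have "{\<omega> \<in> space (path_space \<Gamma>). lamps_converge \<Lambda> \<omega>} \<in> sets (path_space \<Gamma>)" using conv_meas by simp
  then show ?thesis
    unfolding w.walk_law_eq by (subst AE_distr_iff[OF w.measurable_W]) (use AE_good good_converge in \<open>auto elim!: AE_mp\<close>)
qed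

lemma AE_equiv: "\<gamma> \<in> carrier \<Gamma> \<Longrightarrow> AE \<omega> in walk_law \<Gamma> \<mu>. lim_lamps (path_translate \<Gamma> \<gamma> \<omega>) = act \<gamma> (lim_lamps \<omega>)"
proof -
  assume g: "\<gamma> \<in> carrier \<Gamma>"
  show ?thesis using AE_converge AE_space[of "walk_law \<Gamma> \<mu>"]
    by eventually_elim (simp add: limit_equiv g)
qed

lemma distr_N: "distr (walk_law \<Gamma> \<mu>) N lim_lamps = N"
  unfolding limit_lamps_law_def by (rule distr_cong) auto

end

sublocale lamplighter \<subseteq> bd: boundary "wreath L \<Lambda>" \<mu> "limit_lamps_law L \<Lambda> \<mu>" "lamp_action L \<Lambda>" "limit_lamps L \<Lambda>"
  by unfold_locales
    (simp_all add: fin_\<mu> limit_meas meas_N distr_N limit_shift AE_equiv act_meas act_comp act_one space_N)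

context lamplighter
begin

section \<open>Infinitely many lamps stay lit\<close>

lemma singleton_N: "\<phi> \<in> carrier \<Lambda> \<rightarrow>\<^sub>E carrier L \<Longrightarrow> {\<phi>} \<in> sets N"
proof -
  assume \<phi>: "\<phi> \<in> carrier \<Lambda> \<rightarrow>\<^sub>E carrier L"
  have "(\<Pi>\<^sub>E z\<in>carrier \<Lambda>. {\<phi> z}) \<in> sets NN"
    by (rule sets_PiM_I_countable[OF countable_\<Lambda>]) (use \<phi> in auto)
  moreover have "(\<Pi>\<^sub>E z\<in>carrier \<Lambda>. {\<phi> z}) = {\<phi>}"
    using \<phi> by (intro PiE_singleton) (auto simp: PiE_def)
  ultimately show ?thesis by (simp add: sets_N)
qed

text \<open>A finite configuration of maximal mass would have a finite orbit: by stationarity the finite set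
  of atoms of maximal mass is preserved by the support of \<open>\<mu>\<close>, hence by the whole group.\<close>

lemma finite_config_null:
  assumes \<phi>0: "\<phi>0 \<in> fst ` carrier \<Gamma>"
  shows "measure N {\<phi>0} = 0"
proof (rule ccontr)
  interpret N: prob_space N by (rule bd.prob_N)
  let ?C = "fst ` carrier \<Gamma>"
  let ?m = "\<lambda>\<phi>. measure N {\<phi>}"
  assume nz: "?m \<phi>0 \<noteq> 0"
  have CE: "\<phi> \<in> carrier \<Lambda> \<rightarrow>\<^sub>E carrier L" if "\<phi> \<in> ?C" for \<phi> using that fst_\<Gamma> by blast
  have actC: "act \<gamma> \<phi> \<in> ?C" if g: "\<gamma> \<in> carrier \<Gamma>" and p: "\<phi> \<in> ?C" for \<gamma> \<phi>
  proof -
    obtain x where x: "(\<phi>, x) \<in> carrier \<Gamma>" using p by auto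
    have "fst (\<gamma> \<otimes>\<^bsub>\<Gamma>\<^esub> (\<phi>, x)) = act \<gamma> \<phi>"
      using CE[OF p] by (simp add: mult_\<Gamma> lamp_action_def case_prod_beta')
    moreover have "\<gamma> \<otimes>\<^bsub>\<Gamma>\<^esub> (\<phi>, x) \<in> carrier \<Gamma>" using g x by simp
    ultimately show ?thesis by (metis image_eqI)
  qed
  have fin_ge: "finite {\<phi> \<in> ?C. a \<le> ?m \<phi>}" if a: "0 < a" for a
  proof (rule ccontr)
    assume inf: "infinite {\<phi> \<in> ?C. a \<le> ?m \<phi>}"
    obtain k :: nat where k: "1 < real k * a" using reals_Archimedean3[OF a] by auto
    obtain F where F: "F \<subseteq> {\<phi> \<in> ?C. a \<le> ?m \<phi>}" "card F = k" "finite F"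
      using infinite_arbitrarily_large[OF inf, of k] by auto
    have "real k * a \<le> (\<Sum>\<phi>\<in>F. ?m \<phi>)" using sum_bounded_below[of F a ?m] F by auto
    also have "\<dots> = measure N (\<Union>\<phi>\<in>F. {\<phi>})"
      using F CE by (intro N.finite_measure_finite_Union[symmetric]) (auto simp: disjoint_family_on_def intro!: singleton_N)
    also have "\<dots> \<le> 1" by (rule N.prob_le_1)
    finally show False using k by simp
  qed
  have pos0: "0 < ?m \<phi>0" using nz measure_nonneg[of N "{\<phi>0}"] by linarith
  let ?A = "{\<phi> \<in> ?C. ?m \<phi>0 \<le> ?m \<phi>}"
  have finA: "finite ?A" by (rule fin_ge[OF pos0])
  define Mx where "Mx = Max (?m ` ?A)"
  have A0: "\<phi>0 \<in> ?A" using \<phi>0 by simp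
  have Mx_in: "Mx \<in> ?m ` ?A" unfolding Mx_def using finA A0 by (intro Max_in) auto
  have Mx_ge: "?m \<phi> \<le> Mx" if "\<phi> \<in> ?C" for \<phi>
  proof (cases "\<phi> \<in> ?A")
    case True then show ?thesis unfolding Mx_def using finA by (intro Max_ge) auto
  next
    case False
    then have "?m \<phi> < ?m \<phi>0" using that by auto
    also have "?m \<phi>0 \<le> Mx" unfolding Mx_def using finA A0 by (intro Max_ge) auto
    finally show ?thesis by simp
  qed
  define F where "F = {\<phi> \<in> ?C. ?m \<phi> = Mx}"
  have Fne: "F \<noteq> {}" using Mx_in by (auto simp: F_def)
  have MxP: "0 < Mx" using Mx_in pos0 by auto
  have finF: "finite F" by (rule finite_subset[OF _ fin_ge[OF MxP]]) (auto simp: F_def)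
  \<comment> \<open>A maximum principle: by stationarity \<open>Mx\<close> is the average over
    \<open>y\<close> of the masses at \<open>act (inv y) \<phi>\<close>, none of which exceeds
    \<open>Mx\<close>, so all of them equal it.\<close>
  have inv1: "act (inv\<^bsub>\<Gamma>\<^esub> \<gamma>) \<phi> \<in> F" if g: "\<gamma> \<in> set_pmf \<mu>" and p: "\<phi> \<in> F" for \<gamma> \<phi>
  proof -
    have pC: "\<phi> \<in> ?C" and pM: "?m \<phi> = Mx" using p by (auto simp: F_def)
    have pE: "\<phi> \<in> carrier \<Lambda> \<rightarrow>\<^sub>E carrier L" by (rule CE[OF pC])
    have "ennreal Mx = emeasure N {\<phi>}" using pM by (simp add: N.emeasure_eq_measure)
    also have "\<dots> = (\<integral>\<^sup>+\<xi>. indicator {\<phi>} (bd.\<beta> \<xi>) \<partial>w.S)"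
      by (subst bd.nn_integral_beta) (use singleton_N[OF pE] in auto)
    also have "\<dots> = (\<integral>\<^sup>+y. \<integral>\<^sup>+\<theta>. indicator {\<phi>} (act y \<theta>) \<partial>N \<partial>measure_pmf (w.P (Suc 0)))"
      by (rule bd.nn_integral_joint) (use singleton_N[OF pE] in auto)
    also have "\<dots> = (\<integral>\<^sup>+y. ennreal (?m (act (inv\<^bsub>\<Gamma>\<^esub> y) \<phi>)) \<partial>measure_pmf \<mu>)"
      unfolding w.walk_1
    proof (rule nn_integral_cong_AE, rule AE_pmfI)
      fix y assume "y \<in> set_pmf \<mu>"
      then have y: "y \<in> carrier \<Gamma>" using supp_\<mu> by blast
      have iy: "act (inv\<^bsub>\<Gamma>\<^esub> y) \<phi> \<in> carrier \<Lambda> \<rightarrow>\<^sub>E carrier L" using act_in[OF _ pE] y by simp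
      have "indicator {\<phi>} (act y \<theta>) = (indicator {act (inv\<^bsub>\<Gamma>\<^esub> y) \<phi>} \<theta> :: ennreal)" if t: "\<theta> \<in> space N" for \<theta>
      proof -
        have t': "\<theta> \<in> carrier \<Lambda> \<rightarrow>\<^sub>E carrier L" using t by (simp add: space_N)
        have "act y \<theta> = \<phi> \<longleftrightarrow> \<theta> = act (inv\<^bsub>\<Gamma>\<^esub> y) \<phi>"
          using act_comp[OF y _ pE, of "inv\<^bsub>\<Gamma>\<^esub> y"] act_comp[OF _ y t', of "inv\<^bsub>\<Gamma>\<^esub> y"] act_one[OF pE] act_one[OF t'] y by auto
        then show ?thesis by (auto simp: indicator_def)
      qed
      then have "(\<integral>\<^sup>+\<theta>. indicator {\<phi>} (act y \<theta>) \<partial>N) = (\<integral>\<^sup>+\<theta>. indicator {act (inv\<^bsub>\<Gamma>\<^esub> y) \<phi>} \<theta> \<partial>N)"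
        by (intro nn_integral_cong)
      also have "\<dots> = ennreal (?m (act (inv\<^bsub>\<Gamma>\<^esub> y) \<phi>))"
        using singleton_N[OF iy] by (simp add: N.emeasure_eq_measure)
      finally show "(\<integral>\<^sup>+\<theta>. indicator {\<phi>} (act y \<theta>) \<partial>N) = ennreal (?m (act (inv\<^bsub>\<Gamma>\<^esub> y) \<phi>))" .
    qed
    finally have eq: "(\<integral>\<^sup>+y. ennreal (?m (act (inv\<^bsub>\<Gamma>\<^esub> y) \<phi>)) \<partial>measure_pmf \<mu>) = ennreal Mx" ..
    have le: "?m (act (inv\<^bsub>\<Gamma>\<^esub> y) \<phi>) \<le> Mx" if "y \<in> set_pmf \<mu>" for y
      by (rule Mx_ge[OF actC[OF _ pC]]) (use that supp_\<mu> in auto)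
    have i: "integrable (measure_pmf \<mu>) (\<lambda>y. ?m (act (inv\<^bsub>\<Gamma>\<^esub> y) \<phi>))"
      by (rule integrable_pmf_bounded[where B = 1]) simp
    have "ennreal (measure_pmf.expectation \<mu> (\<lambda>y. ?m (act (inv\<^bsub>\<Gamma>\<^esub> y) \<phi>))) = ennreal Mx"
      unfolding eq[symmetric] by (rule nn_integral_eq_integral[symmetric, OF i]) simp
    then have "measure_pmf.expectation \<mu> (\<lambda>y. ?m (act (inv\<^bsub>\<Gamma>\<^esub> y) \<phi>)) = Mx"
      using MxP by (subst (asm) ennreal_inj) (auto intro!: integral_nonneg_AE)
    then have "measure_pmf.expectation \<mu> (\<lambda>y. Mx - ?m (act (inv\<^bsub>\<Gamma>\<^esub> y) \<phi>)) = 0" using i by simp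
    then have "AE y in measure_pmf \<mu>. Mx - ?m (act (inv\<^bsub>\<Gamma>\<^esub> y) \<phi>) = 0"
      using i le by (subst (asm) integral_nonneg_eq_0_iff_AE) (auto simp: AE_measure_pmf_iff)
    then have "?m (act (inv\<^bsub>\<Gamma>\<^esub> \<gamma>) \<phi>) = Mx" using g by (auto simp: AE_measure_pmf_iff)
    then show ?thesis using actC[OF _ pC, of "inv\<^bsub>\<Gamma>\<^esub> \<gamma>"] g supp_\<mu> by (auto simp: F_def)
  qed
  have FE: "\<phi> \<in> carrier \<Lambda> \<rightarrow>\<^sub>E carrier L" if "\<phi> \<in> F" for \<phi> using that CE by (auto simp: F_def)
  \<comment> \<open>So far only inverses of support elements preserve \<open>F\<close>. An injective
    self-map of a finite set is onto, so the elements themselves preserve it too.\<close>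
  have inv2: "act \<gamma> \<phi> \<in> F" if g: "\<gamma> \<in> set_pmf \<mu>" and p: "\<phi> \<in> F" for \<gamma> \<phi>
  proof -
    have gc: "\<gamma> \<in> carrier \<Gamma>" using g supp_\<mu> by blast
    have ai: "act \<gamma> (act (inv\<^bsub>\<Gamma>\<^esub> \<gamma>) \<psi>) = \<psi>" if "\<psi> \<in> F" for \<psi>
      using act_comp[OF gc _ FE[OF that], of "inv\<^bsub>\<Gamma>\<^esub> \<gamma>"] act_one[OF FE[OF that]] gc by simp
    have "inj_on (act (inv\<^bsub>\<Gamma>\<^esub> \<gamma>)) F" by (rule inj_on_inverseI[where g = "act \<gamma>"]) (rule ai)
    then have "act (inv\<^bsub>\<Gamma>\<^esub> \<gamma>) ` F = F" using inv1[OF g] finF by (intro endo_inj_surj) auto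
    then obtain \<psi> where "\<psi> \<in> F" "\<phi> = act (inv\<^bsub>\<Gamma>\<^esub> \<gamma>) \<psi>" using p by blast
    then show ?thesis using ai by simp
  qed
  have all: "\<forall>\<phi>\<in>F. act \<gamma> \<phi> \<in> F" if "\<gamma> \<in> generate \<Gamma> (set_pmf \<mu>)" for \<gamma>
    using that
  proof induction
    case one
    then show ?case using act_one FE by auto
  next
    case (eng h1 h2)
    then have "h1 \<in> carrier \<Gamma>" "h2 \<in> carrier \<Gamma>" using gen by auto
    then show ?case using eng act_comp FE by simp
  qed (use inv1 inv2 in auto)
  obtain \<phi> where p: "\<phi> \<in> F" using Fne by blast
  obtain l where l: "l \<in> carrier L" "l \<noteq> \<one>\<^bsub>L\<^esub>" using L_nontriv LL.one_closed by blast
  \<comment> \<open>Switching one lamp, at each of the infinitely many sites in turn, produces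
    infinitely many different images of \<phi>, all of which would lie in the finite set
    \<open>F\<close>.\<close>
  define \<delta> where "\<delta> z = (\<lambda>z'\<in>carrier \<Lambda>. if z' = z then l else \<one>\<^bsub>L\<^esub>)" for z
  have \<delta>: "(\<delta> z, \<one>\<^bsub>\<Lambda>\<^esub>) \<in> carrier \<Gamma>" if "z \<in> carrier \<Lambda>" for z
    using l by (auto simp: carrier_\<Gamma> \<delta>_def intro: finite_subset[of _ "{z}"])
  have a: "act (\<delta> z, \<one>\<^bsub>\<Lambda>\<^esub>) \<phi> z' = \<delta> z z' \<otimes>\<^bsub>L\<^esub> \<phi> z'" if "z' \<in> carrier \<Lambda>" for z z'
    using act_apply[OF FE[OF p] that] that by simp
  have "inj_on (\<lambda>z. act (\<delta> z, \<one>\<^bsub>\<Lambda>\<^esub>) \<phi>) (carrier \<Lambda>)"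
  proof (rule inj_onI, rule ccontr)
    fix z z' assume z: "z \<in> carrier \<Lambda>" "z' \<in> carrier \<Lambda>" and eq: "act (\<delta> z, \<one>\<^bsub>\<Lambda>\<^esub>) \<phi> = act (\<delta> z', \<one>\<^bsub>\<Lambda>\<^esub>) \<phi>" and ne: "z \<noteq> z'"
    have "\<phi> z \<in> carrier L" using FE[OF p] z by (auto simp: PiE_iff)
    moreover have "l \<otimes>\<^bsub>L\<^esub> \<phi> z = \<one>\<^bsub>L\<^esub> \<otimes>\<^bsub>L\<^esub> \<phi> z"
      using fun_cong[OF eq, of z] a[OF z(1), of z] a[OF z(1), of z'] z ne by (simp add: \<delta>_def)
    ultimately show False using l by (metis LL.one_closed LL.right_cancel)
  qed
  moreover have "(\<lambda>z. act (\<delta> z, \<one>\<^bsub>\<Lambda>\<^esub>) \<phi>) ` carrier \<Lambda> \<subseteq> F"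
    using all \<delta> gen p by auto
  ultimately have "finite (carrier \<Lambda>)" using finF by (meson finite_imageD finite_subset)
  then show False using \<Lambda>_infinite by simp
qed

text \<open>A limit with finitely many lit lamps is one of countably many configurations, each of
  mass 0.\<close>

lemma AE_infinite_lit: "AE \<xi> in w.S. infinite {z \<in> carrier \<Lambda>. lim_lamps (W \<xi>) z \<noteq> \<one>\<^bsub>L\<^esub>}"
proof -
  interpret N: prob_space N by (rule bd.prob_N)
  let ?C = "fst ` carrier \<Gamma>"
  have "AE \<theta> in N. \<theta> \<noteq> \<phi>" if "\<phi> \<in> ?C" for \<phi>
  proof -
    have "\<phi> \<in> carrier \<Lambda> \<rightarrow>\<^sub>E carrier L" using that fst_\<Gamma> by blast
    then have "{\<phi>} \<in> null_sets N"
      using finite_config_null[OF that] singleton_N by (auto simp: null_sets_def N.emeasure_eq_measure)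
    then show ?thesis by (rule AE_I') auto
  qed
  then have "AE \<theta> in N. \<forall>\<phi>\<in>?C. \<theta> \<noteq> \<phi>"
    using w.countable_carrier by (subst AE_ball_countable) auto
  from bd.AE_beta[OF this] AE_space[of w.S] show ?thesis
  proof eventually_elim
    fix \<xi> assume *: "\<forall>\<phi>\<in>?C. lim_lamps (W \<xi>) \<noteq> \<phi>" and sp: "\<xi> \<in> space w.S"
    show "infinite {z \<in> carrier \<Lambda>. lim_lamps (W \<xi>) z \<noteq> \<one>\<^bsub>L\<^esub>}"
    proof
      assume "finite {z \<in> carrier \<Lambda>. lim_lamps (W \<xi>) z \<noteq> \<one>\<^bsub>L\<^esub>}"
      then have "(lim_lamps (W \<xi>), \<one>\<^bsub>\<Lambda>\<^esub>) \<in> carrier \<Gamma>"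
        using limit_in[OF w.W_space[OF sp]] by (simp add: carrier_\<Gamma>)
      then have "fst (lim_lamps (W \<xi>), \<one>\<^bsub>\<Lambda>\<^esub>) \<in> ?C" by (rule imageI)
      then show False using * by (simp only: fst_conv) blast
    qed
  qed
qed

end

section \<open>Coding the walk by its limiting lamps\<close>

text \<open>Cesaro averaging, applied later to the probabilities that a lamp is within reach again
  long after its block.\<close>

lemma averages_vanish:
  fixes f :: "nat \<Rightarrow> real"
  assumes f: "f \<longlonglongrightarrow> 0" and \<epsilon>: "0 < \<epsilon>"
  shows "\<forall>\<^sub>F k in sequentially. (\<Sum>i<k. f i) \<le> \<epsilon> * real k"
proof -
  obtain i0 where i0: "\<And>i. i0 \<le> i \<Longrightarrow> f i < \<epsilon> / 2"
    using order_tendstoD(2)[OF f, of "\<epsilon> / 2"] \<epsilon> by (auto simp: eventually_sequentially)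
  obtain k0 :: nat where k0: "(\<Sum>i<i0. \<bar>f i\<bar>) < real k0 * (\<epsilon> / 2)" using reals_Archimedean3[of "\<epsilon> / 2"] \<epsilon> by auto
  have "(\<Sum>i<k. f i) \<le> \<epsilon> * real k" if k: "k0 \<le> k" for k
  proof -
    have "(\<Sum>i<k. f i) \<le> (\<Sum>i<k. (if i < i0 then \<bar>f i\<bar> else 0) + \<epsilon> / 2)"
      by (rule sum_mono) (use i0 \<epsilon> in \<open>force simp: not_less\<close>)
    also have "\<dots> = (\<Sum>i\<in>{..<k} \<inter> {i. i < i0}. \<bar>f i\<bar>) + real k * (\<epsilon> / 2)"
      by (simp add: sum.distrib sum.inter_restrict)
    also have "(\<Sum>i\<in>{..<k} \<inter> {i. i < i0}. \<bar>f i\<bar>) \<le> (\<Sum>i<i0. \<bar>f i\<bar>)" by (rule sum_mono2) auto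
    also have "\<dots> \<le> real k0 * (\<epsilon> / 2)" using k0 by simp
    also have "\<dots> \<le> real k * (\<epsilon> / 2)" using k \<epsilon> by (intro mult_right_mono) auto
    finally show ?thesis by (simp add: field_simps)
  qed
  then show ?thesis by (auto simp: eventually_sequentially)
qed

lemma nn_integral_set_pmf: "(\<integral>\<^sup>+x. f x \<partial>measure_pmf p) = (\<integral>\<^sup>+x. ennreal (pmf p x) * f x \<partial>count_space (set_pmf p))"
  unfolding nn_integral_measure_pmf by (rule nn_integral_count_space_eq) (auto simp: set_pmf_iff)

lemma nn_integral_count_space_le:
  fixes f :: "'a \<Rightarrow> ennreal"
  assumes A: "countable A" and le: "\<And>F. finite F \<Longrightarrow> F \<subseteq> A \<Longrightarrow> (\<Sum>x\<in>F. f x) \<le> c"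
  shows "(\<integral>\<^sup>+x. f x \<partial>count_space A) \<le> c"
proof -
  define F where "F j = {x \<in> A. to_nat_on A x \<le> j}" for j :: nat
  have fin: "finite (F j)" for j
  proof (rule finite_imageD)
    show "finite (to_nat_on A ` F j)" by (rule finite_subset[of _ "{..j}"]) (auto simp: F_def)
    show "inj_on (to_nat_on A) (F j)" using inj_on_to_nat_on[OF A] by (rule inj_on_subset) (auto simp: F_def)
  qed
  have "(\<integral>\<^sup>+x. f x \<partial>count_space A) = (\<integral>\<^sup>+x. (SUP j. f x * indicator (F j) x) \<partial>count_space A)"
  proof (rule nn_integral_cong)
    fix x assume "x \<in> space (count_space A)"
    then have x: "x \<in> F (to_nat_on A x)" by (simp add: F_def)
    show "f x = (SUP j. f x * indicator (F j) x)"
    proof (rule antisym)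
      have "f x = f x * indicator (F (to_nat_on A x)) x" using x by simp
      also have "\<dots> \<le> (SUP j. f x * indicator (F j) x)" by (rule SUP_upper) simp
      finally show "f x \<le> (SUP j. f x * indicator (F j) x)" .
    qed (auto intro!: SUP_least split: split_indicator)
  qed
  also have "\<dots> = (SUP j. \<integral>\<^sup>+x. f x * indicator (F j) x \<partial>count_space A)"
    by (rule nn_integral_monotone_convergence_SUP)
      (auto simp: incseq_def le_fun_def F_def intro!: mult_left_mono split: split_indicator)
  also have "\<dots> \<le> c"
  proof (rule SUP_least)
    fix j
    have "(\<integral>\<^sup>+x. f x * indicator (F j) x \<partial>count_space A) = (\<Sum>x\<in>F j. f x * indicator (F j) x)"
      by (rule nn_integral_count_space'[OF fin]) (auto simp: F_def)
    also have "\<dots> = (\<Sum>x\<in>F j. f x)" by (intro sum.cong) auto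
    also have "\<dots> \<le> c" by (rule le[OF fin]) (auto simp: F_def)
    finally show "(\<integral>\<^sup>+x. f x * indicator (F j) x \<partial>count_space A) \<le> c" .
  qed
  finally show ?thesis .
qed

text \<open>Coding in two stages: an auxiliary word \<open>c\<close>, then \<open>y\<close>. Summing
  out \<open>c\<close> leaves a subprobability \<open>q\<close> for \<open>y\<close> given \<theta>,
  to which \<open>gibbs\<close> applies, and the single word \<open>C \<xi>\<close> in use bounds
  \<open>q\<close> from below. The function \<open>g\<close> bounds the code length.\<close>

lemma (in boundary) gibbs_code:
  fixes wt :: "'c \<Rightarrow> 'd \<Rightarrow> 'a \<Rightarrow> real" and C :: "(nat \<Rightarrow> 'a) \<Rightarrow> 'd" and g :: "(nat \<Rightarrow> 'a) \<Rightarrow> real"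
  assumes A: "countable A" and nn: "\<And>\<theta> c y. 0 \<le> wt \<theta> c y"
    and m: "\<And>c y. c \<in> A \<Longrightarrow> y \<in> set_pmf (P n) \<Longrightarrow> (\<lambda>\<theta>. wt \<theta> c y) \<in> borel_measurable N"
    and sum: "\<And>\<theta>. \<theta> \<in> space N \<Longrightarrow> (\<integral>\<^sup>+c. \<integral>\<^sup>+y. ennreal (wt \<theta> c y) \<partial>count_space (set_pmf (P n)) \<partial>count_space A) \<le> 1"
    and C: "AE \<xi> in S. C \<xi> \<in> A \<and> 0 < wt (\<beta> \<xi>) (C \<xi>) (Y n \<xi>) \<and> - g \<xi> \<le> ln (wt (\<beta> \<xi>) (C \<xi>) (Y n \<xi>))"
    and g: "integrable S g"
  shows "ent (P n) - I n \<le> (\<integral>\<xi>. g \<xi> \<partial>S)"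
proof -
  let ?A = "set_pmf (P n)"
  define q where "q \<theta> y = (if y \<in> ?A then enn2real (\<integral>\<^sup>+c. ennreal (wt \<theta> c y) \<partial>count_space A) else 0)" for \<theta> y
  have m': "(\<lambda>\<theta>. \<integral>\<^sup>+c. ennreal (wt \<theta> c y) \<partial>count_space A) \<in> borel_measurable N" if y: "y \<in> ?A" for y
  proof -
    interpret sigma_finite_measure "count_space A" by (rule sigma_finite_measure_count_space_countable[OF A])
    have "(\<lambda>(c, \<theta>). ennreal (wt \<theta> c y)) \<in> borel_measurable (count_space A \<Otimes>\<^sub>M N)"
      by (rule measurable_pair_measure_countable1[OF A]) (use m y in auto)
    from measurable_pair_swap[OF this]
    have "(\<lambda>(\<theta>, c). ennreal (wt \<theta> c y)) \<in> borel_measurable (N \<Otimes>\<^sub>M count_space A)" by simp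
    then show ?thesis by (rule borel_measurable_nn_integral)
  qed
  have swap: "(\<integral>\<^sup>+y. \<integral>\<^sup>+c. ennreal (wt \<theta> c y) \<partial>count_space A \<partial>count_space ?A) =
      (\<integral>\<^sup>+c. \<integral>\<^sup>+y. ennreal (wt \<theta> c y) \<partial>count_space ?A \<partial>count_space A)" for \<theta>
    by (rule nn_integral_count_space_nn_integral[OF A]) auto
  have q_eq: "ennreal (q \<theta> y) = (\<integral>\<^sup>+c. ennreal (wt \<theta> c y) \<partial>count_space A) \<and> q \<theta> y \<le> 1"
    if t: "\<theta> \<in> space N" and y: "y \<in> ?A" for \<theta> y
  proof -
    have "(\<integral>\<^sup>+c. ennreal (wt \<theta> c y) \<partial>count_space A) \<le> (\<integral>\<^sup>+y. \<integral>\<^sup>+c. ennreal (wt \<theta> c y) \<partial>count_space A \<partial>count_space ?A)"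
    proof -
      have "(\<integral>\<^sup>+c. ennreal (wt \<theta> c y) \<partial>count_space A) = (\<integral>\<^sup>+z. (\<integral>\<^sup>+c. ennreal (wt \<theta> c z) \<partial>count_space A) * indicator {y} z \<partial>count_space ?A)"
        using y by (subst nn_integral_indicator_singleton) auto
      also have "\<dots> \<le> (\<integral>\<^sup>+y. \<integral>\<^sup>+c. ennreal (wt \<theta> c y) \<partial>count_space A \<partial>count_space ?A)"
        by (rule nn_integral_mono) (auto split: split_indicator)
      finally show ?thesis .
    qed
    also have "\<dots> \<le> 1" unfolding swap by (rule sum[OF t])
    finally have le: "(\<integral>\<^sup>+c. ennreal (wt \<theta> c y) \<partial>count_space A) \<le> 1" .
    have eq: "ennreal (q \<theta> y) = (\<integral>\<^sup>+c. ennreal (wt \<theta> c y) \<partial>count_space A)"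
      using y by (simp add: q_def) (rule ennreal_enn2real[OF order.strict_trans1[OF le]], simp)
    have "ennreal (q \<theta> y) \<le> 1" by (simp only: eq le)
    then have "q \<theta> y \<le> 1" by simp
    then show ?thesis using eq by simp
  qed
  have q_nn: "0 \<le> q \<theta> y" for \<theta> y by (simp add: q_def)
  have q_m: "(\<lambda>\<theta>. q \<theta> y) \<in> borel_measurable N" for y
    using m' unfolding q_def by (cases "y \<in> ?A") auto
  have q_sum: "(\<integral>\<^sup>+y. \<integral>\<^sup>+\<theta>. ennreal (q \<theta> y) \<partial>N \<partial>count_space ?A) \<le> 1"
  proof -
    have "(\<integral>\<^sup>+y. \<integral>\<^sup>+\<theta>. ennreal (q \<theta> y) \<partial>N \<partial>count_space ?A) = (\<integral>\<^sup>+\<theta>. \<integral>\<^sup>+y. ennreal (q \<theta> y) \<partial>count_space ?A \<partial>N)"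
      by (rule nn_integral_count_space_nn_integral[symmetric]) (use q_m in auto)
    also have "\<dots> = (\<integral>\<^sup>+\<theta>. \<integral>\<^sup>+y. \<integral>\<^sup>+c. ennreal (wt \<theta> c y) \<partial>count_space A \<partial>count_space ?A \<partial>N)"
      by (intro nn_integral_cong) (use q_eq in auto)
    also have "\<dots> \<le> (\<integral>\<^sup>+\<theta>. 1 \<partial>N)"
      by (rule nn_integral_mono) (simp only: swap sum)
    also have "\<dots> = 1" by (simp add: prob_space.emeasure_space_1[OF prob_N])
    finally show ?thesis .
  qed
  have ev: "AE \<xi> in S. 0 < q (\<beta> \<xi>) (Y n \<xi>) \<and> - g \<xi> \<le> ln (q (\<beta> \<xi>) (Y n \<xi>)) \<and> ln (q (\<beta> \<xi>) (Y n \<xi>)) \<le> 0"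
    using C AE_Y[of n] AE_space[of S]
  proof eventually_elim
    fix \<xi> assume c: "C \<xi> \<in> A \<and> 0 < wt (\<beta> \<xi>) (C \<xi>) (Y n \<xi>) \<and> - g \<xi> \<le> ln (wt (\<beta> \<xi>) (C \<xi>) (Y n \<xi>))"
      and y: "Y n \<xi> \<in> ?A" and sp: "\<xi> \<in> space S"
    have "ennreal (wt (\<beta> \<xi>) (C \<xi>) (Y n \<xi>)) = (\<integral>\<^sup>+c. ennreal (wt (\<beta> \<xi>) c (Y n \<xi>)) * indicator {C \<xi>} c \<partial>count_space A)"
      using c by (subst nn_integral_indicator_singleton) auto
    also have "\<dots> \<le> (\<integral>\<^sup>+c. ennreal (wt (\<beta> \<xi>) c (Y n \<xi>)) \<partial>count_space A)"
      by (rule nn_integral_mono) (auto split: split_indicator)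
    also have "\<dots> = ennreal (q (\<beta> \<xi>) (Y n \<xi>))" using q_eq[OF beta_space[OF sp] y] by simp
    finally have le: "wt (\<beta> \<xi>) (C \<xi>) (Y n \<xi>) \<le> q (\<beta> \<xi>) (Y n \<xi>)" by (simp add: q_nn)
    then have p: "0 < q (\<beta> \<xi>) (Y n \<xi>)" using c by linarith
    have "ln (wt (\<beta> \<xi>) (C \<xi>) (Y n \<xi>)) \<le> ln (q (\<beta> \<xi>) (Y n \<xi>))" using le c p by (subst ln_le_cancel_iff) auto
    moreover have "ln (q (\<beta> \<xi>) (Y n \<xi>)) \<le> 0" using q_eq[OF beta_space[OF sp] y] p by simp
    ultimately show "0 < q (\<beta> \<xi>) (Y n \<xi>) \<and> - g \<xi> \<le> ln (q (\<beta> \<xi>) (Y n \<xi>)) \<and> ln (q (\<beta> \<xi>) (Y n \<xi>)) \<le> 0"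
      using p c by linarith
  qed
  have qYm: "(\<lambda>\<xi>. q (\<beta> \<xi>) (Y n \<xi>)) \<in> borel_measurable S"
    by (rule joint_meas[of "\<lambda>y \<theta>. q \<theta> y"]) (rule q_m)
  have int: "integrable S (\<lambda>\<xi>. ln (q (\<beta> \<xi>) (Y n \<xi>)))"
    by (rule Bochner_Integration.integrable_bound[OF g]) (use qYm ev in \<open>auto elim!: AE_mp\<close>)
  have "ent (P n) - I n \<le> - (\<integral>\<xi>. ln (q (\<beta> \<xi>) (Y n \<xi>)) \<partial>S)"
    by (rule gibbs(6)[OF q_m q_nn q_sum _ int]) (use ev in \<open>auto elim!: AE_mp\<close>)
  also have "\<dots> = (\<integral>\<xi>. - ln (q (\<beta> \<xi>) (Y n \<xi>)) \<partial>S)" by simp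
  also have "\<dots> \<le> (\<integral>\<xi>. g \<xi> \<partial>S)"
    by (rule integral_mono_AE) (use int g ev in \<open>auto elim!: AE_mp\<close>)
  finally show ?thesis .
qed

text \<open>Merging a large finite set \<open>Q\<close> into the single symbol \<open>None\<close>
  leaves a law almost concentrated there. The information contents tend to 0 pointwise as
  \<open>Q\<close> grows and are dominated by those of \<open>p\<close>.\<close>

lemma truncation_entropy:
  assumes p: "fin_ent p" and \<epsilon>: "0 < \<epsilon>"
  obtains Q where "finite Q" "Q \<subseteq> set_pmf p" "ent (map_pmf (\<lambda>x. if x \<in> Q then None else Some x) p) \<le> \<epsilon>" "measure p (- Q) \<le> \<epsilon>"
proof -
  let ?S = "set_pmf p"
  define A where "A j = {x \<in> ?S. to_nat_on ?S x \<le> j}" for j :: nat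
  have fin: "finite (A j)" for j
  proof (rule finite_imageD)
    show "finite (to_nat_on ?S ` A j)" by (rule finite_subset[of _ "{..j}"]) (auto simp: A_def)
    show "inj_on (to_nat_on ?S) (A j)" using inj_on_to_nat_on[of ?S] by (rule inj_on_subset) (auto simp: A_def)
  qed
  define s where "s j x = (if x \<in> A j then None else Some x)" for j x
  define f where "f j x = - ln (pmf (map_pmf (s j) p) (s j x))" for j x
  have incA: "incseq A" by (auto simp: incseq_def A_def)
  have UnA: "(\<Union>j. A j) = ?S" by (auto simp: A_def)
  have mA: "(\<lambda>j. measure p (A j)) \<longlonglongrightarrow> 1"
  proof -
    have "(\<lambda>j. measure p (A j)) \<longlonglongrightarrow> measure p (\<Union>j. A j)"
      by (rule measure_pmf.finite_Lim_measure_incseq[OF _ incA]) auto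
    moreover have "measure p ?S = 1" by (rule measure_pmf.prob_eq_1[THEN iffD2]) (auto simp: AE_measure_pmf_iff)
    ultimately show ?thesis by (simp add: UnA)
  qed
  have pmfle: "pmf p x \<le> pmf (map_pmf (s j) p) (s j x)" for j x
  proof -
    have "measure p {x} \<le> measure p (s j -` {s j x})" by (rule measure_pmf.finite_measure_mono) auto
    then show ?thesis by (simp add: measure_pmf_single pmf_map)
  qed
  have fb: "0 \<le> f j x \<and> f j x \<le> - ln (pmf p x)" if "x \<in> ?S" for j x
    using pmfle[of x j] pmf_positive[OF that] pmf_le_1[of "map_pmf (s j) p" "s j x"] by (simp add: f_def)
  have flim: "(\<lambda>j. f j x) \<longlonglongrightarrow> 0" if x: "x \<in> ?S" for x
  proof -
    have "\<forall>\<^sub>F j in sequentially. f j x = - ln (measure p (A j))"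
      using eventually_ge_at_top[of "to_nat_on ?S x"]
    proof eventually_elim
      fix j assume "to_nat_on ?S x \<le> j"
      then have "s j x = None" using x by (simp add: s_def A_def)
      moreover have "s j -` {None} = A j" by (auto simp: s_def split: if_splits)
      ultimately show "f j x = - ln (measure p (A j))" by (simp add: f_def pmf_map)
    qed
    moreover have "(\<lambda>j. - ln (measure p (A j))) \<longlonglongrightarrow> - ln 1"
      by (intro tendsto_intros mA) simp
    ultimately show ?thesis by (simp add: tendsto_cong)
  qed
  have "(\<lambda>j. measure_pmf.expectation p (f j)) \<longlonglongrightarrow> measure_pmf.expectation p (\<lambda>_. 0)"
  proof (rule integral_dominated_convergence[where w = "\<lambda>x. - ln (pmf p x)"])
    show "integrable (measure_pmf p) (\<lambda>x. - ln (pmf p x))" using p by (simp add: fin_ent_def)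
    show "AE x in measure_pmf p. (\<lambda>j. f j x) \<longlonglongrightarrow> 0" using flim by (intro AE_pmfI)
    show "AE x in measure_pmf p. norm (f j x) \<le> - ln (pmf p x)" for j
    proof (rule AE_pmfI)
      fix x assume "x \<in> ?S"
      from fb[OF this, of j] show "norm (f j x) \<le> - ln (pmf p x)" by simp
    qed
  qed auto
  then have "(\<lambda>j. ent (map_pmf (s j) p)) \<longlonglongrightarrow> 0" by (simp add: ent_def f_def[abs_def])
  then have e1: "\<forall>\<^sub>F j in sequentially. ent (map_pmf (s j) p) < \<epsilon>" by (rule order_tendstoD) (rule \<epsilon>)
  have e2: "\<forall>\<^sub>F j in sequentially. 1 - \<epsilon> < measure p (A j)" by (rule order_tendstoD(1)[OF mA]) (use \<epsilon> in simp)
  obtain j where j: "ent (map_pmf (s j) p) < \<epsilon>" "1 - \<epsilon> < measure p (A j)"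
    using eventually_conj[OF e1 e2] by (auto simp: eventually_sequentially)
  have "measure p (- A j) = 1 - measure p (A j)" using measure_pmf.prob_compl[of "A j" p] by (simp add: Compl_eq_Diff_UNIV)
  then show ?thesis
    using j by (intro that[OF fin[of j]]) (auto simp: s_def[abs_def] A_def)
qed

context lamplighter
begin

section \<open>Supports of configurations and late visits to lamps\<close>

definition supp :: "('g \<Rightarrow> 'l) \<Rightarrow> 'g set" where
  "supp \<phi> = {z \<in> carrier \<Lambda>. \<phi> z \<noteq> \<one>\<^bsub>L\<^esub>}"

lemma supp_mult:
  assumes g: "g \<in> carrier \<Gamma>" and h: "h \<in> carrier \<Gamma>"
  shows "supp (fst (g \<otimes>\<^bsub>\<Gamma>\<^esub> h)) \<subseteq> supp (fst g) \<union> (\<lambda>q. snd g \<otimes>\<^bsub>\<Lambda>\<^esub> q) ` supp (fst h)"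
proof
  fix z assume "z \<in> supp (fst (g \<otimes>\<^bsub>\<Gamma>\<^esub> h))"
  then have z: "z \<in> carrier \<Lambda>" and ne: "fst g z \<otimes>\<^bsub>L\<^esub> fst h (inv\<^bsub>\<Lambda>\<^esub> snd g \<otimes>\<^bsub>\<Lambda>\<^esub> z) \<noteq> \<one>\<^bsub>L\<^esub>"
    by (auto simp: supp_def mult_\<Gamma> lamp_mult_def lamp_translate_def)
  have s: "snd g \<in> carrier \<Lambda>" by (rule snd_\<Gamma>[OF g])
  show "z \<in> supp (fst g) \<union> (\<lambda>q. snd g \<otimes>\<^bsub>\<Lambda>\<^esub> q) ` supp (fst h)"
  proof (cases "fst g z = \<one>\<^bsub>L\<^esub>")
    case True
    then have "fst h (inv\<^bsub>\<Lambda>\<^esub> snd g \<otimes>\<^bsub>\<Lambda>\<^esub> z) \<noteq> \<one>\<^bsub>L\<^esub>" using ne by auto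
    moreover have "z = snd g \<otimes>\<^bsub>\<Lambda>\<^esub> (inv\<^bsub>\<Lambda>\<^esub> snd g \<otimes>\<^bsub>\<Lambda>\<^esub> z)" using s z by (simp add: GL.m_assoc[symmetric])
    ultimately show ?thesis using s z by (intro UnI2 image_eqI[of _ _ "inv\<^bsub>\<Lambda>\<^esub> snd g \<otimes>\<^bsub>\<Lambda>\<^esub> z"]) (auto simp: supp_def)
  next
    case False
    then show ?thesis using z by (auto simp: supp_def)
  qed
qed

lemma supp_walk: "g \<in> set_pmf (w.P m) \<Longrightarrow> finite (supp (fst g)) \<and> card (supp (fst g)) \<le> m * card B"
proof (induction m arbitrary: g)
  case 0
  then show ?case by (simp add: one_\<Gamma> supp_def lamp_id_def)
next
  case (Suc m)
  then obtain a y where ay: "a \<in> set_pmf (w.P m)" "y \<in> set_pmf \<mu>" "g = a \<otimes>\<^bsub>\<Gamma>\<^esub> y"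
    by (auto simp: conv_pmf_def)
  have c: "a \<in> carrier \<Gamma>" "y \<in> carrier \<Gamma>" using ay supp_\<mu> w.supp_walk by blast+
  have yB: "supp (fst y) \<subseteq> B" using in_B[OF ay(2)] by (auto simp: supp_def)
  then have fy: "finite (supp (fst y))" "card (supp (fst y)) \<le> card B" using finite_B by (auto intro: finite_subset card_mono)
  let ?U = "supp (fst a) \<union> (\<lambda>q. snd a \<otimes>\<^bsub>\<Lambda>\<^esub> q) ` supp (fst y)"
  have sub: "supp (fst g) \<subseteq> ?U" unfolding ay(3) by (rule supp_mult[OF c])
  have fU: "finite ?U" using Suc.IH[OF ay(1)] fy by auto
  have "card (supp (fst g)) \<le> card ?U" by (rule card_mono[OF fU sub])
  also have "\<dots> \<le> card (supp (fst a)) + card ((\<lambda>q. snd a \<otimes>\<^bsub>\<Lambda>\<^esub> q) ` supp (fst y))" by (rule card_Un_le)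
  also have "\<dots> \<le> m * card B + card B"
    using Suc.IH[OF ay(1)] card_image_le[OF fy(1), of "\<lambda>q. snd a \<otimes>\<^bsub>\<Lambda>\<^esub> q"] fy(2) by linarith
  finally show ?case using finite_subset[OF sub fU] by simp
qed

lemma touched_meas: "Measurable.pred w.S (touched T q)"
proof -
  have "Measurable.pred w.S (\<lambda>\<xi>. \<exists>t. T \<le> t \<and> inv\<^bsub>\<Lambda>\<^esub> (X t \<xi>) \<otimes>\<^bsub>\<Lambda>\<^esub> q \<in> B)"
    by (intro pred_intros_countable pred_intros_logic) (simp, rule w.pred_fun_Y[of "\<lambda>g. inv\<^bsub>\<Lambda>\<^esub> (snd g) \<otimes>\<^bsub>\<Lambda>\<^esub> q \<in> B"])
  then show ?thesis by (simp add: touched_def[abs_def])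
qed

text \<open>By stationarity of the increments this is also the chance that the site displaced by
  \<open>q\<close> from the present position is within reach \<open>T\<close> or more steps later,
  see \<open>touched_prob\<close>.\<close>

definition H :: "'g \<Rightarrow> nat \<Rightarrow> real" where
  "H q T = measure w.S {\<xi> \<in> space w.S. touched T q \<xi>}"

lemma H_tendsto: "q \<in> carrier \<Lambda> \<Longrightarrow> H q \<longlonglongrightarrow> 0"
proof -
  assume q: "q \<in> carrier \<Lambda>"
  let ?A = "\<lambda>T. {\<xi> \<in> space w.S. touched T q \<xi>}"
  have s: "?A T \<in> sets w.S" for T using touched_meas by simp
  have "(\<lambda>T. measure w.S (?A T)) \<longlonglongrightarrow> measure w.S (\<Inter>T. ?A T)"
    using s by (intro w.seq.P.finite_Lim_measure_decseq) (auto simp: decseq_def touched_def intro: order_trans)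
  also have "measure w.S (\<Inter>T. ?A T) = 0"
  proof -
    have "AE \<xi> in w.S. \<xi> \<notin> (\<Inter>T. ?A T)"
      using AE_good by eventually_elim (use not_touched_eventually[OF _ q] in auto)
    moreover have "(\<Inter>T. ?A T) \<in> sets w.S" using s by auto
    ultimately have "(\<Inter>T. ?A T) \<in> null_sets w.S" by (simp add: AE_iff_null_sets)
    then show ?thesis by (simp add: measure_eq_0_null_sets)
  qed
  finally show ?thesis by (simp add: H_def[abs_def])
qed

lemma touched_shift:
  assumes sp: "\<xi> \<in> space w.S" and q: "q \<in> carrier \<Lambda>" and i: "i \<le> n"
  shows "touched n (X i \<xi> \<otimes>\<^bsub>\<Lambda>\<^esub> q) \<xi> \<longleftrightarrow> touched (n - i) q (w.advance i \<xi>)"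
proof -
  have eq: "inv\<^bsub>\<Lambda>\<^esub> (X (i + t) \<xi>) \<otimes>\<^bsub>\<Lambda>\<^esub> (X i \<xi> \<otimes>\<^bsub>\<Lambda>\<^esub> q) = inv\<^bsub>\<Lambda>\<^esub> (X t (w.advance i \<xi>)) \<otimes>\<^bsub>\<Lambda>\<^esub> q" for t
  proof -
    have c: "X i \<xi> \<in> carrier \<Lambda>" "X t (w.advance i \<xi>) \<in> carrier \<Lambda>"
      using X_closed[OF sp] X_closed[OF w.advance_space[OF sp]] by auto
    then have "inv\<^bsub>\<Lambda>\<^esub> (X i \<xi>) \<otimes>\<^bsub>\<Lambda>\<^esub> (X i \<xi> \<otimes>\<^bsub>\<Lambda>\<^esub> q) = q" using q by (simp add: GL.m_assoc[symmetric])
    then show ?thesis using X_add[OF sp, of i t] c q by (simp add: GL.inv_mult_group GL.m_assoc)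
  qed
  show ?thesis
  proof
    assume "touched n (X i \<xi> \<otimes>\<^bsub>\<Lambda>\<^esub> q) \<xi>"
    then obtain t where t: "n \<le> t" "inv\<^bsub>\<Lambda>\<^esub> (X t \<xi>) \<otimes>\<^bsub>\<Lambda>\<^esub> (X i \<xi> \<otimes>\<^bsub>\<Lambda>\<^esub> q) \<in> B" by (auto simp: touched_def)
    then have "inv\<^bsub>\<Lambda>\<^esub> (X (t - i) (w.advance i \<xi>)) \<otimes>\<^bsub>\<Lambda>\<^esub> q \<in> B" using eq[of "t - i"] i by simp
    then show "touched (n - i) q (w.advance i \<xi>)" using t i by (auto simp: touched_def intro!: exI[of _ "t - i"])
  next
    assume "touched (n - i) q (w.advance i \<xi>)"
    then obtain t where t: "n - i \<le> t" "inv\<^bsub>\<Lambda>\<^esub> (X t (w.advance i \<xi>)) \<otimes>\<^bsub>\<Lambda>\<^esub> q \<in> B" by (auto simp: touched_def)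
    then show "touched n (X i \<xi> \<otimes>\<^bsub>\<Lambda>\<^esub> q) \<xi>" using eq[of t] i by (auto simp: touched_def intro!: exI[of _ "i + t"])
  qed
qed

lemma touched_prob:
  assumes q: "q \<in> carrier \<Lambda>" and i: "i \<le> n"
  shows "{\<xi> \<in> space w.S. touched n (X i \<xi> \<otimes>\<^bsub>\<Lambda>\<^esub> q) \<xi>} \<in> sets w.S"
    and "measure w.S {\<xi> \<in> space w.S. touched n (X i \<xi> \<otimes>\<^bsub>\<Lambda>\<^esub> q) \<xi>} = H q (n - i)"
proof -
  let ?A = "{\<xi> \<in> space w.S. touched (n - i) q \<xi>}"
  have A: "?A \<in> sets w.S" using touched_meas by simp
  have eq: "{\<xi> \<in> space w.S. touched n (X i \<xi> \<otimes>\<^bsub>\<Lambda>\<^esub> q) \<xi>} = w.advance i -` ?A \<inter> space w.S"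
    using touched_shift[OF _ q i] w.advance_space by auto
  show "{\<xi> \<in> space w.S. touched n (X i \<xi> \<otimes>\<^bsub>\<Lambda>\<^esub> q) \<xi>} \<in> sets w.S"
    unfolding eq by (rule measurable_sets[OF w.measurable_advance A])
  have "H q (n - i) = measure (distr w.S w.S (w.advance i)) ?A" unfolding w.distr_advance H_def ..
  also have "\<dots> = measure w.S (w.advance i -` ?A \<inter> space w.S)"
    by (rule measure_distr[OF w.measurable_advance A])
  finally show "measure w.S {\<xi> \<in> space w.S. touched n (X i \<xi> \<otimes>\<^bsub>\<Lambda>\<^esub> q) \<xi>} = H q (n - i)" unfolding eq ..
qed

text \<open>The first lit lamp of index at least \<open>J\<close>; meaningless if only finitely many lamps are lit.\<close>

definition zJ :: "nat \<Rightarrow> ('g \<Rightarrow> 'l) \<Rightarrow> 'g" where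
  "zJ J \<theta> = from_nat_into (carrier \<Lambda>) (LEAST i. J \<le> i \<and> \<theta> (from_nat_into (carrier \<Lambda>) i) \<noteq> \<one>\<^bsub>L\<^esub>)"

lemma zJ_carrier: "zJ J \<theta> \<in> carrier \<Lambda>"
  unfolding zJ_def by (rule from_nat_into) (use \<Lambda>_infinite in auto)

lemma zJ_meas: "(\<lambda>\<theta>. (f :: 'g \<Rightarrow> real) (zJ J \<theta>)) \<in> borel_measurable N"
proof -
  have c: "from_nat_into (carrier \<Lambda>) i \<in> carrier \<Lambda>" for i by (rule from_nat_into) (use \<Lambda>_infinite in auto)
  have "(\<lambda>\<theta>. LEAST i. J \<le> i \<and> \<theta> (from_nat_into (carrier \<Lambda>) i) \<noteq> \<one>\<^bsub>L\<^esub>) \<in> NN \<rightarrow>\<^sub>M count_space UNIV"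
  proof (rule measurable_Least)
    fix i
    have "Measurable.pred NN (\<lambda>\<theta>. \<theta> (from_nat_into (carrier \<Lambda>) i) \<noteq> \<one>\<^bsub>L\<^esub>)"
      by (rule measurable_compose[OF measurable_component_singleton[OF c]]) simp
    then show "Measurable.pred NN (\<lambda>\<theta>. J \<le> i \<and> \<theta> (from_nat_into (carrier \<Lambda>) i) \<noteq> \<one>\<^bsub>L\<^esub>)" by simp
  qed
  from measurable_compose[OF this, of "\<lambda>i. f (from_nat_into (carrier \<Lambda>) i)" borel]
  show ?thesis by (simp add: zJ_def meas_N)
qed

text \<open>A lit lamp must have been within reach at some time. Only finitely many sites are within
  reach before \<open>s0\<close>; beyond their indices every lit lamp was reached at some
  \<open>t \<ge> s0\<close>, and one of the finitely many shifts by \<open>B\<close> leads back to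
  \<open>X t\<close>.\<close>

lemma zJ_visited:
  assumes g: "good \<xi>" and inf: "infinite {z \<in> carrier \<Lambda>. lim_lamps (W \<xi>) z \<noteq> \<one>\<^bsub>L\<^esub>}"
  obtains J0 where "\<And>J. J0 \<le> J \<Longrightarrow> \<exists>t\<ge>s0. \<exists>b\<in>B. zJ J (lim_lamps (W \<xi>)) \<otimes>\<^bsub>\<Lambda>\<^esub> inv\<^bsub>\<Lambda>\<^esub> b = X t \<xi>"
proof -
  let ?e = "from_nat_into (carrier \<Lambda>)" and ?\<theta> = "lim_lamps (W \<xi>)"
  have sp: "\<xi> \<in> space w.S" using g by (simp add: good_def)
  have bij: "bij_betw ?e UNIV (carrier \<Lambda>)" by (rule bij_betw_from_nat_into[OF countable_\<Lambda> \<Lambda>_infinite])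
  have lit: "J \<le> (LEAST i. J \<le> i \<and> ?\<theta> (?e i) \<noteq> \<one>\<^bsub>L\<^esub>) \<and> ?\<theta> (zJ J ?\<theta>) \<noteq> \<one>\<^bsub>L\<^esub>" for J
  proof -
    have "\<exists>i. J \<le> i \<and> ?\<theta> (?e i) \<noteq> \<one>\<^bsub>L\<^esub>"
    proof (rule ccontr)
      assume no: "\<not> ?thesis"
      have "{z \<in> carrier \<Lambda>. ?\<theta> z \<noteq> \<one>\<^bsub>L\<^esub>} \<subseteq> ?e ` {..<J}"
      proof
        fix z assume z: "z \<in> {z \<in> carrier \<Lambda>. ?\<theta> z \<noteq> \<one>\<^bsub>L\<^esub>}"
        then obtain i where "z = ?e i" using bij by (auto simp: bij_betw_def)
        then show "z \<in> ?e ` {..<J}" using z no by (auto simp: not_le)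
      qed
      then show False using inf by (meson finite_imageI finite_lessThan finite_subset)
    qed
    then have "J \<le> (LEAST i. J \<le> i \<and> ?\<theta> (?e i) \<noteq> \<one>\<^bsub>L\<^esub>) \<and> ?\<theta> (?e (LEAST i. J \<le> i \<and> ?\<theta> (?e i) \<noteq> \<one>\<^bsub>L\<^esub>)) \<noteq> \<one>\<^bsub>L\<^esub>"
      by (rule LeastI_ex)
    then show ?thesis by (simp add: zJ_def)
  qed
  have "finite (\<Union>t<s0. (\<lambda>b. X t \<xi> \<otimes>\<^bsub>\<Lambda>\<^esub> b) ` B)" using finite_B by auto
  then have "finite {i. ?e i \<in> (\<Union>t<s0. (\<lambda>b. X t \<xi> \<otimes>\<^bsub>\<Lambda>\<^esub> b) ` B)}"
    using finite_vimageI[of "\<Union>t<s0. (\<lambda>b. X t \<xi> \<otimes>\<^bsub>\<Lambda>\<^esub> b) ` B" ?e] bij by (auto simp: vimage_def bij_betw_def)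
  then obtain J0 where J0: "\<forall>i\<in>{i. ?e i \<in> (\<Union>t<s0. (\<lambda>b. X t \<xi> \<otimes>\<^bsub>\<Lambda>\<^esub> b) ` B)}. i < J0"
    using finite_nat_set_iff_bounded by auto
  show ?thesis
  proof (rule that)
    fix J assume J: "J0 \<le> J"
    let ?z = "zJ J ?\<theta>"
    have zc: "?z \<in> carrier \<Lambda>" by (rule zJ_carrier)
    have "touched 0 ?z \<xi>"
    proof (rule ccontr)
      assume "\<not> touched 0 ?z \<xi>"
      from limit_untouched[OF g zc this] have "?\<theta> ?z = \<one>\<^bsub>L\<^esub>" using zc by (simp add: one_\<Gamma> lamp_id_def)
      then show False using lit[of J] by simp
    qed
    then obtain t where t: "inv\<^bsub>\<Lambda>\<^esub> (X t \<xi>) \<otimes>\<^bsub>\<Lambda>\<^esub> ?z \<in> B" by (auto simp: touched_def)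
    let ?b = "inv\<^bsub>\<Lambda>\<^esub> (X t \<xi>) \<otimes>\<^bsub>\<Lambda>\<^esub> ?z"
    have xc: "X t \<xi> \<in> carrier \<Lambda>" by (rule X_closed[OF sp])
    have zb: "?z \<otimes>\<^bsub>\<Lambda>\<^esub> inv\<^bsub>\<Lambda>\<^esub> ?b = X t \<xi>" using xc zc by (simp add: GL.inv_mult_group GL.m_assoc[symmetric])
    have "s0 \<le> t"
    proof (rule ccontr)
      assume "\<not> s0 \<le> t"
      moreover have "?z = X t \<xi> \<otimes>\<^bsub>\<Lambda>\<^esub> ?b" using xc zc by (simp add: GL.m_assoc[symmetric])
      ultimately have "?z \<in> (\<Union>t<s0. (\<lambda>b. X t \<xi> \<otimes>\<^bsub>\<Lambda>\<^esub> b) ` B)" using t by auto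
      then have "(LEAST i. J \<le> i \<and> ?\<theta> (?e i) \<noteq> \<one>\<^bsub>L\<^esub>) < J0" using J0 unfolding zJ_def by blast
      then show False using lit[of J] J by linarith
    qed
    then show "\<exists>t\<ge>s0. \<exists>b\<in>B. ?z \<otimes>\<^bsub>\<Lambda>\<^esub> inv\<^bsub>\<Lambda>\<^esub> b = X t \<xi>" using zb t by blast
  qed
qed

lemma B_nonempty: "B \<noteq> {}"
proof
  assume "B = {}"
  have "AE \<xi> in w.S. False"
    using AE_good AE_infinite_lit
  proof eventually_elim
    fix \<xi> assume "good \<xi>" "infinite {z \<in> carrier \<Lambda>. lim_lamps (W \<xi>) z \<noteq> \<one>\<^bsub>L\<^esub>}"
    from zJ_visited[OF this, of 0] show False using \<open>B = {}\<close> by blast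
  qed
  then show False using w.seq.P.AE_False by simp
qed

lemma base_AE: "AE \<eta> in bs.S. Q \<eta> \<Longrightarrow> AE \<xi> in w.S. Q (\<lambda>i. snd (\<xi> i))"
  by (rule AE_distrD[OF base_path_meas]) (simp only: base_path_law)

lemma two_time_meas: "(\<lambda>\<xi>. f (X s \<xi>) (X t \<xi>)) \<in> borel_measurable w.S" for f :: "'g \<Rightarrow> 'g \<Rightarrow> 'x :: topological_space"
  by (rule measurable_compose_countable'[OF _ w.measurable_Y w.countable_carrier, of "\<lambda>y \<xi>. f (snd y) (X t \<xi>)"])
    (rule w.measurable_fun_Y[where f = "\<lambda>z. f _ (snd z)"])

lemma two_time_expectation:
  fixes f :: "'g \<Rightarrow> 'g \<Rightarrow> real"
  assumes f: "\<And>x l. 0 \<le> f x l"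
  shows "(\<integral>\<xi>. f (X n \<xi>) (X (n + j) \<xi>) \<partial>w.S) = measure_pmf.expectation (pair_pmf (bs.P n) (bs.P j)) (\<lambda>(x, l). f x (x \<otimes>\<^bsub>\<Lambda>\<^esub> l))"
proof -
  have "(\<integral>\<^sup>+\<xi>. ennreal (f (X n \<xi>) (X (n + j) \<xi>)) \<partial>w.S) =
      (\<integral>\<^sup>+\<xi>. ennreal (f (X n \<xi>) (X n \<xi> \<otimes>\<^bsub>\<Lambda>\<^esub> X j (w.advance n \<xi>))) \<partial>w.S)"
    by (rule nn_integral_cong) (simp only: X_add)
  also have "\<dots> = (\<integral>\<^sup>+y. \<integral>\<^sup>+\<xi>. ennreal (f (snd y) (snd y \<otimes>\<^bsub>\<Lambda>\<^esub> X j \<xi>)) \<partial>w.S \<partial>measure_pmf (w.P n))"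
    by (rule w.nn_integral_Y_shift[where F = "\<lambda>y \<xi>. ennreal (f (snd y) (snd y \<otimes>\<^bsub>\<Lambda>\<^esub> X j \<xi>))"])
      (rule w.measurable_fun_Y[where f = "\<lambda>z. ennreal (f _ (_ \<otimes>\<^bsub>\<Lambda>\<^esub> snd z))"])
  also have "\<dots> = (\<integral>\<^sup>+y. \<integral>\<^sup>+z. ennreal (f (snd y) (snd y \<otimes>\<^bsub>\<Lambda>\<^esub> snd z)) \<partial>measure_pmf (w.P j) \<partial>measure_pmf (w.P n))"
    by (simp only: w.nn_integral_Y[where F = "\<lambda>z. ennreal (f _ (_ \<otimes>\<^bsub>\<Lambda>\<^esub> snd z))"])
  also have "\<dots> = (\<integral>\<^sup>+x. \<integral>\<^sup>+l. ennreal (f x (x \<otimes>\<^bsub>\<Lambda>\<^esub> l)) \<partial>measure_pmf (bs.P j) \<partial>measure_pmf (bs.P n))"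
    by (simp add: walk_snd[symmetric])
  also have "\<dots> = (\<integral>\<^sup>+z. ennreal (case z of (x, l) \<Rightarrow> f x (x \<otimes>\<^bsub>\<Lambda>\<^esub> l)) \<partial>measure_pmf (pair_pmf (bs.P n) (bs.P j)))"
    by (simp add: nn_integral_pair_pmf')
  finally have eq: "(\<integral>\<^sup>+\<xi>. ennreal (f (X n \<xi>) (X (n + j) \<xi>)) \<partial>w.S) = \<dots>" .
  have "(\<integral>\<xi>. f (X n \<xi>) (X (n + j) \<xi>) \<partial>w.S) = enn2real (\<integral>\<^sup>+\<xi>. ennreal (f (X n \<xi>) (X (n + j) \<xi>)) \<partial>w.S)"
    by (rule integral_eq_nn_integral[OF two_time_meas]) (simp add: f)
  moreover have "measure_pmf.expectation (pair_pmf (bs.P n) (bs.P j)) (\<lambda>(x, l). f x (x \<otimes>\<^bsub>\<Lambda>\<^esub> l)) =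
    enn2real (\<integral>\<^sup>+z. ennreal (case z of (x, l) \<Rightarrow> f x (x \<otimes>\<^bsub>\<Lambda>\<^esub> l)) \<partial>measure_pmf (pair_pmf (bs.P n) (bs.P j)))"
    by (rule integral_eq_nn_integral) (auto simp: f)
  ultimately show ?thesis using eq by simp
qed

text \<open>The score \<open>r \<theta> x\<close> approximates the likelihood ratio of \<open>X n = x\<close> given \<open>\<theta>\<close>, read off from a remote lit lamp.
  As the position of the walker when switching that lamp is only known up to the lamp range, one averages
  over \<open>B\<close>, at the cost of \<open>ln (card B)\<close>.\<close>

lemma exit_score:
  assumes h: "\<And>m. real m * h \<le> ent (bs.P m)"
  obtains r :: "('g \<Rightarrow> 'l) \<Rightarrow> 'g \<Rightarrow> real" where
    "\<And>x. (\<lambda>\<theta>. r \<theta> x) \<in> borel_measurable N" "\<And>\<theta> x. 1 / 2 \<le> r \<theta> x"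
    "\<And>\<theta>. (\<integral>\<^sup>+x. ennreal (pmf (bs.P n) x * r \<theta> x) \<partial>count_space (set_pmf (bs.P n))) \<le> 1"
    "integrable w.S (\<lambda>\<xi>. ln (r (bd.\<beta> \<xi>) (X n \<xi>)))"
    "(\<integral>\<xi>. - ln (r (bd.\<beta> \<xi>) (X n \<xi>)) \<partial>w.S) \<le> ln (2 * real (card B)) - real n * h + 1"
proof -
  let ?p = "bs.P n"
  let ?c = "real (card B)"
  have c: "1 \<le> ?c" using finite_B B_nonempty by (simp add: Suc_le_eq card_gt_0_iff)
  obtain u where u0: "\<And>x g. 0 \<le> u x g" and usum: "\<And>F g. finite F \<Longrightarrow> (\<Sum>x\<in>F. u x g) \<le> 1"
    and harm: "\<And>x j g. n \<le> j \<Longrightarrow> g \<in> set_pmf (bs.P j) \<Longrightarrow> u x g = measure_pmf.expectation \<mu>b (\<lambda>a. u x (g \<otimes>\<^bsub>\<Lambda>\<^esub> a))"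
    and lim: "\<And>c. (\<lambda>j. measure_pmf.expectation (pair_pmf ?p (bs.P j)) (\<lambda>(x, l). ln (1 + u x (x \<otimes>\<^bsub>\<Lambda>\<^esub> l) / pmf ?p x))) \<longlonglongrightarrow> c
      \<Longrightarrow> real n * h \<le> c"
    by (rule bs.boundary_kernel[OF fin_\<mu>b h, where n = n]) (rule that, assumption+)
  have u1: "u x g \<le> 1" for x g using usum[of "{x}" g] by simp
  \<comment> \<open>Times the prior mass of \<open>x\<close>, this is the average over
    \<open>b\<close> of the even mixture of the prior and the posterior \<open>u\<close>. The prior
    half keeps \<open>r\<close> at least \<open>1 / 2\<close>, so that its logarithm stays bounded
    below.\<close>
  define r where "r J \<theta> x = (\<Sum>b\<in>B. (1 + u x (zJ J \<theta> \<otimes>\<^bsub>\<Lambda>\<^esub> inv\<^bsub>\<Lambda>\<^esub> b) / pmf ?p x) / (2 * ?c))" for J \<theta> x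
  have term0: "0 \<le> u x g / pmf ?p x" for x g by (simp add: u0)
  have r_half: "1 / 2 \<le> r J \<theta> x" for J \<theta> x
  proof -
    have "(\<Sum>b\<in>B. 1 / (2 * ?c)) \<le> r J \<theta> x" unfolding r_def
      by (rule sum_mono, rule divide_right_mono) (use term0[of x] c in auto)
    then show ?thesis using c by simp
  qed
  have r_meas: "(\<lambda>\<theta>. r J \<theta> x) \<in> borel_measurable N" for J x
    unfolding r_def
    by (intro borel_measurable_sum) (rule zJ_meas[where f = "\<lambda>z. (1 + u x (z \<otimes>\<^bsub>\<Lambda>\<^esub> inv\<^bsub>\<Lambda>\<^esub> _) / pmf ?p x) / (2 * ?c)"])
  have r_sum: "(\<integral>\<^sup>+x. ennreal (pmf ?p x * r J \<theta> x) \<partial>count_space (set_pmf ?p)) \<le> 1" for J \<theta>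
  proof (rule nn_integral_count_space_le[OF countable_set_pmf])
    fix F assume F: "finite F" "F \<subseteq> set_pmf ?p"
    have pF: "(\<Sum>x\<in>F. pmf ?p x) \<le> 1" using F by (simp add: measure_measure_pmf_finite[symmetric])
    have "(\<Sum>x\<in>F. pmf ?p x * r J \<theta> x) = (\<Sum>b\<in>B. \<Sum>x\<in>F. (pmf ?p x + u x (zJ J \<theta> \<otimes>\<^bsub>\<Lambda>\<^esub> inv\<^bsub>\<Lambda>\<^esub> b)) / (2 * ?c))"
      unfolding r_def sum_distrib_left
      by (subst sum.swap, intro sum.cong refl) (use F in \<open>auto simp: field_simps set_pmf_iff\<close>)
    also have "\<dots> \<le> (\<Sum>b\<in>B. 1 / ?c)"
    proof (rule sum_mono)
      fix b
      have "(\<Sum>x\<in>F. (pmf ?p x + u x (zJ J \<theta> \<otimes>\<^bsub>\<Lambda>\<^esub> inv\<^bsub>\<Lambda>\<^esub> b)) / (2 * ?c)) =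
        ((\<Sum>x\<in>F. pmf ?p x) + (\<Sum>x\<in>F. u x (zJ J \<theta> \<otimes>\<^bsub>\<Lambda>\<^esub> inv\<^bsub>\<Lambda>\<^esub> b))) / (2 * ?c)"
        by (simp add: sum_divide_distrib[symmetric] sum.distrib)
      also have "\<dots> \<le> 2 / (2 * ?c)"
        by (rule divide_right_mono) (use pF usum[OF F(1), of "zJ J \<theta> \<otimes>\<^bsub>\<Lambda>\<^esub> inv\<^bsub>\<Lambda>\<^esub> b"] c in linarith)+
      finally show "(\<Sum>x\<in>F. (pmf ?p x + u x (zJ J \<theta> \<otimes>\<^bsub>\<Lambda>\<^esub> inv\<^bsub>\<Lambda>\<^esub> b)) / (2 * ?c)) \<le> 1 / ?c" by simp
    qed
    also have "\<dots> = 1" using c by simp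
    finally have le: "(\<Sum>x\<in>F. pmf ?p x * r J \<theta> x) \<le> 1" .
    have "0 \<le> pmf ?p x * r J \<theta> x" for x by (rule mult_nonneg_nonneg) (use r_half[of J \<theta> x] in simp_all)
    then have "(\<Sum>x\<in>F. ennreal (pmf ?p x * r J \<theta> x)) = ennreal (\<Sum>x\<in>F. pmf ?p x * r J \<theta> x)" by (rule sum_ennreal)
    also have "\<dots> \<le> ennreal 1" by (rule ennreal_leI[OF le])
    finally show "(\<Sum>x\<in>F. ennreal (pmf ?p x * r J \<theta> x)) \<le> 1" by simp
  qed
  define bnd where "bnd \<xi> = ln (2 * ?c) + ln 2 - ln (pmf ?p (X n \<xi>))" for \<xi>
  have bnd_int: "integrable w.S bnd"
  proof -
    have "integrable (measure_pmf ?p) (\<lambda>x. ln (pmf ?p x))" using fin_ent_walk[OF fin_\<mu>b, of \<Lambda> n] by (simp add: fin_ent_def)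
    then have "integrable (measure_pmf (w.P n)) (\<lambda>y. ln (pmf ?p (snd y)))"
      unfolding walk_snd[symmetric] by (simp only: integrable_map_pmf_eq)
    then have "integrable w.S (\<lambda>\<xi>. ln (pmf ?p (X n \<xi>)))" by (subst w.integrable_Y(1)[where F = "\<lambda>y. ln (pmf ?p (snd y))"])
    then show ?thesis unfolding bnd_def by (intro Bochner_Integration.integrable_diff Bochner_Integration.integrable_add) auto
  qed
  have AE_X: "AE \<xi> in w.S. X n \<xi> \<in> set_pmf ?p"
    using w.AE_Y[of n] by eventually_elim (use walk_snd[of n] in \<open>simp flip: walk_snd\<close>)
  define f where "f x v = ln (1 + v / pmf ?p x)" for x v
  have f_bnd: "0 \<le> f x v \<and> f x v \<le> ln 2 - ln (pmf ?p x)" if "x \<in> set_pmf ?p" "0 \<le> v" "v \<le> 1" for x v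
  proof -
    have p: "0 < pmf ?p x" "pmf ?p x \<le> 1" using that(1) by (auto simp: pmf_positive pmf_le_1)
    have "v / pmf ?p x \<le> 1 / pmf ?p x" by (rule divide_right_mono) (use that(3) in auto)
    moreover have "1 \<le> 1 / pmf ?p x" using p by simp
    moreover have "2 / pmf ?p x = 1 / pmf ?p x + 1 / pmf ?p x" by simp
    moreover have "0 \<le> v / pmf ?p x" using that(2) by simp
    ultimately have "0 < 1 + v / pmf ?p x \<and> 1 + v / pmf ?p x \<le> 2 / pmf ?p x" by linarith
    then have "f x v \<le> ln (2 / pmf ?p x)" unfolding f_def using p by (subst ln_le_cancel_iff) auto
    then show ?thesis using p that(2) by (simp add: f_def ln_divide_pos)
  qed
  have r_bnd: "\<bar>ln (r J \<theta> x)\<bar> \<le> ln 2 - ln (pmf ?p x)" if x: "x \<in> set_pmf ?p" for J \<theta> x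
  proof -
    have p: "0 < pmf ?p x" "pmf ?p x \<le> 1" using x by (auto simp: pmf_positive pmf_le_1)
    have "r J \<theta> x \<le> (\<Sum>b\<in>B. (2 / pmf ?p x) / (2 * ?c))" unfolding r_def
    proof (rule sum_mono, rule divide_right_mono)
      fix b
      have "u x (zJ J \<theta> \<otimes>\<^bsub>\<Lambda>\<^esub> inv\<^bsub>\<Lambda>\<^esub> b) / pmf ?p x \<le> 1 / pmf ?p x" by (rule divide_right_mono) (use u1 in auto)
      moreover have "1 \<le> 1 / pmf ?p x" using p by simp
      moreover have "2 / pmf ?p x = 1 / pmf ?p x + 1 / pmf ?p x" by simp
      ultimately show "1 + u x (zJ J \<theta> \<otimes>\<^bsub>\<Lambda>\<^esub> inv\<^bsub>\<Lambda>\<^esub> b) / pmf ?p x \<le> 2 / pmf ?p x" by linarith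
    qed (use c in simp)
    also have "\<dots> = 1 / pmf ?p x" using c by simp
    finally have "r J \<theta> x \<le> 1 / pmf ?p x" .
    then have "ln (r J \<theta> x) \<le> ln (1 / pmf ?p x)" using r_half[of J \<theta> x] p by (subst ln_le_cancel_iff) auto
    moreover have "ln (1 / 2) \<le> ln (r J \<theta> x)" using r_half[of J \<theta> x] by (subst ln_le_cancel_iff) auto
    moreover have "ln (1 / pmf ?p x) = - ln (pmf ?p x)" "ln (1 / 2 :: real) = - ln 2" using p by (simp_all add: ln_divide_pos)
    moreover have "ln (pmf ?p x) \<le> 0" "0 \<le> ln (2::real)" using p by simp_all
    ultimately show ?thesis by linarith
  qed
  \<comment> \<open>The score of the true position at time \<open>n\<close>, evaluated at the true
    position at time \<open>t\<close>; \<open>G'\<close> is its limit along the path.\<close>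
  define G where "G t \<xi> = f (X n \<xi>) (u (X n \<xi>) (X t \<xi>))" for t \<xi>
  define G' where "G' \<xi> = f (X n \<xi>) (lim (\<lambda>t. u (X n \<xi>) (X t \<xi>)))" for \<xi>
  have G_meas [measurable]: "G t \<in> borel_measurable w.S" for t
    unfolding G_def[abs_def] by (rule two_time_meas[of "\<lambda>x l. f x (u x l)"])
  have G'_meas [measurable]: "G' \<in> borel_measurable w.S"
  proof -
    have [measurable]: "(\<lambda>\<xi>. u (X n \<xi>) (X t \<xi>)) \<in> borel_measurable w.S" for t by (rule two_time_meas)
    have [measurable]: "(\<lambda>\<xi>. pmf ?p (X n \<xi>)) \<in> borel_measurable w.S" by (rule two_time_meas[of "\<lambda>x l. pmf ?p x"])
    show ?thesis unfolding G'_def[abs_def] f_def by measurable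
  qed
  have conv: "AE \<xi> in w.S. convergent (\<lambda>t. u (X n \<xi>) (X t \<xi>))"
  proof -
    have "AE \<eta> in bs.S. \<forall>x\<in>set_pmf ?p. convergent (\<lambda>t. u x (bs.Y t \<eta>))"
      unfolding AE_ball_countable[OF countable_set_pmf]
    proof
      fix x
      show "AE \<eta> in bs.S. convergent (\<lambda>t. u x (bs.Y t \<eta>))"
        by (rule bs.harmonic_converges[of "u x" n]) (simp add: u0 u1, rule harm)
    qed
    from base_AE[OF this] have "AE \<xi> in w.S. \<forall>x\<in>set_pmf ?p. convergent (\<lambda>t. u x (X t \<xi>))" by (simp only: X_base)
    with AE_X show ?thesis by eventually_elim blast
  qed
  have G_lim: "AE \<xi> in w.S. (\<lambda>t. G t \<xi>) \<longlonglongrightarrow> G' \<xi> \<and> 0 \<le> G' \<xi> \<and> G' \<xi> \<le> bnd \<xi>"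
    using conv AE_X
  proof eventually_elim
    fix \<xi> assume cv: "convergent (\<lambda>t. u (X n \<xi>) (X t \<xi>))" and x: "X n \<xi> \<in> set_pmf ?p"
    let ?v = "lim (\<lambda>t. u (X n \<xi>) (X t \<xi>))"
    have L: "(\<lambda>t. u (X n \<xi>) (X t \<xi>)) \<longlonglongrightarrow> ?v" using cv by (simp add: convergent_LIMSEQ_iff)
    have v: "0 \<le> ?v" "?v \<le> 1"
      by (rule LIMSEQ_le_const[OF L], use u0 in blast) (rule LIMSEQ_le_const2[OF L], use u1 in blast)
    have "0 < 1 + ?v / pmf ?p (X n \<xi>)" using v by (intro add_pos_nonneg) auto
    then have "(\<lambda>t. G t \<xi>) \<longlonglongrightarrow> G' \<xi>" unfolding G_def G'_def f_def
      by (intro tendsto_intros L) (use x in \<open>auto simp: set_pmf_iff\<close>)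
    moreover have "0 \<le> ln (2 * ?c)" using c by simp
    ultimately show "(\<lambda>t. G t \<xi>) \<longlonglongrightarrow> G' \<xi> \<and> 0 \<le> G' \<xi> \<and> G' \<xi> \<le> bnd \<xi>"
      using f_bnd[OF x v] unfolding bnd_def G'_def by linarith
  qed
  have G'_int: "integrable w.S G'"
    by (rule Bochner_Integration.integrable_bound[OF bnd_int G'_meas]) (use G_lim in \<open>eventually_elim, auto\<close>)
  \<comment> \<open>The limit required by \<open>lim\<close> exists by convergence of
    \<open>u\<close> along paths and dominated convergence with \<open>bnd\<close>.\<close>
  have nh: "real n * h \<le> (\<integral>\<xi>. G' \<xi> \<partial>w.S)"
  proof (rule lim)
    have "(\<lambda>t. \<integral>\<xi>. G t \<xi> \<partial>w.S) \<longlonglongrightarrow> (\<integral>\<xi>. G' \<xi> \<partial>w.S)"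
    proof (rule integral_dominated_convergence[where w = bnd])
      show "AE \<xi> in w.S. (\<lambda>t. G t \<xi>) \<longlonglongrightarrow> G' \<xi>" using G_lim by eventually_elim simp
      show "AE \<xi> in w.S. norm (G t \<xi>) \<le> bnd \<xi>" for t
        using AE_X
      proof eventually_elim
        fix \<xi> assume x: "X n \<xi> \<in> set_pmf ?p"
        have "0 \<le> ln (2 * ?c)" using c by simp
        moreover have "0 \<le> G t \<xi> \<and> G t \<xi> \<le> ln 2 - ln (pmf ?p (X n \<xi>))"
          unfolding G_def by (rule f_bnd[OF x u0 u1])
        ultimately show "norm (G t \<xi>) \<le> bnd \<xi>" unfolding bnd_def real_norm_def by linarith
      qed
    qed (use bnd_int in auto)
    then have "(\<lambda>j. \<integral>\<xi>. G (n + j) \<xi> \<partial>w.S) \<longlonglongrightarrow> (\<integral>\<xi>. G' \<xi> \<partial>w.S)"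
      by (subst add.commute) (rule LIMSEQ_ignore_initial_segment)
    moreover have "(\<integral>\<xi>. G (n + j) \<xi> \<partial>w.S) =
        measure_pmf.expectation (pair_pmf ?p (bs.P j)) (\<lambda>(x, l). ln (1 + u x (x \<otimes>\<^bsub>\<Lambda>\<^esub> l) / pmf ?p x))" for j
      unfolding G_def f_def
      by (rule two_time_expectation[of "\<lambda>x l. ln (1 + u x l / pmf ?p x)"]) (simp add: u0)
    ultimately show "(\<lambda>j. measure_pmf.expectation (pair_pmf ?p (bs.P j)) (\<lambda>(x, l). ln (1 + u x (x \<otimes>\<^bsub>\<Lambda>\<^esub> l) / pmf ?p x)))
      \<longlonglongrightarrow> (\<integral>\<xi>. G' \<xi> \<partial>w.S)" by simp
  qed
  \<comment> \<open>For large \<open>J\<close> one summand of \<open>r\<close> is evaluated at a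
    late position \<open>X t\<close>, so the first term is at least \<open>G t\<close>. The other
    \<open>b\<close> may make it larger; the cap at \<open>G'\<close> turns this one-sided bound
    into convergence.\<close>
  define K where "K J \<xi> = min (ln (r J (bd.\<beta> \<xi>) (X n \<xi>)) + ln (2 * ?c)) (G' \<xi>)" for J \<xi>
  have R_meas [measurable]: "(\<lambda>\<xi>. r J (bd.\<beta> \<xi>) (X n \<xi>)) \<in> borel_measurable w.S" for J
    by (rule bd.joint_meas[of "\<lambda>y \<theta>. r J \<theta> (snd y)"]) (rule r_meas)
  have lnr: "AE \<xi> in w.S. \<bar>ln (r J (bd.\<beta> \<xi>) (X n \<xi>))\<bar> + ln (2 * ?c) \<le> bnd \<xi>" for J
    using AE_X by eventually_elim (use r_bnd[of _ J] in \<open>force simp: bnd_def\<close>)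
  have R_int: "integrable w.S (\<lambda>\<xi>. ln (r J (bd.\<beta> \<xi>) (X n \<xi>)))" for J
  proof (rule Bochner_Integration.integrable_bound[OF bnd_int])
    have "0 \<le> ln (2 * ?c)" using c by simp
    with lnr[of J] show "AE \<xi> in w.S. norm (ln (r J (bd.\<beta> \<xi>) (X n \<xi>))) \<le> norm (bnd \<xi>)"
      by (auto elim!: AE_mp)
  qed measurable
  have "(\<lambda>J. \<integral>\<xi>. K J \<xi> \<partial>w.S) \<longlonglongrightarrow> (\<integral>\<xi>. G' \<xi> \<partial>w.S)"
  proof (rule integral_dominated_convergence[where w = bnd])
    show "AE \<xi> in w.S. (\<lambda>J. K J \<xi>) \<longlonglongrightarrow> G' \<xi>"
      using G_lim AE_good AE_infinite_lit
    proof eventually_elim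
      fix \<xi> assume L: "(\<lambda>t. G t \<xi>) \<longlonglongrightarrow> G' \<xi> \<and> 0 \<le> G' \<xi> \<and> G' \<xi> \<le> bnd \<xi>"
        and g: "good \<xi>" and inf: "infinite {z \<in> carrier \<Lambda>. bd.\<beta> \<xi> z \<noteq> \<one>\<^bsub>L\<^esub>}"
      show "(\<lambda>J. K J \<xi>) \<longlonglongrightarrow> G' \<xi>"
      proof (rule LIMSEQ_I)
        fix e :: real assume e: "0 < e"
        obtain s0 where s0: "\<And>t. s0 \<le> t \<Longrightarrow> \<bar>G t \<xi> - G' \<xi>\<bar> < e" using LIMSEQ_D[OF conjunct1[OF L] e] by auto
        obtain J0 where J0: "\<And>J. J0 \<le> J \<Longrightarrow> \<exists>t\<ge>s0. \<exists>b\<in>B. zJ J (bd.\<beta> \<xi>) \<otimes>\<^bsub>\<Lambda>\<^esub> inv\<^bsub>\<Lambda>\<^esub> b = X t \<xi>"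
          using zJ_visited[OF g inf] by blast
        have "\<bar>K J \<xi> - G' \<xi>\<bar> < e" if J: "J0 \<le> J" for J
        proof -
          obtain t b where t: "s0 \<le> t" "b \<in> B" "zJ J (bd.\<beta> \<xi>) \<otimes>\<^bsub>\<Lambda>\<^esub> inv\<^bsub>\<Lambda>\<^esub> b = X t \<xi>" using J0[OF J] by blast
          let ?x = "X n \<xi>" and ?\<theta> = "bd.\<beta> \<xi>"
          have "(\<Sum>b\<in>{b}. (1 + u ?x (zJ J ?\<theta> \<otimes>\<^bsub>\<Lambda>\<^esub> inv\<^bsub>\<Lambda>\<^esub> b) / pmf ?p ?x) / (2 * ?c)) \<le> r J ?\<theta> ?x"
            unfolding r_def using t(2) term0[of ?x] c by (intro sum_mono2[OF finite_B]) (auto intro!: divide_nonneg_nonneg add_nonneg_nonneg)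
          then have le: "(1 + u ?x (X t \<xi>) / pmf ?p ?x) \<le> r J ?\<theta> ?x * (2 * ?c)" using t(3) c by (simp add: field_simps)
          have p1: "0 < 1 + u ?x (X t \<xi>) / pmf ?p ?x" using term0[of ?x "X t \<xi>"] by linarith
          have rp: "0 < r J ?\<theta> ?x" using r_half[of J ?\<theta> ?x] by linarith
          have "G t \<xi> \<le> ln (r J ?\<theta> ?x * (2 * ?c))" unfolding G_def f_def
            using le p1 rp c by (subst ln_le_cancel_iff) auto
          also have "\<dots> = ln (r J ?\<theta> ?x) + ln (2 * ?c)" using rp c by (intro ln_mult_pos) auto
          finally show ?thesis using s0[OF t(1)] e unfolding K_def by linarith
        qed
        then show "\<exists>no. \<forall>J\<ge>no. norm (K J \<xi> - G' \<xi>) < e" by (auto intro!: exI[of _ J0])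
      qed
    qed
    show "AE \<xi> in w.S. norm (K J \<xi>) \<le> bnd \<xi>" for J
      using lnr[of J] G_lim
    proof eventually_elim
      fix \<xi> assume *: "\<bar>ln (r J (bd.\<beta> \<xi>) (X n \<xi>))\<bar> + ln (2 * ?c) \<le> bnd \<xi>" "(\<lambda>t. G t \<xi>) \<longlonglongrightarrow> G' \<xi> \<and> 0 \<le> G' \<xi> \<and> G' \<xi> \<le> bnd \<xi>"
      have "0 \<le> ln (2 * ?c)" using c by simp
      then show "norm (K J \<xi>) \<le> bnd \<xi>" using * unfolding K_def real_norm_def by linarith
    qed
  qed (use bnd_int in \<open>auto simp: K_def\<close>)
  \<comment> \<open>A loss bounded independently of \<open>n\<close> is harmless, so a finite
    \<open>J\<close> within 1 of the limit suffices. This is the summand 1 in the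
    conclusion.\<close>
  then have "\<forall>\<^sub>F J in sequentially. (\<integral>\<xi>. G' \<xi> \<partial>w.S) - 1 < (\<integral>\<xi>. K J \<xi> \<partial>w.S)" by (rule order_tendstoD) simp
  then obtain J where J: "(\<integral>\<xi>. G' \<xi> \<partial>w.S) - 1 < (\<integral>\<xi>. K J \<xi> \<partial>w.S)" by (auto simp: eventually_sequentially)
  have "(\<integral>\<xi>. K J \<xi> \<partial>w.S) \<le> (\<integral>\<xi>. ln (r J (bd.\<beta> \<xi>) (X n \<xi>)) + ln (2 * ?c) \<partial>w.S)"
    by (rule integral_mono) (use R_int G'_int in \<open>auto simp: K_def\<close>)
  also have "\<dots> = (\<integral>\<xi>. ln (r J (bd.\<beta> \<xi>) (X n \<xi>)) \<partial>w.S) + ln (2 * ?c)"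
    using R_int[of J] by (simp add: w.seq.P.prob_space)
  finally have "(\<integral>\<xi>. - ln (r J (bd.\<beta> \<xi>) (X n \<xi>)) \<partial>w.S) \<le> ln (2 * ?c) - real n * h + 1"
    using J nh by simp
  then show ?thesis by (intro that[of "r J"] r_meas r_half r_sum R_int)
qed

text \<open>A product law on configurations that are trivial off \<open>A \<union> A'\<close>: on
  \<open>A\<close> the lamp copies \<theta> with probability \<open>1 - \<delta>\<close> and is
  resampled uniformly otherwise, on the rest of \<open>A'\<close> it is uniform. Mixing in the
  uniform law keeps all weights positive.\<close>

definition config_weight :: "real \<Rightarrow> 'g set \<Rightarrow> 'g set \<Rightarrow> ('g \<Rightarrow> 'l) \<Rightarrow> ('g \<Rightarrow> 'l) \<Rightarrow> real" where
  "config_weight \<delta> A A' \<theta> \<phi> = (\<Prod>z\<in>A \<union> A'.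
    if z \<in> A then \<delta> / real (card (carrier L)) + (1 - \<delta>) * of_bool (\<phi> z = \<theta> z) else 1 / real (card (carrier L)))"

lemma card_L: "1 < real (card (carrier L))"
proof -
  have "card {\<one>\<^bsub>L\<^esub>} < card (carrier L)" using L_nontriv L_finite by (intro psubset_card_mono) auto
  then show ?thesis by simp
qed

text \<open>Such configurations are determined by their restriction to \<open>A \<union> A'\<close>,
  and the sum over restrictions factors over sites. Each factor is at most 1, and may be smaller
  since \<open>\<theta> z\<close> is not assumed to lie in \<open>carrier L\<close>.\<close>

lemma config_weight_sum:
  assumes \<delta>: "0 < \<delta>" "\<delta> < 1" and A: "finite A" "finite A'" "A \<union> A' \<subseteq> carrier \<Lambda>"
    and F: "finite F" "F \<subseteq> {\<phi> \<in> carrier \<Lambda> \<rightarrow>\<^sub>E carrier L. \<forall>z\<in>carrier \<Lambda> - (A \<union> A'). \<phi> z = \<one>\<^bsub>L\<^esub>}"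
  shows "(\<Sum>\<phi>\<in>F. config_weight \<delta> A A' \<theta> \<phi>) \<le> 1"
proof -
  let ?T = "A \<union> A'" and ?l = "real (card (carrier L))"
  define v where "v z l = (if z \<in> A then \<delta> / ?l + (1 - \<delta>) * of_bool (l = \<theta> z) else 1 / ?l)" for z l
  have v0: "0 \<le> v z l" for z l using \<delta> by (simp add: v_def)
  have vsum: "(\<Sum>l\<in>carrier L. v z l) \<le> 1" for z
  proof (cases "z \<in> A")
    case True
    define t :: real where "t = (\<Sum>l\<in>carrier L. of_bool (l = \<theta> z))"
    have "t \<le> 1" using L_finite by (simp add: t_def of_bool_def)
    then have le: "(1 - \<delta>) * t \<le> 1 - \<delta>" by (rule mult_left_le) (use \<delta> in simp)
    have "(\<Sum>l\<in>carrier L. v z l) = \<delta> + (1 - \<delta>) * t"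
      using True card_L by (simp add: v_def t_def sum.distrib sum_distrib_left)
    also have "\<dots> \<le> \<delta> + (1 - \<delta>)" by (rule add_left_mono[OF le])
    finally show ?thesis by simp
  qed (use card_L in \<open>simp add: v_def\<close>)
  have inj: "inj_on (\<lambda>\<phi>. restrict \<phi> ?T) F"
  proof (rule inj_onI)
    fix \<phi> \<psi> assume a: "\<phi> \<in> F" "\<psi> \<in> F" and eq: "restrict \<phi> ?T = restrict \<psi> ?T"
    show "\<phi> = \<psi>"
    proof
      fix z
      have E: "\<phi> \<in> extensional (carrier \<Lambda>)" "\<psi> \<in> extensional (carrier \<Lambda>)" using a F(2) by (auto simp: PiE_def)
      consider "z \<in> ?T" | "z \<in> carrier \<Lambda> - ?T" | "z \<notin> carrier \<Lambda>" by blast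
      then show "\<phi> z = \<psi> z"
      proof cases
        case 1
        then show ?thesis using fun_cong[OF eq, of z] by simp
      next
        case 2
        then have "\<phi> z = \<one>\<^bsub>L\<^esub>" "\<psi> z = \<one>\<^bsub>L\<^esub>" using a F(2) by blast+
        then show ?thesis by simp
      next
        case 3
        then show ?thesis using E by (simp add: extensional_def)
      qed
    qed
  qed
  have "(\<Sum>\<phi>\<in>F. config_weight \<delta> A A' \<theta> \<phi>) = (\<Sum>\<phi>\<in>F. \<Prod>z\<in>?T. v z (restrict \<phi> ?T z))"
    unfolding config_weight_def v_def by (intro sum.cong prod.cong refl) auto
  also have "\<dots> = (\<Sum>\<psi>\<in>(\<lambda>\<phi>. restrict \<phi> ?T) ` F. \<Prod>z\<in>?T. v z (\<psi> z))"
    by (subst sum.reindex[OF inj]) simp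
  also have "\<dots> \<le> (\<Sum>\<psi>\<in>PiE ?T (\<lambda>_. carrier L). \<Prod>z\<in>?T. v z (\<psi> z))"
  proof (rule sum_mono2)
    show "finite (PiE ?T (\<lambda>_. carrier L))" using A L_finite by (intro finite_PiE) auto
    have "\<phi> z \<in> carrier L" if "\<phi> \<in> F" "z \<in> ?T" for \<phi> z
    proof -
      have "\<phi> \<in> carrier \<Lambda> \<rightarrow>\<^sub>E carrier L" "z \<in> carrier \<Lambda>" using that F(2) A(3) by blast+
      then show ?thesis by (rule PiE_mem)
    qed
    then show "(\<lambda>\<phi>. restrict \<phi> ?T) ` F \<subseteq> PiE ?T (\<lambda>_. carrier L)"
      by (intro image_subsetI restrict_PiE_iff[THEN iffD2] ballI)
  qed (simp add: prod_nonneg v0)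
  also have "\<dots> = (\<Prod>z\<in>?T. \<Sum>l\<in>carrier L. v z l)"
    by (rule prod_sum_PiE[symmetric]) (use A L_finite in auto)
  also have "\<dots> \<le> 1" by (rule prod_le_1) (simp add: sum_nonneg v0 vsum)
  finally show ?thesis .
qed

text \<open>The length is additive over sites: a correct prediction on \<open>A\<close> costs at
  most \<open>- ln (1 - \<delta>)\<close>, a wrong one
  \<open>ln (card (carrier L) / \<delta>)\<close>, and a uniformly coded lamp
  \<open>ln (card (carrier L))\<close>.\<close>

lemma config_weight_cost:
  assumes \<delta>: "0 < \<delta>" "\<delta> < 1" and A: "finite A" "finite A'"
  shows "0 < config_weight \<delta> A A' \<theta> \<phi>"
    and "- ln (config_weight \<delta> A A' \<theta> \<phi>) \<le> - ln (1 - \<delta>) * real (card A)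
      + ln (real (card (carrier L)) / \<delta>) * real (card {z \<in> A. \<phi> z \<noteq> \<theta> z}) + ln (real (card (carrier L))) * real (card A')"
proof -
  let ?T = "A \<union> A'" and ?l = "real (card (carrier L))"
  define v where "v z = (if z \<in> A then \<delta> / ?l + (1 - \<delta>) * of_bool (\<phi> z = \<theta> z) else 1 / ?l)" for z
  have l: "1 < ?l" by (rule card_L)
  have v: "0 < v z" for z using \<delta> l by (auto simp: v_def add_pos_nonneg)
  have cw: "config_weight \<delta> A A' \<theta> \<phi> = (\<Prod>z\<in>?T. v z)" unfolding config_weight_def v_def ..
  show "0 < config_weight \<delta> A A' \<theta> \<phi>" unfolding cw by (rule prod_pos) (simp add: v)
  let ?c = "\<lambda>z. - ln (1 - \<delta>) * indicator A z + ln (?l / \<delta>) * indicator {z \<in> A. \<phi> z \<noteq> \<theta> z} z + ln ?l * indicator A' z"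
  have p1: "0 \<le> - ln (1 - \<delta>)" using \<delta> by simp
  have p2: "0 \<le> ln (?l / \<delta>)" using \<delta> l by (simp add: field_simps)
  have p3: "0 \<le> ln ?l" using l by simp
  have step: "- ln (v z) \<le> ?c z" if z: "z \<in> ?T" for z
  proof (cases "z \<in> A")
    case True
    show ?thesis
    proof (cases "\<phi> z = \<theta> z")
      case eq: True
      have "ln (1 - \<delta>) \<le> ln (v z)" using True eq \<delta> l v[of z] by (subst ln_le_cancel_iff) (auto simp: v_def)
      then show ?thesis using True eq p3 by (simp split: split_indicator)
    next
      case False
      have "ln (?l / \<delta>) = - ln (\<delta> / ?l)" using \<delta> l by (simp add: ln_divide_pos)
      then show ?thesis using True False p1 p3 by (simp add: v_def split: split_indicator)
    qed
  next
    case False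
    then have "v z = 1 / ?l" "z \<in> A'" using z by (auto simp: v_def)
    then show ?thesis using False l by (simp add: ln_divide_pos)
  qed
  have "- ln (config_weight \<delta> A A' \<theta> \<phi>) = (\<Sum>z\<in>?T. - ln (v z))"
    unfolding cw using A v[THEN less_imp_neq] by (subst ln_prod) (auto simp: sum_negf)
  also have "\<dots> \<le> (\<Sum>z\<in>?T. ?c z)" by (rule sum_mono) (rule step)
  also have "\<dots> = - ln (1 - \<delta>) * (\<Sum>z\<in>?T. indicator A z) + ln (?l / \<delta>) * (\<Sum>z\<in>?T. indicator {z \<in> A. \<phi> z \<noteq> \<theta> z} z) + ln ?l * (\<Sum>z\<in>?T. indicator A' z)"
    by (simp only: sum.distrib sum_distrib_left)
  also have "\<dots> = - ln (1 - \<delta>) * real (card A) + ln (?l / \<delta>) * real (card {z \<in> A. \<phi> z \<noteq> \<theta> z}) + ln ?l * real (card A')"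
  proof -
    have "(\<Sum>z\<in>?T. indicator D z :: real) = real (card D)" if "D \<subseteq> ?T" for D
      using A that by (subst sum.mono_neutral_cong_right[of ?T D _ "\<lambda>_. 1"]) auto
    then show ?thesis by (simp only: Un_upper1 Un_upper2 subset_trans[OF Collect_restrict Un_upper1])
  qed
  finally show "- ln (config_weight \<delta> A A' \<theta> \<phi>) \<le> - ln (1 - \<delta>) * real (card A)
      + ln (?l / \<delta>) * real (card {z \<in> A. \<phi> z \<noteq> \<theta> z}) + ln ?l * real (card A')" .
qed

abbreviation "pp c j \<equiv> partial_product \<Lambda> (\<lambda>i. fst (c i)) j"

text \<open>The displacements of a random code word multiply to the base walk at time
  \<open>k * m\<close>. This makes the mean of the score over code words its mean over the base
  position, which \<open>exit_score\<close> normalises.\<close>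

lemma pp_law:
  assumes "map_pmf fst cp = bs.P m"
  shows "map_pmf (\<lambda>c. pp c k) (Pi_pmf {..<k} d (\<lambda>_. cp)) = bs.P (k * m)"
proof (induction k)
  case (Suc k)
  have pu: "pp (c(k := x)) (Suc k) = pp c k \<otimes>\<^bsub>\<Lambda>\<^esub> fst x" for c x
  proof -
    have "pp (c(k := x)) k = pp c k" by (rule bs.Y_cong) simp
    then show ?thesis by (simp only: partial_product.simps fun_upd_same)
  qed
  have "map_pmf (\<lambda>c. pp c (Suc k)) (Pi_pmf {..<Suc k} d (\<lambda>_. cp)) =
      map_pmf (\<lambda>(x, c). pp c k \<otimes>\<^bsub>\<Lambda>\<^esub> fst x) (pair_pmf cp (Pi_pmf {..<k} d (\<lambda>_. cp)))"
    by (subst lessThan_Suc, subst Pi_pmf_insert)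
      (auto simp: map_pmf_comp case_prod_beta' pu simp del: partial_product.simps fun_upd_apply)
  also have "\<dots> = bind_pmf cp (\<lambda>x. bind_pmf (Pi_pmf {..<k} d (\<lambda>_. cp)) (\<lambda>c. return_pmf (pp c k \<otimes>\<^bsub>\<Lambda>\<^esub> fst x)))"
    by (simp add: pair_pmf_def map_bind_pmf)
  also have "\<dots> = bind_pmf (Pi_pmf {..<k} d (\<lambda>_. cp)) (\<lambda>c. bind_pmf cp (\<lambda>x. return_pmf (pp c k \<otimes>\<^bsub>\<Lambda>\<^esub> fst x)))"
    by (rule bind_commute_pmf)
  also have "\<dots> = conv_pmf \<Lambda> (map_pmf (\<lambda>c. pp c k) (Pi_pmf {..<k} d (\<lambda>_. cp))) (map_pmf fst cp)"
    by (simp add: conv_pmf_bind bind_map_pmf map_pmf_comp) (simp add: map_pmf_def)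
  also have "\<dots> = bs.P (k * m + m)" using Suc.IH assms by (simp add: bs.walk_add)
  finally show ?case by (simp add: add.commute)
qed simp

lemma integrable_advance:
  fixes F :: "('g \<Rightarrow> 'l) \<times> 'g \<Rightarrow> real"
  shows "integrable w.S (\<lambda>\<xi>. F (w.Y m (w.advance i \<xi>))) \<longleftrightarrow> integrable (measure_pmf (w.P m)) F"
    and "(\<integral>\<xi>. F (w.Y m (w.advance i \<xi>)) \<partial>w.S) = measure_pmf.expectation (w.P m) F"
proof -
  have "integrable (distr w.S w.S (w.advance i)) (\<lambda>\<xi>. F (w.Y m \<xi>)) \<longleftrightarrow> integrable w.S (\<lambda>\<xi>. F (w.Y m (w.advance i \<xi>)))"
    by (rule integrable_distr_eq[OF w.measurable_advance w.measurable_fun_Y])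
  then show "integrable w.S (\<lambda>\<xi>. F (w.Y m (w.advance i \<xi>))) \<longleftrightarrow> integrable (measure_pmf (w.P m)) F"
    by (simp only: w.distr_advance w.integrable_Y(1))
  have "(\<integral>\<xi>. F (w.Y m \<xi>) \<partial>distr w.S w.S (w.advance i)) = (\<integral>\<xi>. F (w.Y m (w.advance i \<xi>)) \<partial>w.S)"
    by (rule integral_distr[OF w.measurable_advance w.measurable_fun_Y])
  then show "(\<integral>\<xi>. F (w.Y m (w.advance i \<xi>)) \<partial>w.S) = measure_pmf.expectation (w.P m) F"
    by (simp only: w.distr_advance w.integrable_Y(2))
qed

lemma supp_blocks:
  assumes sp: "\<xi> \<in> space w.S"
  shows "supp (\<Phi> (k * m) \<xi>) \<subseteq> (\<Union>j<k. (\<lambda>q. X (j * m) \<xi> \<otimes>\<^bsub>\<Lambda>\<^esub> q) ` supp (fst (w.Y m (w.advance (j * m) \<xi>))))"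
proof (induction k)
  case 0
  then show ?case by (simp add: one_\<Gamma> supp_def lamp_id_def)
next
  case (Suc k)
  have "w.Y (Suc k * m) \<xi> = w.Y (k * m) \<xi> \<otimes>\<^bsub>\<Gamma>\<^esub> w.Y m (w.advance (k * m) \<xi>)"
    using w.Y_shift[OF sp, of "k * m" m] by (simp add: add.commute)
  then have "supp (\<Phi> (Suc k * m) \<xi>) \<subseteq> supp (\<Phi> (k * m) \<xi>) \<union> (\<lambda>q. X (k * m) \<xi> \<otimes>\<^bsub>\<Lambda>\<^esub> q) ` supp (fst (w.Y m (w.advance (k * m) \<xi>)))"
    using supp_mult[OF w.Y_closed[OF sp, of "k * m"] w.Y_closed[OF w.advance_space[OF sp, of "k * m"], of m]] by simp
  then show ?case using Suc.IH unfolding lessThan_Suc by blast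
qed

text \<open>The code word \<open>c\<close> lists the block displacements and the exceptional block increments.  \<open>A c\<close> contains the
  sites reachable by ordinary blocks, where \<open>\<Phi> n\<close> is predicted by \<open>\<theta>\<close> with error rate \<open>\<delta>\<close>, and \<open>A' c\<close> those of
  exceptional blocks, where it is coded uniformly.\<close>

lemma code_bound:
  fixes QQ :: "(('g \<Rightarrow> 'l) \<times> 'g) set" and m k :: nat
  defines "s \<equiv> (\<lambda>\<eta>. if \<eta> \<in> QQ then None else Some \<eta>)"
  defines "Q \<equiv> (\<Union>\<eta>\<in>QQ. supp (fst \<eta>))"
  assumes h: "\<And>m. real m * h \<le> ent (bs.P m)" and QQ: "finite QQ" "QQ \<subseteq> set_pmf (w.P m)" and \<delta>: "0 < \<delta>" "\<delta> < 1"
  shows "ent (w.P (k * m)) - bd.I (k * m) \<le>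
    real k * (ent (bs.P m) + ent (map_pmf s (w.P m)) + ln (real (card (carrier L))) * (real (m * card B) * measure (w.P m) (- QQ)))
    + (ln (2 * real (card B)) - real (k * m) * h + 1)
    + - ln (1 - \<delta>) * real (k * card Q) + ln (real (card (carrier L)) / \<delta>) * (\<Sum>j<k. \<Sum>q\<in>Q. H q ((k - j) * m))"
proof -
  let ?n = "k * m" and ?l = "real (card (carrier L))"
  define sp where "sp = map_pmf s (w.P m)"
  \<comment> \<open>Displacement and symbol are correlated in the actual walk but coded as if
    independent; a code only has to have total mass at most 1, and the loss is at most the small
    entropy of the symbol.\<close>
  define cp where "cp = pair_pmf (bs.P m) sp"
  define d :: "'g \<times> (('g \<Rightarrow> 'l) \<times> 'g) option" where "d = undefined"
  define Cp where "Cp = Pi_pmf {..<k} d (\<lambda>_. cp)"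
  define \<eta> where "\<eta> j \<xi> = w.Y m (w.advance (j * m) \<xi>)" for j \<xi>
  define C where "C \<xi> j = (if j < k then (snd (\<eta> j \<xi>), s (\<eta> j \<xi>)) else d)" for \<xi> j
  \<comment> \<open>The intersection with \<open>carrier \<Lambda>\<close>, and in \<open>A'\<close>
    the restriction to possible increments, make both sets finite subsets of the base group for
    every word \<open>c\<close>, including words that never occur.\<close>
  define A where "A c = carrier \<Lambda> \<inter> (\<Union>j<k. (\<lambda>q. pp c j \<otimes>\<^bsub>\<Lambda>\<^esub> q) ` Q)" for c :: "nat \<Rightarrow> 'g \<times> (('g \<Rightarrow> 'l) \<times> 'g) option"
  define A' where "A' c = carrier \<Lambda> \<inter> (\<Union>j<k. case snd (c j) of None \<Rightarrow> {} | Some y \<Rightarrow> if y \<in> set_pmf (w.P m) then (\<lambda>q. pp c j \<otimes>\<^bsub>\<Lambda>\<^esub> q) ` supp (fst y) else {})"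
    for c :: "nat \<Rightarrow> 'g \<times> (('g \<Rightarrow> 'l) \<times> 'g) option"
  define V where "V c = {y. fst y \<in> carrier \<Lambda> \<rightarrow>\<^sub>E carrier L \<and> (\<forall>z\<in>carrier \<Lambda> - (A c \<union> A' c). fst y z = \<one>\<^bsub>L\<^esub>) \<and> snd y = pp c k}" for c
  obtain r where r_meas: "\<And>x. (\<lambda>\<theta>. r \<theta> x) \<in> borel_measurable N" and r_half: "\<And>\<theta> x. 1 / 2 \<le> r \<theta> x"
    and r_sum: "\<And>\<theta>. (\<integral>\<^sup>+x. ennreal (pmf (bs.P ?n) x * r \<theta> x) \<partial>count_space (set_pmf (bs.P ?n))) \<le> 1"
    and r_int: "integrable w.S (\<lambda>\<xi>. ln (r (bd.\<beta> \<xi>) (X ?n \<xi>)))"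
    and r_le: "(\<integral>\<xi>. - ln (r (bd.\<beta> \<xi>) (X ?n \<xi>)) \<partial>w.S) \<le> ln (2 * real (card B)) - real ?n * h + 1"
    by (rule exit_score[OF h, of ?n]) (rule that, assumption+)
  have r0: "0 < r \<theta> x" for \<theta> x using r_half[of \<theta> x] by linarith
  \<comment> \<open>The prior of the code word, corrected by the score of the base position it
    encodes, times the law of the lamps given the word. The correction recovers the cost
    \<open>h n\<close> from \<theta>.\<close>
  define wt where "wt \<theta> c y = pmf Cp c * r \<theta> (pp c k) * (if y \<in> V c then config_weight \<delta> (A c) (A' c) \<theta> (fst y) else 0)" for \<theta> c y
  have finQ: "finite Q" using QQ supp_walk by (auto simp: Q_def)
  have finA: "finite (A c)" for c using finQ by (simp add: A_def)
  have finA': "finite (A' c)" for c using supp_walk by (auto simp: A'_def split: option.split)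
  have l1: "1 < ?l" by (rule card_L)
  have cw0: "0 < config_weight \<delta> (A c) (A' c) \<theta> \<phi>" for c \<theta> \<phi>
    by (rule config_weight_cost(1)[OF \<delta> finA finA'])
  have wt_nn: "0 \<le> wt \<theta> c y" for \<theta> c y
    using r0[of \<theta> "pp c k"] cw0[of c \<theta> "fst y"] by (simp add: wt_def)
  have wt_meas: "(\<lambda>\<theta>. wt \<theta> c y) \<in> borel_measurable N" for c y
  proof -
    have "(\<lambda>\<theta>. config_weight \<delta> (A c) (A' c) \<theta> (fst y)) \<in> borel_measurable N"
      unfolding config_weight_def
    proof (rule borel_measurable_prod)
      fix z assume "z \<in> A c \<union> A' c"
      then have z: "z \<in> carrier \<Lambda>" by (auto simp: A_def A'_def)
      have "(\<lambda>\<theta>. \<theta> z) \<in> N \<rightarrow>\<^sub>M count_space (carrier L)"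
        unfolding meas_N by (rule measurable_component_singleton[OF z])
      then have "(\<lambda>\<theta>. (\<lambda>l. if z \<in> A c then \<delta> / ?l + (1 - \<delta>) * of_bool (fst y z = l) else 1 / ?l) (\<theta> z)) \<in> borel_measurable N"
        by (rule measurable_compose) simp
      then show "(\<lambda>\<theta>. if z \<in> A c then \<delta> / ?l + (1 - \<delta>) * of_bool (fst y z = \<theta> z) else 1 / ?l) \<in> borel_measurable N" .
    qed
    then have "(\<lambda>\<theta>. (pmf Cp c * r \<theta> (pp c k)) * config_weight \<delta> (A c) (A' c) \<theta> (fst y)) \<in> borel_measurable N"
      by (rule borel_measurable_times[rotated]) (rule borel_measurable_times[OF borel_measurable_const], rule r_meas)
    then show ?thesis unfolding wt_def by (cases "y \<in> V c") (simp_all only: if_True if_False mult_zero_right borel_measurable_const)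
  qed
  have inner: "(\<integral>\<^sup>+y. ennreal (wt \<theta> c y) \<partial>count_space (set_pmf (w.P ?n))) \<le> ennreal (pmf Cp c) * ennreal (r \<theta> (pp c k))" for \<theta> c
  proof (rule nn_integral_count_space_le[OF countable_set_pmf])
    fix F :: "(('g \<Rightarrow> 'l) \<times> 'g) set" assume F: "finite F"
    let ?F = "fst ` (F \<inter> V c)"
    have inj: "inj_on fst (F \<inter> V c)" by (rule inj_onI) (auto simp: V_def prod_eq_iff)
    have "(\<Sum>y\<in>F. if y \<in> V c then config_weight \<delta> (A c) (A' c) \<theta> (fst y) else 0) = (\<Sum>y\<in>F \<inter> V c. config_weight \<delta> (A c) (A' c) \<theta> (fst y))"
      using F by (simp add: sum.inter_restrict)
    also have "\<dots> = (\<Sum>\<phi>\<in>?F. config_weight \<delta> (A c) (A' c) \<theta> \<phi>)" by (subst sum.reindex[OF inj]) simp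
    also have "\<dots> \<le> 1"
      by (rule config_weight_sum[OF \<delta> finA finA']) (use F in \<open>auto simp: V_def A_def A'_def\<close>)
    finally have le: "(\<Sum>y\<in>F. if y \<in> V c then config_weight \<delta> (A c) (A' c) \<theta> (fst y) else 0) \<le> 1" .
    have "(\<Sum>y\<in>F. ennreal (wt \<theta> c y)) = ennreal (\<Sum>y\<in>F. wt \<theta> c y)" by (rule sum_ennreal) (rule wt_nn)
    also have "(\<Sum>y\<in>F. wt \<theta> c y) = pmf Cp c * r \<theta> (pp c k) * (\<Sum>y\<in>F. if y \<in> V c then config_weight \<delta> (A c) (A' c) \<theta> (fst y) else 0)"
      unfolding wt_def sum_distrib_left ..
    also have "ennreal \<dots> \<le> ennreal (pmf Cp c * r \<theta> (pp c k))"
      by (rule ennreal_leI, rule mult_left_le[OF le]) (use r0[of \<theta> "pp c k"] in simp)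
    finally show "(\<Sum>y\<in>F. ennreal (wt \<theta> c y)) \<le> ennreal (pmf Cp c) * ennreal (r \<theta> (pp c k))"
      using r0[of \<theta> "pp c k"] by (simp add: ennreal_mult less_imp_le)
  qed
  \<comment> \<open>Summing the lamps out leaves the mean of the score over code words; by
    \<open>pp_law\<close> it is a mean over the base position at time \<open>k * m\<close>, at most
    1.\<close>
  have wt_sum: "(\<integral>\<^sup>+c. \<integral>\<^sup>+y. ennreal (wt \<theta> c y) \<partial>count_space (set_pmf (w.P ?n)) \<partial>count_space (set_pmf Cp)) \<le> 1" for \<theta>
  proof -
    have "(\<integral>\<^sup>+c. \<integral>\<^sup>+y. ennreal (wt \<theta> c y) \<partial>count_space (set_pmf (w.P ?n)) \<partial>count_space (set_pmf Cp)) \<le>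
        (\<integral>\<^sup>+c. ennreal (pmf Cp c) * ennreal (r \<theta> (pp c k)) \<partial>count_space (set_pmf Cp))"
      by (rule nn_integral_mono) (rule inner)
    also have "\<dots> = (\<integral>\<^sup>+c. ennreal (r \<theta> (pp c k)) \<partial>measure_pmf Cp)" by (rule nn_integral_set_pmf[symmetric])
    also have "\<dots> = (\<integral>\<^sup>+x. ennreal (r \<theta> x) \<partial>measure_pmf (map_pmf (\<lambda>c. pp c k) Cp))" by simp
    also have "map_pmf (\<lambda>c. pp c k) Cp = bs.P ?n"
      unfolding Cp_def by (rule pp_law) (simp add: cp_def map_fst_pair_pmf)
    also have "(\<integral>\<^sup>+x. ennreal (r \<theta> x) \<partial>measure_pmf (bs.P ?n)) = (\<integral>\<^sup>+x. ennreal (pmf (bs.P ?n) x * r \<theta> x) \<partial>count_space (set_pmf (bs.P ?n)))"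
      by (subst nn_integral_set_pmf, intro nn_integral_cong) (use r0 in \<open>simp add: ennreal_mult less_imp_le\<close>)
    also have "\<dots> \<le> 1" by (rule r_sum)
    finally show ?thesis .
  qed
  define T where "T j q \<xi> = (indicator {\<xi> \<in> space w.S. touched ?n (X (j * m) \<xi> \<otimes>\<^bsub>\<Lambda>\<^esub> q) \<xi>} \<xi> :: real)" for j q \<xi>
  \<comment> \<open>The cost of one block: its displacement, its symbol, and, if the block is
    exceptional, uniform coding of its at most \<open>m * card B\<close> lamps.\<close>
  define blk where "blk y = - ln (pmf (bs.P m) (snd y)) - ln (pmf sp (s y)) + ln ?l * (real (m * card B) * indicator (- QQ) y)" for y
  define g where "g \<xi> = (\<Sum>j<k. blk (\<eta> j \<xi>)) + - ln (r (bd.\<beta> \<xi>) (X ?n \<xi>)) + - ln (1 - \<delta>) * real (k * card Q)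
      + ln (?l / \<delta>) * (\<Sum>j<k. \<Sum>q\<in>Q. T j q \<xi>)" for \<xi>
  have Qc: "q \<in> carrier \<Lambda>" if "q \<in> Q" for q using that by (auto simp: Q_def supp_def)
  have jk: "j * m \<le> ?n" if "j < k" for j using that by simp
  have blk_int: "integrable (measure_pmf (w.P m)) blk"
    and blk_E: "measure_pmf.expectation (w.P m) blk = ent (bs.P m) + ent sp + ln ?l * (real (m * card B) * measure (w.P m) (- QQ))"
  proof -
    have f: "fin_ent (bs.P m)" "fin_ent sp" unfolding sp_def by (intro fin_ent_walk fin_ent_map fin_\<mu>b fin_\<mu>)+
    have i1: "integrable (measure_pmf (w.P m)) (\<lambda>y. ln (pmf (bs.P m) (snd y)))"
      using f(1) unfolding fin_ent_def walk_snd[symmetric] by (simp only: integrable_map_pmf_eq)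
    have e1: "measure_pmf.expectation (w.P m) (\<lambda>y. - ln (pmf (bs.P m) (snd y))) = ent (bs.P m)"
      unfolding ent_def by (subst (2) walk_snd[symmetric]) (rule integral_map_pmf[symmetric])
    have i2: "integrable (measure_pmf (w.P m)) (\<lambda>y. ln (pmf sp (s y)))"
      using f(2) unfolding fin_ent_def by (subst (asm) (1) sp_def) (simp only: integrable_map_pmf_eq)
    have e2: "measure_pmf.expectation (w.P m) (\<lambda>y. - ln (pmf sp (s y))) = ent sp"
      unfolding ent_def by (subst (2) sp_def) (rule integral_map_pmf[symmetric])
    have i3: "integrable (measure_pmf (w.P m)) (indicator (- QQ) :: _ \<Rightarrow> real)" by (rule integrable_real_indicator) (simp_all add: measure_pmf.emeasure_eq_measure)
    show "integrable (measure_pmf (w.P m)) blk" unfolding blk_def[abs_def]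
      using i1 i2 i3 by (intro Bochner_Integration.integrable_add Bochner_Integration.integrable_diff integrable_mult_right Bochner_Integration.integrable_minus) auto
    have "measure_pmf.expectation (w.P m) blk = measure_pmf.expectation (w.P m) (\<lambda>y. - ln (pmf (bs.P m) (snd y)))
      + measure_pmf.expectation (w.P m) (\<lambda>y. - ln (pmf sp (s y))) + ln ?l * (real (m * card B) * measure_pmf.expectation (w.P m) (indicator (- QQ)))"
      unfolding blk_def[abs_def] using i1 i2 i3 by simp
    then show "measure_pmf.expectation (w.P m) blk = ent (bs.P m) + ent sp + ln ?l * (real (m * card B) * measure (w.P m) (- QQ))"
      by (simp only: e1 e2) simp
  qed
  have T_int: "integrable w.S (T j q)" "(\<integral>\<xi>. T j q \<xi> \<partial>w.S) = H q ((k - j) * m)" if "j < k" "q \<in> Q" for j q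
  proof -
    note tp = touched_prob[OF Qc[OF that(2)] jk[OF that(1)]]
    show "integrable w.S (T j q)" unfolding T_def[abs_def]
      by (rule integrable_real_indicator[OF tp(1)]) (simp add: w.seq.P.emeasure_eq_measure)
    have "(\<integral>\<xi>. T j q \<xi> \<partial>w.S) = measure w.S {\<xi> \<in> space w.S. touched ?n (X (j * m) \<xi> \<otimes>\<^bsub>\<Lambda>\<^esub> q) \<xi>}"
      unfolding T_def using tp(1) by simp
    then show "(\<integral>\<xi>. T j q \<xi> \<partial>w.S) = H q ((k - j) * m)" by (simp add: tp(2) diff_mult_distrib)
  qed
  have blk_adv: "integrable w.S (\<lambda>\<xi>. blk (\<eta> j \<xi>))" "(\<integral>\<xi>. blk (\<eta> j \<xi>) \<partial>w.S) = measure_pmf.expectation (w.P m) blk" for j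
    unfolding \<eta>_def by (simp_all only: integrable_advance blk_int)
  have g_int: "integrable w.S g" unfolding g_def[abs_def]
    by (intro Bochner_Integration.integrable_add Bochner_Integration.integrable_sum Bochner_Integration.integrable_minus
        integrable_mult_right blk_adv r_int T_int w.seq.P.integrable_const) auto
  have g_E: "(\<integral>\<xi>. g \<xi> \<partial>w.S) = real k * measure_pmf.expectation (w.P m) blk + (\<integral>\<xi>. - ln (r (bd.\<beta> \<xi>) (X ?n \<xi>)) \<partial>w.S)
      + - ln (1 - \<delta>) * real (k * card Q) + ln (?l / \<delta>) * (\<Sum>j<k. \<Sum>q\<in>Q. H q ((k - j) * m))"
  proof -
    have 1: "(\<integral>\<xi>. (\<Sum>j<k. blk (\<eta> j \<xi>)) \<partial>w.S) = real k * measure_pmf.expectation (w.P m) blk"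
      by (subst Bochner_Integration.integral_sum) (simp_all only: blk_adv, simp)
    have 2: "(\<integral>\<xi>. (\<Sum>j<k. \<Sum>q\<in>Q. T j q \<xi>) \<partial>w.S) = (\<Sum>j<k. \<Sum>q\<in>Q. H q ((k - j) * m))"
      by (subst Bochner_Integration.integral_sum, intro Bochner_Integration.integrable_sum T_int, simp, simp, intro sum.cong refl,
        subst Bochner_Integration.integral_sum, intro T_int, simp, simp, intro sum.cong refl T_int) simp_all
    have i1: "integrable w.S (\<lambda>\<xi>. \<Sum>j<k. blk (\<eta> j \<xi>))" by (intro Bochner_Integration.integrable_sum blk_adv)
    have i2: "integrable w.S (\<lambda>\<xi>. \<Sum>j<k. \<Sum>q\<in>Q. T j q \<xi>)" by (intro Bochner_Integration.integrable_sum T_int) auto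
    show ?thesis unfolding g_def using i1 i2 r_int
      by (simp add: 1 2 w.seq.P.prob_space)
  qed
  have main: "AE \<xi> in w.S. C \<xi> \<in> set_pmf Cp \<and> 0 < wt (bd.\<beta> \<xi>) (C \<xi>) (w.Y ?n \<xi>) \<and> - g \<xi> \<le> ln (wt (bd.\<beta> \<xi>) (C \<xi>) (w.Y ?n \<xi>))"
  proof -
    have "AE \<xi> in w.S. \<forall>j. \<eta> j \<xi> \<in> set_pmf (w.P m)"
      unfolding AE_all_countable \<eta>_def by (intro allI w.AE_advance w.AE_Y)
    then show ?thesis using AE_good
    proof eventually_elim
      fix \<xi> assume \<eta>: "\<forall>j. \<eta> j \<xi> \<in> set_pmf (w.P m)" and g: "good \<xi>"
      let ?c = "C \<xi>" and ?\<theta> = "bd.\<beta> \<xi>"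
      have sp: "\<xi> \<in> space w.S" using g by (simp add: good_def)
      have ppX: "pp ?c j = X (j * m) \<xi>" if "j \<le> k" for j
        using that
      proof (induction j)
        case (Suc j)
        then have "pp ?c (Suc j) = X (j * m) \<xi> \<otimes>\<^bsub>\<Lambda>\<^esub> snd (\<eta> j \<xi>)" by (simp add: C_def)
        also have "\<dots> = X (j * m + m) \<xi>" using X_add[OF sp, of "j * m" m] by (simp add: \<eta>_def)
        finally show ?case by (simp add: add.commute)
      qed (simp add: one_\<Gamma>)
      have pos: "0 < pmf (bs.P m) (snd (\<eta> j \<xi>))" "0 < pmf sp (s (\<eta> j \<xi>))" for j
        using \<eta> by (auto intro!: pmf_positive simp: sp_def walk_snd[symmetric])
      have pmfC: "pmf Cp ?c = (\<Prod>j<k. pmf (bs.P m) (snd (\<eta> j \<xi>)) * pmf sp (s (\<eta> j \<xi>)))"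
        unfolding Cp_def by (subst pmf_Pi') (auto simp: C_def cp_def pmf_pair)
      have pC: "0 < pmf Cp ?c" unfolding pmfC by (rule prod_pos) (simp add: pos)
      have lnC: "ln (pmf Cp ?c) = (\<Sum>j<k. ln (pmf (bs.P m) (snd (\<eta> j \<xi>))) + ln (pmf sp (s (\<eta> j \<xi>))))"
        unfolding pmfC using pos by (subst ln_prod) (auto simp: ln_mult_pos less_imp_neq[symmetric])
      have V: "w.Y ?n \<xi> \<in> V ?c"
      proof -
        have "\<Phi> ?n \<xi> z = \<one>\<^bsub>L\<^esub>" if z: "z \<in> carrier \<Lambda> - (A ?c \<union> A' ?c)" for z
        proof (rule ccontr)
          assume "\<Phi> ?n \<xi> z \<noteq> \<one>\<^bsub>L\<^esub>"
          then have "z \<in> supp (\<Phi> ?n \<xi>)" using z by (simp add: supp_def)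
          then obtain j q where j: "j < k" and q: "q \<in> supp (fst (\<eta> j \<xi>))" and zq: "z = X (j * m) \<xi> \<otimes>\<^bsub>\<Lambda>\<^esub> q"
            using supp_blocks[OF sp, of k m] unfolding \<eta>_def by blast
          have zp: "z = pp ?c j \<otimes>\<^bsub>\<Lambda>\<^esub> q" using zq j ppX by simp
          show False
          proof (cases "\<eta> j \<xi> \<in> QQ")
            case True
            then have "q \<in> Q" using q by (auto simp: Q_def)
            then have "z \<in> A ?c" using z j zp by (auto simp: A_def)
            then show False using z by simp
          next
            case False
            then have "snd (?c j) = Some (\<eta> j \<xi>)" using j by (simp add: C_def s_def)
            then have "z \<in> (case snd (?c j) of None \<Rightarrow> {} | Some y \<Rightarrow> if y \<in> set_pmf (w.P m) then (\<lambda>q. pp ?c j \<otimes>\<^bsub>\<Lambda>\<^esub> q) ` supp (fst y) else {})"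
              using zp q \<eta> by simp
            then have "z \<in> A' ?c" using z j unfolding A'_def by blast
            then show False using z by simp
          qed
        qed
        then show ?thesis using \<Phi>_closed[OF sp, of ?n] ppX[of k] by (simp add: V_def)
      qed
      have cA: "card (A ?c) \<le> k * card Q"
      proof -
        have "card (A ?c) \<le> card (\<Union>j<k. (\<lambda>q. pp ?c j \<otimes>\<^bsub>\<Lambda>\<^esub> q) ` Q)"
          unfolding A_def by (rule card_mono) (use finQ in auto)
        also have "\<dots> \<le> (\<Sum>j<k. card ((\<lambda>q. pp ?c j \<otimes>\<^bsub>\<Lambda>\<^esub> q) ` Q))" by (rule card_UN_le) simp
        also have "\<dots> \<le> (\<Sum>j<k. card Q)" by (rule sum_mono) (rule card_image_le[OF finQ])
        finally show ?thesis by simp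
      qed
      have cA': "real (card (A' ?c)) \<le> (\<Sum>j<k. real (m * card B) * indicator (- QQ) (\<eta> j \<xi>))"
      proof -
        define U where "U j = (if \<eta> j \<xi> \<in> QQ then {} else (\<lambda>q. pp ?c j \<otimes>\<^bsub>\<Lambda>\<^esub> q) ` supp (fst (\<eta> j \<xi>)))" for j
        have fs: "finite (supp (fst (\<eta> j \<xi>)))" "card (supp (fst (\<eta> j \<xi>))) \<le> m * card B" for j
          using supp_walk[OF \<eta>[rule_format, of j]] by blast+
        have "card (A' ?c) \<le> card (\<Union>j<k. U j)"
        proof (rule card_mono)
          show "finite (\<Union>j<k. U j)" using fs by (auto simp: U_def)
          have "(case snd (?c j) of None \<Rightarrow> {} | Some y \<Rightarrow> if y \<in> set_pmf (w.P m) then (\<lambda>q. pp ?c j \<otimes>\<^bsub>\<Lambda>\<^esub> q) ` supp (fst y) else {}) = U j"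
            if j: "j < k" for j
          proof -
            have "snd (?c j) = s (\<eta> j \<xi>)" using j by (simp add: C_def)
            then show ?thesis using \<eta> by (simp add: s_def U_def)
          qed
          then have "A' ?c = carrier \<Lambda> \<inter> (\<Union>j<k. U j)" unfolding A'_def by (intro arg_cong2[where f = "(\<inter>)"] SUP_cong refl) simp
          then show "A' ?c \<subseteq> (\<Union>j<k. U j)" by blast
        qed
        also have "\<dots> \<le> (\<Sum>j<k. card (U j))" by (rule card_UN_le) simp
        finally have "real (card (A' ?c)) \<le> (\<Sum>j<k. real (card (U j)))" by (simp flip: of_nat_sum)
        also have "\<dots> \<le> (\<Sum>j<k. real (m * card B) * indicator (- QQ) (\<eta> j \<xi>))"
        proof (rule sum_mono)
          fix j
          have "card ((\<lambda>q. pp ?c j \<otimes>\<^bsub>\<Lambda>\<^esub> q) ` supp (fst (\<eta> j \<xi>))) \<le> m * card B"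
            using card_image_le[OF fs(1)] fs(2) by (rule order_trans)
          then have "real (card ((\<lambda>q. pp ?c j \<otimes>\<^bsub>\<Lambda>\<^esub> q) ` supp (fst (\<eta> j \<xi>)))) \<le> real (m * card B)" by (simp only: of_nat_le_iff)
          then show "real (card (U j)) \<le> real (m * card B) * indicator (- QQ) (\<eta> j \<xi>)" by (simp add: U_def)
        qed
        finally show ?thesis .
      qed
      \<comment> \<open>A site of \<open>A\<close> where \<Phi> at time \<open>k * m\<close> differs
        from \<theta> comes within reach at or after that time, so the errors are counted by the
        events \<open>T\<close>.\<close>
      have cD: "real (card {z \<in> A ?c. \<Phi> ?n \<xi> z \<noteq> ?\<theta> z}) \<le> (\<Sum>j<k. \<Sum>q\<in>Q. T j q \<xi>)"
      proof -
        let ?D = "\<lambda>j. {q \<in> Q. touched ?n (X (j * m) \<xi> \<otimes>\<^bsub>\<Lambda>\<^esub> q) \<xi>}"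
        have "{z \<in> A ?c. \<Phi> ?n \<xi> z \<noteq> ?\<theta> z} \<subseteq> (\<Union>j<k. (\<lambda>q. X (j * m) \<xi> \<otimes>\<^bsub>\<Lambda>\<^esub> q) ` ?D j)"
        proof
          fix z assume z: "z \<in> {z \<in> A ?c. \<Phi> ?n \<xi> z \<noteq> ?\<theta> z}"
          then obtain j q where j: "j < k" "q \<in> Q" "z = X (j * m) \<xi> \<otimes>\<^bsub>\<Lambda>\<^esub> q" "z \<in> carrier \<Lambda>"
            using ppX by (auto simp: A_def)
          have "touched ?n z \<xi>" using limit_untouched[OF g j(4), of ?n] z by (metis (mono_tags, lifting) mem_Collect_eq)
          then show "z \<in> (\<Union>j<k. (\<lambda>q. X (j * m) \<xi> \<otimes>\<^bsub>\<Lambda>\<^esub> q) ` ?D j)" using j by blast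
        qed
        then have "card {z \<in> A ?c. \<Phi> ?n \<xi> z \<noteq> ?\<theta> z} \<le> card (\<Union>j<k. (\<lambda>q. X (j * m) \<xi> \<otimes>\<^bsub>\<Lambda>\<^esub> q) ` ?D j)"
          by (rule card_mono[rotated]) (use finQ in auto)
        also have "\<dots> \<le> (\<Sum>j<k. card ((\<lambda>q. X (j * m) \<xi> \<otimes>\<^bsub>\<Lambda>\<^esub> q) ` ?D j))" by (rule card_UN_le) simp
        also have "\<dots> \<le> (\<Sum>j<k. card (?D j))" by (rule sum_mono) (rule card_image_le, use finQ in simp)
        finally have "real (card {z \<in> A ?c. \<Phi> ?n \<xi> z \<noteq> ?\<theta> z}) \<le> (\<Sum>j<k. real (card (?D j)))" by (simp flip: of_nat_sum)
        also have "\<dots> = (\<Sum>j<k. \<Sum>q\<in>Q. T j q \<xi>)"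
        proof (rule sum.cong[OF refl])
          fix j
          have "(\<Sum>q\<in>Q. T j q \<xi>) = (\<Sum>q\<in>Q. if touched ?n (X (j * m) \<xi> \<otimes>\<^bsub>\<Lambda>\<^esub> q) \<xi> then 1 else 0)"
            using sp by (intro sum.cong refl) (simp add: T_def indicator_def)
          also have "\<dots> = real (card (?D j))" using finQ by (simp add: sum.inter_filter[symmetric])
          finally show "real (card (?D j)) = (\<Sum>q\<in>Q. T j q \<xi>)" by simp
        qed
        finally show ?thesis .
      qed
      let ?w = "config_weight \<delta> (A ?c) (A' ?c) ?\<theta> (\<Phi> ?n \<xi>)"
      have wt_eq: "wt ?\<theta> ?c (w.Y ?n \<xi>) = pmf Cp ?c * r ?\<theta> (X ?n \<xi>) * ?w"
        using V ppX[of k] by (simp add: wt_def)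
      have wpos: "0 < wt ?\<theta> ?c (w.Y ?n \<xi>)" unfolding wt_eq using pC r0 cw0 by (intro mult_pos_pos) auto
      have "- ln ?w \<le> - ln (1 - \<delta>) * real (card (A ?c)) + ln (?l / \<delta>) * real (card {z \<in> A ?c. \<Phi> ?n \<xi> z \<noteq> ?\<theta> z}) + ln ?l * real (card (A' ?c))"
        by (rule config_weight_cost(2)[OF \<delta> finA finA'])
      also have "\<dots> \<le> - ln (1 - \<delta>) * real (k * card Q) + ln (?l / \<delta>) * (\<Sum>j<k. \<Sum>q\<in>Q. T j q \<xi>)
          + ln ?l * (\<Sum>j<k. real (m * card B) * indicator (- QQ) (\<eta> j \<xi>))"
      proof (intro add_mono mult_left_mono cD cA')
        show "real (card (A ?c)) \<le> real (k * card Q)" by (rule of_nat_mono[OF cA])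
        show "0 \<le> - ln (1 - \<delta>)" using \<delta> by simp
        show "0 \<le> ln (?l / \<delta>)" using \<delta> l1 by (simp add: field_simps)
        show "0 \<le> ln ?l" using l1 by simp
      qed
      finally have lw: "- ln ?w \<le> \<dots>" .
      have "ln (wt ?\<theta> ?c (w.Y ?n \<xi>)) = ln (pmf Cp ?c) + ln (r ?\<theta> (X ?n \<xi>)) + ln ?w"
        unfolding wt_eq using pC r0[of ?\<theta> "X ?n \<xi>"] cw0[of ?c ?\<theta> "\<Phi> ?n \<xi>"] by (simp add: ln_mult_pos)
      moreover have "(\<Sum>j<k. blk (\<eta> j \<xi>)) = - ln (pmf Cp ?c) + ln ?l * (\<Sum>j<k. real (m * card B) * indicator (- QQ) (\<eta> j \<xi>))"
        unfolding lnC blk_def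
        by (simp only: sum.distrib sum_subtractf sum_negf sum_distrib_left[symmetric])
      ultimately have "- g \<xi> \<le> ln (wt ?\<theta> ?c (w.Y ?n \<xi>))" using lw unfolding g_def by linarith
      then show "?c \<in> set_pmf Cp \<and> 0 < wt ?\<theta> ?c (w.Y ?n \<xi>) \<and> - g \<xi> \<le> ln (wt ?\<theta> ?c (w.Y ?n \<xi>))"
        using wpos pC by (simp add: set_pmf_iff)
    qed
  qed
  have "ent (w.P ?n) - bd.I ?n \<le> (\<integral>\<xi>. g \<xi> \<partial>w.S)"
    by (rule bd.gibbs_code[where wt = wt and C = C and A = "set_pmf Cp", OF countable_set_pmf wt_nn wt_meas wt_sum main g_int])
  then show ?thesis using r_le unfolding g_E blk_E sp_def by linarith
qed

text \<open>The parameters depend on each other in this order: the block length \<open>m\<close>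
  from the entropy rate, the finite set \<open>QQ\<close> of ordinary increments from
  \<open>m\<close>, the error rate \<delta> from the number of sites they reach, and last the number
  \<open>k\<close> of blocks.\<close>

theorem entropy_gap:
  assumes \<epsilon>: "0 < \<epsilon>"
  shows "\<exists>n. ent (w.P (Suc n)) - bd.I (Suc n) \<le> \<epsilon> * real (Suc n)"
proof -
  let ?f = "\<lambda>m. ent (bs.P (Suc m)) / real (Suc m)"
  define h where "h = (INF m. ?f m)"
  have bdd: "bdd_below (range ?f)" by (intro bdd_belowI2[where m = 0] divide_nonneg_nonneg ent_nonneg) simp
  have h: "real m * h \<le> ent (bs.P m)" for m
  proof (cases m)
    case (Suc j)
    have "h \<le> ?f j" unfolding h_def by (rule cINF_lower[OF bdd]) simp
    then show ?thesis unfolding Suc by (simp add: field_simps)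
  qed (simp add: ent_nonneg)
  have "(INF m. ?f m) < h + \<epsilon> / 8" using \<epsilon> by (simp add: h_def)
  then obtain m0 where m0: "?f m0 < h + \<epsilon> / 8" using cINF_less_iff[OF _ bdd] by auto
  define m where "m = Suc m0"
  have m1: "1 \<le> real m" by (simp add: m_def)
  have Em: "ent (bs.P m) \<le> real m * h + real m * \<epsilon> / 8" using m0 unfolding m_def[symmetric] using m1 by (simp add: field_simps)
  let ?l = "real (card (carrier L))"
  define c where "c = ln ?l * real (m * card B)"
  have c0: "0 \<le> c" unfolding c_def using card_L by (intro mult_nonneg_nonneg) auto
  \<comment> \<open>The first bound serves the entropy of the symbol; the second serves the lamps of
    exceptional blocks, whose probability is multiplied by \<open>c\<close>. The 1 guards against
    \<open>c = 0\<close>.\<close>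
  define \<tau> where "\<tau> = min (\<epsilon> / 8) (\<epsilon> / (8 * (c + 1)))"
  have \<tau>: "0 < \<tau>" "\<tau> \<le> \<epsilon> / 8"
    using \<epsilon> c0 by (simp add: \<tau>_def) (unfold \<tau>_def, rule min.cobounded1)
  have "c * \<tau> \<le> c * (\<epsilon> / (8 * (c + 1)))" unfolding \<tau>_def by (rule mult_left_mono) (use c0 in auto)
  also have "\<dots> \<le> \<epsilon> / 8" using c0 \<epsilon> by (simp add: field_simps)
  finally have c\<tau>: "c * \<tau> \<le> \<epsilon> / 8" .
  obtain QQ where QQ: "finite QQ" "QQ \<subseteq> set_pmf (w.P m)"
    and entQ: "ent (map_pmf (\<lambda>x. if x \<in> QQ then None else Some x) (w.P m)) \<le> \<tau>" and mQ: "measure (w.P m) (- QQ) \<le> \<tau>"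
    using truncation_entropy[OF fin_ent_walk[OF fin_\<mu>] \<tau>(1)] by blast
  define Q where "Q = (\<Union>\<eta>\<in>QQ. supp (fst \<eta>))"
  have Qc: "q \<in> carrier \<Lambda>" if "q \<in> Q" for q using that by (auto simp: Q_def supp_def)
  \<comment> \<open>Solves \<open>- ln (1 - \<delta>) = \<epsilon> / (8 * (card Q + 1))\<close>, so
    that correct predictions cost at most \<open>\<epsilon> / 8\<close> per block.\<close>
  define \<delta> where "\<delta> = 1 - exp (- (\<epsilon> / (8 * (real (card Q) + 1))))"
  have \<delta>: "0 < \<delta>" "\<delta> < 1" using \<epsilon> by (auto simp: \<delta>_def)
  have a: "- ln (1 - \<delta>) * real (card Q) \<le> \<epsilon> / 8" using \<epsilon> by (simp add: \<delta>_def field_simps)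
  define b where "b = ln (?l / \<delta>)"
  have b0: "0 \<le> b" unfolding b_def using \<delta> card_L by (simp add: field_simps)
  define f where "f i = (\<Sum>q\<in>Q. H q (Suc i * m))" for i
  have "f \<longlonglongrightarrow> (\<Sum>q\<in>Q. 0)" unfolding f_def[abs_def]
  proof (rule tendsto_sum)
    fix q assume "q \<in> Q"
    have sm: "strict_mono (\<lambda>i. Suc i * m)" by (rule strict_monoI, rule mult_less_mono1) (simp_all add: m_def)
    show "(\<lambda>i. H q (Suc i * m)) \<longlonglongrightarrow> 0"
      using LIMSEQ_subseq_LIMSEQ[OF H_tendsto[OF Qc[OF \<open>q \<in> Q\<close>]] sm] by (simp add: comp_def)
  qed
  then have "f \<longlonglongrightarrow> 0" by simp
  then have ev: "\<forall>\<^sub>F k in sequentially. (\<Sum>i<k. f i) \<le> (\<epsilon> / (8 * (b + 1))) * real k"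
    by (rule averages_vanish) (use \<epsilon> b0 in simp)
  obtain k0 :: nat where k0: "\<bar>ln (2 * real (card B))\<bar> + 1 < real k0 * (\<epsilon> / 8)"
    using reals_Archimedean3[THEN spec, of "\<epsilon> / 8" "\<bar>ln (2 * real (card B))\<bar> + 1"] \<epsilon> by auto
  \<comment> \<open>Starting from \<open>Suc k0\<close> also keeps \<open>k\<close> positive, so
    that \<open>k * m\<close> is a successor.\<close>
  obtain k where k: "(\<Sum>i<k. f i) \<le> (\<epsilon> / (8 * (b + 1))) * real k" "Suc k0 \<le> k"
    using eventually_happens'[OF _ eventually_conj[OF ev eventually_ge_at_top[of "Suc k0"]]] by auto
  have const: "ln (2 * real (card B)) + 1 \<le> real k * \<epsilon> / 8"
  proof -
    have "real k0 * (\<epsilon> / 8) \<le> real k * (\<epsilon> / 8)" by (rule mult_right_mono) (use k(2) \<epsilon> in auto)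
    then show ?thesis using k0 by (simp add: field_simps)
  qed
  have sumH: "b * (\<Sum>j<k. \<Sum>q\<in>Q. H q ((k - j) * m)) \<le> real k * \<epsilon> / 8"
  proof -
    have "(\<Sum>j<k. \<Sum>q\<in>Q. H q ((k - j) * m)) = (\<Sum>j<k. f (k - Suc j))"
      unfolding f_def by (intro sum.cong refl) (simp add: Suc_diff_Suc)
    also have "\<dots> = (\<Sum>i<k. f i)" by (rule sum.nat_diff_reindex)
    finally have "b * (\<Sum>j<k. \<Sum>q\<in>Q. H q ((k - j) * m)) \<le> b * ((\<epsilon> / (8 * (b + 1))) * real k)"
      using k(1) b0 by (simp only: mult_left_mono)
    also have "\<dots> = (b / (b + 1)) * (real k * \<epsilon> / 8)" using b0 by (simp add: field_simps)
    also have "\<dots> \<le> 1 * (real k * \<epsilon> / 8)" by (rule mult_right_mono) (use b0 \<epsilon> in auto)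
    finally show ?thesis by simp
  qed
  let ?e = "ent (map_pmf (\<lambda>x. if x \<in> QQ then None else Some x) (w.P m))"
  have "ent (w.P (k * m)) - bd.I (k * m) \<le>
    real k * (ent (bs.P m) + ?e + ln ?l * (real (m * card B) * measure (w.P m) (- QQ)))
    + (ln (2 * real (card B)) - real (k * m) * h + 1)
    + - ln (1 - \<delta>) * real (k * card Q) + b * (\<Sum>j<k. \<Sum>q\<in>Q. H q ((k - j) * m))"
    unfolding b_def Q_def by (rule code_bound[OF h QQ \<delta>])
  also have "\<dots> \<le> (real k * real m * h + real k * real m * \<epsilon> / 8 + real k * \<epsilon> / 4)
    + (real k * \<epsilon> / 8 - real k * real m * h) + real k * \<epsilon> / 8 + real k * \<epsilon> / 8"
  proof (intro add_mono sumH)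
    have "c * measure (w.P m) (- QQ) \<le> c * \<tau>" by (rule mult_left_mono[OF mQ c0])
    then have "ent (bs.P m) + ?e + ln ?l * (real (m * card B) * measure (w.P m) (- QQ)) \<le> (real m * h + real m * \<epsilon> / 8) + \<epsilon> / 8 + \<epsilon> / 8"
      using Em entQ \<tau>(2) c\<tau> unfolding c_def by (simp only: mult.assoc)
    then have "real k * (ent (bs.P m) + ?e + ln ?l * (real (m * card B) * measure (w.P m) (- QQ))) \<le> real k * ((real m * h + real m * \<epsilon> / 8) + \<epsilon> / 8 + \<epsilon> / 8)"
      by (rule mult_left_mono) simp
    also have "\<dots> = real k * real m * h + real k * real m * \<epsilon> / 8 + real k * \<epsilon> / 4" by (simp add: field_simps)
    finally show "real k * (ent (bs.P m) + ?e + ln ?l * (real (m * card B) * measure (w.P m) (- QQ))) \<le> \<dots>" .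
    show "ln (2 * real (card B)) - real (k * m) * h + 1 \<le> real k * \<epsilon> / 8 - real k * real m * h" using const by simp
    have "real k * (- ln (1 - \<delta>) * real (card Q)) \<le> real k * (\<epsilon> / 8)" by (rule mult_left_mono[OF a]) simp
    then show "- ln (1 - \<delta>) * real (k * card Q) \<le> real k * \<epsilon> / 8" by (simp add: ac_simps)
  qed
  \<comment> \<open>Five errors of \<open>\<epsilon> / 8\<close> per block and one of
    \<open>\<epsilon> / 8\<close> per step; as \<open>m \<ge> 1\<close>, they sum to at most three
    quarters of the allowance.\<close>
  also have "\<dots> = real k * real m * \<epsilon> / 8 + 5 * (real k * 1 * \<epsilon> / 8)" by simp
  also have "\<dots> \<le> real k * real m * \<epsilon> / 8 + 5 * (real k * real m * \<epsilon> / 8)"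
    by (intro add_left_mono mult_left_mono divide_right_mono mult_right_mono m1) (use \<epsilon> in auto)
  also have "\<dots> \<le> \<epsilon> * real (k * m)" using \<epsilon> by (simp add: field_simps)
  finally have le: "ent (w.P (k * m)) - bd.I (k * m) \<le> \<epsilon> * real (k * m)" .
  have "k * m \<noteq> 0" using k(2) by (simp add: m_def)
  then have "k * m = Suc (k * m - 1)" by simp
  then show ?thesis using le by metis
qed

section \<open>The measurable structure of the configuration space and the conclusion\<close>

lemma countably_generated_N: "countably_generated N"
proof -
  let ?C = "(\<lambda>(i, A). {f \<in> \<Pi>\<^sub>E i\<in>carrier \<Lambda>. space (count_space (carrier L)). f i \<in> A}) ` (carrier \<Lambda> \<times> Pow (carrier L))"
  have "countable (Pow (carrier L))" using L_finite by (simp add: countable_finite)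
  then have "countable ?C" using countable_\<Lambda> by (intro countable_image countable_SIGMA) auto
  moreover have "sets N = sigma_sets (space N) ?C"
    unfolding sets_N sets_PiM_single space_N by (rule arg_cong2[where f = sigma_sets]) (auto simp: image_iff)
  moreover have "?C \<subseteq> Pow (space N)" by (auto simp: space_N)
  ultimately show ?thesis unfolding countably_generated_def by blast
qed

lemma separates_points_N: "separates_points N"
  unfolding separates_points_def space_N
  using singleton_N by blast

theorem poisson_boundary_limit_lamps: "poisson_boundary \<Gamma> \<mu> N act lim_lamps"
proof -
  have b: "lim_lamps \<in> invariant_space \<Gamma> \<rightarrow>\<^sub>M N" using limit_meas_inv by (simp add: meas_N)
  show ?thesis unfolding poisson_boundary_def
    by (intro conjI ballI bd.prob_N countably_generated_N separates_points_N group_action_act bd.act_meas b AE_equiv distr_N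
        bd.poisson_criterion[OF b] entropy_gap)
qed

end

text \<open>The first conjunct certifies that the default value in \<open>limit_lamps\<close> is
  taken on a null set only, so that the law in the second one is that of the genuine limit.\<close>

theorem theorem1p1:
  fixes L :: "('l, 'm) monoid_scheme"
    and \<Lambda> :: "('g, 'n) monoid_scheme"
    and \<mu> :: "(('g \<Rightarrow> 'l) \<times> 'g) pmf"
  assumes "group L" and "finite (carrier L)" and "carrier L \<noteq> {\<one>\<^bsub>L\<^esub>}"
    and "finitely_generated_group \<Lambda>" and "infinite (carrier \<Lambda>)"
    and "set_pmf \<mu> \<subseteq> carrier (wreath L \<Lambda>)"
    and "pmf_entropy \<mu> < \<infinity>"
    and "bounded_lamp_range L \<Lambda> \<mu>"
    and "generate (wreath L \<Lambda>) (set_pmf \<mu>) = carrier (wreath L \<Lambda>)"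
    and "transient_walk \<Lambda> (map_pmf snd \<mu>)"
  shows "(AE \<omega> in walk_law (wreath L \<Lambda>) \<mu>. lamps_converge \<Lambda> \<omega>) \<and>
    poisson_boundary (wreath L \<Lambda>) \<mu>
      (limit_lamps_law L \<Lambda> \<mu>) (lamp_action L \<Lambda>) (limit_lamps L \<Lambda>)"
proof -
  interpret lamplighter L \<Lambda> \<mu>
    using assms fin_ent_if_pmf_entropy by (intro lamplighter.intro) (auto simp: finitely_generated_group_def)
  show ?thesis using AE_converge poisson_boundary_limit_lamps by blast
qed

end
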